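(* Let $(\mathcal{C},J)$ be a site with $J$ precanonical, and let $\mathfrak{W}$ be the class of local weak equivalences in the 2-category $\mathbf{PreSt}(\mathcal{C})$ of prestacks. For a map $p\colon E\to B$ in $\mathbf{PreSt}(\mathcal{C})$ the following are equivalent: (1) $p$ is a local fibration; (2) $\mathfrak{W}\pitchfork p$.
   Context: The Axiom of Choice is assumed. Sites and prestacks. $\mathcal{C}$ is a category with finite limits and $J$ is a Grothendieck topology on it, assigning to each object $U$ a collection $J(U)$ of covering sieves; a cover of $U$ is an element $\mathcal{S}\in J(U)$, written $\mathcal{S}=(f_\alpha\colon U_\alpha\to U)_\alpha$. Precanonical means that every representable presheaf is a sheaf. $[\mathcal{C}^{\mathrm{op}},\mathbf{Cat}]_{\mathrm{ps}}$ is the 2-category of pseudofunctors $\mathcal{C}^{\mathrm{op}}\to\mathbf{Cat}$, pseudonatural transformations and modifications. For such a pseudofunctor $F$, $x\in F(U)$ and $f\colon V\to U$, write $x|_V=F(f)(x)$; write $|_\alpha$ for restriction to $U_\alpha$, $|_{\alpha\beta}$ for restriction to $U_\alpha\times_U U_\beta$, and $|_{\alpha\beta\gamma}$ for restriction to $U_\alpha\times_UU_\beta\times_UU_\gamma$. $F$ is a prestack if for all $U$ and $a,b\in F(U)$ the presheaf $(V\to U)\mapsto\mathrm{Hom}_{F(V)}(a|_V,b|_V)$ on $\mathcal{C}/U$ is a sheaf. $\mathbf{PreSt}(\mathcal{C})$ is the full sub-2-category of prestacks. Descent data. $\sigma_{\alpha\beta}(x)\colon x|_\beta|_{\alpha\beta}\to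 x|_\alpha|_{\alpha\beta}$ denotes the canonical isomorphism from pseudofunctoriality. For $p\colon E\to B$ in $[\mathcal{C}^{\mathrm{op}},\mathbf{Cat}]_{\mathrm{ps}}$ and a cover $\mathcal{S}=(f_\alpha\colon U_\alpha\to U)_\alpha$, the category $\mathbf{Desc}(p,\mathcal{S})$ has as objects tuples $(b,(e_\alpha),(\psi_\alpha),(\vartheta_{\alpha\beta}))$ with $b\in B(U)$, $e_\alpha\in E(U_\alpha)$, isomorphisms $\psi_\alpha\colon p(e_\alpha)\to b|_\alpha$ and isomorphisms $\vartheta_{\alpha\beta}\colon e_\beta|_{\alpha\beta}\to e_\alpha|_{\alpha\beta}$ such that: (i) $\vartheta_{\alpha\alpha}$ restricted along the diagonal $U_\alpha\to U_\alpha\times_UU_\alpha$ is $1_{e_\alpha}$ modulo coherence isomorphisms; (ii) $\vartheta_{\alpha\beta}|_{\alpha\beta\gamma}\circ\vartheta_{\beta\gamma}|_{\alpha\beta\gamma}=\vartheta_{\alpha\gamma}|_{\alpha\beta\gamma}$ modulo the canonical coherence isomorphisms of $E$; (iii) the composites $p(e_\beta|_{\alpha\beta})\cong p(e_\beta)|_{\alpha\beta}\xrightarrow{\psi_\beta|_{\alpha\beta}}b|_\beta|_{\alpha\beta}\xrightarrow{\sigma_{\alpha\beta}(b)}b|_\alpha|_{\alpha\beta}$ and $p(e_\beta|_{\alpha\beta})\xrightarrow{p(\vartheta_{\alpha\beta})}p(e_\alpha|_{\alpha\beta})\cong p(e_\alpha)|_{\alpha\beta}\xrightarrow{\psi_\alpha|_{\alpha\beta}}b|_\alpha|_{\alpha\beta}$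 agree, the unnamed isomorphisms being those of the pseudonatural transformation $p$. An arrow to $(b',(e'_\alpha),(\psi'_\alpha),(\vartheta'_{\alpha\beta}))$ is a pair $(g,(g_\alpha))$ with $g\colon b\to b'$, $g_\alpha\colon e_\alpha\to e'_\alpha$ such that $g_\alpha|_{\alpha\beta}\circ\vartheta_{\alpha\beta}=\vartheta'_{\alpha\beta}\circ g_\beta|_{\alpha\beta}$ and $g|_\alpha\circ\psi_\alpha=\psi'_\alpha\circ p(g_\alpha)$. The functor $\Phi_{\mathcal{S}}\colon E(U)\to\mathbf{Desc}(p,\mathcal{S})$ sends $e$ to $(p(e),(e|_\alpha),(p(e|_\alpha)\cong p(e)|_\alpha),(\sigma_{\alpha\beta}(e)))$. $p\colon E\to B$ is a local fibration if for every $U$ and every cover $\mathcal{S}$ of $U$, $\Phi_{\mathcal{S}}$ is an equivalence of categories. A map $h\colon A\to B$ of prestacks is a local weak equivalence if each $h_U\colon A(U)\to B(U)$ is full and faithful and, for every $U$ and $b\in B(U)$, there are a cover $(f_\alpha\colon U_\alpha\to U)$ of $U$ and, for each $\alpha$, an object $\tilde b_\alpha\in A(U_\alpha)$ and an isomorphism $h(\tilde b_\alpha)\to b|_\alpha$. Lifting. For $f\colon A\to C$ and $p\colon E\to B$, $f\pitchfork p$ means: for all $h\colon A\to E$, $k\colon C\to B$ and invertible $\gamma\colon p\circ h\Rightarrow k\circ f$ there are $l\colon C\to E$ and invertible 2-cells $\lambda\colon h\cong l\circ f$, $\rho\colon p\circ l\cong k$ with $\gamma=(\rho*f)\cdot(p*\lambda)$.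 $\mathfrak{W}\pitchfork p$ means $f\pitchfork p$ for all $f\in\mathfrak{W}$. *)

theory Defs
  imports Main "HOL-Library.FuncSet" "HOL-Library.Equipollence"
begin

section \<open>Categories, functors, natural isomorphisms\<close>

record ('o, 'a) cat =
  Obj :: "'o set"
  Arr :: "'a set"
  Dom :: "'a \<Rightarrow> 'o"
  Cod :: "'a \<Rightarrow> 'o"
  Id :: "'o \<Rightarrow> 'a"
  Comp :: "'a \<Rightarrow> 'a \<Rightarrow> 'a"  (infixr "\<cdot>\<index>" 70)

definition hom :: "('o, 'a) cat \<Rightarrow> 'o \<Rightarrow> 'o \<Rightarrow> 'a set" where
  "hom X x y = {f \<in> Arr X. Dom X f = x \<and> Cod X f = y}"

locale category =
  fixes X :: "('o, 'a) cat"
  assumes Dom_Obj: "f \<in> Arr X \<Longrightarrow> Dom X f \<in> Obj X"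
    and Cod_Obj: "f \<in> Arr X \<Longrightarrow> Cod X f \<in> Obj X"
    and Id_hom: "x \<in> Obj X \<Longrightarrow> Id X x \<in> hom X x x"
    and Comp_hom: "f \<in> hom X x y \<Longrightarrow> g \<in> hom X y z \<Longrightarrow> g \<cdot>\<^bsub>X\<^esub> f \<in> hom X x z"
    and Comp_Id_left: "f \<in> hom X x y \<Longrightarrow> Id X y \<cdot>\<^bsub>X\<^esub> f = f"
    and Comp_Id_right: "f \<in> hom X x y \<Longrightarrow> f \<cdot>\<^bsub>X\<^esub> Id X x = f"
    and Comp_assoc: "f \<in> hom X w x \<Longrightarrow> g \<in> hom X x y \<Longrightarrow> h \<in> hom X y z \<Longrightarrow>
          (h \<cdot>\<^bsub>X\<^esub> g) \<cdot>\<^bsub>X\<^esub> f = h \<cdot>\<^bsub>X\<^esub> (g \<cdot>\<^bsub>X\<^esub> f)"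

definition inverse_arrows :: "('o, 'a) cat \<Rightarrow> 'a \<Rightarrow> 'a \<Rightarrow> bool" where
  "inverse_arrows X f g \<longleftrightarrow> f \<in> Arr X \<and> g \<in> hom X (Cod X f) (Dom X f) \<and>
     g \<cdot>\<^bsub>X\<^esub> f = Id X (Dom X f) \<and> f \<cdot>\<^bsub>X\<^esub> g = Id X (Cod X f)"

definition isos :: "('o, 'a) cat \<Rightarrow> 'o \<Rightarrow> 'o \<Rightarrow> 'a set" where
  "isos X x y = {f \<in> hom X x y. \<exists>g. inverse_arrows X f g}"

definition inv_arr :: "('o, 'a) cat \<Rightarrow> 'a \<Rightarrow> 'a" where
  "inv_arr X f = (THE g. inverse_arrows X f g)"

locale cat_functor = X: category X + Y: category Y
  for X :: "('o1, 'a1) cat" and Y :: "('o2, 'a2) cat" +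
  fixes FO :: "'o1 \<Rightarrow> 'o2" and FA :: "'a1 \<Rightarrow> 'a2"
  assumes FO_Obj: "x \<in> Obj X \<Longrightarrow> FO x \<in> Obj Y"
    and FA_hom: "f \<in> hom X x y \<Longrightarrow> FA f \<in> hom Y (FO x) (FO y)"
    and FA_Id: "x \<in> Obj X \<Longrightarrow> FA (Id X x) = Id Y (FO x)"
    and FA_Comp: "f \<in> hom X x y \<Longrightarrow> g \<in> hom X y z \<Longrightarrow> FA (g \<cdot>\<^bsub>X\<^esub> f) = FA g \<cdot>\<^bsub>Y\<^esub> FA f"

locale natural_iso = F: cat_functor X Y FO FA + G: cat_functor X Y GO GA
  for X :: "('o1, 'a1) cat" and Y :: "('o2, 'a2) cat" and FO FA GO GA +
  fixes \<eta> :: "'o1 \<Rightarrow> 'a2"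
  assumes component_iso: "x \<in> Obj X \<Longrightarrow> \<eta> x \<in> isos Y (FO x) (GO x)"
    and naturality: "f \<in> hom X x y \<Longrightarrow> \<eta> y \<cdot>\<^bsub>Y\<^esub> FA f = GA f \<cdot>\<^bsub>Y\<^esub> \<eta> x"

definition full_and_faithful ::
  "('o1, 'a1) cat \<Rightarrow> ('o2, 'a2) cat \<Rightarrow> ('o1 \<Rightarrow> 'o2) \<Rightarrow> ('a1 \<Rightarrow> 'a2) \<Rightarrow> bool" where
  "full_and_faithful X Y FO FA \<longleftrightarrow>
     (\<forall>x\<in>Obj X. \<forall>y\<in>Obj X. bij_betw FA (hom X x y) (hom Y (FO x) (FO y)))"

definition equivalence_of_categories ::
  "('o1, 'a1) cat \<Rightarrow> ('o2, 'a2) cat \<Rightarrow> ('o1 \<Rightarrow> 'o2) \<Rightarrow> ('a1 \<Rightarrow> 'a2) \<Rightarrow> bool" where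
  "equivalence_of_categories X Y FO FA \<longleftrightarrow> cat_functor X Y FO FA \<and>
     (\<exists>GO GA \<eta> \<epsilon>. cat_functor Y X GO GA \<and>
        natural_iso X X (\<lambda>x. x) (\<lambda>f. f) (\<lambda>x. GO (FO x)) (\<lambda>f. GA (FA f)) \<eta> \<and>
        natural_iso Y Y (\<lambda>y. FO (GO y)) (\<lambda>g. FA (GA g)) (\<lambda>y. y) (\<lambda>g. g) \<epsilon>)"

section \<open>Finite limits and fibre products\<close>

definition is_cone ::
  "('i, 'j) cat \<Rightarrow> ('o, 'a) cat \<Rightarrow> ('i \<Rightarrow> 'o) \<Rightarrow> ('j \<Rightarrow> 'a) \<Rightarrow> 'o \<Rightarrow> ('i \<Rightarrow> 'a) \<Rightarrow> bool" where
  "is_cone I X DO DA L \<pi> \<longleftrightarrow> L \<in> Obj X \<and> (\<forall>i\<in>Obj I. \<pi> i \<in> hom X L (DO i)) \<and>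
     (\<forall>u\<in>Arr I. DA u \<cdot>\<^bsub>X\<^esub> \<pi> (Dom I u) = \<pi> (Cod I u))"

definition is_limit ::
  "('i, 'j) cat \<Rightarrow> ('o, 'a) cat \<Rightarrow> ('i \<Rightarrow> 'o) \<Rightarrow> ('j \<Rightarrow> 'a) \<Rightarrow> 'o \<Rightarrow> ('i \<Rightarrow> 'a) \<Rightarrow> bool" where
  "is_limit I X DO DA L \<pi> \<longleftrightarrow> is_cone I X DO DA L \<pi> \<and>
     (\<forall>M \<mu>. is_cone I X DO DA M \<mu> \<longrightarrow>
        (\<exists>!t. t \<in> hom X M L \<and> (\<forall>i\<in>Obj I. \<pi> i \<cdot>\<^bsub>X\<^esub> t = \<mu> i)))"

text \<open>Every finite category is isomorphic to one whose objects and arrows are natural numbers,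
  so these diagram shapes are all the finite ones.\<close>

definition has_finite_limits :: "('o, 'a) cat \<Rightarrow> bool" where
  "has_finite_limits X \<longleftrightarrow>
     (\<forall>(I :: (nat, nat) cat) DO DA. finite (Obj I) \<and> finite (Arr I) \<and> cat_functor I X DO DA \<longrightarrow>
        (\<exists>L \<pi>. is_limit I X DO DA L \<pi>))"

definition is_pullback :: "('o, 'a) cat \<Rightarrow> 'a \<Rightarrow> 'a \<Rightarrow> 'a \<Rightarrow> 'a \<Rightarrow> bool" where
  "is_pullback X f g p q \<longleftrightarrow>
     f \<in> Arr X \<and> g \<in> Arr X \<and> Cod X f = Cod X g \<and>
     p \<in> hom X (Dom X p) (Dom X f) \<and> q \<in> hom X (Dom X p) (Dom X g) \<and>
     f \<cdot>\<^bsub>X\<^esub> p = g \<cdot>\<^bsub>X\<^esub> q \<and>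
     (\<forall>W a b. a \<in> hom X W (Dom X f) \<and> b \<in> hom X W (Dom X g) \<and> f \<cdot>\<^bsub>X\<^esub> a = g \<cdot>\<^bsub>X\<^esub> b \<longrightarrow>
        (\<exists>!t. t \<in> hom X W (Dom X p) \<and> p \<cdot>\<^bsub>X\<^esub> t = a \<and> q \<cdot>\<^bsub>X\<^esub> t = b))"

definition is_triple_pullback ::
  "('o, 'a) cat \<Rightarrow> 'a \<Rightarrow> 'a \<Rightarrow> 'a \<Rightarrow> 'a \<Rightarrow> 'a \<Rightarrow> 'a \<Rightarrow> bool" where
  "is_triple_pullback X f g h p q r \<longleftrightarrow>
     f \<in> Arr X \<and> g \<in> Arr X \<and> h \<in> Arr X \<and> Cod X f = Cod X g \<and> Cod X g = Cod X h \<and>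
     p \<in> hom X (Dom X p) (Dom X f) \<and> q \<in> hom X (Dom X p) (Dom X g) \<and>
     r \<in> hom X (Dom X p) (Dom X h) \<and>
     f \<cdot>\<^bsub>X\<^esub> p = g \<cdot>\<^bsub>X\<^esub> q \<and> g \<cdot>\<^bsub>X\<^esub> q = h \<cdot>\<^bsub>X\<^esub> r \<and>
     (\<forall>W a b c. a \<in> hom X W (Dom X f) \<and> b \<in> hom X W (Dom X g) \<and> c \<in> hom X W (Dom X h) \<and>
        f \<cdot>\<^bsub>X\<^esub> a = g \<cdot>\<^bsub>X\<^esub> b \<and> g \<cdot>\<^bsub>X\<^esub> b = h \<cdot>\<^bsub>X\<^esub> c \<longrightarrow>
        (\<exists>!t. t \<in> hom X W (Dom X p) \<and> p \<cdot>\<^bsub>X\<^esub> t = a \<and> q \<cdot>\<^bsub>X\<^esub> t = b \<and> r \<cdot>\<^bsub>X\<^esub> t = c))"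

text \<open>Chosen fibre products; in a category with finite limits the choices below exist.\<close>

definition pb_legs :: "('o, 'a) cat \<Rightarrow> 'a \<Rightarrow> 'a \<Rightarrow> 'a \<times> 'a" where
  "pb_legs X f g = (SOME (p, q). is_pullback X f g p q)"

definition pr1 :: "('o, 'a) cat \<Rightarrow> 'a \<Rightarrow> 'a \<Rightarrow> 'a" where
  "pr1 X f g = fst (pb_legs X f g)"

definition pr2 :: "('o, 'a) cat \<Rightarrow> 'a \<Rightarrow> 'a \<Rightarrow> 'a" where
  "pr2 X f g = snd (pb_legs X f g)"

definition pb_ob :: "('o, 'a) cat \<Rightarrow> 'a \<Rightarrow> 'a \<Rightarrow> 'o" where
  "pb_ob X f g = Dom X (pr1 X f g)"

definition pb_tuple :: "('o, 'a) cat \<Rightarrow> 'a \<Rightarrow> 'a \<Rightarrow> 'a \<Rightarrow> 'a \<Rightarrow> 'a" where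
  "pb_tuple X f g a b =
     (THE t. t \<in> hom X (Dom X a) (pb_ob X f g) \<and> pr1 X f g \<cdot>\<^bsub>X\<^esub> t = a \<and> pr2 X f g \<cdot>\<^bsub>X\<^esub> t = b)"

definition triple_legs :: "('o, 'a) cat \<Rightarrow> 'a \<Rightarrow> 'a \<Rightarrow> 'a \<Rightarrow> 'a \<times> 'a \<times> 'a" where
  "triple_legs X f g h = (SOME (p, q, r). is_triple_pullback X f g h p q r)"

section \<open>Presheaves of sets, sites, sheaves\<close>

record ('o, 'a, 's) presheaf_data =
  Sec :: "'o \<Rightarrow> 's set"
  Rest :: "'a \<Rightarrow> 's \<Rightarrow> 's"

locale presheaf = X: category X for X :: "('o, 'a) cat" +
  fixes P :: "('o, 'a, 's) presheaf_data"
  assumes Rest_Sec: "f \<in> hom X V U \<Longrightarrow> s \<in> Sec P U \<Longrightarrow> Rest P f s \<in> Sec P V"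
    and Rest_Id: "U \<in> Obj X \<Longrightarrow> s \<in> Sec P U \<Longrightarrow> Rest P (Id X U) s = s"
    and Rest_Comp: "f \<in> hom X V U \<Longrightarrow> g \<in> hom X W V \<Longrightarrow> s \<in> Sec P U \<Longrightarrow>
          Rest P (f \<cdot>\<^bsub>X\<^esub> g) s = Rest P g (Rest P f s)"

definition is_sieve :: "('o, 'a) cat \<Rightarrow> 'o \<Rightarrow> 'a set \<Rightarrow> bool" where
  "is_sieve X U S \<longleftrightarrow> S \<subseteq> {f \<in> Arr X. Cod X f = U} \<and>
     (\<forall>f\<in>S. \<forall>g\<in>Arr X. Cod X g = Dom X f \<longrightarrow> f \<cdot>\<^bsub>X\<^esub> g \<in> S)"

definition pull_sieve :: "('o, 'a) cat \<Rightarrow> 'a \<Rightarrow> 'a set \<Rightarrow> 'a set" where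
  "pull_sieve X f S = {g \<in> Arr X. Cod X g = Dom X f \<and> f \<cdot>\<^bsub>X\<^esub> g \<in> S}"

locale site = X: category X for X :: "('o, 'a) cat" +
  fixes J :: "'o \<Rightarrow> 'a set set"
  assumes finite_limits: "has_finite_limits X"
    and covers_sieve: "U \<in> Obj X \<Longrightarrow> S \<in> J U \<Longrightarrow> is_sieve X U S"
    and maximal_cover: "U \<in> Obj X \<Longrightarrow> {f \<in> Arr X. Cod X f = U} \<in> J U"
    and stable_cover: "f \<in> hom X V U \<Longrightarrow> S \<in> J U \<Longrightarrow> pull_sieve X f S \<in> J V"
    and transitive_cover: "U \<in> Obj X \<Longrightarrow> S \<in> J U \<Longrightarrow> is_sieve X U R \<Longrightarrow>
          (\<And>f. f \<in> S \<Longrightarrow> pull_sieve X f R \<in> J (Dom X f)) \<Longrightarrow> R \<in> J U"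

definition matching_family ::
  "('o, 'a) cat \<Rightarrow> ('o, 'a, 's) presheaf_data \<Rightarrow> 'a set \<Rightarrow> ('a \<Rightarrow> 's) \<Rightarrow> bool" where
  "matching_family X P S s \<longleftrightarrow> (\<forall>f\<in>S. s f \<in> Sec P (Dom X f)) \<and>
     (\<forall>f\<in>S. \<forall>g\<in>Arr X. Cod X g = Dom X f \<longrightarrow> s (f \<cdot>\<^bsub>X\<^esub> g) = Rest P g (s f))"

definition is_sheaf ::
  "('o, 'a) cat \<Rightarrow> ('o \<Rightarrow> 'a set set) \<Rightarrow> ('o, 'a, 's) presheaf_data \<Rightarrow> bool" where
  "is_sheaf X J P \<longleftrightarrow> presheaf X P \<and>
     (\<forall>U\<in>Obj X. \<forall>S\<in>J U. \<forall>s. matching_family X P S s \<longrightarrow>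
        (\<exists>!t. t \<in> Sec P U \<and> (\<forall>f\<in>S. Rest P f t = s f)))"

definition representable :: "('o, 'a) cat \<Rightarrow> 'o \<Rightarrow> ('o, 'a, 'a) presheaf_data" where
  "representable X U = \<lparr>Sec = (\<lambda>V. hom X V U), Rest = (\<lambda>g f. f \<cdot>\<^bsub>X\<^esub> g)\<rparr>"

definition precanonical :: "('o, 'a) cat \<Rightarrow> ('o \<Rightarrow> 'a set set) \<Rightarrow> bool" where
  "precanonical X J \<longleftrightarrow> (\<forall>U\<in>Obj X. is_sheaf X J (representable X U))"

text \<open>In the slice over \<open>U\<close>, the pair \<open>(f, g)\<close> encodes \<open>g\<close> regarded as an arrow from
  \<open>f \<cdot> g\<close> to \<open>f\<close>. A sieve covers \<open>f\<close> in the induced topology iff the underlying sieve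
  on the domain of \<open>f\<close> covers.\<close>

definition slice :: "('o, 'a) cat \<Rightarrow> 'o \<Rightarrow> ('a, 'a \<times> 'a) cat" where
  "slice X U = \<lparr>
     Obj = {f \<in> Arr X. Cod X f = U},
     Arr = {(f, g). f \<in> Arr X \<and> Cod X f = U \<and> g \<in> Arr X \<and> Cod X g = Dom X f},
     Dom = (\<lambda>(f, g). f \<cdot>\<^bsub>X\<^esub> g),
     Cod = fst,
     Id = (\<lambda>f. (f, Id X (Dom X f))),
     Comp = (\<lambda>(f, g) (f', g'). (f, g \<cdot>\<^bsub>X\<^esub> g'))\<rparr>"

definition slice_topology ::
  "('o, 'a) cat \<Rightarrow> ('o \<Rightarrow> 'a set set) \<Rightarrow> 'o \<Rightarrow> 'a \<Rightarrow> ('a \<times> 'a) set set" where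
  "slice_topology X J U f = {S. is_sieve (slice X U) f S \<and> snd ` S \<in> J (Dom X f)}"

section \<open>Pseudofunctors to Cat, pseudonatural transformations, modifications\<close>

text \<open>The universe of small sets is modelled by the subsets of a type \<open>'u\<close>: an object of Cat is
  a category whose objects and whose arrows are elements of \<open>'u\<close>.

  \<open>ResO F f x\<close> and \<open>ResA F f \<phi>\<close> are the restrictions along \<open>f\<close>; \<open>Unt F U x\<close> is the coherence
  isomorphism from \<open>x\<close> to its restriction along the identity of \<open>U\<close>; \<open>Cmp F f g x\<close> is the
  coherence isomorphism from the restriction of \<open>x\<close> along \<open>f\<close> and then \<open>g\<close> to its
  restriction along \<open>f \<cdot> g\<close>.\<close>

record ('o, 'a, 'u) psfun =
  Fib :: "'o \<Rightarrow> ('u, 'u) cat"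
  ResO :: "'a \<Rightarrow> 'u \<Rightarrow> 'u"
  ResA :: "'a \<Rightarrow> 'u \<Rightarrow> 'u"
  Unt :: "'o \<Rightarrow> 'u \<Rightarrow> 'u"
  Cmp :: "'a \<Rightarrow> 'a \<Rightarrow> 'u \<Rightarrow> 'u"

locale pseudofunctor = X: category X for X :: "('o, 'a) cat" +
  fixes F :: "('o, 'a, 'u) psfun"
  assumes Fib_category: "U \<in> Obj X \<Longrightarrow> category (Fib F U)"
    and Res_functor: "f \<in> hom X V U \<Longrightarrow> cat_functor (Fib F U) (Fib F V) (ResO F f) (ResA F f)"
    and Unt_natural: "U \<in> Obj X \<Longrightarrow>
      natural_iso (Fib F U) (Fib F U) (\<lambda>x. x) (\<lambda>\<phi>. \<phi>)
        (ResO F (Id X U)) (ResA F (Id X U)) (Unt F U)"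
    and Cmp_natural: "f \<in> hom X V U \<Longrightarrow> g \<in> hom X W V \<Longrightarrow>
      natural_iso (Fib F U) (Fib F W)
        (\<lambda>x. ResO F g (ResO F f x)) (\<lambda>\<phi>. ResA F g (ResA F f \<phi>))
        (ResO F (f \<cdot>\<^bsub>X\<^esub> g)) (ResA F (f \<cdot>\<^bsub>X\<^esub> g)) (Cmp F f g)"
    and Cmp_Unt_left: "f \<in> hom X V U \<Longrightarrow> x \<in> Obj (Fib F U) \<Longrightarrow>
      Cmp F (Id X U) f x \<cdot>\<^bsub>Fib F V\<^esub> ResA F f (Unt F U x) = Id (Fib F V) (ResO F f x)"
    and Cmp_Unt_right: "f \<in> hom X V U \<Longrightarrow> x \<in> Obj (Fib F U) \<Longrightarrow>
      Cmp F f (Id X V) x \<cdot>\<^bsub>Fib F V\<^esub> Unt F V (ResO F f x) = Id (Fib F V) (ResO F f x)"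
    and Cmp_assoc: "f \<in> hom X V U \<Longrightarrow> g \<in> hom X W V \<Longrightarrow> h \<in> hom X T W \<Longrightarrow>
      x \<in> Obj (Fib F U) \<Longrightarrow>
      Cmp F (f \<cdot>\<^bsub>X\<^esub> g) h x \<cdot>\<^bsub>Fib F T\<^esub> ResA F h (Cmp F f g x) =
      Cmp F f (g \<cdot>\<^bsub>X\<^esub> h) x \<cdot>\<^bsub>Fib F T\<^esub> Cmp F g h (ResO F f x)"

text \<open>\<open>NatC p f x\<close> is the structure isomorphism from \<open>p\<close> of the restriction of \<open>x\<close> along \<open>f\<close>
  to the restriction along \<open>f\<close> of \<open>p x\<close>.\<close>

record ('o, 'a, 'u) psnat =
  NatO :: "'o \<Rightarrow> 'u \<Rightarrow> 'u"
  NatA :: "'o \<Rightarrow> 'u \<Rightarrow> 'u"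
  NatC :: "'a \<Rightarrow> 'u \<Rightarrow> 'u"

locale pseudonatural = E: pseudofunctor X E + B: pseudofunctor X B
  for X :: "('o, 'a) cat" and E B :: "('o, 'a, 'u) psfun" +
  fixes p :: "('o, 'a, 'u) psnat"
  assumes Nat_functor: "U \<in> Obj X \<Longrightarrow> cat_functor (Fib E U) (Fib B U) (NatO p U) (NatA p U)"
    and NatC_natural: "f \<in> hom X V U \<Longrightarrow>
      natural_iso (Fib E U) (Fib B V)
        (\<lambda>x. NatO p V (ResO E f x)) (\<lambda>\<phi>. NatA p V (ResA E f \<phi>))
        (\<lambda>x. ResO B f (NatO p U x)) (\<lambda>\<phi>. ResA B f (NatA p U \<phi>)) (NatC p f)"
    and NatC_Unt: "U \<in> Obj X \<Longrightarrow> x \<in> Obj (Fib E U) \<Longrightarrow>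
      NatC p (Id X U) x \<cdot>\<^bsub>Fib B U\<^esub> NatA p U (Unt E U x) = Unt B U (NatO p U x)"
    and NatC_Cmp: "f \<in> hom X V U \<Longrightarrow> g \<in> hom X W V \<Longrightarrow> x \<in> Obj (Fib E U) \<Longrightarrow>
      NatC p (f \<cdot>\<^bsub>X\<^esub> g) x \<cdot>\<^bsub>Fib B W\<^esub> NatA p W (Cmp E f g x) =
      Cmp B f g (NatO p U x) \<cdot>\<^bsub>Fib B W\<^esub> ResA B g (NatC p f x) \<cdot>\<^bsub>Fib B W\<^esub> NatC p g (ResO E f x)"

text \<open>The composite of \<open>h\<close> followed by \<open>p\<close>; \<open>B\<close> is the target of \<open>p\<close>.\<close>

definition psnat_comp ::
  "('o, 'a) cat \<Rightarrow> ('o, 'a, 'u) psfun \<Rightarrow> ('o, 'a, 'u) psnat \<Rightarrow> ('o, 'a, 'u) psnat \<Rightarrow>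
   ('o, 'a, 'u) psnat" where
  "psnat_comp X B p h = \<lparr>
     NatO = (\<lambda>U x. NatO p U (NatO h U x)),
     NatA = (\<lambda>U \<phi>. NatA p U (NatA h U \<phi>)),
     NatC = (\<lambda>f x. NatC p f (NatO h (Cod X f) x) \<cdot>\<^bsub>Fib B (Dom X f)\<^esub> NatA p (Dom X f) (NatC h f x))\<rparr>"

locale modification = p: pseudonatural X E B p + q: pseudonatural X E B q
  for X :: "('o, 'a) cat" and E B :: "('o, 'a, 'u) psfun" and p q +
  fixes m :: "'o \<Rightarrow> 'u \<Rightarrow> 'u"
  assumes mod_hom: "U \<in> Obj X \<Longrightarrow> x \<in> Obj (Fib E U) \<Longrightarrow>
      m U x \<in> hom (Fib B U) (NatO p U x) (NatO q U x)"
    and mod_natural: "U \<in> Obj X \<Longrightarrow> \<phi> \<in> hom (Fib E U) x y \<Longrightarrow>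
      m U y \<cdot>\<^bsub>Fib B U\<^esub> NatA p U \<phi> = NatA q U \<phi> \<cdot>\<^bsub>Fib B U\<^esub> m U x"
    and mod_NatC: "f \<in> hom X V U \<Longrightarrow> x \<in> Obj (Fib E U) \<Longrightarrow>
      ResA B f (m U x) \<cdot>\<^bsub>Fib B V\<^esub> NatC p f x = NatC q f x \<cdot>\<^bsub>Fib B V\<^esub> m V (ResO E f x)"

definition invertible_modification ::
  "('o, 'a) cat \<Rightarrow> ('o, 'a, 'u) psfun \<Rightarrow> ('o, 'a, 'u) psfun \<Rightarrow> ('o, 'a, 'u) psnat \<Rightarrow>
   ('o, 'a, 'u) psnat \<Rightarrow> ('o \<Rightarrow> 'u \<Rightarrow> 'u) \<Rightarrow> bool" where
  "invertible_modification X E B p q m \<longleftrightarrow> modification X E B p q m \<and>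
     (\<exists>n. modification X E B q p n \<and>
        (\<forall>U\<in>Obj X. \<forall>x\<in>Obj (Fib E U).
           n U x \<cdot>\<^bsub>Fib B U\<^esub> m U x = Id (Fib B U) (NatO p U x) \<and>
           m U x \<cdot>\<^bsub>Fib B U\<^esub> n U x = Id (Fib B U) (NatO q U x)))"

section \<open>Prestacks\<close>

text \<open>For \<open>\<phi>\<close> from the restriction of \<open>x\<close> along \<open>u\<close> to the restriction of \<open>y\<close> along \<open>v\<close>, this is
  the restriction of \<open>\<phi>\<close> along \<open>t\<close>, conjugated by coherence isomorphisms so as to go from the
  restriction of \<open>x\<close> along \<open>u \<cdot> t\<close> to the restriction of \<open>y\<close> along \<open>v \<cdot> t\<close>.\<close>

definition restrict_mor ::
  "('o, 'a) cat \<Rightarrow> ('o, 'a, 'u) psfun \<Rightarrow> 'a \<Rightarrow> 'a \<Rightarrow> 'u \<Rightarrow> 'u \<Rightarrow> 'a \<Rightarrow> 'u \<Rightarrow> 'u" where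
  "restrict_mor X F u v x y t \<phi> =
     Cmp F v t y \<cdot>\<^bsub>Fib F (Dom X t)\<^esub> ResA F t \<phi> \<cdot>\<^bsub>Fib F (Dom X t)\<^esub>
       inv_arr (Fib F (Dom X t)) (Cmp F u t x)"

definition hom_presheaf ::
  "('o, 'a) cat \<Rightarrow> ('o, 'a, 'u) psfun \<Rightarrow> 'u \<Rightarrow> 'u \<Rightarrow> ('a, 'a \<times> 'a, 'u) presheaf_data" where
  "hom_presheaf X F a b = \<lparr>
     Sec = (\<lambda>f. hom (Fib F (Dom X f)) (ResO F f a) (ResO F f b)),
     Rest = (\<lambda>(f, g). restrict_mor X F f f a b g)\<rparr>"

definition prestack ::
  "('o, 'a) cat \<Rightarrow> ('o \<Rightarrow> 'a set set) \<Rightarrow> ('o, 'a, 'u) psfun \<Rightarrow> bool" where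
  "prestack X J F \<longleftrightarrow> pseudofunctor X F \<and>
     (\<forall>U\<in>Obj X. \<forall>a\<in>Obj (Fib F U). \<forall>b\<in>Obj (Fib F U).
        is_sheaf (slice X U) (slice_topology X J U) (hom_presheaf X F a b))"

section \<open>Descent data and local fibrations\<close>

text \<open>A covering sieve \<open>S\<close> is regarded as the family of its own elements, so an index \<open>\<alpha>\<close> is an
  arrow \<open>\<alpha> \<in> S\<close> with domain \<open>U\<^sub>\<alpha>\<close>. Families indexed by \<open>S\<close> are extensional functions
  (\<open>undefined\<close> off \<open>S\<close>), so that equality of families is equality of functions.\<close>

text \<open>The composite below typechecks because \<open>\<beta> \<cdot> pr2 = \<alpha> \<cdot> pr1\<close>.\<close>

definition sigma ::
  "('o, 'a) cat \<Rightarrow> ('o, 'a, 'u) psfun \<Rightarrow> 'a \<Rightarrow> 'a \<Rightarrow> 'u \<Rightarrow> 'u" where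
  "sigma X F \<alpha> \<beta> x =
     inv_arr (Fib F (pb_ob X \<alpha> \<beta>)) (Cmp F \<alpha> (pr1 X \<alpha> \<beta>) x)
       \<cdot>\<^bsub>Fib F (pb_ob X \<alpha> \<beta>)\<^esub> Cmp F \<beta> (pr2 X \<alpha> \<beta>) x"

record ('a, 'u) descent =
  dbase :: 'u
  dloc :: "'a \<Rightarrow> 'u"
  dpsi :: "'a \<Rightarrow> 'u"
  dtheta :: "'a \<times> 'a \<Rightarrow> 'u"

record ('a, 'u) descent_arr =
  asrc :: "('a, 'u) descent"
  atgt :: "('a, 'u) descent"
  abase :: 'u
  aloc :: "'a \<Rightarrow> 'u"

text \<open>\<open>\<theta>\<^sub>\<alpha>\<^sub>\<alpha>\<close> restricts along the diagonal \<open>\<delta>\<close> to an automorphism of the restriction of \<open>e\<^sub>\<alpha>\<close>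
  along an identity; conjugating by \<open>Unt\<close> makes it an automorphism of \<open>e\<^sub>\<alpha>\<close> itself.\<close>

definition descent_unit ::
  "('o, 'a) cat \<Rightarrow> ('o, 'a, 'u) psfun \<Rightarrow> 'a set \<Rightarrow> ('a, 'u) descent \<Rightarrow> bool" where
  "descent_unit X E S d \<longleftrightarrow> (\<forall>\<alpha>\<in>S.
     let V = Dom X \<alpha>; e = dloc d \<alpha>; \<delta> = pb_tuple X \<alpha> \<alpha> (Id X V) (Id X V) in
       inv_arr (Fib E V) (Unt E V e) \<cdot>\<^bsub>Fib E V\<^esub>
         restrict_mor X E (pr2 X \<alpha> \<alpha>) (pr1 X \<alpha> \<alpha>) e e \<delta> (dtheta d (\<alpha>, \<alpha>)) \<cdot>\<^bsub>Fib E V\<^esub> Unt E V e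
       = Id (Fib E V) e)"

text \<open>The local \<open>\<theta> \<mu> \<nu> r s\<close> is \<open>\<theta>\<^sub>\<mu>\<^sub>\<nu>\<close> restricted to the triple fibre product, where \<open>r\<close> and \<open>s\<close> are
  the projections to \<open>U\<^sub>\<mu>\<close> and \<open>U\<^sub>\<nu>\<close>.\<close>

definition descent_cocycle ::
  "('o, 'a) cat \<Rightarrow> ('o, 'a, 'u) psfun \<Rightarrow> 'a set \<Rightarrow> ('a, 'u) descent \<Rightarrow> bool" where
  "descent_cocycle X E S d \<longleftrightarrow> (\<forall>\<alpha>\<in>S. \<forall>\<beta>\<in>S. \<forall>\<gamma>\<in>S.
     let (q\<alpha>, q\<beta>, q\<gamma>) = triple_legs X \<alpha> \<beta> \<gamma>;
         \<theta> = (\<lambda>\<mu> \<nu> r s. restrict_mor X E (pr2 X \<mu> \<nu>) (pr1 X \<mu> \<nu>) (dloc d \<nu>) (dloc d \<mu>)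
                (pb_tuple X \<mu> \<nu> r s) (dtheta d (\<mu>, \<nu>)))
     in \<theta> \<alpha> \<beta> q\<alpha> q\<beta> \<cdot>\<^bsub>Fib E (Dom X q\<alpha>)\<^esub> \<theta> \<beta> \<gamma> q\<beta> q\<gamma> = \<theta> \<alpha> \<gamma> q\<alpha> q\<gamma>)"

definition descent_compat ::
  "('o, 'a) cat \<Rightarrow> ('o, 'a, 'u) psfun \<Rightarrow> ('o, 'a, 'u) psnat \<Rightarrow> 'a set \<Rightarrow>
   ('a, 'u) descent \<Rightarrow> bool" where
  "descent_compat X B p S d \<longleftrightarrow> (\<forall>\<alpha>\<in>S. \<forall>\<beta>\<in>S.
     let W = pb_ob X \<alpha> \<beta>; \<pi>1 = pr1 X \<alpha> \<beta>; \<pi>2 = pr2 X \<alpha> \<beta> in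
       sigma X B \<alpha> \<beta> (dbase d) \<cdot>\<^bsub>Fib B W\<^esub> ResA B \<pi>2 (dpsi d \<beta>) \<cdot>\<^bsub>Fib B W\<^esub> NatC p \<pi>2 (dloc d \<beta>)
       = ResA B \<pi>1 (dpsi d \<alpha>) \<cdot>\<^bsub>Fib B W\<^esub> NatC p \<pi>1 (dloc d \<alpha>) \<cdot>\<^bsub>Fib B W\<^esub>
           NatA p W (dtheta d (\<alpha>, \<beta>)))"

definition descent_objects ::
  "('o, 'a) cat \<Rightarrow> ('o, 'a, 'u) psfun \<Rightarrow> ('o, 'a, 'u) psfun \<Rightarrow> ('o, 'a, 'u) psnat \<Rightarrow>
   'o \<Rightarrow> 'a set \<Rightarrow> ('a, 'u) descent set" where
  "descent_objects X E B p U S = {d.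
     dbase d \<in> Obj (Fib B U) \<and>
     dloc d \<in> (\<Pi>\<^sub>E \<alpha>\<in>S. Obj (Fib E (Dom X \<alpha>))) \<and>
     dpsi d \<in> (\<Pi>\<^sub>E \<alpha>\<in>S. isos (Fib B (Dom X \<alpha>))
                 (NatO p (Dom X \<alpha>) (dloc d \<alpha>)) (ResO B \<alpha> (dbase d))) \<and>
     dtheta d \<in> (\<Pi>\<^sub>E (\<alpha>, \<beta>)\<in>S \<times> S. isos (Fib E (pb_ob X \<alpha> \<beta>))
                 (ResO E (pr2 X \<alpha> \<beta>) (dloc d \<beta>)) (ResO E (pr1 X \<alpha> \<beta>) (dloc d \<alpha>))) \<and>
     descent_unit X E S d \<and> descent_cocycle X E S d \<and> descent_compat X B p S d}"

definition descent_arrows ::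
  "('o, 'a) cat \<Rightarrow> ('o, 'a, 'u) psfun \<Rightarrow> ('o, 'a, 'u) psfun \<Rightarrow> ('o, 'a, 'u) psnat \<Rightarrow>
   'o \<Rightarrow> 'a set \<Rightarrow> ('a, 'u) descent_arr set" where
  "descent_arrows X E B p U S = {k.
     asrc k \<in> descent_objects X E B p U S \<and> atgt k \<in> descent_objects X E B p U S \<and>
     abase k \<in> hom (Fib B U) (dbase (asrc k)) (dbase (atgt k)) \<and>
     aloc k \<in> (\<Pi>\<^sub>E \<alpha>\<in>S. hom (Fib E (Dom X \<alpha>)) (dloc (asrc k) \<alpha>) (dloc (atgt k) \<alpha>)) \<and>
     (\<forall>\<alpha>\<in>S. \<forall>\<beta>\<in>S.
        ResA E (pr1 X \<alpha> \<beta>) (aloc k \<alpha>) \<cdot>\<^bsub>Fib E (pb_ob X \<alpha> \<beta>)\<^esub> dtheta (asrc k) (\<alpha>, \<beta>) =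
        dtheta (atgt k) (\<alpha>, \<beta>) \<cdot>\<^bsub>Fib E (pb_ob X \<alpha> \<beta>)\<^esub> ResA E (pr2 X \<alpha> \<beta>) (aloc k \<beta>)) \<and>
     (\<forall>\<alpha>\<in>S.
        ResA B \<alpha> (abase k) \<cdot>\<^bsub>Fib B (Dom X \<alpha>)\<^esub> dpsi (asrc k) \<alpha> =
        dpsi (atgt k) \<alpha> \<cdot>\<^bsub>Fib B (Dom X \<alpha>)\<^esub> NatA p (Dom X \<alpha>) (aloc k \<alpha>))}"

definition Desc ::
  "('o, 'a) cat \<Rightarrow> ('o, 'a, 'u) psfun \<Rightarrow> ('o, 'a, 'u) psfun \<Rightarrow> ('o, 'a, 'u) psnat \<Rightarrow>
   'o \<Rightarrow> 'a set \<Rightarrow> (('a, 'u) descent, ('a, 'u) descent_arr) cat" where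
  "Desc X E B p U S = \<lparr>
     Obj = descent_objects X E B p U S,
     Arr = descent_arrows X E B p U S,
     Dom = asrc,
     Cod = atgt,
     Id = (\<lambda>d. \<lparr>asrc = d, atgt = d, abase = Id (Fib B U) (dbase d),
                 aloc = (\<lambda>\<alpha>\<in>S. Id (Fib E (Dom X \<alpha>)) (dloc d \<alpha>))\<rparr>),
     Comp = (\<lambda>k l. \<lparr>asrc = asrc l, atgt = atgt k, abase = abase k \<cdot>\<^bsub>Fib B U\<^esub> abase l,
                 aloc = (\<lambda>\<alpha>\<in>S. aloc k \<alpha> \<cdot>\<^bsub>Fib E (Dom X \<alpha>)\<^esub> aloc l \<alpha>)\<rparr>)\<rparr>"

definition PhiO ::
  "('o, 'a) cat \<Rightarrow> ('o, 'a, 'u) psfun \<Rightarrow> ('o, 'a, 'u) psnat \<Rightarrow> 'o \<Rightarrow> 'a set \<Rightarrow> 'u \<Rightarrow>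
   ('a, 'u) descent" where
  "PhiO X E p U S e = \<lparr>
     dbase = NatO p U e,
     dloc = (\<lambda>\<alpha>\<in>S. ResO E \<alpha> e),
     dpsi = (\<lambda>\<alpha>\<in>S. NatC p \<alpha> e),
     dtheta = (\<lambda>(\<alpha>, \<beta>)\<in>S \<times> S. sigma X E \<alpha> \<beta> e)\<rparr>"

definition PhiA ::
  "('o, 'a) cat \<Rightarrow> ('o, 'a, 'u) psfun \<Rightarrow> ('o, 'a, 'u) psnat \<Rightarrow> 'o \<Rightarrow> 'a set \<Rightarrow> 'u \<Rightarrow>
   ('a, 'u) descent_arr" where
  "PhiA X E p U S \<phi> = \<lparr>
     asrc = PhiO X E p U S (Dom (Fib E U) \<phi>),
     atgt = PhiO X E p U S (Cod (Fib E U) \<phi>),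
     abase = NatA p U \<phi>,
     aloc = (\<lambda>\<alpha>\<in>S. ResA E \<alpha> \<phi>)\<rparr>"

definition local_fibration ::
  "('o, 'a) cat \<Rightarrow> ('o \<Rightarrow> 'a set set) \<Rightarrow> ('o, 'a, 'u) psfun \<Rightarrow> ('o, 'a, 'u) psfun \<Rightarrow>
   ('o, 'a, 'u) psnat \<Rightarrow> bool" where
  "local_fibration X J E B p \<longleftrightarrow> (\<forall>U\<in>Obj X. \<forall>S\<in>J U.
     equivalence_of_categories (Fib E U) (Desc X E B p U S) (PhiO X E p U S) (PhiA X E p U S))"

section \<open>Local weak equivalences and lifting\<close>

text \<open>Maps are recorded as triples of source, target and underlying transformation.\<close>

definition local_weak_equivalences ::
  "('o, 'a) cat \<Rightarrow> ('o \<Rightarrow> 'a set set) \<Rightarrow>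
   (('o, 'a, 'u) psfun \<times> ('o, 'a, 'u) psfun \<times> ('o, 'a, 'u) psnat) set" where
  "local_weak_equivalences X J = {(A, B, h).
     prestack X J A \<and> prestack X J B \<and> pseudonatural X A B h \<and>
     (\<forall>U\<in>Obj X. full_and_faithful (Fib A U) (Fib B U) (NatO h U) (NatA h U)) \<and>
     (\<forall>U\<in>Obj X. \<forall>b\<in>Obj (Fib B U). \<exists>S\<in>J U. \<forall>\<alpha>\<in>S. \<exists>b'\<in>Obj (Fib A (Dom X \<alpha>)).
        isos (Fib B (Dom X \<alpha>)) (NatO h (Dom X \<alpha>) b') (ResO B \<alpha> b) \<noteq> {})}"

text \<open>\<open>lifts X A C f E B p\<close>: the map \<open>f\<close> from \<open>A\<close> to \<open>C\<close> lifts (in the bicategorical sense)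
  against the map \<open>p\<close> from \<open>E\<close> to \<open>B\<close>. The last line is \<open>\<gamma> = (\<rho> * f) \<cdot> (p * \<kappa>)\<close>.\<close>

definition lifts ::
  "('o, 'a) cat \<Rightarrow> ('o, 'a, 'u) psfun \<Rightarrow> ('o, 'a, 'u) psfun \<Rightarrow> ('o, 'a, 'u) psnat \<Rightarrow>
   ('o, 'a, 'u) psfun \<Rightarrow> ('o, 'a, 'u) psfun \<Rightarrow> ('o, 'a, 'u) psnat \<Rightarrow> bool" where
  "lifts X A C f E B p \<longleftrightarrow>
     (\<forall>h k \<gamma>. pseudonatural X A E h \<and> pseudonatural X C B k \<and>
        invertible_modification X A B (psnat_comp X B p h) (psnat_comp X B k f) \<gamma> \<longrightarrow>
        (\<exists>l \<kappa> \<rho>. pseudonatural X C E l \<and>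
           invertible_modification X A E h (psnat_comp X E l f) \<kappa> \<and>
           invertible_modification X C B (psnat_comp X B p l) k \<rho> \<and>
           (\<forall>U\<in>Obj X. \<forall>x\<in>Obj (Fib A U).
              \<gamma> U x = \<rho> U (NatO f U x) \<cdot>\<^bsub>Fib B U\<^esub> NatA p U (\<kappa> U x))))"

definition class_lifts ::
  "('o, 'a) cat \<Rightarrow> (('o, 'a, 'u) psfun \<times> ('o, 'a, 'u) psfun \<times> ('o, 'a, 'u) psnat) set \<Rightarrow>
   ('o, 'a, 'u) psfun \<Rightarrow> ('o, 'a, 'u) psfun \<Rightarrow> ('o, 'a, 'u) psnat \<Rightarrow> bool" where
  "class_lifts X W E B p \<longleftrightarrow> (\<forall>(A, C, f)\<in>W. lifts X A C f E B p)"

end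

theory Submission
  imports Defs
begin

text \<open>In the Grothendieck construction of a pseudofunctor all coherence isomorphisms are absorbed into
  composition: pseudonatural transformations become functors over the site that preserve cartesian
  arrows, invertible modifications become vertical natural isomorphisms, and a prestack is a fibred
  category whose arrows glue uniquely along covers. A descent datum on a covering sieve \<open>S\<close> becomes
  a cartesian functor from \<open>S\<close> into the total category of \<open>E\<close> together with compatible cartesian
  arrows to an object \<open>b\<close> of the total category of \<open>B\<close>. Since \<open>\<Phi>\<close> is fully faithful for prestacks,
  \<open>p\<close> is a local fibration iff every such datum can be glued.

  If data can be glued and \<open>f\<close> is a local weak equivalence from \<open>A\<close> to \<open>C\<close>, then for \<open>c\<close> in \<open>C\<close> the
  objects \<open>a\<close> of \<open>A\<close> with a cartesian arrow from \<open>f a\<close> to \<open>c\<close> lie over a covering sieve; the objects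
  \<open>h a\<close> glue to an object \<open>l c\<close> over \<open>k c\<close>, and \<open>l\<close> is defined on arrows by gluing in \<open>E\<close>.
  Conversely, as the topology is precanonical, the inclusion of a covering sieve of \<open>U\<close> into the
  representable of \<open>U\<close> is a local weak equivalence between discrete prestacks; a descent datum is
  a lifting problem for it, and the value of a lift at the identity of \<open>U\<close> glues the datum.\<close>

text \<open>Descent data are conjugated by coherence isomorphisms and indexed by chosen fibre
  products, while a lift needs a plain functor on the sieve. The two are exchanged as follows. The
  gluing isomorphism for \<open>\<alpha>\<close> and \<open>\<alpha> \<cdot>[X] g\<close>, applied
  to an identity, is a cartesian arrow over \<open>g\<close>; conversely, both restrictions to a
  fibre product are compared with the object over its common composite into \<open>U\<close>. So
  both directions can work with \<open>effective\<close>, and fibre products occur only in its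
  comparison with \<Phi>.

  The lift is built from chosen local preimages, and its functoriality must not depend on them. The
  remedy is \<open>tau\<close>, which sends any arrow from \<open>F a\<close> to \<open>c\<close>,
  over a suitable cover, to an arrow from \<open>H a\<close> to the glued object; the equations for
  the lift are checked through \<open>tau\<close>.

  Precanonicity enters through uniqueness: arrows into \<open>U\<close> that agree on a cover are
  equal, which makes the hom presheaves of a discrete fibre sheaves. Fibres are categories on the
  type \<open>'u\<close>, so arrows into \<open>U\<close> are represented by codes, and local
  smallness supplies injective ones.\<close>

abbreviation (input) comp_in ("(_ \<cdot>[_]/ _)" [71, 0, 70] 70)
  where "g \<cdot>[X] f \<equiv> Comp X g f"

section \<open>Categories, equivalences and fibre products\<close>

lemma in_hom: "f \<in> hom X x y \<longleftrightarrow> f \<in> Arr X \<and> Dom X f = x \<and> Cod X f = y"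
  by (simp add: hom_def)

section \<open>Composition and isomorphisms in one category\<close>

context category begin

lemma Comp_Arr [simp]: "\<lbrakk>g \<in> Arr X; f \<in> Arr X; Dom X g = Cod X f\<rbrakk> \<Longrightarrow> g \<cdot>[X] f \<in> Arr X"
  using Comp_hom[of f _ _ g] by (simp add: in_hom)

lemma Dom_Comp [simp]: "\<lbrakk>g \<in> Arr X; f \<in> Arr X; Dom X g = Cod X f\<rbrakk> \<Longrightarrow> Dom X (g \<cdot>[X] f) = Dom X f"
  using Comp_hom[of f _ _ g] by (simp add: in_hom)

lemma Cod_Comp [simp]: "\<lbrakk>g \<in> Arr X; f \<in> Arr X; Dom X g = Cod X f\<rbrakk> \<Longrightarrow> Cod X (g \<cdot>[X] f) = Cod X g"
  using Comp_hom[of f _ _ g] by (simp add: in_hom)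

lemma assoc [simp]: "\<lbrakk>f \<in> Arr X; g \<in> Arr X; h \<in> Arr X; Dom X g = Cod X f; Dom X h = Cod X g\<rbrakk>
    \<Longrightarrow> (h \<cdot>[X] g) \<cdot>[X] f = h \<cdot>[X] (g \<cdot>[X] f)"
  using Comp_assoc[of f _ _ g _ h] by (simp add: in_hom)

lemma Id_Arr [simp]: "x \<in> Obj X \<Longrightarrow> Id X x \<in> Arr X"
  and Dom_Id [simp]: "x \<in> Obj X \<Longrightarrow> Dom X (Id X x) = x"
  and Cod_Id [simp]: "x \<in> Obj X \<Longrightarrow> Cod X (Id X x) = x"
  using Id_hom[of x] by (simp_all add: in_hom)

lemma Id_left [simp]: "f \<in> Arr X \<Longrightarrow> Cod X f = y \<Longrightarrow> Id X y \<cdot>[X] f = f"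
  using Comp_Id_left[of f _ y] by (simp add: in_hom)

lemma Id_right [simp]: "f \<in> Arr X \<Longrightarrow> Dom X f = x \<Longrightarrow> f \<cdot>[X] Id X x = f"
  using Comp_Id_right[of f x] by (simp add: in_hom)

declare Dom_Obj [simp] Cod_Obj [simp]

text \<open>Composites are normalised to the right by \<open>assoc\<close>, which hides the factor
  \<open>g \<cdot>[X] f\<close> as soon as a tail \<open>z\<close> precedes it. This form of an
  equation between two factors still applies in that normal form.\<close>

lemma compose_eq: "\<lbrakk>g \<cdot>[X] f = k; z \<in> Arr X; f \<in> Arr X; g \<in> Arr X; Cod X z = Dom X f; Dom X g = Cod X f\<rbrakk>
    \<Longrightarrow> g \<cdot>[X] (f \<cdot>[X] z) = k \<cdot>[X] z"
  by (metis assoc)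

lemma compose_eq2: "\<lbrakk>g \<cdot>[X] f = g' \<cdot>[X] f'; z \<in> Arr X; f \<in> Arr X; g \<in> Arr X; f' \<in> Arr X; g' \<in> Arr X;
     Cod X z = Dom X f; Dom X g = Cod X f; Cod X z = Dom X f'; Dom X g' = Cod X f'\<rbrakk>
    \<Longrightarrow> g \<cdot>[X] (f \<cdot>[X] z) = g' \<cdot>[X] (f' \<cdot>[X] z)"
  by (metis assoc)

lemma inverse_arrows_unique:
  assumes "inverse_arrows X f g" "inverse_arrows X f g'" shows "g = g'"
proof -
  have "g = g \<cdot>[X] (f \<cdot>[X] g')" using assms by (simp add: inverse_arrows_def in_hom)
  also have "\<dots> = Id X (Dom X f) \<cdot>[X] g'"
    using assms by (intro compose_eq) (auto simp: inverse_arrows_def in_hom)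
  also have "\<dots> = g'" using assms by (simp add: inverse_arrows_def in_hom)
  finally show ?thesis .
qed

lemma inv_arr_inverse:
  assumes "f \<in> isos X x y" shows "inverse_arrows X f (inv_arr X f)"
  unfolding inv_arr_def
  using assms inverse_arrows_unique by (auto simp: isos_def intro: theI)

lemma isos_Arr: "f \<in> isos X x y \<Longrightarrow> f \<in> Arr X \<and> Dom X f = x \<and> Cod X f = y"
  by (simp add: isos_def in_hom)

lemma isos_Obj: "f \<in> isos X x y \<Longrightarrow> x \<in> Obj X \<and> y \<in> Obj X"
  using isos_Arr[of f x y] Dom_Obj[of f] Cod_Obj[of f] by auto

lemma inv_arr_simps:
  assumes "f \<in> isos X x y"
  shows "inv_arr X f \<in> Arr X" "Dom X (inv_arr X f) = y" "Cod X (inv_arr X f) = x"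
    "inv_arr X f \<cdot>[X] f = Id X x" "f \<cdot>[X] inv_arr X f = Id X y"
  using inv_arr_inverse[OF assms] isos_Arr[OF assms] by (auto simp: inverse_arrows_def in_hom)

lemma isosI: "\<lbrakk>f \<in> hom X x y; g \<in> hom X y x; g \<cdot>[X] f = Id X x; f \<cdot>[X] g = Id X y\<rbrakk> \<Longrightarrow> f \<in> isos X x y"
  by (auto simp: isos_def inverse_arrows_def in_hom)

lemma inv_arr_isos: "f \<in> isos X x y \<Longrightarrow> inv_arr X f \<in> isos X y x"
  using inv_arr_simps[of f x y] isos_Arr[of f x y] by (intro isosI[where g = f]) (auto simp: in_hom)

lemma Id_isos: "x \<in> Obj X \<Longrightarrow> Id X x \<in> isos X x x"
  by (rule isosI[where g = "Id X x"]) (auto simp: in_hom)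

lemma isos_Comp:
  assumes "f \<in> isos X x y" "g \<in> isos X y z" shows "g \<cdot>[X] f \<in> isos X x z"
proof (rule isosI)
  note [simp] = isos_Arr[OF assms(1)] isos_Arr[OF assms(2)] inv_arr_simps[OF assms(1)] inv_arr_simps[OF assms(2)]
  show "g \<cdot>[X] f \<in> hom X x z" by (simp add: in_hom)
  show "inv_arr X f \<cdot>[X] inv_arr X g \<in> hom X z x" by (simp add: in_hom)
  have O: "y \<in> Obj X" using isos_Obj[OF assms(1)] by blast
  show "(inv_arr X f \<cdot>[X] inv_arr X g) \<cdot>[X] (g \<cdot>[X] f) = Id X x"
    using compose_eq[OF inv_arr_simps(4)[OF assms(2)], of f] by simp
  show "(g \<cdot>[X] f) \<cdot>[X] (inv_arr X f \<cdot>[X] inv_arr X g) = Id X z"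
    using compose_eq[OF inv_arr_simps(5)[OF assms(1)], of "inv_arr X g"] by simp
qed

lemma iso_cancel_left:
  assumes f: "f \<in> isos X x y" and "g \<in> Arr X" "h \<in> Arr X" "Cod X g = x" "Cod X h = x"
    and eq: "f \<cdot>[X] g = f \<cdot>[X] h"
  shows "g = h"
proof -
  note [simp] = isos_Arr[OF f] inv_arr_simps[OF f] assms(2-5)
  have "inv_arr X f \<cdot>[X] (f \<cdot>[X] g) = g" "inv_arr X f \<cdot>[X] (f \<cdot>[X] h) = h"
    using compose_eq[OF inv_arr_simps(4)[OF f], of g] compose_eq[OF inv_arr_simps(4)[OF f], of h] by simp_all
  with eq show ?thesis by metis
qed

lemma iso_cancel_right:
  assumes f: "f \<in> isos X x y" and "g \<in> Arr X" "h \<in> Arr X" "Dom X g = y" "Dom X h = y"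
    and eq: "g \<cdot>[X] f = h \<cdot>[X] f"
  shows "g = h"
proof -
  note [simp] = isos_Arr[OF f] inv_arr_simps[OF f] assms(2-5)
  have "(g \<cdot>[X] f) \<cdot>[X] inv_arr X f = g" "(h \<cdot>[X] f) \<cdot>[X] inv_arr X f = h"
    by simp_all
  with eq show ?thesis by metis
qed

end

section \<open>Functors, full faithfulness and equivalences\<close>

context cat_functor begin

lemma FA_Arr [simp]: "f \<in> Arr X \<Longrightarrow> FA f \<in> Arr Y"
  and FA_Dom [simp]: "f \<in> Arr X \<Longrightarrow> Dom Y (FA f) = FO (Dom X f)"
  and FA_Cod [simp]: "f \<in> Arr X \<Longrightarrow> Cod Y (FA f) = FO (Cod X f)"
  using FA_hom[of f] by (simp_all add: in_hom)

lemma FA_comp [simp]: "f \<in> Arr X \<Longrightarrow> g \<in> Arr X \<Longrightarrow> Dom X g = Cod X f \<Longrightarrow> FA (g \<cdot>[X] f) = FA g \<cdot>[Y] FA f"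
  using FA_Comp[of f _ _ g] by (simp add: in_hom)

declare FO_Obj [simp] FA_Id [simp]

lemma FA_isos: "f \<in> isos X x y \<Longrightarrow> FA f \<in> isos Y (FO x) (FO y)"
proof (rule Y.isosI)
  assume f: "f \<in> isos X x y"
  note [simp] = X.isos_Arr[OF f] X.inv_arr_simps[OF f]
  have O: "x \<in> Obj X" "y \<in> Obj X" using X.isos_Obj[OF f] by auto
  show "FA f \<in> hom Y (FO x) (FO y)" "FA (inv_arr X f) \<in> hom Y (FO y) (FO x)" by (simp_all add: in_hom)
  show "FA (inv_arr X f) \<cdot>[Y] FA f = Id Y (FO x)" "FA f \<cdot>[Y] FA (inv_arr X f) = Id Y (FO y)"
    using O by (simp_all flip: FA_comp)
qed

text \<open>Fullness gives a preimage of the inverse, and faithfulness pulls the two identities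
  back.\<close>

lemma ff_reflects_isos:
  assumes ff: "full_and_faithful X Y FO FA" and f: "f \<in> hom X x y" and iso: "FA f \<in> isos Y (FO x) (FO y)"
  shows "f \<in> isos X x y"
proof -
  have O[simp]: "x \<in> Obj X" "y \<in> Obj X" "f \<in> Arr X" "Dom X f = x" "Cod X f = y" using f by (auto simp: in_hom)
  note [simp] = Y.isos_Arr[OF iso] Y.inv_arr_simps[OF iso]
  have "inv_arr Y (FA f) \<in> FA ` hom X y x"
    using ff unfolding full_and_faithful_def bij_betw_def by (metis (no_types, lifting) O(1,2) Y.inv_arr_isos Y.isos_Arr in_hom iso)
  then obtain g where g: "g \<in> hom X y x" and Fg: "FA g = inv_arr Y (FA f)" by auto
  have [simp]: "g \<in> Arr X" "Dom X g = y" "Cod X g = x" using g by (auto simp: in_hom)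
  have inj: "inj_on FA (hom X z z)" if "z \<in> Obj X" for z
    using ff that by (auto simp: full_and_faithful_def bij_betw_def)
  show ?thesis
  proof (rule X.isosI[OF f g])
    show "g \<cdot>[X] f = Id X x" by (rule inj_onD[OF inj[of x]]) (auto simp: in_hom Fg)
    show "f \<cdot>[X] g = Id X y" by (rule inj_onD[OF inj[of y]]) (auto simp: in_hom Fg)
  qed
qed

text \<open>A preimage up to isomorphism is chosen for every object, and an arrow is sent to the
  preimage of its conjugate by the chosen isomorphisms. Functoriality and naturality are then
  equations between preimages, which faithfulness reduces to cancelling inverses.\<close>

lemma equivalenceI:
  assumes ff: "full_and_faithful X Y FO FA"
    and ess: "\<And>y. y \<in> Obj Y \<Longrightarrow> \<exists>x\<in>Obj X. isos Y y (FO x) \<noteq> {}"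
  shows "equivalence_of_categories X Y FO FA"
proof -
  have "\<forall>y\<in>Obj Y. \<exists>xu. fst xu \<in> Obj X \<and> snd xu \<in> isos Y y (FO (fst xu))" using ess by fastforce
  then obtain xu where xu: "\<And>y. y \<in> Obj Y \<Longrightarrow> fst (xu y) \<in> Obj X \<and> snd (xu y) \<in> isos Y y (FO (fst (xu y)))"
    by metis
  define GO where "GO y = fst (xu y)" for y
  define u where "u y = snd (xu y)" for y
  have GO[simp]: "GO y \<in> Obj X" and u: "u y \<in> isos Y y (FO (GO y))" if "y \<in> Obj Y" for y
    using xu[OF that] by (auto simp: GO_def u_def)
  define v where "v y = inv_arr Y (u y)" for y
  have us[simp]: "u y \<in> Arr Y" "Dom Y (u y) = y" "Cod Y (u y) = FO (GO y)"
    "v y \<in> Arr Y" "Dom Y (v y) = FO (GO y)" "Cod Y (v y) = y"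
    "v y \<cdot>[Y] u y = Id Y y" "u y \<cdot>[Y] v y = Id Y (FO (GO y))" if "y \<in> Obj Y" for y
    using Y.isos_Arr[OF u[OF that]] Y.inv_arr_simps[OF u[OF that]] by (auto simp: v_def)
  have vu1: "v y \<cdot>[Y] (u y \<cdot>[Y] z) = z" if "y \<in> Obj Y" "z \<in> Arr Y" "Cod Y z = y" for y z
    using that Y.compose_eq[of "v y" "u y" "Id Y y" z] by auto
  have vu2: "u y \<cdot>[Y] (v y \<cdot>[Y] w) = w" if "y \<in> Obj Y" "w \<in> Arr Y" "Cod Y w = FO (GO y)" for y w
    using that Y.compose_eq[of "u y" "v y" "Id Y (FO (GO y))" w] by auto
  note vu = vu1 vu2
  have inj: "f = g" if "f \<in> Arr X" "g \<in> Arr X" "Dom X f = Dom X g" "Cod X f = Cod X g" "FA f = FA g" for f g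
  proof -
    have "inj_on FA (hom X (Dom X f) (Cod X f))" using ff that by (auto simp: full_and_faithful_def bij_betw_def)
    then show ?thesis by (rule inj_onD) (use that in \<open>auto simp: in_hom\<close>)
  qed
  have sur: "\<exists>f. f \<in> Arr X \<and> Dom X f = x \<and> Cod X f = y \<and> FA f = g"
    if "x \<in> Obj X" "y \<in> Obj X" "g \<in> Arr Y" "Dom Y g = FO x" "Cod Y g = FO y" for x y g
  proof -
    have "g \<in> FA ` hom X x y" using ff that by (auto simp: full_and_faithful_def bij_betw_def in_hom)
    then show ?thesis by (auto simp: in_hom)
  qed
  have "\<exists>f. f \<in> Arr X \<and> Dom X f = GO (Dom Y g) \<and> Cod X f = GO (Cod Y g) \<and> FA f = u (Cod Y g) \<cdot>[Y] (g \<cdot>[Y] v (Dom Y g))"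
    if "g \<in> Arr Y" for g by (rule sur) (use that in auto)
  then obtain GA where GA[simp]: "\<And>g. g \<in> Arr Y \<Longrightarrow> GA g \<in> Arr X" "\<And>g. g \<in> Arr Y \<Longrightarrow> Dom X (GA g) = GO (Dom Y g)"
      "\<And>g. g \<in> Arr Y \<Longrightarrow> Cod X (GA g) = GO (Cod Y g)"
      "\<And>g. g \<in> Arr Y \<Longrightarrow> FA (GA g) = u (Cod Y g) \<cdot>[Y] (g \<cdot>[Y] v (Dom Y g))" by metis
  interpret G: cat_functor Y X GO GA
  proof
    show "GA (Id Y y) = Id X (GO y)" if "y \<in> Obj Y" for y
      by (rule inj) (use that in auto)
    show "GA (g \<cdot>[Y] f) = GA g \<cdot>[X] GA f" if "f \<in> hom Y x y" "g \<in> hom Y y z" for f g x y z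
    proof (rule inj)
      have [simp]: "f \<in> Arr Y" "g \<in> Arr Y" "Dom Y f = x" "Cod Y f = y" "Dom Y g = y" "Cod Y g = z" "x \<in> Obj Y" "y \<in> Obj Y" "z \<in> Obj Y"
        using that by (auto simp: in_hom)
      show "GA (g \<cdot>[Y] f) \<in> Arr X" "GA g \<cdot>[X] GA f \<in> Arr X" "Dom X (GA (g \<cdot>[Y] f)) = Dom X (GA g \<cdot>[X] GA f)"
        "Cod X (GA (g \<cdot>[Y] f)) = Cod X (GA g \<cdot>[X] GA f)" by auto
      show "FA (GA (g \<cdot>[Y] f)) = FA (GA g \<cdot>[X] GA f)" by (simp add: vu)
    qed
  qed (auto simp: in_hom)
  have "\<exists>f. f \<in> Arr X \<and> Dom X f = x \<and> Cod X f = GO (FO x) \<and> FA f = u (FO x)" if "x \<in> Obj X" for x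
    by (rule sur) (use that in auto)
  then obtain \<eta> where \<eta>[simp]: "\<And>x. x \<in> Obj X \<Longrightarrow> \<eta> x \<in> Arr X" "\<And>x. x \<in> Obj X \<Longrightarrow> Dom X (\<eta> x) = x"
      "\<And>x. x \<in> Obj X \<Longrightarrow> Cod X (\<eta> x) = GO (FO x)" "\<And>x. x \<in> Obj X \<Longrightarrow> FA (\<eta> x) = u (FO x)" by metis
  have 1: "natural_iso X X (\<lambda>x. x) (\<lambda>f. f) (\<lambda>x. GO (FO x)) (\<lambda>f. GA (FA f)) \<eta>"
  proof
    show "\<eta> x \<in> isos X x (GO (FO x))" if "x \<in> Obj X" for x
      by (rule ff_reflects_isos[OF ff]) (use that u[of "FO x"] in \<open>auto simp: in_hom\<close>)
    show "\<eta> y \<cdot>[X] f = GA (FA f) \<cdot>[X] \<eta> x" if "f \<in> hom X x y" for f x y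
      by (rule inj) (use that in \<open>auto simp: in_hom\<close>)
  qed (auto simp: in_hom)
  have 2: "natural_iso Y Y (\<lambda>y. FO (GO y)) (\<lambda>g. FA (GA g)) (\<lambda>y. y) (\<lambda>g. g) v"
  proof
    show "v y \<in> isos Y (FO (GO y)) y" if "y \<in> Obj Y" for y
      using Y.inv_arr_isos[OF u[OF that]] by (simp add: v_def)
    show "v y \<cdot>[Y] FA (GA g) = g \<cdot>[Y] v x" if "g \<in> hom Y x y" for g x y
      using that by (auto simp: in_hom vu)
  qed (auto simp: in_hom vu)
  show ?thesis unfolding equivalence_of_categories_def
    using cat_functor_axioms G.cat_functor_axioms 1 2 by blast
qed

end

text \<open>The inverse of the counit at \<open>y\<close> is the required isomorphism. This is the
  part of an equivalence from which glued objects will be obtained.\<close>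

lemma equivalence_ess_surj:
  assumes "equivalence_of_categories X Y FO FA" "y \<in> Obj Y"
  shows "\<exists>x\<in>Obj X. isos Y y (FO x) \<noteq> {}"
proof -
  obtain GO GA \<eta> \<epsilon> where "cat_functor Y X GO GA" and n: "natural_iso Y Y (\<lambda>y. FO (GO y)) (\<lambda>g. FA (GA g)) (\<lambda>y. y) (\<lambda>g. g) \<epsilon>"
    using assms(1) unfolding equivalence_of_categories_def by blast
  then interpret G: cat_functor Y X GO GA by blast
  interpret n: natural_iso Y Y "\<lambda>y. FO (GO y)" "\<lambda>g. FA (GA g)" "\<lambda>y. y" "\<lambda>g. g" \<epsilon> by fact
  have "inv_arr Y (\<epsilon> y) \<in> isos Y y (FO (GO y))"
    using n.component_iso[OF assms(2)] G.X.inv_arr_isos by blast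
  then show ?thesis using G.FO_Obj[OF assms(2)] by blast
qed

section \<open>Existence of fibre products\<close>

context category begin

lemma pullback_exists:
  assumes lim: "has_finite_limits X" and f: "f \<in> Arr X" and g: "g \<in> Arr X" and fg: "Cod X f = Cod X g"
  shows "\<exists>p q. is_pullback X f g p q"
proof -
  \<comment> \<open>The cospan as a category on numbers: the objects 0, 1, 2 double as their
    identities, 3 runs from 0 to 2 and 4 from 1 to 2.\<close>
  define D where "D n = (if n = 3 then 0 else if n = 4 then 1 else n)" for n :: nat
  define C where "C n = (if n = 3 then 2 else if n = 4 then 2 else n)" for n :: nat
  define I :: "(nat, nat) cat" where "I = \<lparr>Obj = {0,1,2}, Arr = {0,1,2,3,4}, Dom = D, Cod = C, Id = (\<lambda>n. n),
     Comp = (\<lambda>m n. if m \<le> 2 then n else m)\<rparr>"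
  interpret I: category I
    by unfold_locales (auto simp: I_def in_hom D_def C_def split: if_splits)
  define DO where "DO n = (if n = 0 then Dom X f else if n = 1 then Dom X g else Cod X f)" for n :: nat
  define DA where "DA n = (if n = 3 then f else if n = 4 then g else Id X (DO n))" for n :: nat
  have diag: "cat_functor I X DO DA"
    by unfold_locales (use f g fg in \<open>auto simp: I_def in_hom D_def C_def DO_def DA_def split: if_splits\<close>)
  have "finite (Obj I)" "finite (Arr I)" by (auto simp: I_def)
  then obtain L \<pi> where L: "is_limit I X DO DA L \<pi>" using lim diag unfolding has_finite_limits_def by blast
  have cone_iff: "is_cone I X DO DA M \<mu> \<longleftrightarrow> M \<in> Obj X \<and> \<mu> 0 \<in> hom X M (Dom X f) \<and> \<mu> 1 \<in> hom X M (Dom X g) \<and>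
      \<mu> 2 \<in> hom X M (Cod X f) \<and> f \<cdot>[X] \<mu> 0 = \<mu> 2 \<and> g \<cdot>[X] \<mu> 1 = \<mu> 2" for M \<mu>
    using f g fg by (auto simp: is_cone_def I_def D_def C_def DO_def DA_def in_hom)
  have cL: "is_cone I X DO DA L \<pi>" using L by (simp add: is_limit_def)
  have "is_pullback X f g (\<pi> 0) (\<pi> 1)"
    unfolding is_pullback_def
  proof (intro conjI allI impI)
    fix W a b assume ab: "a \<in> hom X W (Dom X f) \<and> b \<in> hom X W (Dom X g) \<and> f \<cdot>[X] a = g \<cdot>[X] b"
    define \<mu> where "\<mu> n = (if n = 0 then a else if n = 1 then b else f \<cdot>[X] a)" for n :: nat
    have "is_cone I X DO DA W \<mu>" unfolding cone_iff using ab f g fg by (auto simp: \<mu>_def in_hom)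
    then have "\<exists>!t. t \<in> hom X W L \<and> (\<forall>i\<in>Obj I. \<pi> i \<cdot>[X] t = \<mu> i)" using L by (simp add: is_limit_def)
    moreover have "t \<in> hom X W L \<and> (\<forall>i\<in>Obj I. \<pi> i \<cdot>[X] t = \<mu> i) \<longleftrightarrow>
        t \<in> hom X W (Dom X (\<pi> 0)) \<and> \<pi> 0 \<cdot>[X] t = a \<and> \<pi> 1 \<cdot>[X] t = b" for t
    proof -
      \<comment> \<open>The leg at the corner 2 is determined by the leg at 0, so a mediating arrow
        of cones is a mediating arrow of spans.\<close>
      have "\<pi> 2 \<cdot>[X] t = f \<cdot>[X] (\<pi> 0 \<cdot>[X] t)" if "t \<in> hom X W L"
      proof -
        have "f \<cdot>[X] (\<pi> 0 \<cdot>[X] t) = \<pi> 2 \<cdot>[X] t"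
          by (rule compose_eq) (use cL that f in \<open>auto simp: cone_iff in_hom\<close>)
        then show ?thesis by simp
      qed
      then show ?thesis using cL unfolding cone_iff by (auto simp: I_def \<mu>_def in_hom)
    qed
    ultimately show "\<exists>!t. t \<in> hom X W (Dom X (\<pi> 0)) \<and> \<pi> 0 \<cdot>[X] t = a \<and> \<pi> 1 \<cdot>[X] t = b" by simp
  qed (use cL f g fg in \<open>auto simp: cone_iff in_hom\<close>)
  then show ?thesis by blast
qed

text \<open>Two successive fibre products: \<open>h\<close> is pulled back along the common
  composite of the square on \<open>f\<close> and \<open>g\<close>. Uniqueness in the first square
  identifies the composite with \<open>s\<close>.\<close>

lemma triple_pullback_exists:
  assumes lim: "has_finite_limits X" and f: "f \<in> Arr X" and g: "g \<in> Arr X" and h: "h \<in> Arr X"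
    and fg: "Cod X f = Cod X g" and gh: "Cod X g = Cod X h"
  shows "\<exists>p q r. is_triple_pullback X f g h p q r"
proof -
  obtain p q where pq: "is_pullback X f g p q" using pullback_exists[OF lim f g fg] by blast
  then have [simp]: "p \<in> Arr X" "q \<in> Arr X" "Dom X q = Dom X p" "Cod X p = Dom X f" "Cod X q = Dom X g"
    and e1: "g \<cdot>[X] q = f \<cdot>[X] p" by (auto simp: is_pullback_def in_hom)
  obtain s r where sr: "is_pullback X (f \<cdot>[X] p) h s r" using pullback_exists[OF lim _ h, of "f \<cdot>[X] p"] f fg gh by auto
  then have [simp]: "s \<in> Arr X" "r \<in> Arr X" "Dom X r = Dom X s" "Cod X s = Dom X p" "Cod X r = Dom X h"
    and e2: "h \<cdot>[X] r = f \<cdot>[X] (p \<cdot>[X] s)" using f by (auto simp: is_pullback_def in_hom)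
  note [simp] = f g h
  have e3: "g \<cdot>[X] (q \<cdot>[X] s) = f \<cdot>[X] (p \<cdot>[X] s)" using compose_eq2[OF e1, of s] by simp
  have "is_triple_pullback X f g h (p \<cdot>[X] s) (q \<cdot>[X] s) r"
    unfolding is_triple_pullback_def
  proof (intro conjI allI impI)
    fix W a b c assume A: "a \<in> hom X W (Dom X f) \<and> b \<in> hom X W (Dom X g) \<and> c \<in> hom X W (Dom X h) \<and>
        f \<cdot>[X] a = g \<cdot>[X] b \<and> g \<cdot>[X] b = h \<cdot>[X] c"
    have u1: "\<exists>!t. t \<in> hom X W (Dom X p) \<and> p \<cdot>[X] t = a \<and> q \<cdot>[X] t = b" using A pq unfolding is_pullback_def by blast
    then obtain t where t: "t \<in> hom X W (Dom X p)" "p \<cdot>[X] t = a" "q \<cdot>[X] t = b" by blast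
    have "\<exists>!z. z \<in> hom X W (Dom X s) \<and> s \<cdot>[X] z = t \<and> r \<cdot>[X] z = c"
    proof -
      have "(f \<cdot>[X] p) \<cdot>[X] t = h \<cdot>[X] c" "t \<in> hom X W (Dom X (f \<cdot>[X] p))"
        using t A by (auto simp: in_hom)
      then show ?thesis using A sr unfolding is_pullback_def by blast
    qed
    moreover have "z \<in> hom X W (Dom X s) \<and> s \<cdot>[X] z = t \<and> r \<cdot>[X] z = c \<longleftrightarrow>
       z \<in> hom X W (Dom X (p \<cdot>[X] s)) \<and> (p \<cdot>[X] s) \<cdot>[X] z = a \<and> (q \<cdot>[X] s) \<cdot>[X] z = b \<and> r \<cdot>[X] z = c" for z
    proof
      assume z: "z \<in> hom X W (Dom X s) \<and> s \<cdot>[X] z = t \<and> r \<cdot>[X] z = c"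
      then show "z \<in> hom X W (Dom X (p \<cdot>[X] s)) \<and> (p \<cdot>[X] s) \<cdot>[X] z = a \<and> (q \<cdot>[X] s) \<cdot>[X] z = b \<and> r \<cdot>[X] z = c"
        using t(2,3) by (simp add: in_hom)
    next
      assume z: "z \<in> hom X W (Dom X (p \<cdot>[X] s)) \<and> (p \<cdot>[X] s) \<cdot>[X] z = a \<and> (q \<cdot>[X] s) \<cdot>[X] z = b \<and> r \<cdot>[X] z = c"
      then have "s \<cdot>[X] z \<in> hom X W (Dom X p)" "p \<cdot>[X] (s \<cdot>[X] z) = a" "q \<cdot>[X] (s \<cdot>[X] z) = b"
        by (auto simp: in_hom)
      then have "s \<cdot>[X] z = t" using u1 t by blast
      then show "z \<in> hom X W (Dom X s) \<and> s \<cdot>[X] z = t \<and> r \<cdot>[X] z = c" using z by (simp add: in_hom)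
    qed
    ultimately show "\<exists>!t. t \<in> hom X W (Dom X (p \<cdot>[X] s)) \<and> (p \<cdot>[X] s) \<cdot>[X] t = a \<and> (q \<cdot>[X] s) \<cdot>[X] t = b \<and> r \<cdot>[X] t = c"
      by simp
  qed (use fg gh in \<open>auto simp: in_hom e1 e2 e3\<close>)
  then show ?thesis by blast
qed

end

section \<open>Fibred categories and gluing\<close>

text \<open>Objects and arrows of a category over \<open>X\<close> are pairs whose first component is the image in \<open>X\<close>.\<close>

definition cartesian :: "('o, 'a) cat \<Rightarrow> ('o \<times> 't, 'a \<times> 'm) cat \<Rightarrow> 'a \<times> 'm \<Rightarrow> bool" where
  "cartesian X T f \<longleftrightarrow> f \<in> Arr T \<and>
     (\<forall>m\<in>Arr T. \<forall>v\<in>Arr X. Cod T m = Cod T f \<and> Cod X v = fst (Dom T f) \<and> fst m = fst f \<cdot>[X] v \<longrightarrow>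
        (\<exists>!n. n \<in> hom T (Dom T m) (Dom T f) \<and> fst n = v \<and> f \<cdot>[T] n = m))"

section \<open>Cartesian arrows of a fibred category\<close>

locale fibred = X: category X + T: category T
  for X :: "('o, 'a) cat" and T :: "('o \<times> 't, 'a \<times> 'm) cat" +
  assumes base_functor: "cat_functor T X fst fst"
    and lift_exists: "y \<in> Obj T \<Longrightarrow> u \<in> Arr X \<Longrightarrow> Cod X u = fst y \<Longrightarrow>
      \<exists>f. cartesian X T f \<and> Cod T f = y \<and> fst f = u"
begin

sublocale base: cat_functor T X fst fst by (rule base_functor)

lemma cart_Arr: "cartesian X T f \<Longrightarrow> f \<in> Arr T"
  by (simp add: cartesian_def)

lemma cart_factor:
  assumes "cartesian X T f" "m \<in> Arr T" "v \<in> Arr X" "Cod T m = Cod T f" "Cod X v = fst (Dom T f)"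
    "fst m = fst f \<cdot>[X] v"
  obtains n where "n \<in> Arr T" "Dom T n = Dom T m" "Cod T n = Dom T f" "fst n = v" "f \<cdot>[T] n = m"
  using assms unfolding cartesian_def in_hom by metis

lemma cart_unique:
  assumes f: "cartesian X T f" and n: "n \<in> Arr T" "n' \<in> Arr T" "Cod T n = Dom T f" "Cod T n' = Dom T f"
    "fst n = fst n'" and eq: "f \<cdot>[T] n = f \<cdot>[T] n'"
  shows "n = n'"
proof -
  note [simp] = cart_Arr[OF f] n
  have D: "Dom T n = Dom T n'" using arg_cong[OF eq, of "Dom T"] by simp
  have c: "Cod X (fst n) = fst (Dom T f)" using base.FA_Cod[of n] by simp
  have "\<exists>!k. k \<in> hom T (Dom T (f \<cdot>[T] n)) (Dom T f) \<and> fst k = fst n \<and> f \<cdot>[T] k = f \<cdot>[T] n"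
    using f[unfolded cartesian_def, THEN conjunct2, rule_format, of "f \<cdot>[T] n" "fst n"] c by simp
  moreover have "n \<in> hom T (Dom T (f \<cdot>[T] n)) (Dom T f)" "n' \<in> hom T (Dom T (f \<cdot>[T] n)) (Dom T f)"
    using D by (simp_all add: in_hom)
  ultimately show ?thesis using eq n(5) by metis
qed

lemma cart_comp:
  assumes f: "cartesian X T f" and g: "cartesian X T g" and fg: "Dom T f = Cod T g"
  shows "cartesian X T (f \<cdot>[T] g)"
  unfolding cartesian_def
proof (intro conjI ballI impI ex_ex1I)
  note [simp] = cart_Arr[OF f] cart_Arr[OF g] fg
  show "f \<cdot>[T] g \<in> Arr T" by simp
  fix m v assume m[simp]: "m \<in> Arr T" and v[simp]: "v \<in> Arr X"
    and H: "Cod T m = Cod T (f \<cdot>[T] g) \<and> Cod X v = fst (Dom T (f \<cdot>[T] g)) \<and> fst m = fst (f \<cdot>[T] g) \<cdot>[X] v"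
  obtain n where n: "n \<in> Arr T" "Dom T n = Dom T m" "Cod T n = Dom T f" "fst n = fst g \<cdot>[X] v" "f \<cdot>[T] n = m"
    using cart_factor[OF f m, of "fst g \<cdot>[X] v"] H by auto
  obtain k where k: "k \<in> Arr T" "Dom T k = Dom T n" "Cod T k = Dom T g" "fst k = v" "g \<cdot>[T] k = n"
    using cart_factor[OF g n(1) v] n H by auto
  show "\<exists>n. n \<in> hom T (Dom T m) (Dom T (f \<cdot>[T] g)) \<and> fst n = v \<and> (f \<cdot>[T] g) \<cdot>[T] n = m"
    by (rule exI[of _ k]) (use n k in \<open>auto simp: in_hom\<close>)
  fix n n' assume n: "n \<in> hom T (Dom T m) (Dom T (f \<cdot>[T] g)) \<and> fst n = v \<and> (f \<cdot>[T] g) \<cdot>[T] n = m"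
    and n': "n' \<in> hom T (Dom T m) (Dom T (f \<cdot>[T] g)) \<and> fst n' = v \<and> (f \<cdot>[T] g) \<cdot>[T] n' = m"
  have "g \<cdot>[T] n = g \<cdot>[T] n'" by (rule cart_unique[OF f]) (use n n' in \<open>auto simp: in_hom\<close>)
  then show "n = n'" by (rule cart_unique[OF g, rotated -1]) (use n n' in \<open>auto simp: in_hom\<close>)
qed

text \<open>To factor \<open>m\<close> through \<open>g\<close>, factor
  \<open>f \<cdot>[T] m\<close> through the composite; as \<open>f\<close> is cartesian, the two
  arrows into its source then agree.\<close>

lemma cart_cancel:
  assumes f: "cartesian X T f" and g[simp]: "g \<in> Arr T" and fg: "Dom T f = Cod T g"
    and c: "cartesian X T (f \<cdot>[T] g)"
  shows "cartesian X T g"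
  unfolding cartesian_def
proof (intro conjI ballI impI ex_ex1I)
  note [simp] = cart_Arr[OF f] fg
  have gb[simp]: "Cod X (fst g) = fst (Cod T g)" by simp
  show "g \<in> Arr T" by simp
  fix m v assume m[simp]: "m \<in> Arr T" and v[simp]: "v \<in> Arr X"
    and H: "Cod T m = Cod T g \<and> Cod X v = fst (Dom T g) \<and> fst m = fst g \<cdot>[X] v"
  obtain n where n: "n \<in> Arr T" "Dom T n = Dom T (f \<cdot>[T] m)" "Cod T n = Dom T (f \<cdot>[T] g)" "fst n = v"
    "(f \<cdot>[T] g) \<cdot>[T] n = f \<cdot>[T] m"
    by (rule cart_factor[OF c, of "f \<cdot>[T] m" v]) (use H in auto)
  have "g \<cdot>[T] n = m" by (rule cart_unique[OF f]) (use n H in auto)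
  then show "\<exists>n. n \<in> hom T (Dom T m) (Dom T g) \<and> fst n = v \<and> g \<cdot>[T] n = m"
    using n H by (intro exI[of _ n]) (auto simp: in_hom)
  fix n n' assume n: "n \<in> hom T (Dom T m) (Dom T g) \<and> fst n = v \<and> g \<cdot>[T] n = m"
    and n': "n' \<in> hom T (Dom T m) (Dom T g) \<and> fst n' = v \<and> g \<cdot>[T] n' = m"
  show "n = n'" by (rule cart_unique[OF c]) (use n n' in \<open>auto simp: in_hom\<close>)
qed

lemma iso_cart:
  assumes f: "f \<in> isos T x y" and b: "fst f = Id X (fst x)"
  shows "cartesian X T f"
  unfolding cartesian_def
proof (intro conjI ballI impI ex_ex1I)
  note [simp] = T.isos_Arr[OF f] T.inv_arr_simps[OF f] b
  have O[simp]: "x \<in> Obj T" "y \<in> Obj T" using T.isos_Obj[OF f] by auto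
  show "f \<in> Arr T" by simp
  have xy: "fst x = fst y" using base.FA_Cod[of f] base.FA_Dom[of f] by simp
  then have bi: "fst (inv_arr T f) = Id X (fst x)"
  proof -
    have "fst (inv_arr T f \<cdot>[T] f) = Id X (fst x)" using base.FA_Id[OF O(1)] by simp
    then have "fst (inv_arr T f) \<cdot>[X] Id X (fst x) = Id X (fst x)" by (subst (asm) base.FA_comp) auto
    then show ?thesis using xy by (subst (asm) X.Id_right) auto
  qed
  fix m v assume m[simp]: "m \<in> Arr T" and v[simp]: "v \<in> Arr X"
    and H: "Cod T m = Cod T f \<and> Cod X v = fst (Dom T f) \<and> fst m = fst f \<cdot>[X] v"
  show "\<exists>n. n \<in> hom T (Dom T m) (Dom T f) \<and> fst n = v \<and> f \<cdot>[T] n = m"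
    by (rule exI[of _ "inv_arr T f \<cdot>[T] m"])
       (use H xy bi T.compose_eq[OF T.inv_arr_simps(5)[OF f], of m] in \<open>auto simp: in_hom\<close>)
  fix n n' assume n: "n \<in> hom T (Dom T m) (Dom T f) \<and> fst n = v \<and> f \<cdot>[T] n = m"
    and n': "n' \<in> hom T (Dom T m) (Dom T f) \<and> fst n' = v \<and> f \<cdot>[T] n' = m"
  show "n = n'" by (rule T.iso_cancel_left[OF f]) (use n n' in \<open>auto simp: in_hom\<close>)
qed

text \<open>The identity of the target factors through \<open>f\<close>, which gives a right
  inverse; uniqueness of factorisations through \<open>f\<close> makes it a left inverse as
  well.\<close>

lemma cart_vertical_iso:
  assumes f: "cartesian X T f" and b: "fst f = Id X (fst (Cod T f))"
  shows "f \<in> isos T (Dom T f) (Cod T f)"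
proof -
  note [simp] = cart_Arr[OF f]
  have xy: "fst (Dom T f) = fst (Cod T f)" using base.FA_Dom[of f] b by (metis T.Cod_Obj X.Dom_Id base.FO_Obj cart_Arr f)
  obtain n where n: "n \<in> Arr T" "Dom T n = Cod T f" "Cod T n = Dom T f" "fst n = Id X (fst (Cod T f))"
    "f \<cdot>[T] n = Id T (Cod T f)"
    by (rule cart_factor[OF f, of "Id T (Cod T f)" "Id X (fst (Cod T f))"]) (use b xy in auto)
  have "n \<cdot>[T] f = Id T (Dom T f)"
    by (rule cart_unique[OF f]) (use n b xy T.compose_eq[OF n(5), of f] in auto)
  then show ?thesis using n by (intro T.isosI[where g = n]) (auto simp: in_hom)
qed

lemma iso_vertical_inv:
  assumes f: "f \<in> isos T x y" and b: "fst f = Id X (fst x)"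
  shows "fst (inv_arr T f) = Id X (fst x)" "fst x = fst y"
proof -
  note [simp] = T.isos_Arr[OF f] T.inv_arr_simps[OF f] b
  have O[simp]: "x \<in> Obj T" "y \<in> Obj T" using T.isos_Obj[OF f] by auto
  show xy: "fst x = fst y" using base.FA_Cod[of f] base.FA_Dom[of f] by simp
  have "fst (inv_arr T f \<cdot>[T] f) = Id X (fst x)" using base.FA_Id[OF O(1)] by simp
  then have "fst (inv_arr T f) \<cdot>[X] Id X (fst x) = Id X (fst x)" by (subst (asm) base.FA_comp) auto
  then show "fst (inv_arr T f) = Id X (fst x)" using xy by (subst (asm) X.Id_right) auto
qed

lemma cart_Id: "x \<in> Obj T \<Longrightarrow> cartesian X T (Id T x)"
  using iso_cart[OF T.Id_isos, of x] by simp

end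

text \<open>The family is indexed by all arrows \<open>q\<close> into \<open>x\<close> over the
  cover, rather than by one lift per member. Compatibility is then commutation with precomposition,
  and no choice of lifts or overlaps enters.\<close>

locale prestack_fib = fibred X T + site X J
  for X :: "('o, 'a) cat" and J :: "'o \<Rightarrow> 'a set set" and T :: "('o \<times> 't, 'a \<times> 'm) cat" +
  assumes glue: "\<lbrakk>x \<in> Obj T; y \<in> Obj T; g \<in> hom X (fst x) (fst y); S \<in> J (fst x);
      \<And>q. q \<in> Arr T \<Longrightarrow> Cod T q = x \<Longrightarrow> fst q \<in> S \<Longrightarrow> m q \<in> hom T (Dom T q) y \<and> fst (m q) = g \<cdot>[X] fst q;
      \<And>q w. q \<in> Arr T \<Longrightarrow> Cod T q = x \<Longrightarrow> fst q \<in> S \<Longrightarrow> w \<in> Arr T \<Longrightarrow> Cod T w = Dom T q \<Longrightarrow>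
        m (q \<cdot>[T] w) = m q \<cdot>[T] w\<rbrakk>
    \<Longrightarrow> \<exists>!n. n \<in> hom T x y \<and> fst n = g \<and> (\<forall>q\<in>Arr T. Cod T q = x \<and> fst q \<in> S \<longrightarrow> n \<cdot>[T] q = m q)"

section \<open>Closure properties of covers\<close>

lemma (in site) cover_Arr:
  assumes "U \<in> Obj X" "S \<in> J U" "u \<in> S"
  shows "u \<in> Arr X" "Cod X u = U" "w \<in> Arr X \<Longrightarrow> Cod X w = Dom X u \<Longrightarrow> u \<cdot>[X] w \<in> S"
  using covers_sieve[OF assms(1,2)] assms(3) unfolding is_sieve_def by auto

text \<open>Along a member of \<open>S\<close> the larger sieve pulls back to the maximal sieve, so
  transitivity applies.\<close>

lemma (in site) cover_superset:
  assumes U: "U \<in> Obj X" and S: "S \<in> J U" and R: "is_sieve X U R" and SR: "S \<subseteq> R"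
  shows "R \<in> J U"
proof (rule transitive_cover[OF U S R])
  fix f assume f: "f \<in> S"
  have "pull_sieve X f R = {g \<in> Arr X. Cod X g = Dom X f}"
    using cover_Arr[OF U S f] SR by (auto simp: pull_sieve_def)
  then show "pull_sieve X f R \<in> J (Dom X f)"
    using maximal_cover[of "Dom X f"] cover_Arr[OF U S f] by simp
qed

text \<open>Along a member of \<open>S\<close> the intersection pulls back to the pullback of
  \<open>R\<close>, so transitivity and stability apply.\<close>

lemma (in site) cover_inter:
  assumes U: "U \<in> Obj X" and S: "S \<in> J U" and R: "R \<in> J U"
  shows "S \<inter> R \<in> J U"
proof (rule transitive_cover[OF U S])
  show "is_sieve X U (S \<inter> R)"
    using covers_sieve[OF U S] covers_sieve[OF U R] by (auto simp: is_sieve_def)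
  fix f assume f: "f \<in> S"
  have "pull_sieve X f (S \<inter> R) = pull_sieve X f R"
    using cover_Arr[OF U S f] by (auto simp: pull_sieve_def)
  then show "pull_sieve X f (S \<inter> R) \<in> J (Dom X f)"
    using stable_cover[of f "Dom X f" U R] cover_Arr[OF U S f] R by (simp add: in_hom)
qed

section \<open>Uniqueness, existence and locality by gluing\<close>

context prestack_fib begin

text \<open>This is uniqueness in \<open>glue\<close> for the family of composites with
  \<open>n\<close>. One cartesian lift per member of the cover is enough, because every other arrow
  over that member factors through it.\<close>

lemma separated:
  assumes n: "n \<in> Arr T" "n' \<in> Arr T" "Dom T n = Dom T n'" "Cod T n = Cod T n'" "fst n = fst n'"
    and S: "S \<in> J (fst (Dom T n))"
    and eq: "\<And>u. u \<in> S \<Longrightarrow> \<exists>q. cartesian X T q \<and> Cod T q = Dom T n \<and> fst q = u \<and> n \<cdot>[T] q = n' \<cdot>[T] q"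
  shows "n = n'"
proof -
  define m where "m q = n \<cdot>[T] q" for q
  note [simp] = n(1,2)
  have "\<exists>!k. k \<in> hom T (Dom T n) (Cod T n) \<and> fst k = fst n \<and>
      (\<forall>q\<in>Arr T. Cod T q = Dom T n \<and> fst q \<in> S \<longrightarrow> k \<cdot>[T] q = m q)"
    by (rule glue) (use S in \<open>auto simp: m_def in_hom\<close>)
  moreover have "n' \<cdot>[T] q = m q" if q: "q \<in> Arr T" "Cod T q = Dom T n" "fst q \<in> S" for q
  proof -
    obtain c where c: "cartesian X T c" "Cod T c = Dom T n" "fst c = fst q" "n \<cdot>[T] c = n' \<cdot>[T] c"
      using eq[OF q(3)] by blast
    have dd: "fst (Dom T c) = fst (Dom T q)" using base.FA_Dom[OF cart_Arr[OF c(1)]] base.FA_Dom[OF q(1)] c(3) by simp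
    obtain k where k: "k \<in> Arr T" "Dom T k = Dom T q" "Cod T k = Dom T c" "c \<cdot>[T] k = q"
      by (rule cart_factor[OF c(1) q(1), of "Id X (fst (Dom T q))"]) (use c q dd in auto)
    have "n \<cdot>[T] (c \<cdot>[T] k) = n' \<cdot>[T] (c \<cdot>[T] k)"
      by (rule T.compose_eq2[OF c(4)]) (use k c n cart_Arr[OF c(1)] in auto)
    then show ?thesis using k by (simp add: m_def)
  qed
  moreover have "n \<in> hom T (Dom T n) (Cod T n)" "n' \<in> hom T (Dom T n) (Cod T n)" using n by (auto simp: in_hom)
  ultimately show ?thesis using n(5) by (metis m_def)
qed

text \<open>Gluing from one chosen lift per member. In \<open>compat\<close> the arrow
  \<open>w\<close> is the comparison of the lift over \<open>u \<cdot>[X] v\<close> with the lift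
  over \<open>u\<close>.\<close>

lemma glue_cart:
  assumes x: "x \<in> Obj T" and y: "y \<in> Obj T" and g: "g \<in> hom X (fst x) (fst y)" and S: "S \<in> J (fst x)"
    and j: "\<And>u. u \<in> S \<Longrightarrow> cartesian X T (j u) \<and> Cod T (j u) = x \<and> fst (j u) = u"
    and k: "\<And>u. u \<in> S \<Longrightarrow> k u \<in> hom T (Dom T (j u)) y \<and> fst (k u) = g \<cdot>[X] u"
    and compat: "\<And>u v w. u \<in> S \<Longrightarrow> v \<in> Arr X \<Longrightarrow> Cod X v = Dom X u \<Longrightarrow> w \<in> Arr T \<Longrightarrow>
        Dom T w = Dom T (j (u \<cdot>[X] v)) \<Longrightarrow> Cod T w = Dom T (j u) \<Longrightarrow> fst w = v \<Longrightarrow>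
        j u \<cdot>[T] w = j (u \<cdot>[X] v) \<Longrightarrow> k u \<cdot>[T] w = k (u \<cdot>[X] v)"
  shows "\<exists>n. n \<in> hom T x y \<and> fst n = g \<and> (\<forall>u\<in>S. n \<cdot>[T] j u = k u)"
proof -
  have xb: "fst x \<in> Obj X" using x by simp
  have jA[simp]: "j u \<in> Arr T" "Cod T (j u) = x" "fst (j u) = u" "fst (Dom T (j u)) = Dom X u" if "u \<in> S" for u
    using j[OF that] cart_Arr[of "j u"] base.FA_Dom[of "j u"] by auto
  have kA[simp]: "k u \<in> Arr T" "Cod T (k u) = y" "Dom T (k u) = Dom T (j u)" "fst (k u) = g \<cdot>[X] u" if "u \<in> S" for u
    using k[OF that] by (auto simp: in_hom)
  have uA[simp]: "u \<in> Arr X" "Cod X u = fst x" if "u \<in> S" for u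
    using cover_Arr[OF xb S that] by auto
  have uv[simp]: "u \<cdot>[X] v \<in> S" if "u \<in> S" "v \<in> Arr X" "Cod X v = Dom X u" for u v
    using cover_Arr[OF xb S] that by auto
  have gA[simp]: "g \<in> Arr X" "Dom X g = fst x" "Cod X g = fst y" using g by (auto simp: in_hom)
  \<comment> \<open>Every arrow over the cover is a vertical arrow followed by a chosen lift;
    \<open>m\<close> extends \<open>k\<close> along this factorisation.\<close>
  have "\<exists>r. r \<in> Arr T \<and> Dom T r = Dom T q \<and> Cod T r = Dom T (j (fst q)) \<and> fst r = Id X (fst (Dom T q)) \<and> j (fst q) \<cdot>[T] r = q"
    if q: "q \<in> Arr T" "Cod T q = x" "fst q \<in> S" for q
    by (rule cart_factor[OF j[OF q(3), THEN conjunct1] q(1), of "Id X (fst (Dom T q))"]) (use q in auto)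
  then obtain r where r: "\<And>q. q \<in> Arr T \<Longrightarrow> Cod T q = x \<Longrightarrow> fst q \<in> S \<Longrightarrow>
    r q \<in> Arr T \<and> Dom T (r q) = Dom T q \<and> Cod T (r q) = Dom T (j (fst q)) \<and> fst (r q) = Id X (fst (Dom T q)) \<and> j (fst q) \<cdot>[T] r q = q"
    by metis
  define m where "m q = k (fst q) \<cdot>[T] r q" for q
  have "\<exists>!n. n \<in> hom T x y \<and> fst n = g \<and> (\<forall>q\<in>Arr T. Cod T q = x \<and> fst q \<in> S \<longrightarrow> n \<cdot>[T] q = m q)"
  proof (rule glue[OF x y g S])
    fix q assume q[simp]: "q \<in> Arr T" "Cod T q = x" "fst q \<in> S"
    note rq[simp] = r[OF q]
    show "m q \<in> hom T (Dom T q) y \<and> fst (m q) = g \<cdot>[X] fst q"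
      by (auto simp: m_def in_hom)
    fix w assume w[simp]: "w \<in> Arr T" "Cod T w = Dom T q"
    have wb: "Cod X (fst w) = Dom X (fst q)" by simp
    note rqw[simp] = r[of "q \<cdot>[T] w"]
    obtain z where z[simp]: "z \<in> Arr T" "Dom T z = Dom T (j (fst q \<cdot>[X] fst w))" "Cod T z = Dom T (j (fst q))"
       "fst z = fst w" and jz: "j (fst q) \<cdot>[T] z = j (fst q \<cdot>[X] fst w)"
      by (rule cart_factor[OF j[OF q(3), THEN conjunct1], of "j (fst q \<cdot>[X] fst w)" "fst w"]) auto
    have kz: "k (fst q) \<cdot>[T] z = k (fst q \<cdot>[X] fst w)"
      by (rule compat) (use jz in auto)
    \<comment> \<open>Both sides factor \<open>q \<cdot>[T] w\<close> through the cartesian arrow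
      \<open>j (fst q)\<close>.\<close>
    have "r q \<cdot>[T] w = z \<cdot>[T] r (q \<cdot>[T] w)"
    proof (rule cart_unique[OF j[OF q(3), THEN conjunct1]])
      show "j (fst q) \<cdot>[T] (r q \<cdot>[T] w) = j (fst q) \<cdot>[T] (z \<cdot>[T] r (q \<cdot>[T] w))"
        using T.compose_eq[of "j (fst q)" "r q" q w] T.compose_eq[OF jz, of "r (q \<cdot>[T] w)"] rqw by simp
    qed auto
    then show "m (q \<cdot>[T] w) = m q \<cdot>[T] w"
      using T.compose_eq[OF kz, of "r (q \<cdot>[T] w)"] by (simp add: m_def)
  qed
  then obtain n where n: "n \<in> hom T x y" "fst n = g" "\<And>q. q\<in>Arr T \<Longrightarrow> Cod T q = x \<Longrightarrow> fst q \<in> S \<Longrightarrow> n \<cdot>[T] q = m q"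
    by blast
  have "n \<cdot>[T] j u = k u" if u[simp]: "u \<in> S" for u
  proof -
    have "r (j u) = Id T (Dom T (j u))"
      by (rule cart_unique[OF j[OF u, THEN conjunct1]]) (use r[of "j u"] in auto)
    then show ?thesis using n(3)[of "j u"] by (simp add: m_def)
  qed
  with n show ?thesis by blast
qed

text \<open>Compare \<open>f\<close> with a cartesian arrow \<open>c\<close> of the same base and
  target. The vertical comparison \<open>n\<close> carries cartesian lifts to cartesian arrows, so
  an inverse of it can be glued.\<close>

lemma cart_local:
  assumes f: "f \<in> Arr T" and S: "S \<in> J (fst (Dom T f))"
    and loc: "\<And>u. u \<in> S \<Longrightarrow> \<exists>q. cartesian X T q \<and> Cod T q = Dom T f \<and> fst q = u \<and> cartesian X T (f \<cdot>[T] q)"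
  shows "cartesian X T f"
proof -
  define x where "x = Dom T f"
  note [simp] = f
  have xO: "x \<in> Obj T" "fst x \<in> Obj X" by (auto simp: x_def)
  obtain c where c: "cartesian X T c" "Cod T c = Cod T f" "fst c = fst f"
    using lift_exists[of "Cod T f" "fst f"] by auto
  note [simp] = cart_Arr[OF c(1)] c(2,3)
  have bc: "fst (Dom T c) = fst x" using base.FA_Dom[of c] by (simp add: x_def)
  obtain n where n[simp]: "n \<in> Arr T" "Dom T n = x" "Cod T n = Dom T c" "fst n = Id X (fst x)" and cn: "c \<cdot>[T] n = f"
    by (rule cart_factor[OF c(1) f, of "Id X (fst x)"]) (use bc in \<open>auto simp: x_def\<close>)
  define y where "y = Dom T c"
  have yO[simp]: "y \<in> Obj T" "Dom T c = y" by (auto simp: y_def)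
  have yx: "fst y = fst x" using bc by simp
  have "\<forall>u\<in>S. \<exists>q. cartesian X T q \<and> Cod T q = x \<and> fst q = u \<and> cartesian X T (n \<cdot>[T] q)"
  proof
    fix u assume "u \<in> S"
    then obtain q where q: "cartesian X T q" "Cod T q = x" "fst q = u" "cartesian X T (f \<cdot>[T] q)"
      using loc[OF \<open>u \<in> S\<close>] unfolding x_def by blast
    note [simp] = cart_Arr[OF q(1)] q(2,3)
    have e: "c \<cdot>[T] (n \<cdot>[T] q) = f \<cdot>[T] q" by (rule T.compose_eq[OF cn]) auto
    have "cartesian X T (n \<cdot>[T] q)" by (rule cart_cancel[OF c(1)]) (use q e in auto)
    then show "\<exists>q. cartesian X T q \<and> Cod T q = x \<and> fst q = u \<and> cartesian X T (n \<cdot>[T] q)" using q by blast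
  qed
  then obtain j where j: "\<And>u. u \<in> S \<Longrightarrow> cartesian X T (j u)" and j1[simp]: "\<And>u. u \<in> S \<Longrightarrow> Cod T (j u) = x"
    "\<And>u. u \<in> S \<Longrightarrow> fst (j u) = u" and nj: "\<And>u. u \<in> S \<Longrightarrow> cartesian X T (n \<cdot>[T] j u)" by metis
  have jA[simp]: "j u \<in> Arr T" "fst (Dom T (j u)) = Dom X u" if "u \<in> S" for u
    using j[OF that] cart_Arr[of "j u"] base.FA_Dom[of "j u"] j1 that by auto
  have S': "S \<in> J (fst x)" using S by (simp add: x_def)
  have uA[simp]: "u \<in> Arr X" "Cod X u = fst x" if "u \<in> S" for u
    using cover_Arr[OF xO(2) S' that] by auto
  have uv[simp]: "u \<cdot>[X] v \<in> S" if "u \<in> S" "v \<in> Arr X" "Cod X v = Dom X u" for u v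
    using cover_Arr[OF xO(2) S'] that by auto
  \<comment> \<open>The inverse of \<open>n\<close> is glued along the cartesian lifts
    \<open>n \<cdot>[T] j u\<close> of \<open>y\<close>, on which it has to be
    \<open>j u\<close>.\<close>
  have "\<exists>k. k \<in> hom T y x \<and> fst k = Id X (fst x) \<and> (\<forall>u\<in>S. k \<cdot>[T] (n \<cdot>[T] j u) = j u)"
  proof (rule glue_cart)
    fix u v w assume H: "u \<in> S" "v \<in> Arr X" "Cod X v = Dom X u" "w \<in> Arr T"
        "Dom T w = Dom T (n \<cdot>[T] j (u \<cdot>[X] v))" "Cod T w = Dom T (n \<cdot>[T] j u)" "fst w = v"
        "(n \<cdot>[T] j u) \<cdot>[T] w = n \<cdot>[T] j (u \<cdot>[X] v)"
    obtain z where z: "z \<in> Arr T" "Dom T z = Dom T (j (u \<cdot>[X] v))" "Cod T z = Dom T (j u)" "fst z = v"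
        "j u \<cdot>[T] z = j (u \<cdot>[X] v)"
      by (rule cart_factor[OF j[OF H(1)], of "j (u \<cdot>[X] v)" v]) (use H in auto)
    have "z = w" by (rule cart_unique[OF nj[OF H(1)]]) (use H z in auto)
    then show "j u \<cdot>[T] w = j (u \<cdot>[X] v)" using z by simp
  qed (use nj S' yx xO j in \<open>auto simp: in_hom\<close>)
  then obtain k where k[simp]: "k \<in> Arr T" "Dom T k = y" "Cod T k = x" "fst k = Id X (fst x)"
     and kn: "\<And>u. u \<in> S \<Longrightarrow> k \<cdot>[T] (n \<cdot>[T] j u) = j u" by (auto simp: in_hom)
  have [simp]: "Cod T n = y" by simp
  have "k \<cdot>[T] n = Id T x"
  proof (rule separated[of _ _ S])
    fix u assume "u \<in> S"
    then show "\<exists>q. cartesian X T q \<and> Cod T q = Dom T (k \<cdot>[T] n) \<and> fst q = u \<and> (k \<cdot>[T] n) \<cdot>[T] q = Id T x \<cdot>[T] q"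
      using j kn by (intro exI[of _ "j u"]) auto
  qed (use xO S' in auto)
  moreover have "n \<cdot>[T] k = Id T y"
  proof (rule separated[of _ _ S])
    fix u assume u[simp]: "u \<in> S"
    have "(n \<cdot>[T] k) \<cdot>[T] (n \<cdot>[T] j u) = n \<cdot>[T] j u" using kn by simp
    then show "\<exists>q. cartesian X T q \<and> Cod T q = Dom T (n \<cdot>[T] k) \<and> fst q = u \<and> (n \<cdot>[T] k) \<cdot>[T] q = Id T y \<cdot>[T] q"
      using nj by (intro exI[of _ "n \<cdot>[T] j u"]) auto
  qed (use xO S' yx in auto)
  ultimately have "n \<in> isos T x y" by (intro T.isosI[where g = k]) (auto simp: in_hom)
  then have "cartesian X T n" by (intro iso_cart) auto
  then show ?thesis using cart_comp[OF c(1), of n] cn by simp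
qed

end

section \<open>Cartesian functors and descent data on a sieve\<close>

locale fibred_functor = A: fibred X A + B: fibred X B + cat_functor A B FO FA
  for X :: "('o, 'a) cat" and A :: "('o \<times> 't, 'a \<times> 'm) cat" and B :: "('o \<times> 's, 'a \<times> 'n) cat" and FO FA +
  assumes base_FO [simp]: "x \<in> Obj A \<Longrightarrow> fst (FO x) = fst x"
    and base_FA [simp]: "f \<in> Arr A \<Longrightarrow> fst (FA f) = fst f"
    and FA_cart: "cartesian X A f \<Longrightarrow> cartesian X B (FA f)"

text \<open>A functor over \<open>X\<close> with cartesian values, defined on the sieve \<open>S\<close> regarded as a full subcategory
  of the slice; \<open>t \<alpha> g\<close> is the image of the arrow \<open>g\<close> from \<open>\<alpha> \<cdot> g\<close> to \<open>\<alpha>\<close>.\<close>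

definition descent_family :: "('o, 'a) cat \<Rightarrow> ('o \<times> 't, 'a \<times> 'm) cat \<Rightarrow> 'a set \<Rightarrow> ('a \<Rightarrow> 'o \<times> 't) \<Rightarrow> ('a \<Rightarrow> 'a \<Rightarrow> 'a \<times> 'm) \<Rightarrow> bool" where
  "descent_family X T S e t \<longleftrightarrow> (\<forall>\<alpha>\<in>S. e \<alpha> \<in> Obj T \<and> fst (e \<alpha>) = Dom X \<alpha>) \<and>
     (\<forall>\<alpha>\<in>S. \<forall>g\<in>Arr X. Cod X g = Dom X \<alpha> \<longrightarrow>
        t \<alpha> g \<in> hom T (e (\<alpha> \<cdot>[X] g)) (e \<alpha>) \<and> fst (t \<alpha> g) = g \<and> cartesian X T (t \<alpha> g)) \<and>
     (\<forall>\<alpha>\<in>S. \<forall>g\<in>Arr X. \<forall>h\<in>Arr X. Cod X g = Dom X \<alpha> \<and> Cod X h = Dom X g \<longrightarrow>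
        t \<alpha> (g \<cdot>[X] h) = t \<alpha> g \<cdot>[T] t (\<alpha> \<cdot>[X] g) h)"

text \<open>Essential surjectivity of \<Phi>, read in the total categories: \<open>e\<close>,
  \<open>t\<close> and \<psi> are the datum, \<open>x\<close> with the cartesian cone
  \<open>j\<close> glues it, and the vertical isomorphism \<open>r\<close> compares the image of
  \<open>x\<close> with \<open>b\<close>.\<close>

definition effective :: "('o, 'a) cat \<Rightarrow> ('o \<times> 't, 'a \<times> 'm) cat \<Rightarrow> ('o \<times> 's, 'a \<times> 'n) cat \<Rightarrow>
    ('o \<times> 't \<Rightarrow> 'o \<times> 's) \<Rightarrow> ('a \<times> 'm \<Rightarrow> 'a \<times> 'n) \<Rightarrow> 'o \<Rightarrow> 'a set \<Rightarrow> bool" where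
  "effective X E B PO PA U S \<longleftrightarrow> (\<forall>e t b \<psi>. descent_family X E S e t \<and> b \<in> Obj B \<and> fst b = U \<and>
     (\<forall>\<alpha>\<in>S. \<psi> \<alpha> \<in> hom B (PO (e \<alpha>)) b \<and> fst (\<psi> \<alpha>) = \<alpha> \<and> cartesian X B (\<psi> \<alpha>)) \<and>
     (\<forall>\<alpha>\<in>S. \<forall>g\<in>Arr X. Cod X g = Dom X \<alpha> \<longrightarrow> \<psi> \<alpha> \<cdot>[B] PA (t \<alpha> g) = \<psi> (\<alpha> \<cdot>[X] g)) \<longrightarrow>
     (\<exists>x j r. x \<in> Obj E \<and> fst x = U \<and>
        (\<forall>\<alpha>\<in>S. j \<alpha> \<in> hom E (e \<alpha>) x \<and> fst (j \<alpha>) = \<alpha> \<and> cartesian X E (j \<alpha>)) \<and>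
        (\<forall>\<alpha>\<in>S. \<forall>g\<in>Arr X. Cod X g = Dom X \<alpha> \<longrightarrow> j \<alpha> \<cdot>[E] t \<alpha> g = j (\<alpha> \<cdot>[X] g)) \<and>
        r \<in> isos B (PO x) b \<and> fst r = Id X U \<and> (\<forall>\<alpha>\<in>S. r \<cdot>[B] PA (j \<alpha>) = \<psi> \<alpha>)))"

text \<open>The transition at an identity is idempotent by the composition law, and it is cartesian,
  so one factor can be cancelled.\<close>

lemma (in fibred) descent_family_Id:
  assumes d: "descent_family X T S e t" and a: "\<alpha> \<in> S" "\<alpha> \<in> Arr X"
  shows "t \<alpha> (Id X (Dom X \<alpha>)) = Id T (e \<alpha>)"
proof -
  have O: "e \<alpha> \<in> Obj T" "fst (e \<alpha>) = Dom X \<alpha>" using d a by (auto simp: descent_family_def)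
  have t: "t \<alpha> (Id X (Dom X \<alpha>)) \<in> hom T (e \<alpha>) (e \<alpha>)" "fst (t \<alpha> (Id X (Dom X \<alpha>))) = Id X (Dom X \<alpha>)"
     "cartesian X T (t \<alpha> (Id X (Dom X \<alpha>)))"
    using d[unfolded descent_family_def, THEN conjunct2, THEN conjunct1, rule_format, of \<alpha> "Id X (Dom X \<alpha>)"] a by auto
  have e: "t \<alpha> (Id X (Dom X \<alpha>)) = t \<alpha> (Id X (Dom X \<alpha>)) \<cdot>[T] t \<alpha> (Id X (Dom X \<alpha>))"
    using d[unfolded descent_family_def, THEN conjunct2, THEN conjunct2, rule_format, of \<alpha> "Id X (Dom X \<alpha>)" "Id X (Dom X \<alpha>)"] a by simp
  show ?thesis
  proof (rule cart_unique[OF t(3)])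
    show "t \<alpha> (Id X (Dom X \<alpha>)) \<cdot>[T] t \<alpha> (Id X (Dom X \<alpha>)) = t \<alpha> (Id X (Dom X \<alpha>)) \<cdot>[T] Id T (e \<alpha>)"
      using e[symmetric] t by (simp add: in_hom)
  qed (use t O in \<open>auto simp: in_hom\<close>)
qed

section \<open>Lifting against effective descent\<close>

locale lifting_square = E: prestack_fib X J E + B: prestack_fib X J B +
  F: fibred_functor X A C FO FA + H: fibred_functor X A E HO HA +
  K: fibred_functor X C B KO KA + P: fibred_functor X E B PO PA
  for X :: "('o, 'a) cat" and J :: "'o \<Rightarrow> 'a set set"
    and A :: "('o \<times> 't1, 'a \<times> 'm1) cat" and C :: "('o \<times> 't2, 'a \<times> 'm2) cat"
    and E :: "('o \<times> 't3, 'a \<times> 'm3) cat" and B :: "('o \<times> 't4, 'a \<times> 'm4) cat"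
    and FO FA HO HA KO KA PO PA +
  fixes \<gamma> :: "'o \<times> 't1 \<Rightarrow> 'a \<times> 'm4"
  assumes F_ff: "full_and_faithful A C FO FA"
    and F_surj: "c \<in> Obj C \<Longrightarrow> \<exists>S\<in>J (fst c). \<forall>u\<in>S. \<exists>a\<in>Obj A. \<exists>\<omega>. \<omega> \<in> hom C (FO a) c \<and> cartesian X C \<omega> \<and> fst \<omega> = u"
    and \<gamma>_iso: "a \<in> Obj A \<Longrightarrow> \<gamma> a \<in> isos B (PO (HO a)) (KO (FO a))"
    and \<gamma>_base: "a \<in> Obj A \<Longrightarrow> fst (\<gamma> a) = Id X (fst a)"
    and \<gamma>_nat: "f \<in> Arr A \<Longrightarrow> \<gamma> (Cod A f) \<cdot>[B] PA (HA f) = KA (FA f) \<cdot>[B] \<gamma> (Dom A f)"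
    and eff: "U \<in> Obj X \<Longrightarrow> S \<in> J U \<Longrightarrow> effective X E B PO PA U S"
begin

section \<open>Consequences of full faithfulness\<close>

lemma F_inj: "\<lbrakk>f \<in> Arr A; g \<in> Arr A; Dom A f = Dom A g; Cod A f = Cod A g; FA f = FA g\<rbrakk> \<Longrightarrow> f = g"
proof -
  assume H: "f \<in> Arr A" "g \<in> Arr A" "Dom A f = Dom A g" "Cod A f = Cod A g" "FA f = FA g"
  have "inj_on FA (hom A (Dom A g) (Cod A g))"
    using F_ff H unfolding full_and_faithful_def bij_betw_def by simp
  then show "f = g" by (rule inj_onD) (use H in \<open>auto simp: in_hom\<close>)
qed

lemma F_full:
  assumes "q \<in> Arr C" "Dom C q = FO a" "Cod C q = FO a'" "a \<in> Obj A" "a' \<in> Obj A"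
  obtains m where "m \<in> Arr A" "Dom A m = a" "Cod A m = a'" "FA m = q"
proof -
  have "q \<in> FA ` hom A a a'" using F_ff assms unfolding full_and_faithful_def bij_betw_def by (auto simp: in_hom)
  then show thesis using that by (auto simp: in_hom)
qed

lemma \<gamma>_simps [simp]:
  assumes "a \<in> Obj A"
  shows "\<gamma> a \<in> Arr B" "Dom B (\<gamma> a) = PO (HO a)" "Cod B (\<gamma> a) = KO (FO a)" "fst (\<gamma> a) = Id X (fst a)"
  using B.T.isos_Arr[OF \<gamma>_iso[OF assms]] \<gamma>_base[OF assms] by auto

text \<open>Factor \<open>m\<close> through a cartesian \<open>k\<close> of the same base.
  \<open>F\<close> sends the vertical comparison to a cartesian vertical arrow, hence to an
  isomorphism, and full faithfulness reflects it.\<close>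

lemma F_reflects_cart:
  assumes m: "m \<in> Arr A" and c: "cartesian X C (FA m)"
  shows "cartesian X A m"
proof -
  note [simp] = m
  obtain k where k: "cartesian X A k" "Cod A k = Cod A m" "fst k = fst m"
    using F.A.lift_exists[of "Cod A m" "fst m"] by auto
  note [simp] = F.A.cart_Arr[OF k(1)] k(2,3)
  have [simp]: "fst (Dom A k) = fst (Dom A m)" using F.A.base.FA_Dom[of k] by simp
  obtain n where n[simp]: "n \<in> Arr A" "Dom A n = Dom A m" "Cod A n = Dom A k" "fst n = Id X (fst (Dom A m))" "k \<cdot>[A] n = m"
    by (rule F.A.cart_factor[OF k(1) m, of "Id X (fst (Dom A m))"]) auto
  have "cartesian X C (FA n)"
    by (rule F.B.cart_cancel[OF F.FA_cart[OF k(1)]]) (use c in \<open>auto simp flip: F.FA_comp\<close>)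
  then have "FA n \<in> isos C (FO (Dom A n)) (FO (Cod A n))"
    using F.B.cart_vertical_iso[of "FA n"] by simp
  then have "n \<in> isos A (Dom A n) (Cod A n)"
    by (intro F.ff_reflects_isos[OF F_ff]) (auto simp: in_hom)
  then have "cartesian X A n" by (rule F.A.iso_cart) simp
  then show ?thesis using F.A.cart_comp[OF k(1), of n] by simp
qed

text \<open>The sieve over which \<open>c\<close> lies in the essential image of \<open>F\<close>, with chosen cartesian arrows
  \<open>om c u\<close> from \<open>F (aa c u)\<close> to \<open>c\<close> over its members \<open>u\<close>.\<close>

definition S :: "'o \<times> 't2 \<Rightarrow> 'a set" where
  "S c = {u. \<exists>a\<in>Obj A. \<exists>\<omega>. \<omega> \<in> hom C (FO a) c \<and> cartesian X C \<omega> \<and> fst \<omega> = u}"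

text \<open>For stability, a cartesian lift of \<open>g\<close> in \<open>A\<close>, sent to
  \<open>C\<close> and followed by \<omega>, is again a cartesian arrow out of the image of
  \<open>F\<close>.\<close>

lemma S_sieve: "c \<in> Obj C \<Longrightarrow> is_sieve X (fst c) (S c)"
  unfolding is_sieve_def
proof (intro conjI ballI impI subsetI)
  assume c: "c \<in> Obj C"
  fix u assume "u \<in> S c"
  then obtain a \<omega> where a: "a \<in> Obj A" "\<omega> \<in> hom C (FO a) c" "cartesian X C \<omega>" "fst \<omega> = u" by (auto simp: S_def)
  then have w: "\<omega> \<in> Arr C" "Dom C \<omega> = FO a" "Cod C \<omega> = c" by (auto simp: in_hom)
  show "u \<in> {f \<in> Arr X. Cod X f = fst c}"
    using F.B.base.FA_Arr[of \<omega>] F.B.base.FA_Cod[of \<omega>] w a by auto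
  fix g assume g: "g \<in> Arr X" "Cod X g = Dom X u"
  have "Dom X u = fst a" using F.B.base.FA_Dom[of \<omega>] w a by auto
  then obtain k where k: "cartesian X A k" "Cod A k = a" "fst k = g"
    using F.A.lift_exists[of a g] g a by auto
  note kA = F.A.cart_Arr[OF k(1)]
  have "cartesian X C (\<omega> \<cdot>[C] FA k)"
    by (rule F.B.cart_comp[OF a(3) F.FA_cart[OF k(1)]]) (use kA k w in auto)
  moreover have "\<omega> \<cdot>[C] FA k \<in> hom C (FO (Dom A k)) c" using kA k w by (auto simp: in_hom)
  moreover have "fst (\<omega> \<cdot>[C] FA k) = u \<cdot>[X] g" using kA k w a by auto
  ultimately show "u \<cdot>[X] g \<in> S c" unfolding S_def using kA[THEN F.A.T.Dom_Obj] by blast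
qed

lemma S_cover: "c \<in> Obj C \<Longrightarrow> S c \<in> J (fst c)"
proof -
  assume c: "c \<in> Obj C"
  then obtain R where "R \<in> J (fst c)" "\<forall>u\<in>R. \<exists>a\<in>Obj A. \<exists>\<omega>. \<omega> \<in> hom C (FO a) c \<and> cartesian X C \<omega> \<and> fst \<omega> = u"
    using F_surj by blast
  then show ?thesis using c by (intro E.cover_superset[OF _ _ S_sieve]) (auto simp: S_def)
qed

section \<open>Local preimages and their transition arrows\<close>

definition aw :: "'o \<times> 't2 \<Rightarrow> 'a \<Rightarrow> ('o \<times> 't1) \<times> ('a \<times> 'm2)" where
  "aw c u = (SOME (a, \<omega>). a \<in> Obj A \<and> \<omega> \<in> hom C (FO a) c \<and> cartesian X C \<omega> \<and> fst \<omega> = u)"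

definition aa :: "'o \<times> 't2 \<Rightarrow> 'a \<Rightarrow> 'o \<times> 't1" where "aa c u = fst (aw c u)"
definition om :: "'o \<times> 't2 \<Rightarrow> 'a \<Rightarrow> 'a \<times> 'm2" where "om c u = snd (aw c u)"

lemma om:
  assumes "u \<in> S c"
  shows "aa c u \<in> Obj A" "om c u \<in> Arr C" "Dom C (om c u) = FO (aa c u)" "Cod C (om c u) = c"
    "fst (om c u) = u" "cartesian X C (om c u)" "fst (aa c u) = Dom X u"
proof -
  have "\<exists>x. case x of (a, \<omega>) \<Rightarrow> a \<in> Obj A \<and> \<omega> \<in> hom C (FO a) c \<and> cartesian X C \<omega> \<and> fst \<omega> = u"
    using assms unfolding S_def by blast
  then have "case aw c u of (a, \<omega>) \<Rightarrow> a \<in> Obj A \<and> \<omega> \<in> hom C (FO a) c \<and> cartesian X C \<omega> \<and> fst \<omega> = u"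
    unfolding aw_def by (rule someI_ex)
  then show 1: "aa c u \<in> Obj A" "om c u \<in> Arr C" "Dom C (om c u) = FO (aa c u)" "Cod C (om c u) = c"
    "fst (om c u) = u" "cartesian X C (om c u)" by (auto simp: aa_def om_def in_hom split: prod.splits)
  show "fst (aa c u) = Dom X u" using F.B.base.FA_Dom[of "om c u"] 1 by simp
qed

lemma S_Arr:
  assumes "c \<in> Obj C" "u \<in> S c"
  shows "u \<in> Arr X" "Cod X u = fst c" "v \<in> Arr X \<Longrightarrow> Cod X v = Dom X u \<Longrightarrow> u \<cdot>[X] v \<in> S c"
  using E.cover_Arr[OF _ S_cover[OF assms(1)] assms(2)] assms by auto

text \<open>The transition between two chosen preimages. It exists in \<open>A\<close> because full
  faithfulness lifts the comparison of \<open>om c (u \<cdot>[X] v)\<close> with the cartesian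
  \<open>om c u\<close>.\<close>

definition tt :: "'o \<times> 't2 \<Rightarrow> 'a \<Rightarrow> 'a \<Rightarrow> 'a \<times> 'm1" where
  "tt c u v = (SOME m. m \<in> Arr A \<and> Dom A m = aa c (u \<cdot>[X] v) \<and> Cod A m = aa c u \<and> fst m = v \<and>
     om c u \<cdot>[C] FA m = om c (u \<cdot>[X] v) \<and> cartesian X A m)"

text \<open>The factor of \<open>q\<close> through the cartesian \<open>om c u\<close> runs between
  images of \<open>F\<close>, so fullness lifts it to \<open>A\<close>.\<close>

lemma om_factor:
  assumes c: "c \<in> Obj C" and u: "u \<in> S c" and q: "q \<in> Arr C" "Dom C q = FO a" "Cod C q = c" "a \<in> Obj A"
    and v: "v \<in> Arr X" "Cod X v = Dom X u" "fst q = u \<cdot>[X] v"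
  obtains m where "m \<in> Arr A" "Dom A m = a" "Cod A m = aa c u" "fst m = v" "om c u \<cdot>[C] FA m = q"
proof -
  note [simp] = om[OF u]
  obtain n where n: "n \<in> Arr C" "Dom C n = FO a" "Cod C n = FO (aa c u)" "fst n = v" "om c u \<cdot>[C] n = q"
    by (rule F.B.cart_factor[OF om(6)[OF u] q(1) v(1)]) (use q v in auto)
  obtain m where m: "m \<in> Arr A" "Dom A m = a" "Cod A m = aa c u" "FA m = n"
    using F_full[OF n(1-3)] q by auto
  have "fst m = v" using F.base_FA[OF m(1)] m n by simp
  with m n that show thesis by simp
qed

lemma tt:
  assumes c: "c \<in> Obj C" and u: "u \<in> S c" and v: "v \<in> Arr X" "Cod X v = Dom X u"
  shows "tt c u v \<in> Arr A" "Dom A (tt c u v) = aa c (u \<cdot>[X] v)" "Cod A (tt c u v) = aa c u" "fst (tt c u v) = v"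
     "om c u \<cdot>[C] FA (tt c u v) = om c (u \<cdot>[X] v)" "cartesian X A (tt c u v)"
proof -
  note uv = S_Arr(3)[OF c u v]
  obtain m where m: "m \<in> Arr A" "Dom A m = aa c (u \<cdot>[X] v)" "Cod A m = aa c u" "fst m = v" "om c u \<cdot>[C] FA m = om c (u \<cdot>[X] v)"
    by (rule om_factor[OF c u om(2,3,4)[OF uv] om(1)[OF uv] v]) (use om[OF uv] in auto)
  have "cartesian X C (FA m)"
    by (rule F.B.cart_cancel[OF om(6)[OF u]]) (use m om[OF u] om[OF uv] in auto)
  then have "cartesian X A m" by (rule F_reflects_cart[OF m(1)])
  with m have "\<exists>m. m \<in> Arr A \<and> Dom A m = aa c (u \<cdot>[X] v) \<and> Cod A m = aa c u \<and> fst m = v \<and>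
     om c u \<cdot>[C] FA m = om c (u \<cdot>[X] v) \<and> cartesian X A m" by blast
  note someI_ex[OF this]
  then show "tt c u v \<in> Arr A" "Dom A (tt c u v) = aa c (u \<cdot>[X] v)" "Cod A (tt c u v) = aa c u" "fst (tt c u v) = v"
     "om c u \<cdot>[C] FA (tt c u v) = om c (u \<cdot>[X] v)" "cartesian X A (tt c u v)"
    unfolding tt_def[symmetric] by blast+
qed

text \<open>Cancel the cartesian \<open>om c u\<close> first; then \<open>F\<close> is
  faithful.\<close>

lemma om_inj:
  assumes u: "u \<in> S c" and m: "m \<in> Arr A" "m' \<in> Arr A" "Dom A m = Dom A m'" "Cod A m = aa c u" "Cod A m' = aa c u"
    "fst m = fst m'" and eq: "om c u \<cdot>[C] FA m = om c u \<cdot>[C] FA m'"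
  shows "m = m'"
proof -
  have "FA m = FA m'" by (rule F.B.cart_unique[OF om(6)[OF u] _ _ _ _ _ eq]) (use m om[OF u] in auto)
  then show ?thesis using m by (intro F_inj) auto
qed

text \<open>The composition law holds although preimages and transitions are chosen: both sides have
  the same composite with \<open>om c u\<close>, and \<open>om_inj\<close> applies.\<close>

lemma om_descent_family:
  assumes c: "c \<in> Obj C"
  shows "descent_family X E (S c) (\<lambda>u. HO (aa c u)) (\<lambda>u v. HA (tt c u v))"
  unfolding descent_family_def
proof (intro conjI ballI impI)
  fix u assume u: "u \<in> S c"
  show "HO (aa c u) \<in> Obj E" "fst (HO (aa c u)) = Dom X u" using om[OF u] by auto
  fix v assume v: "v \<in> Arr X" "Cod X v = Dom X u"
  note t = tt[OF c u v]
  show "HA (tt c u v) \<in> hom E (HO (aa c (u \<cdot>[X] v))) (HO (aa c u))" "fst (HA (tt c u v)) = v" "cartesian X E (HA (tt c u v))"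
    using t H.FA_cart by (auto simp: in_hom)
next
  fix u v w assume u: "u \<in> S c" and "v \<in> Arr X" "w \<in> Arr X" "Cod X v = Dom X u \<and> Cod X w = Dom X v"
  then have v: "v \<in> Arr X" "Cod X v = Dom X u" and w: "w \<in> Arr X" "Cod X w = Dom X v" by auto
  note uA[simp] = S_Arr(1)[OF c u]
  have uv: "u \<cdot>[X] v \<in> S c" by (rule S_Arr(3)[OF c u v])
  have vw: "v \<cdot>[X] w \<in> Arr X" "Cod X (v \<cdot>[X] w) = Dom X u" using v w by auto
  have w': "Cod X w = Dom X (u \<cdot>[X] v)" using v w by auto
  have uvw: "(u \<cdot>[X] v) \<cdot>[X] w = u \<cdot>[X] (v \<cdot>[X] w)" using v w by simp
  note t1 = tt[OF c u v] and t2 = tt[OF c uv w(1) w', unfolded uvw] and t3 = tt[OF c u vw]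
  have "tt c u (v \<cdot>[X] w) = tt c u v \<cdot>[A] tt c (u \<cdot>[X] v) w"
  proof (rule om_inj[OF u])
    have "om c u \<cdot>[C] (FA (tt c u v) \<cdot>[C] FA (tt c (u \<cdot>[X] v) w)) = om c (u \<cdot>[X] v) \<cdot>[C] FA (tt c (u \<cdot>[X] v) w)"
      by (rule F.B.T.compose_eq[OF t1(5)]) (use t1 t2 om[OF u] in auto)
    then show "om c u \<cdot>[C] FA (tt c u (v \<cdot>[X] w)) = om c u \<cdot>[C] FA (tt c u v \<cdot>[A] tt c (u \<cdot>[X] v) w)"
      using t1 t2 t3 by simp
  qed (use t1 t2 t3 in auto)
  then show "HA (tt c u (v \<cdot>[X] w)) = HA (tt c u v) \<cdot>[E] HA (tt c (u \<cdot>[X] v) w)"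
    using t1 t2 by simp
qed

text \<open>The arrows to glue along are \<open>K\<close> of \<open>om\<close> preceded by \<gamma>.
  They are cartesian because \<gamma> is a vertical isomorphism, and naturality of \<gamma> is their
  compatibility with the transitions.\<close>

lemma local_solution:
  assumes c: "c \<in> Obj C"
  shows "\<exists>x j r. x \<in> Obj E \<and> fst x = fst c \<and>
        (\<forall>u\<in>S c. j u \<in> hom E (HO (aa c u)) x \<and> fst (j u) = u \<and> cartesian X E (j u)) \<and>
        (\<forall>u\<in>S c. \<forall>v\<in>Arr X. Cod X v = Dom X u \<longrightarrow> j u \<cdot>[E] HA (tt c u v) = j (u \<cdot>[X] v)) \<and>
        r \<in> isos B (PO x) (KO c) \<and> fst r = Id X (fst c) \<and> (\<forall>u\<in>S c. r \<cdot>[B] PA (j u) = KA (om c u) \<cdot>[B] \<gamma> (aa c u))"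
proof (rule eff[OF _ S_cover[OF c], unfolded effective_def, rule_format], goal_cases)
  case 1 show ?case using c by simp
next
  case 2
  show ?case
  proof (intro conjI ballI impI)
    fix u assume u: "u \<in> S c"
    note o = om[OF u] S_Arr(1,2)[OF c u]
    show "KA (om c u) \<cdot>[B] \<gamma> (aa c u) \<in> hom B (PO (HO (aa c u))) (KO c)"
      "fst (KA (om c u) \<cdot>[B] \<gamma> (aa c u)) = u"
      using o by (auto simp: in_hom)
    show "cartesian X B (KA (om c u) \<cdot>[B] \<gamma> (aa c u))"
      by (rule B.cart_comp[OF K.FA_cart[OF o(6)] B.iso_cart[OF \<gamma>_iso[OF o(1)]]]) (use o in auto)
    fix v assume v: "v \<in> Arr X" "Cod X v = Dom X u"
    note t = tt[OF c u v]
    note uv = S_Arr(3)[OF c u v] and o2 = om[OF S_Arr(3)[OF c u v]]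
    have "(KA (om c u) \<cdot>[B] \<gamma> (aa c u)) \<cdot>[B] PA (HA (tt c u v)) = KA (om c u) \<cdot>[B] (KA (FA (tt c u v)) \<cdot>[B] \<gamma> (aa c (u \<cdot>[X] v)))"
      using o t \<gamma>_nat[OF t(1)] by simp
    also have "\<dots> = KA (om c (u \<cdot>[X] v)) \<cdot>[B] \<gamma> (aa c (u \<cdot>[X] v))"
      by (rule B.T.compose_eq) (use o o2 t in \<open>auto simp flip: K.FA_comp\<close>)
    finally show "(KA (om c u) \<cdot>[B] \<gamma> (aa c u)) \<cdot>[B] PA (HA (tt c u v)) = KA (om c (u \<cdot>[X] v)) \<cdot>[B] \<gamma> (aa c (u \<cdot>[X] v))" .
  qed (use c om_descent_family[OF c] in auto)
qed

section \<open>The glued objects and the transport of arrows to them\<close>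

definition sol :: "'o \<times> 't2 \<Rightarrow> ('o \<times> 't3) \<times> ('a \<Rightarrow> 'a \<times> 'm3) \<times> ('a \<times> 'm4)" where
  "sol c = (SOME (x, j, r). x \<in> Obj E \<and> fst x = fst c \<and>
        (\<forall>u\<in>S c. j u \<in> hom E (HO (aa c u)) x \<and> fst (j u) = u \<and> cartesian X E (j u)) \<and>
        (\<forall>u\<in>S c. \<forall>v\<in>Arr X. Cod X v = Dom X u \<longrightarrow> j u \<cdot>[E] HA (tt c u v) = j (u \<cdot>[X] v)) \<and>
        r \<in> isos B (PO x) (KO c) \<and> fst r = Id X (fst c) \<and> (\<forall>u\<in>S c. r \<cdot>[B] PA (j u) = KA (om c u) \<cdot>[B] \<gamma> (aa c u)))"

definition "LO c = fst (sol c)"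
definition "jj c = fst (snd (sol c))"
definition "rr c = snd (snd (sol c))"

lemma sol:
  assumes c: "c \<in> Obj C"
  shows "LO c \<in> Obj E" "fst (LO c) = fst c"
    "rr c \<in> isos B (PO (LO c)) (KO c)" "fst (rr c) = Id X (fst c)"
    "rr c \<in> Arr B" "Dom B (rr c) = PO (LO c)" "Cod B (rr c) = KO c"
  and jj: "\<And>u. u \<in> S c \<Longrightarrow> jj c u \<in> Arr E" "\<And>u. u \<in> S c \<Longrightarrow> Dom E (jj c u) = HO (aa c u)" "\<And>u. u \<in> S c \<Longrightarrow> Cod E (jj c u) = LO c"
    "\<And>u. u \<in> S c \<Longrightarrow> fst (jj c u) = u"
    "\<And>u. u \<in> S c \<Longrightarrow> cartesian X E (jj c u)"
    "\<And>u v. u \<in> S c \<Longrightarrow> v \<in> Arr X \<Longrightarrow> Cod X v = Dom X u \<Longrightarrow> jj c u \<cdot>[E] HA (tt c u v) = jj c (u \<cdot>[X] v)"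
    "\<And>u. u \<in> S c \<Longrightarrow> rr c \<cdot>[B] PA (jj c u) = KA (om c u) \<cdot>[B] \<gamma> (aa c u)"
proof -
  let ?P = "\<lambda>(x, j, r). x \<in> Obj E \<and> fst x = fst c \<and>
        (\<forall>u\<in>S c. j u \<in> hom E (HO (aa c u)) x \<and> fst (j u) = u \<and> cartesian X E (j u)) \<and>
        (\<forall>u\<in>S c. \<forall>v\<in>Arr X. Cod X v = Dom X u \<longrightarrow> j u \<cdot>[E] HA (tt c u v) = j (u \<cdot>[X] v)) \<and>
        r \<in> isos B (PO x) (KO c) \<and> fst r = Id X (fst c) \<and> (\<forall>u\<in>S c. r \<cdot>[B] PA (j u) = KA (om c u) \<cdot>[B] \<gamma> (aa c u))"
  have "\<exists>s. ?P s" using local_solution[OF c] by simp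
  then have "?P (sol c)" unfolding sol_def by (rule someI_ex)
  then have "?P (LO c, jj c, rr c)" by (simp add: LO_def jj_def rr_def)
  then have P: "LO c \<in> Obj E" "fst (LO c) = fst c" "rr c \<in> isos B (PO (LO c)) (KO c)" "fst (rr c) = Id X (fst c)"
     "\<And>u. u \<in> S c \<Longrightarrow> jj c u \<in> hom E (HO (aa c u)) (LO c) \<and> fst (jj c u) = u \<and> cartesian X E (jj c u)"
     "\<And>u v. u \<in> S c \<Longrightarrow> v \<in> Arr X \<Longrightarrow> Cod X v = Dom X u \<Longrightarrow> jj c u \<cdot>[E] HA (tt c u v) = jj c (u \<cdot>[X] v)"
     "\<And>u. u \<in> S c \<Longrightarrow> rr c \<cdot>[B] PA (jj c u) = KA (om c u) \<cdot>[B] \<gamma> (aa c u)"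
    by (simp_all only: prod.case)
  show "LO c \<in> Obj E" "fst (LO c) = fst c" "rr c \<in> isos B (PO (LO c)) (KO c)" "fst (rr c) = Id X (fst c)"
    using P by auto
  show "rr c \<in> Arr B" "Dom B (rr c) = PO (LO c)" "Cod B (rr c) = KO c" using B.T.isos_Arr[OF P(3)] by auto
  show "\<And>u. u \<in> S c \<Longrightarrow> jj c u \<in> Arr E" "\<And>u. u \<in> S c \<Longrightarrow> Dom E (jj c u) = HO (aa c u)" "\<And>u. u \<in> S c \<Longrightarrow> Cod E (jj c u) = LO c"
    "\<And>u. u \<in> S c \<Longrightarrow> fst (jj c u) = u"
    "\<And>u. u \<in> S c \<Longrightarrow> cartesian X E (jj c u)" using P(5) by (auto simp: in_hom)
  show "\<And>u v. u \<in> S c \<Longrightarrow> v \<in> Arr X \<Longrightarrow> Cod X v = Dom X u \<Longrightarrow> jj c u \<cdot>[E] HA (tt c u v) = jj c (u \<cdot>[X] v)"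
    "\<And>u. u \<in> S c \<Longrightarrow> rr c \<cdot>[B] PA (jj c u) = KA (om c u) \<cdot>[B] \<gamma> (aa c u)" using P(6,7) by auto
qed

text \<open>For \<open>q\<close> from \<open>F a\<close> to \<open>c\<close>, this is what the lift
  should assign to \<open>q\<close>, preceded by the comparison at \<open>a\<close>. It is built
  before the lift, from the cone \<open>jj\<close> and the action of \<open>H\<close>;
  \<open>LA_tau\<close> and \<open>kap\<close> make the connection.\<close>

definition tau :: "'o \<times> 't2 \<Rightarrow> 'o \<times> 't1 \<Rightarrow> 'a \<times> 'm2 \<Rightarrow> 'a \<times> 'm3" where
  "tau c a q = jj c (fst q) \<cdot>[E]
     HA (SOME m. m \<in> Arr A \<and> Dom A m = a \<and> Cod A m = aa c (fst q) \<and> fst m = Id X (Dom X (fst q)) \<and> om c (fst q) \<cdot>[C] FA m = q)"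

text \<open>The value of \<open>tau\<close> does not depend on how the arrow is factored through the chosen family.\<close>

lemma tau_factor:
  assumes c: "c \<in> Obj C" and u: "u \<in> S c" and m: "m \<in> Arr A" "Cod A m = aa c u"
  shows "tau c (Dom A m) (om c u \<cdot>[C] FA m) = jj c u \<cdot>[E] HA m"
proof -
  define v where "v = fst m"
  define q where "q = om c u \<cdot>[C] FA m"
  have v: "v \<in> Arr X" "Cod X v = Dom X u" using F.A.base.FA_Cod[OF m(1)] om[OF u] m by (auto simp: v_def)
  note uA = S_Arr(1,2)[OF c u]
  have uv: "u \<cdot>[X] v \<in> S c" by (rule S_Arr(3)[OF c u v])
  have q: "q \<in> Arr C" "Dom C q = FO (Dom A m)" "Cod C q = c" "Dom A m \<in> Obj A" "fst q = u \<cdot>[X] v"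
    using m om[OF u] by (auto simp: q_def v_def)
  let ?P = "\<lambda>k. k \<in> Arr A \<and> Dom A k = Dom A m \<and> Cod A k = aa c (fst q) \<and> fst k = Id X (Dom X (fst q)) \<and> om c (fst q) \<cdot>[C] FA k = q"
  have "\<exists>k. ?P k"
    by (rule om_factor[OF c uv q(1-4), of "Id X (Dom X (u \<cdot>[X] v))"]) (use q uA v in auto)
  then have kP: "?P (SOME k. ?P k)" by (rule someI_ex)
  define k where "k = (SOME k. ?P k)"
  have kP: "?P k" unfolding k_def by (rule kP)
  have k: "k \<in> Arr A" "Dom A k = Dom A m" "Cod A k = aa c (u \<cdot>[X] v)" "fst k = Id X (Dom X v)" "om c (u \<cdot>[X] v) \<cdot>[C] FA k = q"
    using kP uA v unfolding q(5) by auto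
  note t = tt[OF c u v]
  have m_eq: "tt c u v \<cdot>[A] k = m"
  proof (rule om_inj[OF u])
    have "om c u \<cdot>[C] (FA (tt c u v) \<cdot>[C] FA k) = om c (u \<cdot>[X] v) \<cdot>[C] FA k"
      by (rule F.B.T.compose_eq[OF t(5)]) (use t k om[OF u] in auto)
    then show "om c u \<cdot>[C] FA (tt c u v \<cdot>[A] k) = om c u \<cdot>[C] FA m"
      using t k by (simp add: q_def)
  qed (use t k m v in \<open>auto simp: v_def\<close>)
  have "jj c u \<cdot>[E] (HA (tt c u v) \<cdot>[E] HA k) = jj c (u \<cdot>[X] v) \<cdot>[E] HA k"
    by (rule E.T.compose_eq[OF jj(6)[OF c u v]]) (use t k jj[OF c u] in auto)
  moreover have "HA (tt c u v) \<cdot>[E] HA k = HA m" using t k m_eq by (simp flip: H.FA_comp)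
  moreover have "tau c (Dom A m) q = jj c (u \<cdot>[X] v) \<cdot>[E] HA k"
    by (simp add: tau_def k_def q(5))
  ultimately show ?thesis by (simp add: q_def)
qed

lemma tau_decomp:
  assumes c: "c \<in> Obj C" and q: "q \<in> Arr C" "Dom C q = FO a" "Cod C q = c" "a \<in> Obj A" and u: "fst q \<in> S c"
  obtains m where "m \<in> Arr A" "Dom A m = a" "Cod A m = aa c (fst q)" "fst m = Id X (fst a)" "om c (fst q) \<cdot>[C] FA m = q"
    "tau c a q = jj c (fst q) \<cdot>[E] HA m"
proof -
  have d: "Dom X (fst q) = fst a" using F.B.base.FA_Dom[OF q(1)] q by simp
  obtain m where m: "m \<in> Arr A" "Dom A m = a" "Cod A m = aa c (fst q)" "fst m = Id X (fst a)" "om c (fst q) \<cdot>[C] FA m = q"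
    by (rule om_factor[OF c u q, of "Id X (fst a)"]) (use q d S_Arr[OF c u] in auto)
  moreover have "tau c a q = jj c (fst q) \<cdot>[E] HA m" using tau_factor[OF c u m(1,3)] m by simp
  ultimately show thesis using that by blast
qed

lemma tau_simps:
  assumes "c \<in> Obj C" "q \<in> Arr C" "Dom C q = FO a" "Cod C q = c" "a \<in> Obj A" "fst q \<in> S c"
  shows "tau c a q \<in> Arr E" "Dom E (tau c a q) = HO a" "Cod E (tau c a q) = c' \<longleftrightarrow> LO c = c'" "fst (tau c a q) = fst q"
proof -
  obtain m where m: "m \<in> Arr A" "Dom A m = a" "Cod A m = aa c (fst q)" "fst m = Id X (fst a)" "om c (fst q) \<cdot>[C] FA m = q"
    "tau c a q = jj c (fst q) \<cdot>[E] HA m" by (rule tau_decomp[OF assms])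
  have d: "Dom X (fst q) = fst a" using F.B.base.FA_Dom[OF assms(2)] assms by simp
  show "tau c a q \<in> Arr E" "Dom E (tau c a q) = HO a" "Cod E (tau c a q) = c' \<longleftrightarrow> LO c = c'" "fst (tau c a q) = fst q"
    using m d jj[OF assms(1,6)] S_Arr[OF assms(1,6)] by auto
qed

lemma tau_nat:
  assumes c: "c \<in> Obj C" and q: "q \<in> Arr C" "Dom C q = FO (Cod A n)" "Cod C q = c" and u: "fst q \<in> S c" and n: "n \<in> Arr A"
  shows "tau c (Dom A n) (q \<cdot>[C] FA n) = tau c (Cod A n) q \<cdot>[E] HA n"
proof -
  obtain m where m: "m \<in> Arr A" "Dom A m = Cod A n" "Cod A m = aa c (fst q)" "fst m = Id X (fst (Cod A n))" "om c (fst q) \<cdot>[C] FA m = q"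
    "tau c (Cod A n) q = jj c (fst q) \<cdot>[E] HA m" by (rule tau_decomp[OF c q _ u]) (use n in auto)
  have "om c (fst q) \<cdot>[C] (FA m \<cdot>[C] FA n) = q \<cdot>[C] FA n"
    by (rule F.B.T.compose_eq[OF m(5)]) (use m n om[OF u] in auto)
  then have "tau c (Dom A n) (q \<cdot>[C] FA n) = tau c (Dom A (m \<cdot>[A] n)) (om c (fst q) \<cdot>[C] FA (m \<cdot>[A] n))"
    using m n by simp
  also have "\<dots> = jj c (fst q) \<cdot>[E] HA (m \<cdot>[A] n)" by (rule tau_factor[OF c u]) (use m n in auto)
  also have "\<dots> = tau c (Cod A n) q \<cdot>[E] HA n" using m n jj[OF c u] by simp
  finally show ?thesis .
qed

lemma tau_om:
  assumes c: "c \<in> Obj C" and u: "u \<in> S c"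
  shows "tau c (aa c u) (om c u) = jj c u"
  using tau_factor[OF c u, of "Id A (aa c u)"] om[OF u] jj[OF c u] by simp

lemma tau_cart:
  assumes c: "c \<in> Obj C" and q: "q \<in> Arr C" "Dom C q = FO a" "Cod C q = c" "a \<in> Obj A" and u: "fst q \<in> S c"
    and cq: "cartesian X C q"
  shows "cartesian X E (tau c a q)"
proof -
  obtain m where m: "m \<in> Arr A" "Dom A m = a" "Cod A m = aa c (fst q)" "fst m = Id X (fst a)" "om c (fst q) \<cdot>[C] FA m = q"
    "tau c a q = jj c (fst q) \<cdot>[E] HA m" by (rule tau_decomp[OF c q u])
  have "cartesian X C (FA m)" by (rule F.B.cart_cancel[OF om(6)[OF u]]) (use m om[OF u] cq in auto)
  then have "cartesian X E (HA m)" by (intro H.FA_cart F_reflects_cart[OF m(1)])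
  then show ?thesis unfolding m(6) by (rule E.cart_comp[OF jj(5)[OF c u]]) (use m jj[OF c u] in auto)
qed

text \<open>This extends the defining equation of \<open>rr\<close> from the cone to all admissible
  \<open>q\<close>; naturality of \<gamma> moves it past the factor \<open>m\<close>.\<close>

lemma rr_tau:
  assumes c: "c \<in> Obj C" and q: "q \<in> Arr C" "Dom C q = FO a" "Cod C q = c" "a \<in> Obj A" and u: "fst q \<in> S c"
  shows "rr c \<cdot>[B] PA (tau c a q) = KA q \<cdot>[B] \<gamma> a"
proof -
  obtain m where m: "m \<in> Arr A" "Dom A m = a" "Cod A m = aa c (fst q)" "fst m = Id X (fst a)" "om c (fst q) \<cdot>[C] FA m = q"
    "tau c a q = jj c (fst q) \<cdot>[E] HA m" by (rule tau_decomp[OF c q u])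
  note o = om[OF u] and j = jj[OF c u] and s = sol[OF c]
  have "rr c \<cdot>[B] PA (tau c a q) = rr c \<cdot>[B] (PA (jj c (fst q)) \<cdot>[B] PA (HA m))" using m j by simp
  also have "\<dots> = KA (om c (fst q)) \<cdot>[B] (\<gamma> (aa c (fst q)) \<cdot>[B] PA (HA m))"
    by (rule B.T.compose_eq2[OF j(7)]) (use m j s o in auto)
  also have "\<dots> = KA (om c (fst q)) \<cdot>[B] (KA (FA m) \<cdot>[B] \<gamma> a)" using \<gamma>_nat[OF m(1)] m by simp
  also have "\<dots> = KA q \<cdot>[B] \<gamma> a"
    by (rule B.T.compose_eq) (use m o q(4) in \<open>auto simp flip: K.FA_comp\<close>)
  finally show ?thesis .
qed

text \<open>The cover of the source of \<phi> over which the chosen family at the source is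
  available and, after composition with \<phi>, also the one at the target.\<close>

definition R :: "'a \<times> 'm2 \<Rightarrow> 'a set" where
  "R \<phi> = S (Dom C \<phi>) \<inter> pull_sieve X (fst \<phi>) (S (Cod C \<phi>))"

lemma R_cover: "\<phi> \<in> Arr C \<Longrightarrow> R \<phi> \<in> J (fst (Dom C \<phi>))"
  unfolding R_def
  by (rule E.cover_inter) (use S_cover[of "Dom C \<phi>"] E.stable_cover[of "fst \<phi>" "fst (Dom C \<phi>)" "fst (Cod C \<phi>)"] S_cover[of "Cod C \<phi>"] in \<open>auto simp: in_hom\<close>)

lemma R_S: "u \<in> R \<phi> \<Longrightarrow> u \<in> S (Dom C \<phi>)" "u \<in> R \<phi> \<Longrightarrow> fst \<phi> \<cdot>[X] u \<in> S (Cod C \<phi>)"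
  by (auto simp: R_def pull_sieve_def)

text \<open>On the cone the value is forced to be \<open>tau\<close> of \<phi> composed with
  \<open>om\<close>, and naturality of \<open>tau\<close> makes these values compatible.\<close>

lemma LA_exists:
  assumes \<phi>: "\<phi> \<in> Arr C"
  shows "\<exists>n. n \<in> hom E (LO (Dom C \<phi>)) (LO (Cod C \<phi>)) \<and> fst n = fst \<phi> \<and>
     (\<forall>u\<in>R \<phi>. n \<cdot>[E] jj (Dom C \<phi>) u = tau (Cod C \<phi>) (aa (Dom C \<phi>) u) (\<phi> \<cdot>[C] om (Dom C \<phi>) u))"
proof -
  define c where "c = Dom C \<phi>"
  define c' where "c' = Cod C \<phi>"
  have c: "c \<in> Obj C" "c' \<in> Obj C" "Dom C \<phi> = c" "Cod C \<phi> = c'" using \<phi> by (auto simp: c_def c'_def)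
  note [simp] = \<phi> c
  have R: "u \<in> S c" "fst \<phi> \<cdot>[X] u \<in> S c'" if "u \<in> R \<phi>" for u using R_S[OF that] by auto
  have RJ: "R \<phi> \<in> J (fst c)" using R_cover[OF \<phi>] by simp
  have tS: "tau c' (aa c u) (\<phi> \<cdot>[C] om c u) \<in> Arr E" "Dom E (tau c' (aa c u) (\<phi> \<cdot>[C] om c u)) = HO (aa c u)"
     "Cod E (tau c' (aa c u) (\<phi> \<cdot>[C] om c u)) = LO c'" "fst (tau c' (aa c u) (\<phi> \<cdot>[C] om c u)) = fst \<phi> \<cdot>[X] u" if "u \<in> R \<phi>" for u
    using tau_simps[of c' "\<phi> \<cdot>[C] om c u" "aa c u"] R[OF that] om[OF R(1)[OF that]] by auto
  have "\<exists>n. n \<in> hom E (LO c) (LO c') \<and> fst n = fst \<phi> \<and> (\<forall>u\<in>R \<phi>. n \<cdot>[E] jj c u = tau c' (aa c u) (\<phi> \<cdot>[C] om c u))"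
  proof (rule E.glue_cart)
    fix u v w assume u: "u \<in> R \<phi>" and v: "v \<in> Arr X" "Cod X v = Dom X u" and w: "w \<in> Arr E"
      "Dom E w = Dom E (jj c (u \<cdot>[X] v))" "Cod E w = Dom E (jj c u)" "fst w = v" and jw: "jj c u \<cdot>[E] w = jj c (u \<cdot>[X] v)"
    have uv: "u \<cdot>[X] v \<in> S c" by (rule S_Arr(3)[OF c(1) R(1)[OF u] v])
    note t = tt[OF c(1) R(1)[OF u] v] and o = om[OF R(1)[OF u]]
    \<comment> \<open>Both arrows factor \<open>jj c (u \<cdot>[X] v)\<close> through the cartesian
      \<open>jj c u\<close>, which pins down the arbitrary \<open>w\<close>.\<close>
    have "w = HA (tt c u v)"
      by (rule E.cart_unique[OF jj(5)[OF c(1) R(1)[OF u]]]) (use w t jw jj[OF c(1) R(1)[OF u]] v in auto)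
    then have "tau c' (aa c u) (\<phi> \<cdot>[C] om c u) \<cdot>[E] w = tau c' (aa c (u \<cdot>[X] v)) ((\<phi> \<cdot>[C] om c u) \<cdot>[C] FA (tt c u v))"
      using tau_nat[of c' "\<phi> \<cdot>[C] om c u" "tt c u v"] t o R(2)[OF u] by simp
    also have "(\<phi> \<cdot>[C] om c u) \<cdot>[C] FA (tt c u v) = \<phi> \<cdot>[C] om c (u \<cdot>[X] v)" using t o by simp
    finally show "tau c' (aa c u) (\<phi> \<cdot>[C] om c u) \<cdot>[E] w = tau c' (aa c (u \<cdot>[X] v)) (\<phi> \<cdot>[C] om c (u \<cdot>[X] v))" .
  qed (use RJ sol[of c] sol[of c'] jj[OF c(1) R(1)] tS in \<open>auto simp: in_hom\<close>)
  then show ?thesis by simp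
qed

definition "LA \<phi> = (SOME n. n \<in> hom E (LO (Dom C \<phi>)) (LO (Cod C \<phi>)) \<and> fst n = fst \<phi> \<and>
     (\<forall>u\<in>R \<phi>. n \<cdot>[E] jj (Dom C \<phi>) u = tau (Cod C \<phi>) (aa (Dom C \<phi>) u) (\<phi> \<cdot>[C] om (Dom C \<phi>) u)))"

lemma LA:
  assumes \<phi>: "\<phi> \<in> Arr C"
  shows "LA \<phi> \<in> Arr E" "Dom E (LA \<phi>) = LO (Dom C \<phi>)" "Cod E (LA \<phi>) = LO (Cod C \<phi>)" "fst (LA \<phi>) = fst \<phi>"
    and LA_jj: "u \<in> R \<phi> \<Longrightarrow> LA \<phi> \<cdot>[E] jj (Dom C \<phi>) u = tau (Cod C \<phi>) (aa (Dom C \<phi>) u) (\<phi> \<cdot>[C] om (Dom C \<phi>) u)"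
proof -
  have "LA \<phi> \<in> hom E (LO (Dom C \<phi>)) (LO (Cod C \<phi>)) \<and> fst (LA \<phi>) = fst \<phi> \<and>
     (\<forall>u\<in>R \<phi>. LA \<phi> \<cdot>[E] jj (Dom C \<phi>) u = tau (Cod C \<phi>) (aa (Dom C \<phi>) u) (\<phi> \<cdot>[C] om (Dom C \<phi>) u))"
    unfolding LA_def by (rule someI_ex) (rule LA_exists[OF \<phi>])
  then show "LA \<phi> \<in> Arr E" "Dom E (LA \<phi>) = LO (Dom C \<phi>)" "Cod E (LA \<phi>) = LO (Cod C \<phi>)" "fst (LA \<phi>) = fst \<phi>"
    "u \<in> R \<phi> \<Longrightarrow> LA \<phi> \<cdot>[E] jj (Dom C \<phi>) u = tau (Cod C \<phi>) (aa (Dom C \<phi>) u) (\<phi> \<cdot>[C] om (Dom C \<phi>) u)"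
    by (auto simp: in_hom)
qed

text \<open>The equation that defines \<open>LA\<close> speaks of the chosen \<open>om\<close> only.
  Factoring \<open>q\<close> through \<open>om\<close> gives it for every \<open>q\<close> over the
  cover \<open>R\<close>, in particular for composites with other arrows.\<close>

lemma LA_tau:
  assumes \<phi>: "\<phi> \<in> Arr C" and q: "q \<in> Arr C" "Dom C q = FO a" "Cod C q = Dom C \<phi>" "a \<in> Obj A" and u: "fst q \<in> R \<phi>"
  shows "LA \<phi> \<cdot>[E] tau (Dom C \<phi>) a q = tau (Cod C \<phi>) a (\<phi> \<cdot>[C] q)"
proof -
  define c where "c = Dom C \<phi>"
  define c' where "c' = Cod C \<phi>"
  have c: "c \<in> Obj C" "c' \<in> Obj C" "Dom C \<phi> = c" "Cod C \<phi> = c'" using \<phi> by (auto simp: c_def c'_def)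
  have uS: "fst q \<in> S c" "fst \<phi> \<cdot>[X] fst q \<in> S c'" using R_S[OF u] c by auto
  obtain m where m: "m \<in> Arr A" "Dom A m = a" "Cod A m = aa c (fst q)" "fst m = Id X (fst a)" "om c (fst q) \<cdot>[C] FA m = q"
    "tau c a q = jj c (fst q) \<cdot>[E] HA m" by (rule tau_decomp[OF c(1) q(1,2) _ q(4) uS(1)]) (use c q in auto)
  note o = om[OF uS(1)] and j = jj[OF c(1) uS(1)]
  have "LA \<phi> \<cdot>[E] (jj c (fst q) \<cdot>[E] HA m) = tau c' (aa c (fst q)) (\<phi> \<cdot>[C] om c (fst q)) \<cdot>[E] HA m"
    by (rule E.T.compose_eq[OF LA_jj[OF \<phi> u, unfolded c]]) (use j m LA[OF \<phi>] c in auto)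
  also have "\<dots> = tau c' a ((\<phi> \<cdot>[C] om c (fst q)) \<cdot>[C] FA m)"
    using tau_nat[of c' "\<phi> \<cdot>[C] om c (fst q)" m] m c \<phi> o uS by simp
  also have "(\<phi> \<cdot>[C] om c (fst q)) \<cdot>[C] FA m = \<phi> \<cdot>[C] q" using m c \<phi> o by simp
  finally show ?thesis using m c by simp
qed

text \<open>The cone \<open>jj\<close> consists of cartesian lifts over \<open>S c\<close>, so
  \<open>separated\<close> can test arrows on it over any cover inside that sieve.\<close>

lemma LO_separated:
  assumes n: "n \<in> Arr E" "n' \<in> Arr E" "Dom E n = LO c" "Dom E n' = LO c" "Cod E n = Cod E n'" "fst n = fst n'"
    and c: "c \<in> Obj C" and Q: "Q \<in> J (fst c)" "Q \<subseteq> S c"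
    and eq: "\<And>u. u \<in> Q \<Longrightarrow> n \<cdot>[E] jj c u = n' \<cdot>[E] jj c u"
  shows "n = n'"
proof (rule E.separated[of n n' Q])
  show "\<exists>q. cartesian X E q \<and> Cod E q = Dom E n \<and> fst q = u \<and> n \<cdot>[E] q = n' \<cdot>[E] q" if u: "u \<in> Q" for u
    using jj[OF c, of u] eq[OF u] n u Q(2) by (intro exI[of _ "jj c u"]) auto
qed (use n sol[OF c] Q in auto)

lemma LA_Id: "c \<in> Obj C \<Longrightarrow> LA (Id C c) = Id E (LO c)"
proof (rule LO_separated[of _ _ c "R (Id C c)"])
  assume c: "c \<in> Obj C"
  note L = LA[of "Id C c"]
  show "LA (Id C c) \<cdot>[E] jj c u = Id E (LO c) \<cdot>[E] jj c u" if u: "u \<in> R (Id C c)" for u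
  proof -
    have "u \<in> S c" using R_S[OF u] c by simp
    then show ?thesis using LA_jj[of "Id C c" u] u c om[of u c] jj[of c u] tau_om[of c u] by simp
  qed
qed (use sol[of c] LA[of "Id C c"] R_cover[of "Id C c"] R_S[of _ "Id C c"] in auto)

lemma LA_Comp:
  assumes f: "f \<in> Arr C" and g: "g \<in> Arr C" and fg: "Dom C g = Cod C f"
  shows "LA (g \<cdot>[C] f) = LA g \<cdot>[E] LA f"
proof -
  define c where "c = Dom C f"
  define d where "d = Cod C f"
  define e where "e = Cod C g"
  have c: "c \<in> Obj C" "d \<in> Obj C" "e \<in> Obj C" "Dom C f = c" "Cod C f = d" "Dom C g = d" "Cod C g = e"
    using f g fg by (auto simp: c_def d_def e_def)
  note [simp] = f g c
  note Lf = LA[OF f] and Lg = LA[OF g] and Lgf = LA[of "g \<cdot>[C] f"]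
  \<comment> \<open>The common refinement on which the defining equations of \<open>LA\<close> for
    \<open>f\<close>, for \<open>g\<close> and for their composite are all available.\<close>
  define Q where "Q = (R f \<inter> pull_sieve X (fst f) (R g)) \<inter> R (g \<cdot>[C] f)"
  have fb: "fst f \<in> hom X (fst c) (fst d)" using F.B.base.FA_hom[of f c d] by (simp add: in_hom)
  have QJ: "Q \<in> J (fst c)" unfolding Q_def
    using R_cover[of "g \<cdot>[C] f"] R_cover[OF f] E.stable_cover[OF fb, of "R g"] R_cover[OF g]
    by (intro E.cover_inter) auto
  show ?thesis
  proof (rule LO_separated[OF _ _ _ _ _ _ c(1) QJ])
    show "LA (g \<cdot>[C] f) \<cdot>[E] jj c u = (LA g \<cdot>[E] LA f) \<cdot>[E] jj c u" if u: "u \<in> Q" for u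
    proof -
      have R1: "u \<in> R f" and R2: "u \<in> R (g \<cdot>[C] f)" and R3: "fst f \<cdot>[X] u \<in> R g"
        using u by (auto simp: Q_def pull_sieve_def)
      have uS: "u \<in> S c" "fst f \<cdot>[X] u \<in> S d" using R_S[OF R1] by auto
      note o = om[OF uS(1)] and j = jj[OF c(1) uS(1)]
      have "(LA g \<cdot>[E] LA f) \<cdot>[E] jj c u = LA g \<cdot>[E] tau d (aa c u) (f \<cdot>[C] om c u)"
        using LA_jj[OF f R1] Lf Lg j by simp
      also have "\<dots> = tau e (aa c u) (g \<cdot>[C] (f \<cdot>[C] om c u))"
        using LA_tau[OF g, of "f \<cdot>[C] om c u" "aa c u"] o R3 by simp
      also have "\<dots> = LA (g \<cdot>[C] f) \<cdot>[E] jj c u" using LA_jj[OF _ R2] o by simp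
      finally show ?thesis by simp
    qed
    show "Q \<subseteq> S c" using R_S(1)[of _ f] by (auto simp: Q_def)
  qed (use Lf Lg Lgf in auto)
qed

text \<open>Checked on the cone by \<open>cart_local\<close>: there the composite is
  \<open>tau\<close> of a cartesian arrow.\<close>

lemma LA_cart:
  assumes "cartesian X C \<phi>" shows "cartesian X E (LA \<phi>)"
proof (rule E.cart_local[of _ "R \<phi>"])
  have \<phi>: "\<phi> \<in> Arr C" using assms by (simp add: cartesian_def)
  define c where "c = Dom C \<phi>"
  define c' where "c' = Cod C \<phi>"
  have c: "c \<in> Obj C" "c' \<in> Obj C" "Dom C \<phi> = c" "Cod C \<phi> = c'" using \<phi> by (auto simp: c_def c'_def)
  show "LA \<phi> \<in> Arr E" "R \<phi> \<in> J (fst (Dom E (LA \<phi>)))" using LA[OF \<phi>] R_cover[OF \<phi>] sol[of c] c by auto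
  fix u assume u: "u \<in> R \<phi>"
  have uS: "u \<in> S c" "fst \<phi> \<cdot>[X] u \<in> S c'" using R_S[OF u] c by auto
  note o = om[OF uS(1)] and j = jj[OF c(1) uS(1)]
  have "cartesian X C (\<phi> \<cdot>[C] om c u)" by (rule F.B.cart_comp[OF assms]) (use o c in auto)
  then have "cartesian X E (LA \<phi> \<cdot>[E] jj c u)" using LA_jj[OF \<phi> u] c
    tau_cart[of c' "\<phi> \<cdot>[C] om c u" "aa c u"] o \<phi> uS by simp
  then show "\<exists>q. cartesian X E q \<and> Cod E q = Dom E (LA \<phi>) \<and> fst q = u \<and> cartesian X E (LA \<phi> \<cdot>[E] q)"
    using j LA[OF \<phi>] c by (intro exI[of _ "jj c u"]) auto
qed

lemma L_fibred_functor: "fibred_functor X C E LO LA"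
proof
  show "LO x \<in> Obj E" "fst (LO x) = fst x" if "x \<in> Obj C" for x using sol[OF that] by auto
  show "LA f \<in> hom E (LO x) (LO y)" if "f \<in> hom C x y" for f x y using that LA[of f] by (auto simp: in_hom)
  show "LA (Id C x) = Id E (LO x)" if "x \<in> Obj C" for x using LA_Id[OF that] .
  show "LA (g \<cdot>[C] f) = LA g \<cdot>[E] LA f" if "f \<in> hom C x y" "g \<in> hom C y z" for f g x y z
    using LA_Comp[of f g] that by (auto simp: in_hom)
  show "fst (LA f) = fst f" if "f \<in> Arr C" for f using LA[OF that] by simp
  show "cartesian X E (LA f)" if "cartesian X C f" for f using LA_cart[OF that] .
qed

section \<open>The two comparison isomorphisms\<close>

definition "kap a = tau (FO a) a (Id C (FO a))"

lemma Id_in_S: "a \<in> Obj A \<Longrightarrow> Id X (fst a) \<in> S (FO a)"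
  unfolding S_def using F.B.cart_Id[of "FO a"] F.B.base.FA_Id[of "FO a"]
  by (intro CollectI bexI[of _ a] exI[of _ "Id C (FO a)"]) (auto simp: in_hom)

text \<open>Cartesian over an identity, hence invertible. The identity of \<open>fst a\<close>
  belongs to \<open>S (FO a)\<close>, so \<open>tau\<close> is available there without
  refinement.\<close>

lemma kap:
  assumes a: "a \<in> Obj A"
  shows "kap a \<in> isos E (HO a) (LO (FO a))" "fst (kap a) = Id X (fst a)"
    "kap a \<in> Arr E" "Dom E (kap a) = HO a" "Cod E (kap a) = LO (FO a)"
proof -
  have b: "fst (Id C (FO a)) = Id X (fst a)" using F.B.base.FA_Id[of "FO a"] a by simp
  show 1: "fst (kap a) = Id X (fst a)" "kap a \<in> Arr E" "Dom E (kap a) = HO a" "Cod E (kap a) = LO (FO a)"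
    using tau_simps[of "FO a" "Id C (FO a)" a] a b Id_in_S[OF a] by (auto simp: kap_def)
  have "cartesian X E (kap a)"
    unfolding kap_def by (rule tau_cart) (use a b Id_in_S[OF a] F.B.cart_Id[of "FO a"] in auto)
  then show "kap a \<in> isos E (HO a) (LO (FO a))"
    using E.cart_vertical_iso[of "kap a"] 1 a sol[of "FO a"] by simp
qed

lemma kap_nat:
  assumes f: "f \<in> Arr A"
  shows "kap (Cod A f) \<cdot>[E] HA f = LA (FA f) \<cdot>[E] kap (Dom A f)"
proof -
  define a where "a = Dom A f"
  define a' where "a' = Cod A f"
  have a: "a \<in> Obj A" "a' \<in> Obj A" "Dom A f = a" "Cod A f = a'" using f by (auto simp: a_def a'_def)
  note [simp] = f a
  have b: "fst (Id C (FO d)) = Id X (fst d)" if "d \<in> Obj A" for d using F.B.base.FA_Id[of "FO d"] that by simp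
  have fb: "fst f \<in> Arr X" "Dom X (fst f) = fst a" "Cod X (fst f) = fst a'"
    using F.A.base.FA_Dom[OF f] F.A.base.FA_Cod[OF f] by auto
  have max: "fst f \<in> S (FO a')" using S_Arr(3)[of "FO a'" "Id X (fst a')" "fst f"] Id_in_S[of a'] fb by simp
  \<comment> \<open>Source and target lie in the image of \<open>F\<close>, so \<open>R\<close>
    contains the identity and \<open>LA_tau\<close> applies to the identity arrow itself.\<close>
  have R: "Id X (fst a) \<in> R (FA f)" using Id_in_S[of a] max fb by (simp add: R_def pull_sieve_def)
  have "LA (FA f) \<cdot>[E] kap a = tau (FO a') a (FA f)"
    using LA_tau[of "FA f" "Id C (FO a)" a] R b[of a] by (simp add: kap_def)
  also have "\<dots> = kap a' \<cdot>[E] HA f"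
    using tau_nat[of "FO a'" "Id C (FO a')" f] Id_in_S[of a'] b[of a'] by (simp add: kap_def)
  finally show ?thesis by simp
qed

text \<open>By separatedness it is enough to compare after the cartesian arrows
  \<open>PA (jj c u)\<close>, where both sides become \<open>K\<close> of the same arrow preceded by
  \<gamma>.\<close>

lemma rr_nat:
  assumes \<phi>: "\<phi> \<in> Arr C"
  shows "rr (Cod C \<phi>) \<cdot>[B] PA (LA \<phi>) = KA \<phi> \<cdot>[B] rr (Dom C \<phi>)"
proof (rule B.separated[of _ _ "R \<phi>"])
  define c where "c = Dom C \<phi>"
  define c' where "c' = Cod C \<phi>"
  have c: "c \<in> Obj C" "c' \<in> Obj C" "Dom C \<phi> = c" "Cod C \<phi> = c'" using \<phi> by (auto simp: c_def c'_def)
  note [simp] = \<phi> c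
  note L = LA[OF \<phi>] and s = sol[of c] and s' = sol[of c']
  have pb: "fst \<phi> \<in> Arr X" "Dom X (fst \<phi>) = fst c" "Cod X (fst \<phi>) = fst c'"
    using F.B.base.FA_Dom[OF \<phi>] F.B.base.FA_Cod[OF \<phi>] by auto
  show "rr (Cod C \<phi>) \<cdot>[B] PA (LA \<phi>) \<in> Arr B" "KA \<phi> \<cdot>[B] rr (Dom C \<phi>) \<in> Arr B"
    "Dom B (rr (Cod C \<phi>) \<cdot>[B] PA (LA \<phi>)) = Dom B (KA \<phi> \<cdot>[B] rr (Dom C \<phi>))"
    "Cod B (rr (Cod C \<phi>) \<cdot>[B] PA (LA \<phi>)) = Cod B (KA \<phi> \<cdot>[B] rr (Dom C \<phi>))"
    "fst (rr (Cod C \<phi>) \<cdot>[B] PA (LA \<phi>)) = fst (KA \<phi> \<cdot>[B] rr (Dom C \<phi>))"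
    "R \<phi> \<in> J (fst (Dom B (rr (Cod C \<phi>) \<cdot>[B] PA (LA \<phi>))))"
    using L s s' pb R_cover[OF \<phi>] by auto
  fix u assume u: "u \<in> R \<phi>"
  have uS: "u \<in> S c" "fst \<phi> \<cdot>[X] u \<in> S c'" using R_S[OF u] by auto
  note o = om[OF uS(1)] and j = jj[OF c(1) uS(1)]
  have "(rr c' \<cdot>[B] PA (LA \<phi>)) \<cdot>[B] PA (jj c u) = rr c' \<cdot>[B] PA (LA \<phi> \<cdot>[E] jj c u)"
    using L s' j by simp
  also have "\<dots> = KA (\<phi> \<cdot>[C] om c u) \<cdot>[B] \<gamma> (aa c u)"
    using LA_jj[OF \<phi> u] rr_tau[of c' "\<phi> \<cdot>[C] om c u" "aa c u"] o uS by simp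
  also have "\<dots> = (KA \<phi> \<cdot>[B] rr c) \<cdot>[B] PA (jj c u)"
    using o j s by simp
  finally show "\<exists>q. cartesian X B q \<and> Cod B q = Dom B (rr (Cod C \<phi>) \<cdot>[B] PA (LA \<phi>)) \<and> fst q = u \<and>
     (rr (Cod C \<phi>) \<cdot>[B] PA (LA \<phi>)) \<cdot>[B] q = (KA \<phi> \<cdot>[B] rr (Dom C \<phi>)) \<cdot>[B] q"
    using j L s s' P.FA_cart[OF j(5)] by (intro exI[of _ "PA (jj c u)"]) auto
qed

theorem lift_exists:
  obtains LO LA \<kappa> \<rho> where "fibred_functor X C E LO LA"
    "\<And>a. a \<in> Obj A \<Longrightarrow> \<kappa> a \<in> isos E (HO a) (LO (FO a)) \<and> fst (\<kappa> a) = Id X (fst a)"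
    "\<And>f. f \<in> Arr A \<Longrightarrow> \<kappa> (Cod A f) \<cdot>[E] HA f = LA (FA f) \<cdot>[E] \<kappa> (Dom A f)"
    "\<And>c. c \<in> Obj C \<Longrightarrow> \<rho> c \<in> isos B (PO (LO c)) (KO c) \<and> fst (\<rho> c) = Id X (fst c)"
    "\<And>f. f \<in> Arr C \<Longrightarrow> \<rho> (Cod C f) \<cdot>[B] PA (LA f) = KA f \<cdot>[B] \<rho> (Dom C f)"
    "\<And>a. a \<in> Obj A \<Longrightarrow> \<gamma> a = \<rho> (FO a) \<cdot>[B] PA (\<kappa> a)"
proof (rule that[OF L_fibred_functor])
  show "kap a \<in> isos E (HO a) (LO (FO a)) \<and> fst (kap a) = Id X (fst a)" if "a \<in> Obj A" for a using kap[OF that] by simp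
  show "kap (Cod A f) \<cdot>[E] HA f = LA (FA f) \<cdot>[E] kap (Dom A f)" if "f \<in> Arr A" for f using kap_nat[OF that] .
  show "rr c \<in> isos B (PO (LO c)) (KO c) \<and> fst (rr c) = Id X (fst c)" if "c \<in> Obj C" for c using sol[OF that] by simp
  show "rr (Cod C f) \<cdot>[B] PA (LA f) = KA f \<cdot>[B] rr (Dom C f)" if "f \<in> Arr C" for f using rr_nat[OF that] .
  show "\<gamma> a = rr (FO a) \<cdot>[B] PA (kap a)" if a: "a \<in> Obj A" for a
    using rr_tau[of "FO a" "Id C (FO a)" a] a Id_in_S[OF a] F.B.base.FA_Id[of "FO a"] by (simp add: kap_def)
qed

end

section \<open>The total category of a pseudofunctor\<close>

text \<open>The arrow \<open>(u, y, \<phi>)\<close> lies over \<open>u\<close>, ends in \<open>y\<close>, and is given by an arrow \<open>\<phi>\<close> into the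
  restriction of \<open>y\<close> along \<open>u\<close>.\<close>

definition Tot :: "('o, 'a) cat \<Rightarrow> ('o, 'a, 'u) psfun \<Rightarrow> ('o \<times> 'u, 'a \<times> 'u \<times> 'u) cat" where
  "Tot X F = \<lparr>
     Obj = {(U, x). U \<in> Obj X \<and> x \<in> Obj (Fib F U)},
     Arr = {(u, y, \<phi>). u \<in> Arr X \<and> y \<in> Obj (Fib F (Cod X u)) \<and>
              \<phi> \<in> Arr (Fib F (Dom X u)) \<and> Cod (Fib F (Dom X u)) \<phi> = ResO F u y},
     Dom = (\<lambda>(u, y, \<phi>). (Dom X u, Dom (Fib F (Dom X u)) \<phi>)),
     Cod = (\<lambda>(u, y, \<phi>). (Cod X u, y)),
     Id = (\<lambda>(U, x). (Id X U, x, Unt F U x)),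
     Comp = (\<lambda>(u, y, \<phi>) (v, x, \<chi>). (u \<cdot>[X] v, y,
       Cmp F u v y \<cdot>[Fib F (Dom X v)] ResA F v \<phi> \<cdot>[Fib F (Dom X v)] \<chi>))\<rparr>"

lemma total_simps [simp]:
  "(U, x) \<in> Obj (Tot X F) \<longleftrightarrow> U \<in> Obj X \<and> x \<in> Obj (Fib F U)"
  "(u, y, \<phi>) \<in> Arr (Tot X F) \<longleftrightarrow> u \<in> Arr X \<and> y \<in> Obj (Fib F (Cod X u)) \<and>
              \<phi> \<in> Arr (Fib F (Dom X u)) \<and> Cod (Fib F (Dom X u)) \<phi> = ResO F u y"
  "Dom (Tot X F) (u, y, \<phi>) = (Dom X u, Dom (Fib F (Dom X u)) \<phi>)"
  "Cod (Tot X F) (u, y, \<phi>) = (Cod X u, y)"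
  "Id (Tot X F) (U, x) = (Id X U, x, Unt F U x)"
  "(u, y, \<phi>) \<cdot>[Tot X F] (v, x, \<chi>) = (u \<cdot>[X] v, y,
       Cmp F u v y \<cdot>[Fib F (Dom X v)] ResA F v \<phi> \<cdot>[Fib F (Dom X v)] \<chi>)"
  by (simp_all add: Tot_def)

lemma total_arrE:
  assumes "f \<in> Arr (Tot X F)"
  obtains u y \<phi> where "f = (u, y, \<phi>)" "u \<in> Arr X" "y \<in> Obj (Fib F (Cod X u))"
    "\<phi> \<in> Arr (Fib F (Dom X u))" "Cod (Fib F (Dom X u)) \<phi> = ResO F u y"
  using assms by (auto simp: Tot_def)

lemma total_objE:
  assumes "z \<in> Obj (Tot X F)"
  obtains U x where "z = (U, x)" "U \<in> Obj X" "x \<in> Obj (Fib F U)"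
  using assms by (auto simp: Tot_def)

section \<open>The Grothendieck construction and its coherence calculus\<close>

context pseudofunctor begin

lemmas Fib_simps [simp] =
  category.Comp_Arr[OF Fib_category] category.Dom_Comp[OF Fib_category] category.Cod_Comp[OF Fib_category]
  category.assoc[OF Fib_category] category.Id_Arr[OF Fib_category] category.Dom_Id[OF Fib_category]
  category.Cod_Id[OF Fib_category] category.Id_left[OF Fib_category] category.Id_right[OF Fib_category]
  category.Dom_Obj[OF Fib_category] category.Cod_Obj[OF Fib_category]

lemma Res_functor': "f \<in> Arr X \<Longrightarrow> cat_functor (Fib F (Cod X f)) (Fib F (Dom X f)) (ResO F f) (ResA F f)"
  by (rule Res_functor) (simp add: in_hom)

lemma ResO_Obj [simp]: "\<lbrakk>f \<in> Arr X; Dom X f = V; x \<in> Obj (Fib F (Cod X f))\<rbrakk> \<Longrightarrow> ResO F f x \<in> Obj (Fib F V)"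
  using cat_functor.FO_Obj[OF Res_functor'] by blast

lemma ResA_simps [simp]:
  "\<lbrakk>f \<in> Arr X; Dom X f = V; \<phi> \<in> Arr (Fib F (Cod X f))\<rbrakk> \<Longrightarrow> ResA F f \<phi> \<in> Arr (Fib F V)"
  "\<lbrakk>f \<in> Arr X; Dom X f = V; \<phi> \<in> Arr (Fib F (Cod X f))\<rbrakk> \<Longrightarrow> Dom (Fib F V) (ResA F f \<phi>) = ResO F f (Dom (Fib F (Cod X f)) \<phi>)"
  "\<lbrakk>f \<in> Arr X; Dom X f = V; \<phi> \<in> Arr (Fib F (Cod X f))\<rbrakk> \<Longrightarrow> Cod (Fib F V) (ResA F f \<phi>) = ResO F f (Cod (Fib F (Cod X f)) \<phi>)"
  "\<lbrakk>f \<in> Arr X; Cod X f = U; x \<in> Obj (Fib F U)\<rbrakk> \<Longrightarrow> ResA F f (Id (Fib F U) x) = Id (Fib F (Dom X f)) (ResO F f x)"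
  "\<lbrakk>f \<in> Arr X; Cod X f = U; \<phi> \<in> Arr (Fib F U); \<psi> \<in> Arr (Fib F U); Dom (Fib F U) \<psi> = Cod (Fib F U) \<phi>\<rbrakk> \<Longrightarrow>
     ResA F f (\<psi> \<cdot>[Fib F U] \<phi>) = ResA F f \<psi> \<cdot>[Fib F (Dom X f)] ResA F f \<phi>"
  using cat_functor.FA_Arr[OF Res_functor'] cat_functor.FA_Dom[OF Res_functor'] cat_functor.FA_Cod[OF Res_functor']
    cat_functor.FA_Id[OF Res_functor'] cat_functor.FA_comp[OF Res_functor'] by blast+

lemma ResA_isos: "\<lbrakk>f \<in> Arr X; \<phi> \<in> isos (Fib F (Cod X f)) x y\<rbrakk> \<Longrightarrow> ResA F f \<phi> \<in> isos (Fib F (Dom X f)) (ResO F f x) (ResO F f y)"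
  using cat_functor.FA_isos[OF Res_functor'] by blast

lemma Unt_isos: "U \<in> Obj X \<Longrightarrow> x \<in> Obj (Fib F U) \<Longrightarrow> Unt F U x \<in> isos (Fib F U) x (ResO F (Id X U) x)"
  using natural_iso.component_iso[OF Unt_natural] by blast

lemma Unt_simps [simp]:
  assumes "U \<in> Obj X" "x \<in> Obj (Fib F U)"
  shows "Unt F U x \<in> Arr (Fib F U)" "Dom (Fib F U) (Unt F U x) = x" "Cod (Fib F U) (Unt F U x) = ResO F (Id X U) x"
  using category.isos_Arr[OF Fib_category Unt_isos] assms by blast+

lemma Unt_nat: "U \<in> Obj X \<Longrightarrow> \<phi> \<in> Arr (Fib F U) \<Longrightarrow>
    ResA F (Id X U) \<phi> \<cdot>[Fib F U] Unt F U (Dom (Fib F U) \<phi>) = Unt F U (Cod (Fib F U) \<phi>) \<cdot>[Fib F U] \<phi>"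
  using natural_iso.naturality[OF Unt_natural, of U \<phi>] by (simp add: in_hom)

lemma Cmp_isos: "\<lbrakk>f \<in> Arr X; g \<in> Arr X; Dom X f = Cod X g; x \<in> Obj (Fib F (Cod X f))\<rbrakk> \<Longrightarrow>
   Cmp F f g x \<in> isos (Fib F (Dom X g)) (ResO F g (ResO F f x)) (ResO F (f \<cdot>[X] g) x)"
  using natural_iso.component_iso[OF Cmp_natural, of f "Dom X f" "Cod X f" g "Dom X g" x] by (simp add: in_hom)

lemma Cmp_simps [simp]:
  assumes "f \<in> Arr X" "g \<in> Arr X" "Dom X f = Cod X g" "Dom X g = W" "x \<in> Obj (Fib F (Cod X f))"
  shows "Cmp F f g x \<in> Arr (Fib F W)" "Dom (Fib F W) (Cmp F f g x) = ResO F g (ResO F f x)"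
    "Cod (Fib F W) (Cmp F f g x) = ResO F (f \<cdot>[X] g) x"
  using category.isos_Arr[OF Fib_category Cmp_isos] assms X.Dom_Obj by metis+

lemma Cmp_nat: "\<lbrakk>f \<in> Arr X; g \<in> Arr X; Dom X f = Cod X g; \<phi> \<in> Arr (Fib F (Cod X f))\<rbrakk> \<Longrightarrow>
    Cmp F f g (Cod (Fib F (Cod X f)) \<phi>) \<cdot>[Fib F (Dom X g)] ResA F g (ResA F f \<phi>) =
    ResA F (f \<cdot>[X] g) \<phi> \<cdot>[Fib F (Dom X g)] Cmp F f g (Dom (Fib F (Cod X f)) \<phi>)"
  using natural_iso.naturality[OF Cmp_natural, of f "Dom X f" "Cod X f" g "Dom X g" \<phi>] by (simp add: in_hom)

lemma Cmp_Unt_left' : "f \<in> Arr X \<Longrightarrow> x \<in> Obj (Fib F (Cod X f)) \<Longrightarrow>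
      Cmp F (Id X (Cod X f)) f x \<cdot>[Fib F (Dom X f)] ResA F f (Unt F (Cod X f) x) = Id (Fib F (Dom X f)) (ResO F f x)"
  using Cmp_Unt_left[of f "Dom X f" "Cod X f"] by (simp add: in_hom)

lemma Cmp_Unt_right': "f \<in> Arr X \<Longrightarrow> x \<in> Obj (Fib F (Cod X f)) \<Longrightarrow>
      Cmp F f (Id X (Dom X f)) x \<cdot>[Fib F (Dom X f)] Unt F (Dom X f) (ResO F f x) = Id (Fib F (Dom X f)) (ResO F f x)"
  using Cmp_Unt_right[of f "Dom X f" "Cod X f"] by (simp add: in_hom)

lemma Cmp_assoc': "\<lbrakk>f \<in> Arr X; g \<in> Arr X; h \<in> Arr X; Dom X f = Cod X g; Dom X g = Cod X h; x \<in> Obj (Fib F (Cod X f))\<rbrakk> \<Longrightarrow>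
      Cmp F (f \<cdot>[X] g) h x \<cdot>[Fib F (Dom X h)] ResA F h (Cmp F f g x) =
      Cmp F f (g \<cdot>[X] h) x \<cdot>[Fib F (Dom X h)] Cmp F g h (ResO F f x)"
  using Cmp_assoc[of f "Dom X f" "Cod X f" g "Dom X g" h "Dom X h" x] by (simp add: in_hom)

text \<open>Associativity combines the coherence of \<open>Cmp\<close> with its naturality. The unit
  laws are the two unit coherences; the right one also uses naturality of
  \<open>Unt\<close>.\<close>

lemma total_category: "category (Tot X F)"
proof
  fix f assume "f \<in> Arr (Tot X F)"
  then show "Dom (Tot X F) f \<in> Obj (Tot X F)" "Cod (Tot X F) f \<in> Obj (Tot X F)"
    by (auto elim!: total_arrE)
next
  fix x assume "x \<in> Obj (Tot X F)"
  then show "Id (Tot X F) x \<in> hom (Tot X F) x x" by (auto elim!: total_objE simp: in_hom)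
next
  fix f g x y z assume "f \<in> hom (Tot X F) x y" "g \<in> hom (Tot X F) y z"
  then show "g \<cdot>[Tot X F] f \<in> hom (Tot X F) x z"
    by (auto elim!: total_arrE simp: in_hom)
next
  fix f x y assume "f \<in> hom (Tot X F) x y"
  then obtain u z \<phi> where f: "f = (u, z, \<phi>)" "x = (Dom X u, Dom (Fib F (Dom X u)) \<phi>)" "y = (Cod X u, z)"
    "u \<in> Arr X" "z \<in> Obj (Fib F (Cod X u))" "\<phi> \<in> Arr (Fib F (Dom X u))" "Cod (Fib F (Dom X u)) \<phi> = ResO F u z"
    by (auto elim!: total_arrE simp: in_hom)
  have "Cmp F (Id X (Cod X u)) u z \<cdot>[Fib F (Dom X u)] ResA F u (Unt F (Cod X u) z) \<cdot>[Fib F (Dom X u)] \<phi> =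
     Id (Fib F (Dom X u)) (ResO F u z) \<cdot>[Fib F (Dom X u)] \<phi>"
    by (rule category.compose_eq[OF Fib_category Cmp_Unt_left']) (use f in auto)
  then show "Id (Tot X F) y \<cdot>[Tot X F] f = f" using f by simp
  have "Cmp F u (Id X (Dom X u)) z \<cdot>[Fib F (Dom X u)] Unt F (Dom X u) (ResO F u z) \<cdot>[Fib F (Dom X u)] \<phi> =
     Id (Fib F (Dom X u)) (ResO F u z) \<cdot>[Fib F (Dom X u)] \<phi>"
    by (rule category.compose_eq[OF Fib_category Cmp_Unt_right']) (use f in auto)
  then show "f \<cdot>[Tot X F] Id (Tot X F) x = f" using f Unt_nat[of "Dom X u" \<phi>] by simp
next
  fix f g h w x y z assume "f \<in> hom (Tot X F) w x" "g \<in> hom (Tot X F) x y" "h \<in> hom (Tot X F) y z"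
  then have A: "f \<in> Arr (Tot X F)" "g \<in> Arr (Tot X F)" "h \<in> Arr (Tot X F)"
    and e: "Cod (Tot X F) f = Dom (Tot X F) g" "Cod (Tot X F) g = Dom (Tot X F) h" by (auto simp: in_hom)
  obtain t a \<xi> where f: "f = (t, a, \<xi>)" "t \<in> Arr X" "a \<in> Obj (Fib F (Cod X t))"
        "\<xi> \<in> Arr (Fib F (Dom X t))" "Cod (Fib F (Dom X t)) \<xi> = ResO F t a" by (rule total_arrE[OF A(1)])
  obtain v b \<chi> where g: "g = (v, b, \<chi>)" "v \<in> Arr X" "b \<in> Obj (Fib F (Cod X v))"
        "\<chi> \<in> Arr (Fib F (Dom X v))" "Cod (Fib F (Dom X v)) \<chi> = ResO F v b" by (rule total_arrE[OF A(2)])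
  obtain u c \<phi> where h: "h = (u, c, \<phi>)" "u \<in> Arr X" "c \<in> Obj (Fib F (Cod X u))"
        "\<phi> \<in> Arr (Fib F (Dom X u))" "Cod (Fib F (Dom X u)) \<phi> = ResO F u c" by (rule total_arrE[OF A(3)])
  have c: "Cod X t = Dom X v" "Cod X v = Dom X u" "Dom (Fib F (Dom X v)) \<chi> = a" "Dom (Fib F (Dom X u)) \<phi> = b"
    using e f(1) g(1) h(1) by auto
  let ?T = "Fib F (Dom X t)"
  have C: "category ?T" using f Fib_category by simp
  have "Cmp F (u \<cdot>[X] v) t c \<cdot>[?T] ResA F t (Cmp F u v c) \<cdot>[?T] (ResA F t (ResA F v \<phi>) \<cdot>[?T] ResA F t \<chi> \<cdot>[?T] \<xi>) =
    Cmp F u (v \<cdot>[X] t) c \<cdot>[?T] Cmp F v t (ResO F u c) \<cdot>[?T] (ResA F t (ResA F v \<phi>) \<cdot>[?T] ResA F t \<chi> \<cdot>[?T] \<xi>)"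
    by (rule category.compose_eq2[OF C Cmp_assoc']) (use f g h c in auto)
  also have "Cmp F v t (ResO F u c) \<cdot>[?T] (ResA F t (ResA F v \<phi>) \<cdot>[?T] ResA F t \<chi> \<cdot>[?T] \<xi>) =
     ResA F (v \<cdot>[X] t) \<phi> \<cdot>[?T] Cmp F v t b \<cdot>[?T] (ResA F t \<chi> \<cdot>[?T] \<xi>)"
    by (rule category.compose_eq2[OF C]) (use f g h c Cmp_nat[of v t \<phi>] in auto)
  finally show "(h \<cdot>[Tot X F] g) \<cdot>[Tot X F] f = h \<cdot>[Tot X F] (g \<cdot>[Tot X F] f)"
    using f g h c by simp
qed

sublocale T: category "Tot X F" by (rule total_category)

text \<open>The chosen cartesian lift of \<open>u\<close> with target \<open>y\<close>.\<close>

abbreviation ci :: "'a \<Rightarrow> 'u \<Rightarrow> 'a \<times> 'u \<times> 'u" where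
  "ci u y \<equiv> (u, y, Id (Fib F (Dom X u)) (ResO F u y))"

text \<open>The embedding of a fibre as the vertical arrows. \<open>Unt\<close> appears because an
  arrow over an identity is given by a fibre arrow into the restriction along that identity.\<close>

definition vt :: "'o \<Rightarrow> 'u \<Rightarrow> 'a \<times> 'u \<times> 'u" where
  "vt U \<chi> = (Id X U, Cod (Fib F U) \<chi>, Unt F U (Cod (Fib F U) \<chi>) \<cdot>[Fib F U] \<chi>)"

lemma vt_simps [simp]:
  assumes "U \<in> Obj X" "\<chi> \<in> Arr (Fib F U)"
  shows "vt U \<chi> \<in> Arr (Tot X F)" "Dom (Tot X F) (vt U \<chi>) = (U, Dom (Fib F U) \<chi>)"
    "Cod (Tot X F) (vt U \<chi>) = (U, Cod (Fib F U) \<chi>)" "fst (vt U \<chi>) = Id X U"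
  using assms by (auto simp: vt_def)

text \<open>Together with \<open>vt_comp\<close>, this turns composites with vertical arrows into
  composites in a fibre, so that coherence computations can be done as equations in the total
  category.\<close>

lemma comp_vt:
  assumes "(u, y, \<phi>) \<in> Arr (Tot X F)" "\<chi> \<in> Arr (Fib F (Dom X u))" "Cod (Fib F (Dom X u)) \<chi> = Dom (Fib F (Dom X u)) \<phi>"
  shows "(u, y, \<phi>) \<cdot>[Tot X F] vt (Dom X u) \<chi> = (u, y, \<phi> \<cdot>[Fib F (Dom X u)] \<chi>)"
proof -
  note [simp] = assms(1)[simplified] assms(2,3)
  let ?V = "Fib F (Dom X u)"
  have C: "category ?V" using Fib_category by simp
  have "ResA F (Id X (Dom X u)) \<phi> \<cdot>[?V] (Unt F (Dom X u) (Dom ?V \<phi>) \<cdot>[?V] \<chi>) = Unt F (Dom X u) (ResO F u y) \<cdot>[?V] (\<phi> \<cdot>[?V] \<chi>)"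
    by (rule category.compose_eq2[OF C]) (use Unt_nat[of "Dom X u" \<phi>] in auto)
  moreover have "Cmp F u (Id X (Dom X u)) y \<cdot>[?V] Unt F (Dom X u) (ResO F u y) \<cdot>[?V] (\<phi> \<cdot>[?V] \<chi>) =
     Id ?V (ResO F u y) \<cdot>[?V] (\<phi> \<cdot>[?V] \<chi>)"
    by (rule category.compose_eq[OF C Cmp_Unt_right']) auto
  ultimately show ?thesis by (simp add: vt_def)
qed

lemma vt_comp:
  assumes "(w, x, \<xi>) \<in> Arr (Tot X F)" "\<chi> \<in> Arr (Fib F (Cod X w))" "Dom (Fib F (Cod X w)) \<chi> = x"
  shows "vt (Cod X w) \<chi> \<cdot>[Tot X F] (w, x, \<xi>) = (w, Cod (Fib F (Cod X w)) \<chi>, ResA F w \<chi> \<cdot>[Fib F (Dom X w)] \<xi>)"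
proof -
  note [simp] = assms(1)[simplified] assms(2,3)
  let ?V = "Fib F (Dom X w)"
  let ?y = "Cod (Fib F (Cod X w)) \<chi>"
  have C: "category ?V" using Fib_category by simp
  have "Cmp F (Id X (Cod X w)) w ?y \<cdot>[?V] ResA F w (Unt F (Cod X w) ?y) \<cdot>[?V] (ResA F w \<chi> \<cdot>[?V] \<xi>) =
    Id ?V (ResO F w ?y) \<cdot>[?V] (ResA F w \<chi> \<cdot>[?V] \<xi>)"
    by (rule category.compose_eq[OF C Cmp_Unt_left']) auto
  then show ?thesis by (simp add: vt_def)
qed

lemma vt_inj:
  assumes "U \<in> Obj X" "\<chi> \<in> Arr (Fib F U)" "\<chi>' \<in> Arr (Fib F U)" "vt U \<chi> = vt U \<chi>'"
  shows "\<chi> = \<chi>'"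
proof -
  have 1: "Cod (Fib F U) \<chi>' = Cod (Fib F U) \<chi>" using assms(4) by (simp add: vt_def)
  have 2: "Unt F U (Cod (Fib F U) \<chi>) \<cdot>[Fib F U] \<chi> = Unt F U (Cod (Fib F U) \<chi>) \<cdot>[Fib F U] \<chi>'"
    using assms(4) unfolding vt_def 1 by simp
  show ?thesis
    by (rule category.iso_cancel_left[OF Fib_category Unt_isos _ _ _ _ 2]) (use assms(1-3) 1 in auto)
qed

lemma vt_Comp:
  assumes "U \<in> Obj X" "\<chi> \<in> Arr (Fib F U)" "\<xi> \<in> Arr (Fib F U)" "Cod (Fib F U) \<xi> = Dom (Fib F U) \<chi>"
  shows "vt U (\<chi> \<cdot>[Fib F U] \<xi>) = vt U \<chi> \<cdot>[Tot X F] vt U \<xi>"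
  using comp_vt[of "Id X U" "Cod (Fib F U) \<chi>" "Unt F U (Cod (Fib F U) \<chi>) \<cdot>[Fib F U] \<chi>" \<xi>] assms
  by (simp add: vt_def)

lemma vt_Id: "U \<in> Obj X \<Longrightarrow> x \<in> Obj (Fib F U) \<Longrightarrow> vt U (Id (Fib F U) x) = Id (Tot X F) (U, x)"
  by (simp add: vt_def)

text \<open>Cancelling the invertible \<open>Unt\<close> recovers the fibre arrow.\<close>

lemma vertical_vt:
  assumes f: "f \<in> Arr (Tot X F)" "fst f = Id X U" "U \<in> Obj X"
  obtains \<chi> where "\<chi> \<in> Arr (Fib F U)" "f = vt U \<chi>"
proof -
  obtain y \<phi> where fy: "f = (Id X U, y, \<phi>)" using f(2) by (cases f) auto
  have [simp]: "y \<in> Obj (Fib F U)" "\<phi> \<in> Arr (Fib F U)" "Cod (Fib F U) \<phi> = ResO F (Id X U) y" "U \<in> Obj X"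
    using f fy by auto
  have C: "category (Fib F U)" using Fib_category f by simp
  have I: "Unt F U y \<in> isos (Fib F U) y (ResO F (Id X U) y)" by (rule Unt_isos) auto
  note v = category.inv_arr_simps[OF C I]
  have "Unt F U y \<cdot>[Fib F U] (inv_arr (Fib F U) (Unt F U y) \<cdot>[Fib F U] \<phi>) = Id (Fib F U) (ResO F (Id X U) y) \<cdot>[Fib F U] \<phi>"
    by (rule category.compose_eq[OF C v(5)]) (use v in auto)
  then show thesis
    by (intro that[of "inv_arr (Fib F U) (Unt F U y) \<cdot>[Fib F U] \<phi>"]) (use v fy in \<open>auto simp: vt_def\<close>)
qed

section \<open>Cartesian and vertical arrows of the total category\<close>

lemma total_base_functor: "cat_functor (Tot X F) X fst fst"
  by unfold_locales (auto simp: in_hom elim!: total_objE total_arrE)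

text \<open>A factorisation through the arrow is a solution of an equation with \<open>k\<close> on
  the left, where \<open>k\<close> is \<open>Cmp\<close> composed with the restricted \<phi>; and
  \<open>k\<close> is invertible.\<close>

lemma iso_cartesian:
  assumes f: "(u, y, \<phi>) \<in> Arr (Tot X F)" and i: "\<phi> \<in> isos (Fib F (Dom X u)) x (ResO F u y)"
  shows "cartesian X (Tot X F) (u, y, \<phi>)"
  unfolding cartesian_def
proof (intro conjI ballI impI)
  note [simp] = f[simplified]
  show "(u, y, \<phi>) \<in> Arr (Tot X F)" by simp
  fix m v assume m: "m \<in> Arr (Tot X F)" and v[simp]: "v \<in> Arr X" and
    H: "Cod (Tot X F) m = Cod (Tot X F) (u, y, \<phi>) \<and> Cod X v = fst (Dom (Tot X F) (u, y, \<phi>)) \<and> fst m = fst (u, y, \<phi>) \<cdot>[X] v"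
  have vc[simp]: "Cod X v = Dom X u" using H by simp
  obtain \<chi> where m': "m = (u \<cdot>[X] v, y, \<chi>)" using m H by (cases m) auto
  then have [simp]: "\<chi> \<in> Arr (Fib F (Dom X v))" "Cod (Fib F (Dom X v)) \<chi> = ResO F (u \<cdot>[X] v) y" using m by auto
  let ?V = "Fib F (Dom X v)"
  have C: "category ?V" using Fib_category by simp
  have dx: "Dom (Fib F (Dom X u)) \<phi> = x" "x \<in> Obj (Fib F (Dom X u))"
    using category.isos_Arr[OF Fib_category i] category.isos_Obj[OF Fib_category i] by auto
  define k where "k = Cmp F u v y \<cdot>[?V] ResA F v \<phi>"
  have ki: "k \<in> isos ?V (ResO F v x) (ResO F (u \<cdot>[X] v) y)"
    unfolding k_def by (rule category.isos_Comp[OF C _ Cmp_isos]) (use ResA_isos[of v \<phi>] i in auto)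
  note kk = category.isos_Arr[OF C ki] category.inv_arr_simps[OF C ki]
  have comp: "(u, y, \<phi>) \<cdot>[Tot X F] (v, x, \<xi>) = (u \<cdot>[X] v, y, k \<cdot>[?V] \<xi>)" if "\<xi> \<in> Arr ?V" "Cod ?V \<xi> = ResO F v x" for \<xi>
    using that dx by (simp add: k_def)
  have "k \<cdot>[?V] (inv_arr ?V k \<cdot>[?V] \<chi>) = Id ?V (ResO F (u \<cdot>[X] v) y) \<cdot>[?V] \<chi>"
    by (rule category.compose_eq[OF C kk(6)]) (use kk in auto)
  then have eq: "k \<cdot>[?V] (inv_arr ?V k \<cdot>[?V] \<chi>) = \<chi>" by simp
  show "\<exists>!n. n \<in> hom (Tot X F) (Dom (Tot X F) m) (Dom (Tot X F) (u, y, \<phi>)) \<and> fst n = v \<and> (u, y, \<phi>) \<cdot>[Tot X F] n = m"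
  proof (rule ex1I[of _ "(v, x, inv_arr ?V k \<cdot>[?V] \<chi>)"])
    show "(v, x, inv_arr ?V k \<cdot>[?V] \<chi>) \<in> hom (Tot X F) (Dom (Tot X F) m) (Dom (Tot X F) (u, y, \<phi>)) \<and>
      fst (v, x, inv_arr ?V k \<cdot>[?V] \<chi>) = v \<and> (u, y, \<phi>) \<cdot>[Tot X F] (v, x, inv_arr ?V k \<cdot>[?V] \<chi>) = m"
      using kk dx eq by (subst comp) (auto simp: in_hom m')
    fix n assume n: "n \<in> hom (Tot X F) (Dom (Tot X F) m) (Dom (Tot X F) (u, y, \<phi>)) \<and> fst n = v \<and> (u, y, \<phi>) \<cdot>[Tot X F] n = m"
    then obtain \<xi> where n': "n = (v, x, \<xi>)" using dx by (cases n) (auto simp: in_hom)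
    then have xi: "\<xi> \<in> Arr ?V" "Cod ?V \<xi> = ResO F v x" using n by (auto simp: in_hom)
    then have "k \<cdot>[?V] \<xi> = \<chi>" using n comp[OF xi] n' m' by simp
    then have "k \<cdot>[?V] \<xi> = k \<cdot>[?V] (inv_arr ?V k \<cdot>[?V] \<chi>)" using eq by simp
    then have "\<xi> = inv_arr ?V k \<cdot>[?V] \<chi>" by (rule category.iso_cancel_left[OF C ki, rotated -1]) (use xi kk in auto)
    then show "n = (v, x, inv_arr ?V k \<cdot>[?V] \<chi>)" using n' by simp
  qed
qed

lemma ci_cartesian: "u \<in> Arr X \<Longrightarrow> y \<in> Obj (Fib F (Cod X u)) \<Longrightarrow> cartesian X (Tot X F) (ci u y)"
  by (rule iso_cartesian) (auto intro: category.Id_isos[OF Fib_category])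

lemma total_fibred: "fibred X (Tot X F)"
proof (intro fibred.intro fibred_axioms.intro)
  show "cat_functor (Tot X F) X fst fst" by (rule total_base_functor)
  show "\<exists>f. cartesian X (Tot X F) f \<and> Cod (Tot X F) f = y \<and> fst f = u"
    if "y \<in> Obj (Tot X F)" "u \<in> Arr X" "Cod X u = fst y" for y u
    using that ci_cartesian[of u "snd y"] by (intro exI[of _ "ci u (snd y)"]) (auto elim!: total_objE)
qed (unfold_locales)

sublocale T: fibred X "Tot X F" by (rule total_fibred)

text \<open>The chosen lift factors through the given cartesian arrow, and its vertical factor
  inverts \<phi>.\<close>

lemma cartesian_iso:
  assumes c: "cartesian X (Tot X F) (u, y, \<phi>)"
  shows "\<phi> \<in> isos (Fib F (Dom X u)) (Dom (Fib F (Dom X u)) \<phi>) (ResO F u y)"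
proof -
  let ?V = "Fib F (Dom X u)"
  have f: "(u, y, \<phi>) \<in> Arr (Tot X F)" using c by (simp add: cartesian_def)
  note [simp] = f[simplified]
  have C: "category ?V" using Fib_category by simp
  obtain n where n: "n \<in> Arr (Tot X F)" "Dom (Tot X F) n = Dom (Tot X F) (ci u y)"
    "Cod (Tot X F) n = Dom (Tot X F) (u, y, \<phi>)" "fst n = Id X (Dom X u)" "(u, y, \<phi>) \<cdot>[Tot X F] n = ci u y"
    by (rule T.cart_factor[OF c, of "ci u y" "Id X (Dom X u)"]) auto
  obtain \<chi> where \<chi>: "\<chi> \<in> Arr ?V" "n = vt (Dom X u) \<chi>" by (rule vertical_vt[OF n(1,4)]) auto
  have ch: "Dom ?V \<chi> = ResO F u y" "Cod ?V \<chi> = Dom ?V \<phi>" using n \<chi> by auto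
  have e1: "\<phi> \<cdot>[?V] \<chi> = Id ?V (ResO F u y)"
    using n(5) comp_vt[OF f \<chi>(1) ch(2)] \<chi> by simp
  have "vt (Dom X u) (\<chi> \<cdot>[?V] \<phi>) = vt (Dom X u) (Id ?V (Dom ?V \<phi>))"
  proof (rule T.cart_unique[OF c])
    show "(u, y, \<phi>) \<cdot>[Tot X F] vt (Dom X u) (\<chi> \<cdot>[?V] \<phi>) = (u, y, \<phi>) \<cdot>[Tot X F] vt (Dom X u) (Id ?V (Dom ?V \<phi>))"
      using category.compose_eq[OF C e1, of \<phi>] ch \<chi> by (subst (1 2) comp_vt) auto
  qed (use \<chi> ch in auto)
  then have "\<chi> \<cdot>[?V] \<phi> = Id ?V (Dom ?V \<phi>)" by (rule vt_inj[rotated -1]) (use \<chi> ch in auto)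
  then show ?thesis using e1 \<chi> ch by (intro category.isosI[OF C, where g = \<chi>]) (auto simp: in_hom)
qed

lemma vt_isos:
  assumes "U \<in> Obj X" "\<chi> \<in> isos (Fib F U) x y"
  shows "vt U \<chi> \<in> isos (Tot X F) (U, x) (U, y)"
proof -
  note C = Fib_category[OF assms(1)]
  note s = category.isos_Arr[OF C assms(2)] category.inv_arr_simps[OF C assms(2)] category.isos_Obj[OF C assms(2)]
  show ?thesis
    by (rule T.isosI[where g = "vt U (inv_arr (Fib F U) \<chi>)"])
       (use assms(1) s vt_Id in \<open>auto simp: in_hom simp flip: vt_Comp\<close>)
qed

text \<open>The inverse of a vertical isomorphism is vertical and so comes from the fibre;
  injectivity of \<open>vt\<close> pulls the two identities back.\<close>

lemma vt_isosD:
  assumes "U \<in> Obj X" "\<chi> \<in> Arr (Fib F U)" "vt U \<chi> \<in> isos (Tot X F) (U, x) (U, y)"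
  shows "\<chi> \<in> isos (Fib F U) x y"
proof -
  note C = Fib_category[OF assms(1)]
  note i = T.isos_Arr[OF assms(3)] T.inv_arr_simps[OF assms(3)]
  have xy: "Dom (Fib F U) \<chi> = x" "Cod (Fib F U) \<chi> = y" "x \<in> Obj (Fib F U)" "y \<in> Obj (Fib F U)" using i assms by auto
  have "fst (inv_arr (Tot X F) (vt U \<chi>)) = Id X U"
    using T.iso_vertical_inv(1)[OF assms(3)] assms by simp
  then obtain \<xi> where x: "\<xi> \<in> Arr (Fib F U)" "inv_arr (Tot X F) (vt U \<chi>) = vt U \<xi>"
    using vertical_vt[of "inv_arr (Tot X F) (vt U \<chi>)" U] i(2) assms(1) by blast
  have d: "Dom (Fib F U) \<xi> = y" "Cod (Fib F U) \<xi> = x" using i(3,4) x assms by auto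
  have "vt U (\<xi> \<cdot>[Fib F U] \<chi>) = vt U (Id (Fib F U) x)" "vt U (\<chi> \<cdot>[Fib F U] \<xi>) = vt U (Id (Fib F U) y)"
    using i(5,6) x d xy assms vt_Id[OF assms(1)] by (auto simp: vt_Comp)
  then have "\<xi> \<cdot>[Fib F U] \<chi> = Id (Fib F U) x" "\<chi> \<cdot>[Fib F U] \<xi> = Id (Fib F U) y"
    using x d xy assms by (auto elim!: vt_inj[rotated -1])
  then show ?thesis using x d xy assms by (intro category.isosI[OF C, where g = \<xi>]) (auto simp: in_hom)
qed

lemma ci_vt: "(u, y, \<phi>) \<in> Arr (Tot X F) \<Longrightarrow> ci u y \<cdot>[Tot X F] vt (Dom X u) \<phi> = (u, y, \<phi>)"
  by (subst comp_vt) auto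

text \<open>The arrow over \<open>t\<close>, from the restriction along
  \<open>u \<cdot>[X] t\<close> to the restriction along \<open>u\<close>, that expresses the chosen
  lift of the composite through the chosen lift of \<open>u\<close>.\<close>

definition cmpi :: "'a \<Rightarrow> 'a \<Rightarrow> 'u \<Rightarrow> 'a \<times> 'u \<times> 'u" where
  "cmpi u t x = (t, ResO F u x, inv_arr (Fib F (Dom X t)) (Cmp F u t x))"

lemma cmpi:
  assumes "u \<in> Arr X" "t \<in> Arr X" "Dom X u = Cod X t" "x \<in> Obj (Fib F (Cod X u))"
  shows "cmpi u t x \<in> Arr (Tot X F)" "Dom (Tot X F) (cmpi u t x) = (Dom X t, ResO F (u \<cdot>[X] t) x)"
    "Cod (Tot X F) (cmpi u t x) = (Dom X u, ResO F u x)" "fst (cmpi u t x) = t"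
    "ci u x \<cdot>[Tot X F] cmpi u t x = ci (u \<cdot>[X] t) x" "cartesian X (Tot X F) (cmpi u t x)"
proof -
  note C = Fib_category[of "Dom X t"]
  have O: "Dom X t \<in> Obj X" using assms by simp
  note s = category.inv_arr_simps[OF C Cmp_isos[OF assms], OF O]
  note i = category.inv_arr_isos[OF C Cmp_isos[OF assms], OF O]
  show 1: "cmpi u t x \<in> Arr (Tot X F)" "Dom (Tot X F) (cmpi u t x) = (Dom X t, ResO F (u \<cdot>[X] t) x)"
    "Cod (Tot X F) (cmpi u t x) = (Dom X u, ResO F u x)" "fst (cmpi u t x) = t"
    "ci u x \<cdot>[Tot X F] cmpi u t x = ci (u \<cdot>[X] t) x"
    using assms s by (auto simp: cmpi_def)
  show "cartesian X (Tot X F) (cmpi u t x)"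
    unfolding cmpi_def by (rule iso_cartesian[OF 1(1)[unfolded cmpi_def]]) (use i in simp)
qed

text \<open>The isomorphisms that conjugate in \<open>restrict_mor\<close> are exactly those in a
  composite with \<open>cmpi\<close>. The later translations of restricted arrows rest on
  this.\<close>

lemma restrict_mor_total:
  assumes "u \<in> Arr X" "t \<in> Arr X" "Dom X u = Cod X t"
  shows "(v \<cdot>[X] t, y, restrict_mor X F u v x y t \<phi>) = (v, y, \<phi>) \<cdot>[Tot X F] cmpi u t x"
  by (simp add: cmpi_def restrict_mor_def)

end

section \<open>Pseudonatural transformations as fibred functors\<close>

definition totO :: "('o, 'a, 'u) psnat \<Rightarrow> 'o \<times> 'u \<Rightarrow> 'o \<times> 'u" where
  "totO p = (\<lambda>(U, x). (U, NatO p U x))"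

definition totA :: "('o, 'a) cat \<Rightarrow> ('o, 'a, 'u) psfun \<Rightarrow> ('o, 'a, 'u) psnat \<Rightarrow> 'a \<times> 'u \<times> 'u \<Rightarrow> 'a \<times> 'u \<times> 'u" where
  "totA X B p = (\<lambda>(u, y, \<phi>). (u, NatO p (Cod X u) y, NatC p u y \<cdot>[Fib B (Dom X u)] NatA p (Dom X u) \<phi>))"

lemma tot_simps [simp]:
  "totO p (U, x) = (U, NatO p U x)"
  "totA X B p (u, y, \<phi>) = (u, NatO p (Cod X u) y, NatC p u y \<cdot>[Fib B (Dom X u)] NatA p (Dom X u) \<phi>)"
  by (simp_all add: totO_def totA_def)

section \<open>From a pseudonatural transformation to a cartesian functor\<close>

context pseudonatural begin

lemma NatO_Obj [simp]: "U \<in> Obj X \<Longrightarrow> x \<in> Obj (Fib E U) \<Longrightarrow> NatO p U x \<in> Obj (Fib B U)"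
  using cat_functor.FO_Obj[OF Nat_functor] by blast

lemma NatA_simps [simp]:
  "\<lbrakk>U \<in> Obj X; \<phi> \<in> Arr (Fib E U)\<rbrakk> \<Longrightarrow> NatA p U \<phi> \<in> Arr (Fib B U)"
  "\<lbrakk>U \<in> Obj X; \<phi> \<in> Arr (Fib E U)\<rbrakk> \<Longrightarrow> Dom (Fib B U) (NatA p U \<phi>) = NatO p U (Dom (Fib E U) \<phi>)"
  "\<lbrakk>U \<in> Obj X; \<phi> \<in> Arr (Fib E U)\<rbrakk> \<Longrightarrow> Cod (Fib B U) (NatA p U \<phi>) = NatO p U (Cod (Fib E U) \<phi>)"
  "\<lbrakk>U \<in> Obj X; x \<in> Obj (Fib E U)\<rbrakk> \<Longrightarrow> NatA p U (Id (Fib E U) x) = Id (Fib B U) (NatO p U x)"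
  "\<lbrakk>U \<in> Obj X; \<phi> \<in> Arr (Fib E U); \<psi> \<in> Arr (Fib E U); Dom (Fib E U) \<psi> = Cod (Fib E U) \<phi>\<rbrakk> \<Longrightarrow>
     NatA p U (\<psi> \<cdot>[Fib E U] \<phi>) = NatA p U \<psi> \<cdot>[Fib B U] NatA p U \<phi>"
  using cat_functor.FA_Arr[OF Nat_functor] cat_functor.FA_Dom[OF Nat_functor] cat_functor.FA_Cod[OF Nat_functor]
    cat_functor.FA_Id[OF Nat_functor] cat_functor.FA_comp[OF Nat_functor] by blast+

lemma NatA_isos: "U \<in> Obj X \<Longrightarrow> \<phi> \<in> isos (Fib E U) x y \<Longrightarrow> NatA p U \<phi> \<in> isos (Fib B U) (NatO p U x) (NatO p U y)"
  using cat_functor.FA_isos[OF Nat_functor] by blast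

lemma NatC_isos: "u \<in> Arr X \<Longrightarrow> x \<in> Obj (Fib E (Cod X u)) \<Longrightarrow>
    NatC p u x \<in> isos (Fib B (Dom X u)) (NatO p (Dom X u) (ResO E u x)) (ResO B u (NatO p (Cod X u) x))"
  using natural_iso.component_iso[OF NatC_natural, of u "Dom X u" "Cod X u" x] by (simp add: in_hom)

lemma NatC_simps [simp]:
  assumes "u \<in> Arr X" "Dom X u = V" "x \<in> Obj (Fib E (Cod X u))"
  shows "NatC p u x \<in> Arr (Fib B V)" "Dom (Fib B V) (NatC p u x) = NatO p V (ResO E u x)"
    "Cod (Fib B V) (NatC p u x) = ResO B u (NatO p (Cod X u) x)"
  using category.isos_Arr[OF B.Fib_category NatC_isos] assms E.X.Dom_Obj by metis+

lemma NatC_nat: "u \<in> Arr X \<Longrightarrow> \<phi> \<in> Arr (Fib E (Cod X u)) \<Longrightarrow>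
    NatC p u (Cod (Fib E (Cod X u)) \<phi>) \<cdot>[Fib B (Dom X u)] NatA p (Dom X u) (ResA E u \<phi>) =
    ResA B u (NatA p (Cod X u) \<phi>) \<cdot>[Fib B (Dom X u)] NatC p u (Dom (Fib E (Cod X u)) \<phi>)"
  using natural_iso.naturality[OF NatC_natural, of u "Dom X u" "Cod X u" \<phi>] by (simp add: in_hom)

lemma NatC_Cmp': "\<lbrakk>f \<in> Arr X; g \<in> Arr X; Dom X f = Cod X g; x \<in> Obj (Fib E (Cod X f))\<rbrakk> \<Longrightarrow>
      NatC p (f \<cdot>[X] g) x \<cdot>[Fib B (Dom X g)] NatA p (Dom X g) (Cmp E f g x) =
      Cmp B f g (NatO p (Cod X f) x) \<cdot>[Fib B (Dom X g)] ResA B g (NatC p f x) \<cdot>[Fib B (Dom X g)] NatC p g (ResO E f x)"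
  using NatC_Cmp[of f "Dom X f" "Cod X f" g "Dom X g" x] by (simp add: in_hom)

text \<open>Composition is preserved by the compatibility of \<open>NatC\<close> with
  \<open>Cmp\<close>, followed by naturality of \<open>NatC\<close> at the fibre arrow of the left
  factor.\<close>

lemma tot_functor: "cat_functor (Tot X E) (Tot X B) (totO p) (totA X B p)"
proof
  fix z assume "z \<in> Obj (Tot X E)"
  then show "totO p z \<in> Obj (Tot X B)" "totA X B p (Id (Tot X E) z) = Id (Tot X B) (totO p z)"
    by (auto elim!: total_objE simp: NatC_Unt)
next
  fix f x y assume "f \<in> hom (Tot X E) x y"
  then show "totA X B p f \<in> hom (Tot X B) (totO p x) (totO p y)"
    by (auto elim!: total_arrE simp: in_hom)
next
  fix f g x y z assume "f \<in> hom (Tot X E) x y" "g \<in> hom (Tot X E) y z"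
  then have A: "f \<in> Arr (Tot X E)" "g \<in> Arr (Tot X E)" and e: "Cod (Tot X E) f = Dom (Tot X E) g" by (auto simp: in_hom)
  obtain v b \<chi> where f: "f = (v, b, \<chi>)" "v \<in> Arr X" "b \<in> Obj (Fib E (Cod X v))"
        "\<chi> \<in> Arr (Fib E (Dom X v))" "Cod (Fib E (Dom X v)) \<chi> = ResO E v b" by (rule total_arrE[OF A(1)])
  obtain u c \<phi> where g: "g = (u, c, \<phi>)" "u \<in> Arr X" "c \<in> Obj (Fib E (Cod X u))"
        "\<phi> \<in> Arr (Fib E (Dom X u))" "Cod (Fib E (Dom X u)) \<phi> = ResO E u c" by (rule total_arrE[OF A(2)])
  have c: "Cod X v = Dom X u" "Dom (Fib E (Dom X u)) \<phi> = b"
    using e f(1) g(1) by auto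
  let ?V = "Fib B (Dom X v)"
  have C: "category ?V" using f B.Fib_category by simp
  have "NatC p (u \<cdot>[X] v) c \<cdot>[?V] NatA p (Dom X v) (Cmp E u v c) \<cdot>[?V] (NatA p (Dom X v) (ResA E v \<phi>) \<cdot>[?V] NatA p (Dom X v) \<chi>) =
    (Cmp B u v (NatO p (Cod X u) c) \<cdot>[?V] ResA B v (NatC p u c) \<cdot>[?V] NatC p v (ResO E u c)) \<cdot>[?V] (NatA p (Dom X v) (ResA E v \<phi>) \<cdot>[?V] NatA p (Dom X v) \<chi>)"
    by (rule category.compose_eq[OF C NatC_Cmp']) (use f g c in auto)
  moreover have "NatC p v (ResO E u c) \<cdot>[?V] (NatA p (Dom X v) (ResA E v \<phi>) \<cdot>[?V] NatA p (Dom X v) \<chi>) =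
     ResA B v (NatA p (Dom X u) \<phi>) \<cdot>[?V] (NatC p v b \<cdot>[?V] NatA p (Dom X v) \<chi>)"
    by (rule category.compose_eq2[OF C]) (use f g c NatC_nat[of v \<phi>] in auto)
  ultimately show "totA X B p (g \<cdot>[Tot X E] f) = totA X B p g \<cdot>[Tot X B] totA X B p f"
    using f g c by simp
qed (unfold_locales)

lemma totA_vt: "U \<in> Obj X \<Longrightarrow> \<phi> \<in> Arr (Fib E U) \<Longrightarrow> totA X B p (E.vt U \<phi>) = B.vt U (NatA p U \<phi>)"
proof -
  assume U: "U \<in> Obj X" and \<phi>: "\<phi> \<in> Arr (Fib E U)"
  note C = B.Fib_category[OF U]
  have "NatC p (Id X U) (Cod (Fib E U) \<phi>) \<cdot>[Fib B U] NatA p U (Unt E U (Cod (Fib E U) \<phi>)) \<cdot>[Fib B U] NatA p U \<phi>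
     = Unt B U (NatO p U (Cod (Fib E U) \<phi>)) \<cdot>[Fib B U] NatA p U \<phi>"
    by (rule category.compose_eq[OF C NatC_Unt]) (use U \<phi> in auto)
  then show ?thesis using U \<phi> by (simp add: E.vt_def B.vt_def)
qed

lemma tot_fibred_functor: "fibred_functor X (Tot X E) (Tot X B) (totO p) (totA X B p)"
proof (intro fibred_functor.intro fibred_functor_axioms.intro)
  show "fst (totO p x) = fst x" if "x \<in> Obj (Tot X E)" for x using that by (auto elim!: total_objE)
  show "fst (totA X B p f) = fst f" if "f \<in> Arr (Tot X E)" for f using that by (auto elim!: total_arrE)
  show "cartesian X (Tot X B) (totA X B p f)" if c: "cartesian X (Tot X E) f" for f
  proof -
    obtain u y \<phi> where f: "f = (u, y, \<phi>)" by (cases f)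
    have fA: "(u, y, \<phi>) \<in> Arr (Tot X E)" using c f by (simp add: cartesian_def)
    have i: "\<phi> \<in> isos (Fib E (Dom X u)) (Dom (Fib E (Dom X u)) \<phi>) (ResO E u y)"
      using E.cartesian_iso c f by simp
    have "NatC p u y \<cdot>[Fib B (Dom X u)] NatA p (Dom X u) \<phi> \<in> isos (Fib B (Dom X u)) (NatO p (Dom X u) (Dom (Fib E (Dom X u)) \<phi>)) (ResO B u (NatO p (Cod X u) y))"
      by (rule category.isos_Comp[OF B.Fib_category NatA_isos[OF _ i] NatC_isos]) (use fA in auto)
    then show ?thesis unfolding f tot_simps by (rule B.iso_cartesian[rotated]) (use fA in auto)
  qed
qed (rule E.total_fibred B.total_fibred tot_functor)+

end

text \<open>In the law for composites, \<open>1\<close> applies \<open>p\<close> to the law of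
  \<open>h\<close>, \<open>2\<close> is the law of \<open>p\<close> at the image of
  \<open>h\<close>, and \<open>3\<close> exchanges the remaining factors by naturality of
  \<open>NatC\<close>.\<close>

lemma psnat_comp_pseudonatural:
  assumes "pseudonatural X A E h" "pseudonatural X E B p"
  shows "pseudonatural X A B (psnat_comp X B p h)"
proof -
  interpret h: pseudonatural X A E h by fact
  interpret p: pseudonatural X E B p by fact
  show ?thesis
  proof (intro pseudonatural.intro pseudonatural_axioms.intro)
    show "pseudofunctor X A" "pseudofunctor X B" by unfold_locales
  next
    fix U assume U: "U \<in> Obj X"
    show "cat_functor (Fib A U) (Fib B U) (NatO (psnat_comp X B p h) U) (NatA (psnat_comp X B p h) U)"
      using U by (auto simp: cat_functor_def cat_functor_axioms_def psnat_comp_def in_hom h.E.Fib_category p.B.Fib_category)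
    fix x assume x: "x \<in> Obj (Fib A U)"
    have "NatA p U (NatC h (Id X U) x) \<cdot>[Fib B U] NatA p U (NatA h U (Unt A U x)) = NatA p U (Unt E U (NatO h U x))"
      using U x h.NatC_Unt[OF U x] by (simp flip: p.NatA_simps(5))
    then show "NatC (psnat_comp X B p h) (Id X U) x \<cdot>[Fib B U] NatA (psnat_comp X B p h) U (Unt A U x) = Unt B U (NatO (psnat_comp X B p h) U x)"
      using U x p.NatC_Unt[of U "NatO h U x"] by (simp add: psnat_comp_def)
  next
    fix f V U assume "f \<in> hom X V U"
    then have f: "f \<in> Arr X" "Dom X f = V" "Cod X f = U" by (auto simp: in_hom)
    have V: "V \<in> Obj X" "U \<in> Obj X" using f by auto
    note C = p.B.Fib_category[OF V(1)]
    have R: "cat_functor (Fib A U) (Fib A V) (ResO A f) (ResA A f)" "cat_functor (Fib B U) (Fib B V) (ResO B f) (ResA B f)"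
      using h.E.Res_functor' p.B.Res_functor' f by auto
    show "natural_iso (Fib A U) (Fib B V) (\<lambda>x. NatO (psnat_comp X B p h) V (ResO A f x))
            (\<lambda>\<phi>. NatA (psnat_comp X B p h) V (ResA A f \<phi>)) (\<lambda>x. ResO B f (NatO (psnat_comp X B p h) U x))
            (\<lambda>\<phi>. ResA B f (NatA (psnat_comp X B p h) U \<phi>)) (NatC (psnat_comp X B p h) f)"
    proof (intro natural_iso.intro natural_iso_axioms.intro)
      show "cat_functor (Fib A U) (Fib B V) (\<lambda>x. NatO (psnat_comp X B p h) V (ResO A f x)) (\<lambda>\<phi>. NatA (psnat_comp X B p h) V (ResA A f \<phi>))"
        using f V by (auto simp: cat_functor_def cat_functor_axioms_def psnat_comp_def in_hom h.E.Fib_category p.B.Fib_category)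
      show "cat_functor (Fib A U) (Fib B V) (\<lambda>x. ResO B f (NatO (psnat_comp X B p h) U x)) (\<lambda>\<phi>. ResA B f (NatA (psnat_comp X B p h) U \<phi>))"
        using f V by (auto simp: cat_functor_def cat_functor_axioms_def psnat_comp_def in_hom h.E.Fib_category p.B.Fib_category)
      fix x assume x: "x \<in> Obj (Fib A U)"
      show "NatC (psnat_comp X B p h) f x \<in> isos (Fib B V) (NatO (psnat_comp X B p h) V (ResO A f x)) (ResO B f (NatO (psnat_comp X B p h) U x))"
        using category.isos_Comp[OF C p.NatA_isos[OF V(1) h.NatC_isos[of f x, unfolded f]] p.NatC_isos[of f "NatO h U x", unfolded f]] f V x
        by (simp add: psnat_comp_def)
    next
      fix \<phi> x y assume "\<phi> \<in> hom (Fib A U) x y"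
      then have \<phi>: "\<phi> \<in> Arr (Fib A U)" "Dom (Fib A U) \<phi> = x" "Cod (Fib A U) \<phi> = y" by (auto simp: in_hom)
      have xy: "x \<in> Obj (Fib A U)" "y \<in> Obj (Fib A U)" using \<phi> V by auto
      have 1: "NatA p V (NatC h f y) \<cdot>[Fib B V] NatA p V (NatA h V (ResA A f \<phi>)) = NatA p V (ResA E f (NatA h U \<phi>)) \<cdot>[Fib B V] NatA p V (NatC h f x)"
        using f V \<phi> xy h.NatC_nat[of f \<phi>] by (simp flip: p.NatA_simps(5))
      have "NatC p f (NatO h U y) \<cdot>[Fib B V] (NatA p V (ResA E f (NatA h U \<phi>)) \<cdot>[Fib B V] NatA p V (NatC h f x)) =
         ResA B f (NatA p U (NatA h U \<phi>)) \<cdot>[Fib B V] (NatC p f (NatO h U x) \<cdot>[Fib B V] NatA p V (NatC h f x))"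
        by (rule category.compose_eq2[OF C]) (use f V \<phi> xy p.NatC_nat[of f "NatA h U \<phi>"] in auto)
      then show "NatC (psnat_comp X B p h) f y \<cdot>[Fib B V] NatA (psnat_comp X B p h) V (ResA A f \<phi>) =
         ResA B f (NatA (psnat_comp X B p h) U \<phi>) \<cdot>[Fib B V] NatC (psnat_comp X B p h) f x"
        using f V \<phi> xy 1 by (simp add: psnat_comp_def)
    qed
    fix g W x assume "g \<in> hom X W V" and x: "x \<in> Obj (Fib A U)"
    then have g: "g \<in> Arr X" "Dom X g = W" "Cod X g = V" by (auto simp: in_hom)
    have W: "W \<in> Obj X" using g by auto
    note C = p.B.Fib_category[OF W]
    have "NatA p W (NatC h (f \<cdot>[X] g) x) \<cdot>[Fib B W] NatA p W (NatA h W (Cmp A f g x)) =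
      NatA p W (Cmp E f g (NatO h U x) \<cdot>[Fib E W] ResA E g (NatC h f x) \<cdot>[Fib E W] NatC h g (ResO A f x))"
      using f g V W x h.NatC_Cmp'[of f g x] by (simp flip: p.NatA_simps(5))
    also have "\<dots> = NatA p W (Cmp E f g (NatO h U x)) \<cdot>[Fib B W] NatA p W (ResA E g (NatC h f x)) \<cdot>[Fib B W] NatA p W (NatC h g (ResO A f x))"
      using f g V W x by simp
    finally have 1: "NatA p W (NatC h (f \<cdot>[X] g) x) \<cdot>[Fib B W] NatA p W (NatA h W (Cmp A f g x)) =
      NatA p W (Cmp E f g (NatO h U x)) \<cdot>[Fib B W] NatA p W (ResA E g (NatC h f x)) \<cdot>[Fib B W] NatA p W (NatC h g (ResO A f x))" .
    have 2: "NatC p (f \<cdot>[X] g) (NatO h U x) \<cdot>[Fib B W] (NatA p W (Cmp E f g (NatO h U x)) \<cdot>[Fib B W] (NatA p W (ResA E g (NatC h f x)) \<cdot>[Fib B W] NatA p W (NatC h g (ResO A f x)))) =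
      (Cmp B f g (NatO p U (NatO h U x)) \<cdot>[Fib B W] ResA B g (NatC p f (NatO h U x)) \<cdot>[Fib B W] NatC p g (ResO E f (NatO h U x))) \<cdot>[Fib B W] (NatA p W (ResA E g (NatC h f x)) \<cdot>[Fib B W] NatA p W (NatC h g (ResO A f x)))"
      by (rule category.compose_eq[OF C]) (use f g V W x p.NatC_Cmp'[of f g "NatO h U x"] in auto)
    have 3: "NatC p g (ResO E f (NatO h U x)) \<cdot>[Fib B W] (NatA p W (ResA E g (NatC h f x)) \<cdot>[Fib B W] NatA p W (NatC h g (ResO A f x))) =
      ResA B g (NatA p V (NatC h f x)) \<cdot>[Fib B W] (NatC p g (NatO h V (ResO A f x)) \<cdot>[Fib B W] NatA p W (NatC h g (ResO A f x)))"
      by (rule category.compose_eq2[OF C]) (use f g V W x p.NatC_nat[of g "NatC h f x"] in auto)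
    show "NatC (psnat_comp X B p h) (f \<cdot>[X] g) x \<cdot>[Fib B W] NatA (psnat_comp X B p h) W (Cmp A f g x) =
       Cmp B f g (NatO (psnat_comp X B p h) U x) \<cdot>[Fib B W] ResA B g (NatC (psnat_comp X B p h) f x) \<cdot>[Fib B W] NatC (psnat_comp X B p h) g (ResO A f x)"
      using f g V W x 1 2 3 by (simp add: psnat_comp_def)
  qed
qed

lemma tot_comp:
  assumes "pseudonatural X A E h" "pseudonatural X E B p"
  shows "totO (psnat_comp X B p h) z = totO p (totO h z)"
    and "f \<in> Arr (Tot X A) \<Longrightarrow> totA X B (psnat_comp X B p h) f = totA X B p (totA X E h f)"
proof -
  interpret h: pseudonatural X A E h by fact
  interpret p: pseudonatural X E B p by fact
  show "totO (psnat_comp X B p h) z = totO p (totO h z)" by (cases z) (simp add: psnat_comp_def)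
  show "totA X B (psnat_comp X B p h) f = totA X B p (totA X E h f)" if "f \<in> Arr (Tot X A)"
    using that by (auto elim!: total_arrE simp: psnat_comp_def)
qed

text \<open>The components are read off from vertical arrows, and \<open>NatC\<close> from the
  images of the chosen lifts, which are invertible because \<open>LA\<close> preserves cartesian
  arrows. Each coherence law is the image under \<open>LA\<close> of one equation between chosen
  lifts and vertical arrows.\<close>

lemma psnat_of_fibred_functor:
  assumes "pseudofunctor X C" "pseudofunctor X E" "fibred_functor X (Tot X C) (Tot X E) LO LA"
  obtains l where "pseudonatural X C E l" "\<And>z. z \<in> Obj (Tot X C) \<Longrightarrow> totO l z = LO z"
    "\<And>f. f \<in> Arr (Tot X C) \<Longrightarrow> totA X E l f = LA f"
proof -
  interpret C: pseudofunctor X C by fact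
  interpret E: pseudofunctor X E by fact
  interpret L: fibred_functor X "Tot X C" "Tot X E" LO LA by fact
  define lO where "lO U x = snd (LO (U, x))" for U x
  have LO: "LO (U, x) = (U, lO U x)" "lO U x \<in> Obj (Fib E U)" if "U \<in> Obj X" "x \<in> Obj (Fib C U)" for U x
    using L.base_FO[of "(U, x)"] L.FO_Obj[of "(U, x)"] that unfolding lO_def by (cases "LO (U, x)"; simp)+
  define lC where "lC u y = snd (snd (LA (C.ci u y)))" for u y
  have LC: "LA (C.ci u y) = (u, lO (Cod X u) y, lC u y)"
    "lC u y \<in> isos (Fib E (Dom X u)) (lO (Dom X u) (ResO C u y)) (ResO E u (lO (Cod X u) y))"
    "lC u y \<in> Arr (Fib E (Dom X u))" "Dom (Fib E (Dom X u)) (lC u y) = lO (Dom X u) (ResO C u y)"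
    "Cod (Fib E (Dom X u)) (lC u y) = ResO E u (lO (Cod X u) y)"
    if uy: "u \<in> Arr X" "y \<in> Obj (Fib C (Cod X u))" for u y
  proof -
    have A: "C.ci u y \<in> Arr (Tot X C)" using uy by simp
    have f: "fst (LA (C.ci u y)) = u" using L.base_FA[OF A] by simp
    have c: "Cod (Tot X E) (LA (C.ci u y)) = (Cod X u, lO (Cod X u) y)"
      using L.FA_Cod[OF A] LO[of "Cod X u" y] uy by simp
    have d: "Dom (Tot X E) (LA (C.ci u y)) = (Dom X u, lO (Dom X u) (ResO C u y))"
      using L.FA_Dom[OF A] LO[of "Dom X u" "ResO C u y"] uy by simp
    obtain b \<xi> where e: "LA (C.ci u y) = (u, b, \<xi>)" using f by (cases "LA (C.ci u y)") auto
    show eq: "LA (C.ci u y) = (u, lO (Cod X u) y, lC u y)" using e c by (simp add: lC_def)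
    have "cartesian X (Tot X E) (LA (C.ci u y))" using L.FA_cart[OF C.ci_cartesian[OF uy]] .
    then show "lC u y \<in> isos (Fib E (Dom X u)) (lO (Dom X u) (ResO C u y)) (ResO E u (lO (Cod X u) y))"
      using E.cartesian_iso[of u "lO (Cod X u) y" "lC u y"] d eq by simp
    then show "lC u y \<in> Arr (Fib E (Dom X u))" "Dom (Fib E (Dom X u)) (lC u y) = lO (Dom X u) (ResO C u y)"
      "Cod (Fib E (Dom X u)) (lC u y) = ResO E u (lO (Cod X u) y)"
      using category.isos_Arr[OF E.Fib_category] uy by auto
  qed
  have "\<exists>\<xi>. \<xi> \<in> Arr (Fib E U) \<and> LA (C.vt U \<phi>) = E.vt U \<xi>" if "U \<in> Obj X" "\<phi> \<in> Arr (Fib C U)" for U \<phi>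
    by (rule E.vertical_vt[of "LA (C.vt U \<phi>)" U]) (use that L.base_FA[of "C.vt U \<phi>"] in auto)
  then obtain lA where lA: "\<And>U \<phi>. U \<in> Obj X \<Longrightarrow> \<phi> \<in> Arr (Fib C U) \<Longrightarrow> lA U \<phi> \<in> Arr (Fib E U)"
    and LV: "\<And>U \<phi>. U \<in> Obj X \<Longrightarrow> \<phi> \<in> Arr (Fib C U) \<Longrightarrow> LA (C.vt U \<phi>) = E.vt U (lA U \<phi>)" by metis
  have lA': "Dom (Fib E U) (lA U \<phi>) = lO U (Dom (Fib C U) \<phi>)" "Cod (Fib E U) (lA U \<phi>) = lO U (Cod (Fib C U) \<phi>)"
    if "U \<in> Obj X" "\<phi> \<in> Arr (Fib C U)" for U \<phi>
    using L.FA_Dom[of "C.vt U \<phi>"] L.FA_Cod[of "C.vt U \<phi>"] LO(1) that lA[OF that] LV[OF that] by auto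
  note lA = lA lA'
  define l where "l = \<lparr>NatO = lO, NatA = lA, NatC = lC\<rparr>"
  have l[simp]: "NatO l = lO" "NatA l = lA" "NatC l = lC" by (simp_all add: l_def)
  have functorial: "cat_functor (Fib C U) (Fib E U) (lO U) (lA U)" if U: "U \<in> Obj X" for U
  proof (intro cat_functor.intro cat_functor_axioms.intro)
    show "lO U x \<in> Obj (Fib E U)" if "x \<in> Obj (Fib C U)" for x using LO U that by auto
    show "lA U f \<in> hom (Fib E U) (lO U x) (lO U y)" if "f \<in> hom (Fib C U) x y" for f x y
      using that lA[OF U, of f] by (auto simp: in_hom)
    show "lA U (Id (Fib C U) x) = Id (Fib E U) (lO U x)" if "x \<in> Obj (Fib C U)" for x
      by (rule E.vt_inj[OF U]) (use U that lA(1)[OF U, of "Id (Fib C U) x"] LO[OF U that] LV[OF U, of "Id (Fib C U) x"] in \<open>auto simp: C.vt_Id E.vt_Id L.FA_Id simp del: total_simps(5)\<close>)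
    show "lA U (g \<cdot>[Fib C U] f) = lA U g \<cdot>[Fib E U] lA U f" if "f \<in> hom (Fib C U) x y" "g \<in> hom (Fib C U) y z" for f g x y z
      by (rule E.vt_inj[OF U]) (use U that lA[OF U] in \<open>auto simp: in_hom C.vt_Comp E.vt_Comp simp flip: LV\<close>)
  qed (use U C.Fib_category E.Fib_category in auto)
  interpret l: pseudonatural X C E l
  proof (intro pseudonatural.intro pseudonatural_axioms.intro)
    show "pseudofunctor X C" "pseudofunctor X E" by unfold_locales
  next
    show "cat_functor (Fib C U) (Fib E U) (NatO l U) (NatA l U)" if "U \<in> Obj X" for U using functorial[OF that] by simp
    fix U assume U: "U \<in> Obj X"
    fix x assume x: "x \<in> Obj (Fib C U)"
    \<comment> \<open>The unit coherence: an identity is the chosen lift of an identity preceded by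
      the vertical \<open>Unt\<close>.\<close>
    have "C.ci (Id X U) x \<cdot>[Tot X C] C.vt U (Unt C U x) = Id (Tot X C) (U, x)"
      using C.comp_vt[of "Id X U" x "Id (Fib C U) (ResO C (Id X U) x)" "Unt C U x"] U x by simp
    then have "LA (C.ci (Id X U) x \<cdot>[Tot X C] C.vt U (Unt C U x)) = Id (Tot X E) (U, lO U x)"
      using L.FA_Id[of "(U, x)"] LO[OF U x] U x by simp
    moreover have "LA (C.ci (Id X U) x \<cdot>[Tot X C] C.vt U (Unt C U x)) = LA (C.ci (Id X U) x) \<cdot>[Tot X E] LA (C.vt U (Unt C U x))"
      by (rule L.FA_comp) (use U x in auto)
    moreover have "\<dots> = (Id X U, lO U x, lC (Id X U) x \<cdot>[Fib E U] lA U (Unt C U x))"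
      using LC[of "Id X U" x] LV[OF U, of "Unt C U x"] U x lA[OF U, of "Unt C U x"] LO(2)[OF U x]
        E.comp_vt[of "Id X U" "lO U x" "lC (Id X U) x" "lA U (Unt C U x)"]
      by (simp del: total_simps(6))
    ultimately show "NatC l (Id X U) x \<cdot>[Fib E U] NatA l U (Unt C U x) = Unt E U (NatO l U x)" by simp
  next
    fix f V U assume "f \<in> hom X V U"
    then have f: "f \<in> Arr X" "Dom X f = V" "Cod X f = U" by (auto simp: in_hom)
    have V: "V \<in> Obj X" "U \<in> Obj X" using f by auto
    note lo = LO(2)[OF V(1)] LO(2)[OF V(2)]
    note la = lA[OF V(1)] lA[OF V(2)]
    interpret lU: cat_functor "Fib C U" "Fib E U" "lO U" "lA U" by (rule functorial[OF V(2)])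
    interpret lV: cat_functor "Fib C V" "Fib E V" "lO V" "lA V" by (rule functorial[OF V(1)])
    show "natural_iso (Fib C U) (Fib E V) (\<lambda>x. NatO l V (ResO C f x)) (\<lambda>\<phi>. NatA l V (ResA C f \<phi>))
            (\<lambda>x. ResO E f (NatO l U x)) (\<lambda>\<phi>. ResA E f (NatA l U \<phi>)) (NatC l f)"
    proof (intro natural_iso.intro natural_iso_axioms.intro)
      show "cat_functor (Fib C U) (Fib E V) (\<lambda>x. NatO l V (ResO C f x)) (\<lambda>\<phi>. NatA l V (ResA C f \<phi>))"
        "cat_functor (Fib C U) (Fib E V) (\<lambda>x. ResO E f (NatO l U x)) (\<lambda>\<phi>. ResA E f (NatA l U \<phi>))"
        using f V by (auto simp: cat_functor_def cat_functor_axioms_def in_hom C.Fib_category E.Fib_category)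
      show "NatC l f x \<in> isos (Fib E V) (NatO l V (ResO C f x)) (ResO E f (NatO l U x))" if "x \<in> Obj (Fib C U)" for x
        using LC(2)[of f x] f that by simp
      fix \<phi> x y assume "\<phi> \<in> hom (Fib C U) x y"
      then have \<phi>: "\<phi> \<in> Arr (Fib C U)" "Dom (Fib C U) \<phi> = x" "Cod (Fib C U) \<phi> = y" by (auto simp: in_hom)
      have xy: "x \<in> Obj (Fib C U)" "y \<in> Obj (Fib C U)" using \<phi> V by auto
      \<comment> \<open>A fibre arrow moves past a chosen lift by being restricted; the image of
        this square is naturality of \<open>NatC\<close>.\<close>
      have "C.vt U \<phi> \<cdot>[Tot X C] C.ci f x = C.ci f y \<cdot>[Tot X C] C.vt V (ResA C f \<phi>)"
        using C.vt_comp[of f x "Id (Fib C V) (ResO C f x)" \<phi>] C.comp_vt[of f y "Id (Fib C V) (ResO C f y)" "ResA C f \<phi>"] f \<phi> xy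
        by simp
      then have "LA (C.vt U \<phi> \<cdot>[Tot X C] C.ci f x) = LA (C.ci f y \<cdot>[Tot X C] C.vt V (ResA C f \<phi>))" by simp
      moreover have "LA (C.vt U \<phi> \<cdot>[Tot X C] C.ci f x) = LA (C.vt U \<phi>) \<cdot>[Tot X E] LA (C.ci f x)"
        by (rule L.FA_comp) (use f V \<phi> xy in auto)
      moreover have "LA (C.ci f y \<cdot>[Tot X C] C.vt V (ResA C f \<phi>)) = LA (C.ci f y) \<cdot>[Tot X E] LA (C.vt V (ResA C f \<phi>))"
        by (rule L.FA_comp) (use f V \<phi> xy in auto)
      moreover have "LA (C.vt U \<phi>) \<cdot>[Tot X E] LA (C.ci f x) = (f, lO U y, ResA E f (lA U \<phi>) \<cdot>[Fib E V] lC f x)"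
        using E.vt_comp[of f "lO U x" "lC f x" "lA U \<phi>"] LC[of f x] LV[OF V(2), of \<phi>] f V \<phi> xy by (simp del: total_simps(6))
      moreover have "LA (C.ci f y) \<cdot>[Tot X E] LA (C.vt V (ResA C f \<phi>)) = (f, lO U y, lC f y \<cdot>[Fib E V] lA V (ResA C f \<phi>))"
        using E.comp_vt[of f "lO U y" "lC f y" "lA V (ResA C f \<phi>)"] LC[of f y] LV[OF V(1), of "ResA C f \<phi>"] f V \<phi> xy by (simp del: total_simps(6))
      ultimately show "NatC l f y \<cdot>[Fib E V] NatA l V (ResA C f \<phi>) = ResA E f (NatA l U \<phi>) \<cdot>[Fib E V] NatC l f x" by simp
    qed
    fix g W x assume "g \<in> hom X W V" and x: "x \<in> Obj (Fib C U)"
    then have g: "g \<in> Arr X" "Dom X g = W" "Cod X g = V" by (auto simp: in_hom)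
    have W: "W \<in> Obj X" using g by auto
    interpret lW: cat_functor "Fib C W" "Fib E W" "lO W" "lA W" by (rule functorial[OF W])
    have fg: "f \<cdot>[X] g \<in> Arr X" "Dom X (f \<cdot>[X] g) = W" "Cod X (f \<cdot>[X] g) = U" using f g by auto
    \<comment> \<open>The composition coherence: a composite of chosen lifts is the chosen lift of
      the composite preceded by the vertical \<open>Cmp\<close>.\<close>
    have "C.ci f x \<cdot>[Tot X C] C.ci g (ResO C f x) = C.ci (f \<cdot>[X] g) x \<cdot>[Tot X C] C.vt W (Cmp C f g x)"
      using C.comp_vt[of "f \<cdot>[X] g" x "Id (Fib C W) (ResO C (f \<cdot>[X] g) x)" "Cmp C f g x"] f g fg x V W by simp
    then have "LA (C.ci f x \<cdot>[Tot X C] C.ci g (ResO C f x)) = LA (C.ci (f \<cdot>[X] g) x \<cdot>[Tot X C] C.vt W (Cmp C f g x))" by simp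
    moreover have "LA (C.ci f x \<cdot>[Tot X C] C.ci g (ResO C f x)) = LA (C.ci f x) \<cdot>[Tot X E] LA (C.ci g (ResO C f x))"
      by (rule L.FA_comp) (use f g V W x in auto)
    moreover have "LA (C.ci (f \<cdot>[X] g) x \<cdot>[Tot X C] C.vt W (Cmp C f g x)) = LA (C.ci (f \<cdot>[X] g) x) \<cdot>[Tot X E] LA (C.vt W (Cmp C f g x))"
      by (rule L.FA_comp) (use f g fg V W x in auto)
    moreover have "LA (C.ci f x) \<cdot>[Tot X E] LA (C.ci g (ResO C f x)) = (f \<cdot>[X] g, lO U x, Cmp E f g (lO U x) \<cdot>[Fib E W] ResA E g (lC f x) \<cdot>[Fib E W] lC g (ResO C f x))"
      using LC(1)[of f x] LC(1)[of g "ResO C f x"] f g x by simp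
    moreover have "LA (C.ci (f \<cdot>[X] g) x) \<cdot>[Tot X E] LA (C.vt W (Cmp C f g x)) = (f \<cdot>[X] g, lO U x, lC (f \<cdot>[X] g) x \<cdot>[Fib E W] lA W (Cmp C f g x))"
      using E.comp_vt[of "f \<cdot>[X] g" "lO U x" "lC (f \<cdot>[X] g) x" "lA W (Cmp C f g x)"] LC[of "f \<cdot>[X] g" x] LV[OF W, of "Cmp C f g x"] f g fg V W x
      by (simp del: total_simps(6))
    ultimately show "NatC l (f \<cdot>[X] g) x \<cdot>[Fib E W] NatA l W (Cmp C f g x) =
       Cmp E f g (NatO l U x) \<cdot>[Fib E W] ResA E g (NatC l f x) \<cdot>[Fib E W] NatC l g (ResO C f x)" by simp
  qed
  show thesis
  proof (rule that[of l])
    show "pseudonatural X C E l" by (rule l.pseudonatural_axioms)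
    show "totO l z = LO z" if "z \<in> Obj (Tot X C)" for z using that LO by (auto elim!: total_objE)
    fix f assume "f \<in> Arr (Tot X C)"
    then obtain u y \<phi> where f: "f = (u, y, \<phi>)" "u \<in> Arr X" "y \<in> Obj (Fib C (Cod X u))"
      "\<phi> \<in> Arr (Fib C (Dom X u))" "Cod (Fib C (Dom X u)) \<phi> = ResO C u y" by (auto elim!: total_arrE)
    have "LA f = LA (C.ci u y \<cdot>[Tot X C] C.vt (Dom X u) \<phi>)" using C.ci_vt[of u y \<phi>] f by simp
    also have "\<dots> = LA (C.ci u y) \<cdot>[Tot X E] LA (C.vt (Dom X u) \<phi>)" by (rule L.FA_comp) (use f in auto)
    also have "\<dots> = (u, lO (Cod X u) y, lC u y \<cdot>[Fib E (Dom X u)] lA (Dom X u) \<phi>)"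
      using E.comp_vt[of u "lO (Cod X u) y" "lC u y" "lA (Dom X u) \<phi>"] LC[of u y] LV[of "Dom X u" \<phi>] f
        lA[of "Dom X u" \<phi>] LO(2) by (simp del: total_simps(6))
    finally show "totA X E l f = LA f" using f by simp
  qed
qed

section \<open>Modifications, prestacks and local weak equivalences\<close>

context modification begin

lemma m_simps [simp]:
  assumes "U \<in> Obj X" "x \<in> Obj (Fib E U)"
  shows "m U x \<in> Arr (Fib B U)" "Dom (Fib B U) (m U x) = NatO p U x" "Cod (Fib B U) (m U x) = NatO q U x"
  using mod_hom[OF assms] by (auto simp: in_hom)

definition vertical :: "'o \<times> 'u \<Rightarrow> 'a \<times> 'u \<times> 'u" where
  "vertical z = p.B.vt (fst z) (m (fst z) (snd z))"

text \<open>An arrow of the total category is a chosen lift preceded by a fibre arrow: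
  \<open>mod_NatC\<close> handles the lift and \<open>mod_natural\<close> the fibre part.\<close>

lemma vertical_nat:
  assumes "f \<in> Arr (Tot X E)"
  shows "vertical (Cod (Tot X E) f) \<cdot>[Tot X B] totA X B p f = totA X B q f \<cdot>[Tot X B] vertical (Dom (Tot X E) f)"
proof -
  obtain u y \<phi> where f: "f = (u, y, \<phi>)" "u \<in> Arr X" "y \<in> Obj (Fib E (Cod X u))"
      "\<phi> \<in> Arr (Fib E (Dom X u))" "Cod (Fib E (Dom X u)) \<phi> = ResO E u y" by (rule total_arrE[OF assms])
  define x where "x = Dom (Fib E (Dom X u)) \<phi>"
  have x: "x \<in> Obj (Fib E (Dom X u))" "Dom (Fib E (Dom X u)) \<phi> = x" using f by (auto simp: x_def)
  let ?V = "Fib B (Dom X u)"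
  have C: "category ?V" using p.B.Fib_category f by simp
  have "ResA B u (m (Cod X u) y) \<cdot>[?V] (NatC p u y \<cdot>[?V] NatA p (Dom X u) \<phi>) =
     NatC q u y \<cdot>[?V] (m (Dom X u) (ResO E u y) \<cdot>[?V] NatA p (Dom X u) \<phi>)"
    by (rule category.compose_eq2[OF C]) (use f mod_NatC[of u "Dom X u" "Cod X u" y] in \<open>auto simp: in_hom\<close>)
  also have "m (Dom X u) (ResO E u y) \<cdot>[?V] NatA p (Dom X u) \<phi> = NatA q (Dom X u) \<phi> \<cdot>[?V] m (Dom X u) x"
    using mod_natural[of "Dom X u" \<phi> x "ResO E u y"] f x by (simp add: in_hom)
  finally have e: "ResA B u (m (Cod X u) y) \<cdot>[?V] (NatC p u y \<cdot>[?V] NatA p (Dom X u) \<phi>) =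
     NatC q u y \<cdot>[?V] (NatA q (Dom X u) \<phi> \<cdot>[?V] m (Dom X u) x)" .
  have "vertical (Cod X u, y) \<cdot>[Tot X B] totA X B p f = (u, NatO q (Cod X u) y, ResA B u (m (Cod X u) y) \<cdot>[?V] (NatC p u y \<cdot>[?V] NatA p (Dom X u) \<phi>))"
    unfolding f(1) tot_simps vertical_def fst_conv snd_conv
    using f by (subst p.B.vt_comp) auto
  moreover have "totA X B q f \<cdot>[Tot X B] vertical (Dom X u, x) = (u, NatO q (Cod X u) y, NatC q u y \<cdot>[?V] (NatA q (Dom X u) \<phi> \<cdot>[?V] m (Dom X u) x))"
    unfolding f(1) tot_simps vertical_def fst_conv snd_conv
    using f x by (subst p.B.comp_vt) auto
  ultimately show ?thesis using f(1) x e by simp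
qed

end

lemma invertible_modification_isos:
  assumes "invertible_modification X E B p q m" "U \<in> Obj X" "x \<in> Obj (Fib E U)"
  shows "m U x \<in> isos (Fib B U) (NatO p U x) (NatO q U x)"
proof -
  obtain n where m: "modification X E B p q m" and n: "modification X E B q p n"
    and nm: "n U x \<cdot>[Fib B U] m U x = Id (Fib B U) (NatO p U x)" "m U x \<cdot>[Fib B U] n U x = Id (Fib B U) (NatO q U x)"
    using assms unfolding invertible_modification_def by blast
  interpret m: modification X E B p q m by fact
  interpret n: modification X E B q p n by fact
  show ?thesis
    by (rule category.isosI[OF m.p.B.Fib_category[OF assms(2)], where g = "n U x"]) (use nm assms in \<open>auto simp: in_hom\<close>)
qed

text \<open>The two laws of a modification are the naturality squares at vertical arrows and at
  chosen lifts.\<close>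

lemma modification_of_vertical:
  assumes p: "pseudonatural X E B p" and q: "pseudonatural X E B q"
    and \<kappa>: "\<And>U x. U \<in> Obj X \<Longrightarrow> x \<in> Obj (Fib E U) \<Longrightarrow> m U x \<in> hom (Fib B U) (NatO p U x) (NatO q U x)"
    and nat: "\<And>f. f \<in> Arr (Tot X E) \<Longrightarrow>
      pseudofunctor.vt X B (fst (Cod (Tot X E) f)) (m (fst (Cod (Tot X E) f)) (snd (Cod (Tot X E) f))) \<cdot>[Tot X B] totA X B p f =
      totA X B q f \<cdot>[Tot X B] pseudofunctor.vt X B (fst (Dom (Tot X E) f)) (m (fst (Dom (Tot X E) f)) (snd (Dom (Tot X E) f)))"
  shows "modification X E B p q m"
proof (intro modification.intro modification_axioms.intro)
  interpret p: pseudonatural X E B p by fact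
  interpret q: pseudonatural X E B q by fact
  show "pseudonatural X E B p" "pseudonatural X E B q" by fact+
  have m[simp]: "m U x \<in> Arr (Fib B U)" "Dom (Fib B U) (m U x) = NatO p U x" "Cod (Fib B U) (m U x) = NatO q U x"
    if "U \<in> Obj X" "x \<in> Obj (Fib E U)" for U x using \<kappa>[OF that] by (auto simp: in_hom)
  fix U assume U: "U \<in> Obj X"
  show "m U x \<in> hom (Fib B U) (NatO p U x) (NatO q U x)" if "x \<in> Obj (Fib E U)" for x using \<kappa>[OF U that] .
  fix \<phi> x y assume "\<phi> \<in> hom (Fib E U) x y"
  then have \<phi>: "\<phi> \<in> Arr (Fib E U)" "Dom (Fib E U) \<phi> = x" "Cod (Fib E U) \<phi> = y" by (auto simp: in_hom)
  have xy: "x \<in> Obj (Fib E U)" "y \<in> Obj (Fib E U)" using \<phi> U by auto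
  have "p.B.vt U (m U y \<cdot>[Fib B U] NatA p U \<phi>) = p.B.vt U (NatA q U \<phi> \<cdot>[Fib B U] m U x)"
    using nat[of "p.E.vt U \<phi>"] U \<phi> xy by (simp add: p.totA_vt q.totA_vt p.B.vt_Comp)
  then show "m U y \<cdot>[Fib B U] NatA p U \<phi> = NatA q U \<phi> \<cdot>[Fib B U] m U x"
    by (rule p.B.vt_inj[OF U, rotated -1]) (use U \<phi> xy in auto)
next
  interpret p: pseudonatural X E B p by fact
  interpret q: pseudonatural X E B q by fact
  have m[simp]: "m U x \<in> Arr (Fib B U)" "Dom (Fib B U) (m U x) = NatO p U x" "Cod (Fib B U) (m U x) = NatO q U x"
    if "U \<in> Obj X" "x \<in> Obj (Fib E U)" for U x using \<kappa>[OF that] by (auto simp: in_hom)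
  fix u V U x assume "u \<in> hom X V U" and x: "x \<in> Obj (Fib E U)"
  then have u: "u \<in> Arr X" "Dom X u = V" "Cod X u = U" by (auto simp: in_hom)
  have V: "V \<in> Obj X" "U \<in> Obj X" using u by auto
  have "p.B.vt U (m U x) \<cdot>[Tot X B] (u, NatO p U x, NatC p u x) = (u, NatO q U x, NatC q u x) \<cdot>[Tot X B] p.B.vt V (m V (ResO E u x))"
    using nat[of "p.E.ci u x"] u V x by (simp del: total_simps(6))
  then show "ResA B u (m U x) \<cdot>[Fib B V] NatC p u x = NatC q u x \<cdot>[Fib B V] m V (ResO E u x)"
    using p.B.vt_comp[of u "NatO p U x" "NatC p u x" "m U x"] p.B.comp_vt[of u "NatO q U x" "NatC q u x" "m V (ResO E u x)"] u V x
    by (simp del: total_simps(6))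
qed

text \<open>The fibre components are isomorphisms, and their inverses again form a modification: its
  laws become those of \<open>m\<close> once \<open>m\<close> is cancelled on both sides.\<close>

lemma modification_of_transformation:
  assumes p: "pseudonatural X E B p" and q: "pseudonatural X E B q"
    and \<kappa>: "\<And>z. z \<in> Obj (Tot X E) \<Longrightarrow> \<kappa> z \<in> isos (Tot X B) (totO p z) (totO q z) \<and> fst (\<kappa> z) = Id X (fst z)"
    and nat: "\<And>f. f \<in> Arr (Tot X E) \<Longrightarrow>
      \<kappa> (Cod (Tot X E) f) \<cdot>[Tot X B] totA X B p f = totA X B q f \<cdot>[Tot X B] \<kappa> (Dom (Tot X E) f)"
  obtains m where "invertible_modification X E B p q m"
    "\<And>U x. U \<in> Obj X \<Longrightarrow> x \<in> Obj (Fib E U) \<Longrightarrow> m U x \<in> hom (Fib B U) (NatO p U x) (NatO q U x) \<and> \<kappa> (U, x) = pseudofunctor.vt X B U (m U x)"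
proof -
  interpret p: pseudonatural X E B p by fact
  interpret q: pseudonatural X E B q by fact
  have "\<exists>\<chi>. \<chi> \<in> Arr (Fib B U) \<and> \<kappa> (U, x) = p.B.vt U \<chi>" if "U \<in> Obj X" "x \<in> Obj (Fib E U)" for U x
    by (rule p.B.vertical_vt[of "\<kappa> (U, x)" U]) (use that \<kappa>[of "(U, x)"] p.B.T.isos_Arr[of "\<kappa> (U, x)"] in auto)
  then obtain m where m: "\<And>U x. U \<in> Obj X \<Longrightarrow> x \<in> Obj (Fib E U) \<Longrightarrow> m U x \<in> Arr (Fib B U)"
    and v: "\<And>U x. U \<in> Obj X \<Longrightarrow> x \<in> Obj (Fib E U) \<Longrightarrow> \<kappa> (U, x) = p.B.vt U (m U x)" by metis
  have mi: "m U x \<in> isos (Fib B U) (NatO p U x) (NatO q U x)" if "U \<in> Obj X" "x \<in> Obj (Fib E U)" for U x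
    using p.B.vt_isosD[of U "m U x"] \<kappa>[of "(U, x)"] m v that by simp
  have mh: "m U x \<in> hom (Fib B U) (NatO p U x) (NatO q U x)" if "U \<in> Obj X" "x \<in> Obj (Fib E U)" for U x
    using mi[OF that] by (simp add: isos_def)
  define n where "n U x = inv_arr (Fib B U) (m U x)" for U x
  have ni: "n U x \<in> Arr (Fib B U)" "Dom (Fib B U) (n U x) = NatO q U x" "Cod (Fib B U) (n U x) = NatO p U x"
    "n U x \<cdot>[Fib B U] m U x = Id (Fib B U) (NatO p U x)" "m U x \<cdot>[Fib B U] n U x = Id (Fib B U) (NatO q U x)" if "U \<in> Obj X" "x \<in> Obj (Fib E U)" for U x
    using category.inv_arr_simps[OF p.B.Fib_category mi[OF that]] that by (auto simp: n_def)
  have ms: "m U x \<in> Arr (Fib B U)" "Dom (Fib B U) (m U x) = NatO p U x" "Cod (Fib B U) (m U x) = NatO q U x"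
    if "U \<in> Obj X" "x \<in> Obj (Fib E U)" for U x using mh[OF that] by (auto simp: in_hom)
  have M: "modification X E B p q m"
  proof (rule modification_of_vertical[OF p q mh])
    fix f assume f: "f \<in> Arr (Tot X E)"
    show "p.B.vt (fst (Cod (Tot X E) f)) (m (fst (Cod (Tot X E) f)) (snd (Cod (Tot X E) f))) \<cdot>[Tot X B] totA X B p f =
      totA X B q f \<cdot>[Tot X B] p.B.vt (fst (Dom (Tot X E) f)) (m (fst (Dom (Tot X E) f)) (snd (Dom (Tot X E) f)))"
      using nat[OF f] f by (auto elim!: total_arrE simp: v simp del: total_simps(6))
  qed
  interpret M: modification X E B p q m by (rule M)
  have N: "modification X E B q p n"
  proof (intro modification.intro modification_axioms.intro)
    show "pseudonatural X E B p" "pseudonatural X E B q" by fact+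
    fix U assume U: "U \<in> Obj X"
    show "n U x \<in> hom (Fib B U) (NatO q U x) (NatO p U x)" if "x \<in> Obj (Fib E U)" for x using ni U that by (auto simp: in_hom)
    fix \<phi> x y assume "\<phi> \<in> hom (Fib E U) x y"
    then have \<phi>: "\<phi> \<in> Arr (Fib E U)" "Dom (Fib E U) \<phi> = x" "Cod (Fib E U) \<phi> = y" by (auto simp: in_hom)
    have xy: "x \<in> Obj (Fib E U)" "y \<in> Obj (Fib E U)" using \<phi> U by auto
    note C = p.B.Fib_category[OF U]
    note [simp] = ni[OF U xy(1)] ni[OF U xy(2)] U \<phi> xy
    have "m U y \<cdot>[Fib B U] (n U y \<cdot>[Fib B U] (NatA q U \<phi> \<cdot>[Fib B U] m U x)) = NatA q U \<phi> \<cdot>[Fib B U] m U x"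
      using category.compose_eq[OF C ni(5)[OF U xy(2)], of "NatA q U \<phi> \<cdot>[Fib B U] m U x"] by simp
    also have "\<dots> = m U y \<cdot>[Fib B U] NatA p U \<phi>" using M.mod_natural[of U \<phi> x y] by (simp add: in_hom)
    finally have "n U y \<cdot>[Fib B U] (NatA q U \<phi> \<cdot>[Fib B U] m U x) = NatA p U \<phi>"
      by (rule category.iso_cancel_left[OF C mi[OF U xy(2)], rotated -1]) auto
    then have "(n U y \<cdot>[Fib B U] NatA q U \<phi>) \<cdot>[Fib B U] m U x = (NatA p U \<phi> \<cdot>[Fib B U] n U x) \<cdot>[Fib B U] m U x"
      by simp
    then show "n U y \<cdot>[Fib B U] NatA q U \<phi> = NatA p U \<phi> \<cdot>[Fib B U] n U x"
      by (rule category.iso_cancel_right[OF C mi[OF U xy(1)], rotated -1]) auto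
  next
    fix u V U x assume "u \<in> hom X V U" and x: "x \<in> Obj (Fib E U)"
    then have u: "u \<in> Arr X" "Dom X u = V" "Cod X u = U" by (auto simp: in_hom)
    have V: "V \<in> Obj X" "U \<in> Obj X" "ResO E u x \<in> Obj (Fib E V)" using u x by auto
    note C = p.B.Fib_category[OF V(1)]
    have i: "ResA B u (m U x) \<in> isos (Fib B V) (ResO B u (NatO p U x)) (ResO B u (NatO q U x))"
      using p.B.ResA_isos[of u "m U x"] mi[OF V(2) x] u by simp
    note [simp] = ni[OF V(2) x] ni[OF V(1,3)] u V x
    have "ResA B u (m U x) \<cdot>[Fib B V] (ResA B u (n U x) \<cdot>[Fib B V] (NatC q u x \<cdot>[Fib B V] m V (ResO E u x))) = NatC q u x \<cdot>[Fib B V] m V (ResO E u x)"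
      using category.compose_eq[OF C, of "ResA B u (m U x)" "ResA B u (n U x)" "Id (Fib B V) (ResO B u (NatO q U x))" "NatC q u x \<cdot>[Fib B V] m V (ResO E u x)"]
        p.B.ResA_simps(5)[of u U "n U x" "m U x"] by simp
    also have "\<dots> = ResA B u (m U x) \<cdot>[Fib B V] NatC p u x" using M.mod_NatC[of u V U x] by (simp add: in_hom)
    finally have "ResA B u (n U x) \<cdot>[Fib B V] (NatC q u x \<cdot>[Fib B V] m V (ResO E u x)) = NatC p u x"
      by (rule category.iso_cancel_left[OF C i, rotated -1]) auto
    then have "(ResA B u (n U x) \<cdot>[Fib B V] NatC q u x) \<cdot>[Fib B V] m V (ResO E u x) = (NatC p u x \<cdot>[Fib B V] n V (ResO E u x)) \<cdot>[Fib B V] m V (ResO E u x)"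
      by simp
    then show "ResA B u (n U x) \<cdot>[Fib B V] NatC q u x = NatC p u x \<cdot>[Fib B V] n V (ResO E u x)"
      by (rule category.iso_cancel_right[OF C mi[OF V(1,3)], rotated -1]) auto
  qed
  have "invertible_modification X E B p q m"
    unfolding invertible_modification_def using M N ni by blast
  then show thesis using that mh v by blast
qed

text \<open>At an identity, the sections of a hom presheaf run between restrictions along that
  identity. Conjugation by \<open>Unt\<close> identifies them with the arrows from \<open>a\<close>
  to \<open>b\<close>, and turns presheaf restriction into \<open>ResA\<close>.\<close>

lemma (in pseudofunctor) restrict_mor_Unt:
  assumes s: "s \<in> Arr X" "Cod X s = U" and U: "U \<in> Obj X" and \<nu>: "\<nu> \<in> Arr (Fib F U)" "Dom (Fib F U) \<nu> = a" "Cod (Fib F U) \<nu> = b"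
  shows "restrict_mor X F (Id X U) (Id X U) a b s (Unt F U b \<cdot>[Fib F U] \<nu> \<cdot>[Fib F U] inv_arr (Fib F U) (Unt F U a)) = ResA F s \<nu>"
proof -
  let ?V = "Fib F (Dom X s)"
  have C: "category (Fib F U)" and CV: "category ?V" using s U Fib_category by auto
  have ab: "a \<in> Obj (Fib F U)" "b \<in> Obj (Fib F U)" using \<nu> U by auto
  note [simp] = s U \<nu> ab
  note i = category.inv_arr_simps[OF C Unt_isos[OF U ab(1)]]
  have ci: "Cmp F (Id X U) s a \<in> isos ?V (ResO F s (ResO F (Id X U) a)) (ResO F s a)"
    using Cmp_isos[of "Id X U" s a] by simp
  note k = category.inv_arr_simps[OF CV ci]
  have 1: "Cmp F (Id X U) s d \<cdot>[?V] ResA F s (Unt F U d) = Id ?V (ResO F s d)" if "d \<in> Obj (Fib F U)" for d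
    using Cmp_Unt_left'[of s d] that by simp
  have ui: "ResA F s (Unt F U a) \<in> isos ?V (ResO F s a) (ResO F s (ResO F (Id X U) a))"
    using ResA_isos[of s "Unt F U a"] Unt_isos[OF U ab(1)] by simp
  have 2: "inv_arr ?V (Cmp F (Id X U) s a) = ResA F s (Unt F U a)"
    by (rule category.iso_cancel_left[OF CV ci]) (use k 1[of a] in auto)
  have 3: "ResA F s (inv_arr (Fib F U) (Unt F U a)) \<cdot>[?V] ResA F s (Unt F U a) = Id ?V (ResO F s a)"
    using i ResA_simps(5)[of s U "Unt F U a" "inv_arr (Fib F U) (Unt F U a)"] by simp
  have "Cmp F (Id X U) s b \<cdot>[?V] (ResA F s (Unt F U b) \<cdot>[?V] ResA F s \<nu>) = Id ?V (ResO F s b) \<cdot>[?V] ResA F s \<nu>"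
    by (rule category.compose_eq[OF CV 1]) auto
  then show ?thesis using i 2 3 by (simp add: restrict_mor_def)
qed

text \<open>An arrow over \<open>g\<close> is a fibre arrow into the restriction of its target, and
  a compatible family is determined by its values on chosen lifts. These values form a matching
  family of a hom presheaf, so the sheaf condition provides the unique glued arrow.\<close>

lemma prestack_glue:
  assumes site: "site X J" and F: "prestack X J F"
  shows "prestack_fib X J (Tot X F)"
proof -
  interpret site X J by fact
  interpret pseudofunctor X F using F by (simp add: prestack_def)
  show ?thesis
  proof (intro prestack_fib.intro prestack_fib_axioms.intro total_fibred site)
    fix x y g S m
    assume xO: "x \<in> Obj (Tot X F)" and yO: "y \<in> Obj (Tot X F)" and g: "g \<in> hom X (fst x) (fst y)" and S: "S \<in> J (fst x)"
      and m1: "\<And>q. q \<in> Arr (Tot X F) \<Longrightarrow> Cod (Tot X F) q = x \<Longrightarrow> fst q \<in> S \<Longrightarrow> m q \<in> hom (Tot X F) (Dom (Tot X F) q) y \<and> fst (m q) = g \<cdot>[X] fst q"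
      and m2: "\<And>q w. q \<in> Arr (Tot X F) \<Longrightarrow> Cod (Tot X F) q = x \<Longrightarrow> fst q \<in> S \<Longrightarrow> w \<in> Arr (Tot X F) \<Longrightarrow> Cod (Tot X F) w = Dom (Tot X F) q \<Longrightarrow>
        m (q \<cdot>[Tot X F] w) = m q \<cdot>[Tot X F] w"
    obtain U a where x: "x = (U, a)" "U \<in> Obj X" "a \<in> Obj (Fib F U)" using xO by (rule total_objE)
    obtain U' b' where y: "y = (U', b')" "U' \<in> Obj X" "b' \<in> Obj (Fib F U')" using yO by (rule total_objE)
    have g: "g \<in> Arr X" "Dom X g = U" "Cod X g = U'" using g x y by (auto simp: in_hom)
    have S: "S \<in> J U" using S x by simp
    \<comment> \<open>Restricting the target along \<open>g\<close> puts both ends in the fibre over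
      \<open>U\<close>, where a hom presheaf is defined.\<close>
    define b where "b = ResO F g b'"
    have b: "b \<in> Obj (Fib F U)" using g y by (simp add: b_def)
    note C = Fib_category[OF x(2)]
    have SA: "s \<in> Arr X" "Cod X s = U" if "s \<in> S" for s
      using cover_Arr[OF x(2) S that] by auto
    have SC: "s \<cdot>[X] h \<in> S" if "s \<in> S" "h \<in> Arr X" "Cod X h = Dom X s" for s h
      using cover_Arr[OF x(2) S that(1)] that by auto
    define \<mu> where "\<mu> s = snd (snd (m (ci s a)))" for s
    have \<mu>: "m (ci s a) = (g \<cdot>[X] s, b', \<mu> s)" "\<mu> s \<in> Arr (Fib F (Dom X s))" "Dom (Fib F (Dom X s)) (\<mu> s) = ResO F s a"
      "Cod (Fib F (Dom X s)) (\<mu> s) = ResO F (g \<cdot>[X] s) b'" if s: "s \<in> S" for s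
    proof -
      have "m (ci s a) \<in> hom (Tot X F) (Dom X s, ResO F s a) y" "fst (m (ci s a)) = g \<cdot>[X] s"
        using m1[of "ci s a"] SA[OF s] s x by auto
      moreover obtain c d e where "m (ci s a) = (c, d, e)" by (cases "m (ci s a)")
      ultimately have mm: "m (ci s a) = (g \<cdot>[X] s, b', \<mu> s)"
        and "m (ci s a) \<in> hom (Tot X F) (Dom X s, ResO F s a) y"
        using y by (auto simp: in_hom \<mu>_def)
      then show "m (ci s a) = (g \<cdot>[X] s, b', \<mu> s)" "\<mu> s \<in> Arr (Fib F (Dom X s))" "Dom (Fib F (Dom X s)) (\<mu> s) = ResO F s a"
      "Cod (Fib F (Dom X s)) (\<mu> s) = ResO F (g \<cdot>[X] s) b'"
        using SA(1,2)[OF s] g(1) y(1) g by (simp_all add: in_hom mm)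
    qed
    have Ci: "Cmp F g s b' \<in> isos (Fib F (Dom X s)) (ResO F s b) (ResO F (g \<cdot>[X] s) b')" if "s \<in> S" for s
      using Cmp_isos[of g s b'] SA[OF that] g y by (simp add: b_def)
    have CS: "category (Fib F (Dom X s))" if "s \<in> S" for s using Fib_category SA[OF that] by simp
    \<comment> \<open>Stripping the invertible \<open>Cmp\<close> leaves arrows between the
      restrictions of \<open>a\<close> and \<open>b\<close>, which are sections of the hom
      presheaf.\<close>
    define \<sigma> where "\<sigma> s = inv_arr (Fib F (Dom X s)) (Cmp F g s b') \<cdot>[Fib F (Dom X s)] \<mu> s" for s
    have \<sigma>: "\<sigma> s \<in> Arr (Fib F (Dom X s))" "Dom (Fib F (Dom X s)) (\<sigma> s) = ResO F s a" "Cod (Fib F (Dom X s)) (\<sigma> s) = ResO F s b"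
      "Cmp F g s b' \<cdot>[Fib F (Dom X s)] \<sigma> s = \<mu> s" if s: "s \<in> S" for s
    proof -
      note i = category.inv_arr_simps[OF CS[OF s] Ci[OF s]]
      show "\<sigma> s \<in> Arr (Fib F (Dom X s))" "Dom (Fib F (Dom X s)) (\<sigma> s) = ResO F s a" "Cod (Fib F (Dom X s)) (\<sigma> s) = ResO F s b"
        using i \<mu>[OF s] SA[OF s] by (auto simp: \<sigma>_def)
      show "Cmp F g s b' \<cdot>[Fib F (Dom X s)] \<sigma> s = \<mu> s"
        unfolding \<sigma>_def using category.compose_eq[OF CS[OF s] i(5), of "\<mu> s"] i \<mu>[OF s] SA[OF s] Cmp_simps[of g s "Dom X s" b'] g y
        by (simp add: b_def)
    qed
    \<comment> \<open>Compatibility of \<open>m\<close> with the comparison \<open>cmpi\<close>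
      becomes the matching condition; associativity of \<open>Cmp\<close> moves the stripped factor
      to the left, where it is cancelled.\<close>
    have \<sigma>_match: "\<sigma> (s \<cdot>[X] h) = restrict_mor X F s s a b h (\<sigma> s)" if s: "s \<in> S" and h: "h \<in> Arr X" "Cod X h = Dom X s" for s h
    proof -
      have sh: "s \<cdot>[X] h \<in> S" using SC[OF s] h by blast
      let ?W = "Fib F (Dom X h)"
      have CW: "category ?W" using Fib_category h by simp
      note sA = SA(1,2)[OF s]
      note k = cmpi[of s h a]
      have "m (ci s a \<cdot>[Tot X F] cmpi s h a) = m (ci s a) \<cdot>[Tot X F] cmpi s h a"
        by (rule m2) (use sA h s x k in auto)
      then have "(g \<cdot>[X] (s \<cdot>[X] h), b', \<mu> (s \<cdot>[X] h)) = ((g \<cdot>[X] s) \<cdot>[X] h, b', restrict_mor X F s (g \<cdot>[X] s) a b' h (\<mu> s))"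
        using k sA h x \<mu>[OF s] \<mu>[OF sh] restrict_mor_total[of s h "g \<cdot>[X] s" b' a "\<mu> s"] by simp
      then have \<mu>_sh: "\<mu> (s \<cdot>[X] h) = restrict_mor X F s (g \<cdot>[X] s) a b' h (\<mu> s)" by simp
      define i where "i = inv_arr ?W (Cmp F s h a)"
      have ci: "Cmp F s h a \<in> isos ?W (ResO F h (ResO F s a)) (ResO F (s \<cdot>[X] h) a)" using Cmp_isos[of s h a] sA h x by simp
      have iA: "i \<in> Arr ?W" "Dom ?W i = ResO F (s \<cdot>[X] h) a" "Cod ?W i = ResO F h (ResO F s a)"
        using category.inv_arr_simps[OF CW ci] by (auto simp: i_def)
      have Ci': "Cmp F g (s \<cdot>[X] h) b' \<in> isos ?W (ResO F (s \<cdot>[X] h) b) (ResO F (g \<cdot>[X] (s \<cdot>[X] h)) b')"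
        using Ci[OF sh] sA h by simp
      have bs: "ResO F s b \<in> Obj (Fib F (Dom X s))" using sA b by simp
      have "Cmp F (g \<cdot>[X] s) h b' \<cdot>[?W] ResA F h (\<mu> s) \<cdot>[?W] i = Cmp F (g \<cdot>[X] s) h b' \<cdot>[?W] (ResA F h (Cmp F g s b') \<cdot>[?W] (ResA F h (\<sigma> s) \<cdot>[?W] i))"
        unfolding \<sigma>(4)[OF s, symmetric] using sA h g y \<sigma>(1-3)[OF s] iA by (simp add: b_def)
      also have "\<dots> = Cmp F g (s \<cdot>[X] h) b' \<cdot>[?W] (Cmp F s h b \<cdot>[?W] (ResA F h (\<sigma> s) \<cdot>[?W] i))"
        unfolding b_def by (rule category.compose_eq2[OF CW Cmp_assoc']) (use sA h g y b \<sigma>[OF s] iA in \<open>auto simp: b_def\<close>)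
      finally have "Cmp F g (s \<cdot>[X] h) b' \<cdot>[?W] \<sigma> (s \<cdot>[X] h) = Cmp F g (s \<cdot>[X] h) b' \<cdot>[?W] restrict_mor X F s s a b h (\<sigma> s)"
        using \<sigma>(4)[OF sh] \<mu>_sh sA h by (simp add: restrict_mor_def i_def)
      then show ?thesis
        by (rule category.iso_cancel_left[OF CW Ci', rotated -1])
           (use sA h g y b \<sigma>[OF s] \<sigma>[OF sh] iA in \<open>auto simp: restrict_mor_def simp flip: i_def\<close>)
    qed
    \<comment> \<open>The sheaf condition is used at the identity of \<open>U\<close>, regarded as
      an object of the slice; the cover \<open>S\<close> is encoded there by the pairs in
      \<open>S'\<close>.\<close>
    have key: "\<exists>!t. t \<in> hom (Fib F U) (ResO F (Id X U) a) (ResO F (Id X U) b) \<and> (\<forall>s\<in>S. restrict_mor X F (Id X U) (Id X U) a b s t = \<sigma> s)"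
    proof -
      define S' where "S' = (\<lambda>s. (Id X U, s)) ` S"
      have "is_sheaf (slice X U) (slice_topology X J U) (hom_presheaf X F a b)" using F x b by (simp add: prestack_def)
      then have sh: "\<And>f T s. f \<in> Obj (slice X U) \<Longrightarrow> T \<in> slice_topology X J U f \<Longrightarrow> matching_family (slice X U) (hom_presheaf X F a b) T s \<Longrightarrow>
        \<exists>!t. t \<in> Sec (hom_presheaf X F a b) f \<and> (\<forall>f\<in>T. Rest (hom_presheaf X F a b) f t = s f)"
        unfolding is_sheaf_def by blast
      have "\<exists>!t. t \<in> Sec (hom_presheaf X F a b) (Id X U) \<and> (\<forall>f\<in>S'. Rest (hom_presheaf X F a b) f t = (\<sigma> \<circ> snd) f)"
      proof (rule sh)
        show "Id X U \<in> Obj (slice X U)" using x by (simp add: slice_def)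
        have "snd ` S' = S" by (auto simp: S'_def image_image)
        moreover have "is_sieve (slice X U) (Id X U) S'"
          unfolding is_sieve_def using SA SC x by (auto simp: slice_def S'_def)
        ultimately show "S' \<in> slice_topology X J U (Id X U)" using S x by (simp add: slice_topology_def)
        show "matching_family (slice X U) (hom_presheaf X F a b) S' (\<sigma> \<circ> snd)"
          unfolding matching_family_def using SA SC \<sigma> x \<sigma>_match by (auto simp: slice_def S'_def hom_presheaf_def in_hom)
      qed
      then show ?thesis using x by (simp add: S'_def hom_presheaf_def)
    qed
    define tr where "tr \<nu> = Unt F U b \<cdot>[Fib F U] \<nu> \<cdot>[Fib F U] inv_arr (Fib F U) (Unt F U a)" for \<nu>
    note ia = category.inv_arr_simps[OF C Unt_isos[OF x(2,3)]] and ib = category.inv_arr_simps[OF C Unt_isos[OF x(2) b]]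
    have tr: "tr \<nu> \<in> hom (Fib F U) (ResO F (Id X U) a) (ResO F (Id X U) b)" "\<And>s. s \<in> S \<Longrightarrow> restrict_mor X F (Id X U) (Id X U) a b s (tr \<nu>) = ResA F s \<nu>"
      if "\<nu> \<in> hom (Fib F U) a b" for \<nu>
      using that restrict_mor_Unt[of _ U \<nu> a b] SA x b ia by (auto simp: in_hom tr_def)
    \<comment> \<open>An arrow \<open>q\<close> over the cover is a chosen lift preceded by a
      vertical arrow, so it suffices to test the glued arrow on the chosen lifts.\<close>
    have iff: "(\<forall>q\<in>Arr (Tot X F). Cod (Tot X F) q = x \<and> fst q \<in> S \<longrightarrow> (g, b', \<nu>) \<cdot>[Tot X F] q = m q) \<longleftrightarrow> (\<forall>s\<in>S. ResA F s \<nu> = \<sigma> s)"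
      if \<nu>: "\<nu> \<in> hom (Fib F U) a b" for \<nu>
    proof -
      have \<nu>A: "\<nu> \<in> Arr (Fib F U)" "Dom (Fib F U) \<nu> = a" "Cod (Fib F U) \<nu> = b" using \<nu> by (auto simp: in_hom)
      have nA: "(g, b', \<nu>) \<in> Arr (Tot X F)" "Dom (Tot X F) (g, b', \<nu>) = x" using g y x \<nu>A by (auto simp: b_def)
      have cis: "(g, b', \<nu>) \<cdot>[Tot X F] ci s a = m (ci s a) \<longleftrightarrow> ResA F s \<nu> = \<sigma> s" if s: "s \<in> S" for s
      proof -
        have "(g, b', \<nu>) \<cdot>[Tot X F] ci s a = (g \<cdot>[X] s, b', Cmp F g s b' \<cdot>[Fib F (Dom X s)] ResA F s \<nu>)"
          using SA[OF s] x g y \<nu>A by simp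
        then have "(g, b', \<nu>) \<cdot>[Tot X F] ci s a = m (ci s a) \<longleftrightarrow>
           Cmp F g s b' \<cdot>[Fib F (Dom X s)] ResA F s \<nu> = Cmp F g s b' \<cdot>[Fib F (Dom X s)] \<sigma> s" using \<mu>[OF s] \<sigma>[OF s] by simp
        also have "\<dots> \<longleftrightarrow> ResA F s \<nu> = \<sigma> s"
          using category.iso_cancel_left[OF CS[OF s] Ci[OF s], of "ResA F s \<nu>" "\<sigma> s"] SA[OF s] \<nu>A \<sigma>[OF s] x by auto
        finally show ?thesis .
      qed
      show ?thesis
      proof (intro iffI ballI impI)
        fix s assume H: "\<forall>q\<in>Arr (Tot X F). Cod (Tot X F) q = x \<and> fst q \<in> S \<longrightarrow> (g, b', \<nu>) \<cdot>[Tot X F] q = m q" and s: "s \<in> S"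
        have "(g, b', \<nu>) \<cdot>[Tot X F] ci s a = m (ci s a)" by (rule H[rule_format]) (use SA[OF s] s x in auto)
        then show "ResA F s \<nu> = \<sigma> s" using cis[OF s] by simp
      next
        fix q assume H: "\<forall>s\<in>S. ResA F s \<nu> = \<sigma> s" and q: "q \<in> Arr (Tot X F)" and qx: "Cod (Tot X F) q = x \<and> fst q \<in> S"
        obtain s \<phi> where qe: "q = (s, a, \<phi>)" using q qx x by (cases q) auto
        have s: "s \<in> S" using qx qe by simp
        note sA = SA(1,2)[OF s]
        have dec: "ci s a \<cdot>[Tot X F] vt (Dom X s) \<phi> = q" using ci_vt[of s a \<phi>] q qe by simp
        have \<phi>: "\<phi> \<in> Arr (Fib F (Dom X s))" "Cod (Fib F (Dom X s)) \<phi> = ResO F s a" using q qe by auto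
        have "m q = m (ci s a) \<cdot>[Tot X F] vt (Dom X s) \<phi>"
          unfolding dec[symmetric] by (rule m2) (use sA s x \<phi> in auto)
        also have "m (ci s a) = (g, b', \<nu>) \<cdot>[Tot X F] ci s a" using cis[OF s] H s by simp
        also have "\<dots> \<cdot>[Tot X F] vt (Dom X s) \<phi> = (g, b', \<nu>) \<cdot>[Tot X F] (ci s a \<cdot>[Tot X F] vt (Dom X s) \<phi>)"
          by (rule T.assoc) (use nA sA x \<phi> in auto)
        finally show "(g, b', \<nu>) \<cdot>[Tot X F] q = m q" by (simp add: dec)
      qed
    qed
    obtain t where t: "t \<in> hom (Fib F U) (ResO F (Id X U) a) (ResO F (Id X U) b)" "\<forall>s\<in>S. restrict_mor X F (Id X U) (Id X U) a b s t = \<sigma> s"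
      using key by blast
    define \<nu> where "\<nu> = inv_arr (Fib F U) (Unt F U b) \<cdot>[Fib F U] t \<cdot>[Fib F U] Unt F U a"
    have \<nu>h: "\<nu> \<in> hom (Fib F U) a b" using t ib x b by (auto simp: \<nu>_def in_hom)
    have tt: "tr \<nu> = t"
    proof -
      have tA: "t \<in> Arr (Fib F U)" "Dom (Fib F U) t = ResO F (Id X U) a" "Cod (Fib F U) t = ResO F (Id X U) b" using t by (auto simp: in_hom)
      have "Unt F U b \<cdot>[Fib F U] (inv_arr (Fib F U) (Unt F U b) \<cdot>[Fib F U] t) = Id (Fib F U) (ResO F (Id X U) b) \<cdot>[Fib F U] t"
        by (rule category.compose_eq[OF C ib(5)]) (use tA ib x b in auto)
      then show ?thesis unfolding tr_def \<nu>_def using tA ia ib x b by simp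
    qed
    show "\<exists>!n. n \<in> hom (Tot X F) x y \<and> fst n = g \<and> (\<forall>q\<in>Arr (Tot X F). Cod (Tot X F) q = x \<and> fst q \<in> S \<longrightarrow> n \<cdot>[Tot X F] q = m q)"
    proof (rule ex1I[of _ "(g, b', \<nu>)"])
      have "(g, b', \<nu>) \<in> hom (Tot X F) x y" using \<nu>h g x y by (auto simp: in_hom b_def)
      then show "(g, b', \<nu>) \<in> hom (Tot X F) x y \<and> fst (g, b', \<nu>) = g \<and>
        (\<forall>q\<in>Arr (Tot X F). Cod (Tot X F) q = x \<and> fst q \<in> S \<longrightarrow> (g, b', \<nu>) \<cdot>[Tot X F] q = m q)"
        using iff[OF \<nu>h] tr(2)[OF \<nu>h] t(2) tt by simp
      fix n assume n: "n \<in> hom (Tot X F) x y \<and> fst n = g \<and> (\<forall>q\<in>Arr (Tot X F). Cod (Tot X F) q = x \<and> fst q \<in> S \<longrightarrow> n \<cdot>[Tot X F] q = m q)"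
      then have nh: "n \<in> Arr (Tot X F)" "Dom (Tot X F) n = x" "Cod (Tot X F) n = y" "fst n = g"
        unfolding in_hom by blast+
      obtain c d \<nu>' where "n = (c, d, \<nu>')" by (cases n)
      then have n': "n = (g, b', \<nu>')" using nh(3,4) y by simp
      have \<nu>'h: "\<nu>' \<in> hom (Fib F U) a b" using nh(1,2) x(1) g unfolding n' in_hom b_def by simp
      have "\<forall>s\<in>S. ResA F s \<nu>' = \<sigma> s" by (rule iff[OF \<nu>'h, THEN iffD1]) (rule n[unfolded n', THEN conjunct2, THEN conjunct2])
      then have "\<forall>s\<in>S. restrict_mor X F (Id X U) (Id X U) a b s (tr \<nu>') = \<sigma> s" using tr(2)[OF \<nu>'h] by simp
      then have "tr \<nu>' = t" using key tr(1)[OF \<nu>'h] t by blast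
      then have "tr \<nu>' = tr \<nu>" by (simp add: tt)
      then have "Unt F U b \<cdot>[Fib F U] \<nu>' \<cdot>[Fib F U] inv_arr (Fib F U) (Unt F U a) = Unt F U b \<cdot>[Fib F U] \<nu> \<cdot>[Fib F U] inv_arr (Fib F U) (Unt F U a)"
        by (simp add: tr_def)
      then have "\<nu>' \<cdot>[Fib F U] inv_arr (Fib F U) (Unt F U a) = \<nu> \<cdot>[Fib F U] inv_arr (Fib F U) (Unt F U a)"
        by (rule category.iso_cancel_left[OF C Unt_isos[OF x(2) b], rotated -1]) (use \<nu>h \<nu>'h ia x in \<open>auto simp: in_hom\<close>)
      then have "\<nu>' = \<nu>"
        by (rule category.iso_cancel_right[OF C category.inv_arr_isos[OF C Unt_isos[OF x(2,3)]], rotated -1]) (use \<nu>h \<nu>'h in \<open>auto simp: in_hom\<close>)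
      then show "n = (g, b', \<nu>)" using n' by simp
    qed
  qed
qed

section \<open>Full faithfulness on total categories\<close>

context pseudonatural begin

text \<open>An arrow over \<open>u\<close> with target \<open>y\<close> is a fibre arrow into the
  restriction of \<open>y\<close>, and its image differs from the fibrewise image by the invertible
  \<open>NatC\<close>. So full faithfulness in each fibre is enough.\<close>

lemma tot_ff:
  assumes ff: "\<And>U. U \<in> Obj X \<Longrightarrow> full_and_faithful (Fib E U) (Fib B U) (NatO p U) (NatA p U)"
  shows "full_and_faithful (Tot X E) (Tot X B) (totO p) (totA X B p)"
  unfolding full_and_faithful_def
proof (intro ballI)
  fix z w assume "z \<in> Obj (Tot X E)" "w \<in> Obj (Tot X E)"
  then obtain V x U y where z: "z = (V, x)" "V \<in> Obj X" "x \<in> Obj (Fib E V)" and w: "w = (U, y)" "U \<in> Obj X" "y \<in> Obj (Fib E U)"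
    by (auto elim!: total_objE)
  interpret T: cat_functor "Tot X E" "Tot X B" "totO p" "totA X B p" by (rule tot_functor)
  have C: "category (Fib B V)" using B.Fib_category z by simp
  have bij: "bij_betw (NatA p V) (hom (Fib E V) x x') (hom (Fib B V) (NatO p V x) (NatO p V x'))" if "x' \<in> Obj (Fib E V)" for x'
    using ff[OF z(2)] z that by (simp add: full_and_faithful_def)
  show "bij_betw (totA X B p) (hom (Tot X E) z w) (hom (Tot X B) (totO p z) (totO p w))"
    unfolding bij_betw_def
  proof
    show "inj_on (totA X B p) (hom (Tot X E) z w)"
    proof (rule inj_onI)
      fix f g assume "f \<in> hom (Tot X E) z w" "g \<in> hom (Tot X E) z w" and eq: "totA X B p f = totA X B p g"
      then have fg: "f \<in> Arr (Tot X E)" "Dom (Tot X E) f = z" "Cod (Tot X E) f = w"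
        "g \<in> Arr (Tot X E)" "Dom (Tot X E) g = z" "Cod (Tot X E) g = w" by (auto simp: in_hom)
      obtain u y' \<phi> where "f = (u, y', \<phi>)" by (cases f)
      then have f: "f = (u, y, \<phi>)" "u \<in> Arr X" "Dom X u = V" "Cod X u = U" "\<phi> \<in> Arr (Fib E V)" "Dom (Fib E V) \<phi> = x" "Cod (Fib E V) \<phi> = ResO E u y"
        using fg(1-3) z w by auto
      obtain v y' \<chi> where "g = (v, y', \<chi>)" by (cases g)
      then have g: "g = (v, y, \<chi>)" "\<chi> \<in> Arr (Fib E V)" "Dom (Fib E V) \<chi> = x" "Cod (Fib E V) \<chi> = ResO E v y"
        using fg(4-6) z w by auto
      have vu: "v = u" using eq f g by simp
      have "NatC p u y \<cdot>[Fib B V] NatA p V \<phi> = NatC p u y \<cdot>[Fib B V] NatA p V \<chi>" using eq f g vu by simp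
      then have "NatA p V \<phi> = NatA p V \<chi>"
        by (rule category.iso_cancel_left[OF C, rotated -1, OF _ NatC_isos[of u y, unfolded f]]) (use f g vu z w in auto)
      then have "\<phi> = \<chi>"
        using bij[of "ResO E u y"] f g vu w unfolding bij_betw_def by (auto simp: in_hom dest!: inj_onD)
      then show "f = g" using f g vu by simp
    qed
    show "totA X B p ` hom (Tot X E) z w = hom (Tot X B) (totO p z) (totO p w)"
    proof (intro equalityI subsetI)
      fix h assume "h \<in> totA X B p ` hom (Tot X E) z w"
      then show "h \<in> hom (Tot X B) (totO p z) (totO p w)" using T.FA_hom by blast
    next
      fix h assume "h \<in> hom (Tot X B) (totO p z) (totO p w)"
      then have hh: "h \<in> Arr (Tot X B)" "Dom (Tot X B) h = totO p z" "Cod (Tot X B) h = totO p w" by (auto simp: in_hom)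
      obtain u y' \<xi> where "h = (u, y', \<xi>)" by (cases h)
      then have h: "h = (u, NatO p U y, \<xi>)" "u \<in> Arr X" "Dom X u = V" "Cod X u = U" "\<xi> \<in> Arr (Fib B V)"
          "Dom (Fib B V) \<xi> = NatO p V x" "Cod (Fib B V) \<xi> = ResO B u (NatO p U y)"
        using hh z w by auto
      have ni: "NatC p u y \<in> isos (Fib B V) (NatO p V (ResO E u y)) (ResO B u (NatO p U y))" using NatC_isos[of u y] h w by simp
      note i = category.inv_arr_simps[OF C ni]
      have "inv_arr (Fib B V) (NatC p u y) \<cdot>[Fib B V] \<xi> \<in> NatA p V ` hom (Fib E V) x (ResO E u y)"
        using bij[of "ResO E u y"] h i z w unfolding bij_betw_def by (auto simp: in_hom)
      then obtain \<phi> where \<phi>: "\<phi> \<in> Arr (Fib E V)" "Dom (Fib E V) \<phi> = x" "Cod (Fib E V) \<phi> = ResO E u y"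
        "inv_arr (Fib B V) (NatC p u y) \<cdot>[Fib B V] \<xi> = NatA p V \<phi>" by (auto simp: in_hom)
      have "NatC p u y \<cdot>[Fib B V] (inv_arr (Fib B V) (NatC p u y) \<cdot>[Fib B V] \<xi>) = Id (Fib B V) (ResO B u (NatO p U y)) \<cdot>[Fib B V] \<xi>"
        by (rule category.compose_eq[OF C i(5)]) (use h i z w in auto)
      then have "totA X B p (u, y, \<phi>) = h" using h \<phi>(4) z by simp
      moreover have "(u, y, \<phi>) \<in> hom (Tot X E) z w" using \<phi> h z w by (simp add: in_hom)
      ultimately show "h \<in> totA X B p ` hom (Tot X E) z w" by blast
    qed
  qed
qed

end

section \<open>Descent data in the total category\<close>

context site begin

lemma pullback:
  assumes "f \<in> Arr X" "g \<in> Arr X" "Cod X f = Cod X g"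
  shows "is_pullback X f g (pr1 X f g) (pr2 X f g)"
proof -
  have "\<exists>z. case z of (p, q) \<Rightarrow> is_pullback X f g p q"
    using X.pullback_exists[OF finite_limits assms] by auto
  then have "case pb_legs X f g of (p, q) \<Rightarrow> is_pullback X f g p q" unfolding pb_legs_def by (rule someI_ex)
  then show ?thesis by (simp add: pr1_def pr2_def split: prod.splits)
qed

lemma pr_simps:
  assumes "f \<in> Arr X" "g \<in> Arr X" "Cod X f = Cod X g"
  shows "pr1 X f g \<in> Arr X" "pr2 X f g \<in> Arr X" "Dom X (pr1 X f g) = pb_ob X f g" "Dom X (pr2 X f g) = pb_ob X f g"
    "Cod X (pr1 X f g) = Dom X f" "Cod X (pr2 X f g) = Dom X g" "f \<cdot>[X] pr1 X f g = g \<cdot>[X] pr2 X f g" "pb_ob X f g \<in> Obj X"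
proof -
  show 1: "pr1 X f g \<in> Arr X" "pr2 X f g \<in> Arr X" "Dom X (pr1 X f g) = pb_ob X f g" "Dom X (pr2 X f g) = pb_ob X f g"
    "Cod X (pr1 X f g) = Dom X f" "Cod X (pr2 X f g) = Dom X g" "f \<cdot>[X] pr1 X f g = g \<cdot>[X] pr2 X f g"
    using pullback[OF assms] by (auto simp: is_pullback_def in_hom pb_ob_def)
  then show "pb_ob X f g \<in> Obj X" using X.Dom_Obj by metis
qed

lemma tuple:
  assumes fg: "f \<in> Arr X" "g \<in> Arr X" "Cod X f = Cod X g"
    and ab: "a \<in> Arr X" "b \<in> Arr X" "Dom X a = Dom X b" "Cod X a = Dom X f" "Cod X b = Dom X g" "f \<cdot>[X] a = g \<cdot>[X] b"
  shows "pb_tuple X f g a b \<in> Arr X" "Dom X (pb_tuple X f g a b) = Dom X a" "Cod X (pb_tuple X f g a b) = pb_ob X f g"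
    "pr1 X f g \<cdot>[X] pb_tuple X f g a b = a" "pr2 X f g \<cdot>[X] pb_tuple X f g a b = b"
proof -
  let ?P = "\<lambda>t. t \<in> hom X (Dom X a) (pb_ob X f g) \<and> pr1 X f g \<cdot>[X] t = a \<and> pr2 X f g \<cdot>[X] t = b"
  have "a \<in> hom X (Dom X a) (Dom X f)" "b \<in> hom X (Dom X a) (Dom X g)" using ab by (auto simp: in_hom)
  then have "\<exists>!t. ?P t" using pullback[OF fg] ab(6) unfolding is_pullback_def pb_ob_def[symmetric] by blast
  then have "?P (pb_tuple X f g a b)" unfolding pb_tuple_def by (rule theI')
  then show "pb_tuple X f g a b \<in> Arr X" "Dom X (pb_tuple X f g a b) = Dom X a" "Cod X (pb_tuple X f g a b) = pb_ob X f g"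
    "pr1 X f g \<cdot>[X] pb_tuple X f g a b = a" "pr2 X f g \<cdot>[X] pb_tuple X f g a b = b" by (auto simp: in_hom)
qed

lemma tuple_unique:
  assumes fg: "f \<in> Arr X" "g \<in> Arr X" "Cod X f = Cod X g"
    and t: "t \<in> Arr X" "Cod X t = pb_ob X f g"
  shows "pb_tuple X f g (pr1 X f g \<cdot>[X] t) (pr2 X f g \<cdot>[X] t) = t"
proof -
  note p = pr_simps[OF fg]
  let ?a = "pr1 X f g \<cdot>[X] t" and ?b = "pr2 X f g \<cdot>[X] t"
  have e: "f \<cdot>[X] ?a = g \<cdot>[X] ?b" by (rule X.compose_eq2[OF p(7)]) (use p t fg in auto)
  have h: "?a \<in> hom X (Dom X t) (Dom X f)" "?b \<in> hom X (Dom X t) (Dom X g)" using p t by (auto simp: in_hom)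
  then have ex: "\<exists>!s. s \<in> hom X (Dom X t) (pb_ob X f g) \<and> pr1 X f g \<cdot>[X] s = ?a \<and> pr2 X f g \<cdot>[X] s = ?b"
    using pullback[OF fg] e unfolding is_pullback_def pb_ob_def[symmetric] by blast
  note s = tuple[OF fg, of ?a ?b]
  have "pb_tuple X f g ?a ?b \<in> hom X (Dom X t) (pb_ob X f g) \<and> pr1 X f g \<cdot>[X] pb_tuple X f g ?a ?b = ?a \<and> pr2 X f g \<cdot>[X] pb_tuple X f g ?a ?b = ?b"
    using s e h p t by (auto simp: in_hom)
  moreover have "t \<in> hom X (Dom X t) (pb_ob X f g)" using t by (simp add: in_hom)
  ultimately show ?thesis using ex by blast
qed

lemma triple:
  assumes "f \<in> Arr X" "g \<in> Arr X" "h \<in> Arr X" "Cod X f = Cod X g" "Cod X g = Cod X h"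
  shows "case triple_legs X f g h of (p, q, r) \<Rightarrow> is_triple_pullback X f g h p q r"
  unfolding triple_legs_def
  by (rule someI_ex) (use X.triple_pullback_exists[OF finite_limits assms] in auto)

end

lemma Desc_simps [simp]:
  "Obj (Desc X E B p U S) = descent_objects X E B p U S"
  "Arr (Desc X E B p U S) = descent_arrows X E B p U S"
  "Dom (Desc X E B p U S) = asrc"
  "Cod (Desc X E B p U S) = atgt"
  "Id (Desc X E B p U S) d = \<lparr>asrc = d, atgt = d, abase = Id (Fib B U) (dbase d),
                 aloc = (\<lambda>\<alpha>\<in>S. Id (Fib E (Dom X \<alpha>)) (dloc d \<alpha>))\<rparr>"
  "k \<cdot>[Desc X E B p U S] l = \<lparr>asrc = asrc l, atgt = atgt k, abase = abase k \<cdot>[Fib B U] abase l,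
                 aloc = (\<lambda>\<alpha>\<in>S. aloc k \<alpha> \<cdot>[Fib E (Dom X \<alpha>)] aloc l \<alpha>)\<rparr>"
  by (simp_all add: Desc_def)

section \<open>Descent data over a fixed cover, and their laws\<close>

locale descent_setting = site X J + pseudonatural X E B p
  for X :: "('o, 'a) cat" and J :: "'o \<Rightarrow> 'a set set" and E B :: "('o, 'a, 'u) psfun" and p :: "('o, 'a, 'u) psnat" +
  fixes U :: 'o and S :: "'a set"
  assumes prestack_E: "prestack X J E" and prestack_B: "prestack X J B"
    and U: "U \<in> Obj X" and S: "S \<in> J U"
begin

sublocale TE: prestack_fib X J "Tot X E"
  by (rule prestack_glue[OF site_axioms prestack_E])
sublocale TB: prestack_fib X J "Tot X B"
  by (rule prestack_glue[OF site_axioms prestack_B])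
sublocale PF: fibred_functor X "Tot X E" "Tot X B" "totO p" "totA X B p"
  by (rule tot_fibred_functor)

lemma S_simps [simp]:
  "\<alpha> \<in> S \<Longrightarrow> \<alpha> \<in> Arr X" "\<alpha> \<in> S \<Longrightarrow> Cod X \<alpha> = U" "\<alpha> \<in> S \<Longrightarrow> g \<in> Arr X \<Longrightarrow> Cod X g = Dom X \<alpha> \<Longrightarrow> \<alpha> \<cdot>[X] g \<in> S"
  using cover_Arr[OF U S] by auto

declare U [simp]

lemma pr_S [simp]:
  assumes "\<alpha> \<in> S" "\<beta> \<in> S"
  shows "pr1 X \<alpha> \<beta> \<in> Arr X" "pr2 X \<alpha> \<beta> \<in> Arr X" "Dom X (pr1 X \<alpha> \<beta>) = pb_ob X \<alpha> \<beta>" "Dom X (pr2 X \<alpha> \<beta>) = pb_ob X \<alpha> \<beta>"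
    "Cod X (pr1 X \<alpha> \<beta>) = Dom X \<alpha>" "Cod X (pr2 X \<alpha> \<beta>) = Dom X \<beta>" "pb_ob X \<alpha> \<beta> \<in> Obj X"
  using pr_simps[of \<alpha> \<beta>] assms by auto

lemma pr_eq: "\<alpha> \<in> S \<Longrightarrow> \<beta> \<in> S \<Longrightarrow> \<alpha> \<cdot>[X] pr1 X \<alpha> \<beta> = \<beta> \<cdot>[X] pr2 X \<alpha> \<beta>"
  using pr_simps[of \<alpha> \<beta>] by auto

text \<open>The typing part of \<open>descent_objects\<close>, split off so that each of the three
  laws can be translated for data that are well typed but not yet lawful.\<close>

definition shape :: "('a, 'u) descent \<Rightarrow> bool" where
  "shape d \<longleftrightarrow> dbase d \<in> Obj (Fib B U) \<and>
     dloc d \<in> (\<Pi>\<^sub>E \<alpha>\<in>S. Obj (Fib E (Dom X \<alpha>))) \<and>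
     dpsi d \<in> (\<Pi>\<^sub>E \<alpha>\<in>S. isos (Fib B (Dom X \<alpha>))
                 (NatO p (Dom X \<alpha>) (dloc d \<alpha>)) (ResO B \<alpha> (dbase d))) \<and>
     dtheta d \<in> (\<Pi>\<^sub>E (\<alpha>, \<beta>)\<in>S \<times> S. isos (Fib E (pb_ob X \<alpha> \<beta>))
                 (ResO E (pr2 X \<alpha> \<beta>) (dloc d \<beta>)) (ResO E (pr1 X \<alpha> \<beta>) (dloc d \<alpha>)))"

lemma descent_objects_shape: "d \<in> descent_objects X E B p U S \<longleftrightarrow>
    shape d \<and> descent_unit X E S d \<and> descent_cocycle X E S d \<and> descent_compat X B p S d"
  by (auto simp: descent_objects_def shape_def)

lemma shapeD:
  assumes "shape d"
  shows "dbase d \<in> Obj (Fib B U)" "\<And>\<alpha>. \<alpha> \<in> S \<Longrightarrow> dloc d \<alpha> \<in> Obj (Fib E (Dom X \<alpha>))"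
    "\<And>\<alpha>. \<alpha> \<in> S \<Longrightarrow> dpsi d \<alpha> \<in> isos (Fib B (Dom X \<alpha>)) (NatO p (Dom X \<alpha>) (dloc d \<alpha>)) (ResO B \<alpha> (dbase d))"
    "\<And>\<alpha> \<beta>. \<alpha> \<in> S \<Longrightarrow> \<beta> \<in> S \<Longrightarrow> dtheta d (\<alpha>, \<beta>) \<in> isos (Fib E (pb_ob X \<alpha> \<beta>))
                 (ResO E (pr2 X \<alpha> \<beta>) (dloc d \<beta>)) (ResO E (pr1 X \<alpha> \<beta>) (dloc d \<alpha>))"
proof -
  show "dbase d \<in> Obj (Fib B U)" using assms by (simp add: shape_def)
  show "dloc d \<alpha> \<in> Obj (Fib E (Dom X \<alpha>))" if "\<alpha> \<in> S" for \<alpha>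
    using assms that by (auto simp: shape_def PiE_def Pi_def)
  show "dpsi d \<alpha> \<in> isos (Fib B (Dom X \<alpha>)) (NatO p (Dom X \<alpha>) (dloc d \<alpha>)) (ResO B \<alpha> (dbase d))" if "\<alpha> \<in> S" for \<alpha>
    using assms that by (auto simp: shape_def PiE_def Pi_def)
  show "dtheta d (\<alpha>, \<beta>) \<in> isos (Fib E (pb_ob X \<alpha> \<beta>))
                 (ResO E (pr2 X \<alpha> \<beta>) (dloc d \<beta>)) (ResO E (pr1 X \<alpha> \<beta>) (dloc d \<alpha>))" if "\<alpha> \<in> S" "\<beta> \<in> S" for \<alpha> \<beta>
  proof -
    have "dtheta d \<in> (\<Pi>\<^sub>E (\<alpha>, \<beta>)\<in>S \<times> S. isos (Fib E (pb_ob X \<alpha> \<beta>))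
                 (ResO E (pr2 X \<alpha> \<beta>) (dloc d \<beta>)) (ResO E (pr1 X \<alpha> \<beta>) (dloc d \<alpha>)))" using assms by (simp add: shape_def)
    from PiE_mem[OF this, of "(\<alpha>, \<beta>)"] that show ?thesis by simp
  qed
qed

lemma shape_simps:
  assumes d: "shape d"
  shows "\<And>\<alpha>. \<alpha> \<in> S \<Longrightarrow> dpsi d \<alpha> \<in> Arr (Fib B (Dom X \<alpha>))"
    "\<And>\<alpha>. \<alpha> \<in> S \<Longrightarrow> Dom (Fib B (Dom X \<alpha>)) (dpsi d \<alpha>) = NatO p (Dom X \<alpha>) (dloc d \<alpha>)"
    "\<And>\<alpha>. \<alpha> \<in> S \<Longrightarrow> Cod (Fib B (Dom X \<alpha>)) (dpsi d \<alpha>) = ResO B \<alpha> (dbase d)"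
    "\<And>\<alpha> \<beta>. \<alpha> \<in> S \<Longrightarrow> \<beta> \<in> S \<Longrightarrow> dtheta d (\<alpha>, \<beta>) \<in> Arr (Fib E (pb_ob X \<alpha> \<beta>))"
    "\<And>\<alpha> \<beta>. \<alpha> \<in> S \<Longrightarrow> \<beta> \<in> S \<Longrightarrow> Dom (Fib E (pb_ob X \<alpha> \<beta>)) (dtheta d (\<alpha>, \<beta>)) = ResO E (pr2 X \<alpha> \<beta>) (dloc d \<beta>)"
    "\<And>\<alpha> \<beta>. \<alpha> \<in> S \<Longrightarrow> \<beta> \<in> S \<Longrightarrow> Cod (Fib E (pb_ob X \<alpha> \<beta>)) (dtheta d (\<alpha>, \<beta>)) = ResO E (pr1 X \<alpha> \<beta>) (dloc d \<alpha>)"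
  using category.isos_Arr[OF B.Fib_category shapeD(3)[OF d]] category.isos_Arr[OF E.Fib_category shapeD(4)[OF d]] by auto

text \<open>The components of a descent datum as objects and arrows of the total categories; \<open>c2 d \<alpha> \<beta>\<close>
  and \<open>Th d \<alpha> \<beta>\<close> have the common source \<open>eb d \<alpha> \<beta>\<close> over the fibre product.\<close>

definition ea :: "('a, 'u) descent \<Rightarrow> 'a \<Rightarrow> 'o \<times> 'u" where "ea d \<alpha> = (Dom X \<alpha>, dloc d \<alpha>)"
definition Th :: "('a, 'u) descent \<Rightarrow> 'a \<Rightarrow> 'a \<Rightarrow> 'a \<times> 'u \<times> 'u" where "Th d \<alpha> \<beta> = (pr1 X \<alpha> \<beta>, dloc d \<alpha>, dtheta d (\<alpha>, \<beta>))"
definition ps :: "('a, 'u) descent \<Rightarrow> 'a \<Rightarrow> 'a \<times> 'u \<times> 'u" where "ps d \<alpha> = (\<alpha>, dbase d, dpsi d \<alpha>)"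
definition c2 :: "('a, 'u) descent \<Rightarrow> 'a \<Rightarrow> 'a \<Rightarrow> 'a \<times> 'u \<times> 'u" where "c2 d \<alpha> \<beta> = E.ci (pr2 X \<alpha> \<beta>) (dloc d \<beta>)"
definition eb :: "('a, 'u) descent \<Rightarrow> 'a \<Rightarrow> 'a \<Rightarrow> 'o \<times> 'u" where "eb d \<alpha> \<beta> = (pb_ob X \<alpha> \<beta>, ResO E (pr2 X \<alpha> \<beta>) (dloc d \<beta>))"

lemma shape_total:
  assumes d: "shape d" and a: "\<alpha> \<in> S"
  shows "ea d \<alpha> \<in> Obj (Tot X E)" "fst (ea d \<alpha>) = Dom X \<alpha>"
    "ps d \<alpha> \<in> Arr (Tot X B)" "Dom (Tot X B) (ps d \<alpha>) = totO p (ea d \<alpha>)" "Cod (Tot X B) (ps d \<alpha>) = (U, dbase d)"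
    "fst (ps d \<alpha>) = \<alpha>" "cartesian X (Tot X B) (ps d \<alpha>)"
  using shapeD[OF d] shape_simps[OF d] a unfolding ea_def ps_def by (auto intro!: B.iso_cartesian)

lemma shape_total2:
  assumes d: "shape d" and a: "\<alpha> \<in> S" "\<beta> \<in> S"
  shows "Th d \<alpha> \<beta> \<in> Arr (Tot X E)" "Dom (Tot X E) (Th d \<alpha> \<beta>) = eb d \<alpha> \<beta>"
    "Cod (Tot X E) (Th d \<alpha> \<beta>) = ea d \<alpha>" "fst (Th d \<alpha> \<beta>) = pr1 X \<alpha> \<beta>" "cartesian X (Tot X E) (Th d \<alpha> \<beta>)"
    "c2 d \<alpha> \<beta> \<in> Arr (Tot X E)" "Dom (Tot X E) (c2 d \<alpha> \<beta>) = eb d \<alpha> \<beta>"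
    "Cod (Tot X E) (c2 d \<alpha> \<beta>) = ea d \<beta>" "fst (c2 d \<alpha> \<beta>) = pr2 X \<alpha> \<beta>" "cartesian X (Tot X E) (c2 d \<alpha> \<beta>)"
    "eb d \<alpha> \<beta> \<in> Obj (Tot X E)" "fst (eb d \<alpha> \<beta>) = pb_ob X \<alpha> \<beta>"
proof -
  note s = shapeD[OF d] shape_simps[OF d]
  show 1: "Th d \<alpha> \<beta> \<in> Arr (Tot X E)" "Dom (Tot X E) (Th d \<alpha> \<beta>) = eb d \<alpha> \<beta>"
    "Cod (Tot X E) (Th d \<alpha> \<beta>) = ea d \<alpha>" "fst (Th d \<alpha> \<beta>) = pr1 X \<alpha> \<beta>"
    "c2 d \<alpha> \<beta> \<in> Arr (Tot X E)" "Dom (Tot X E) (c2 d \<alpha> \<beta>) = eb d \<alpha> \<beta>"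
    "Cod (Tot X E) (c2 d \<alpha> \<beta>) = ea d \<beta>" "fst (c2 d \<alpha> \<beta>) = pr2 X \<alpha> \<beta>"
    "eb d \<alpha> \<beta> \<in> Obj (Tot X E)" "fst (eb d \<alpha> \<beta>) = pb_ob X \<alpha> \<beta>"
    using s a by (auto simp: Th_def c2_def ea_def eb_def)
  show "cartesian X (Tot X E) (c2 d \<alpha> \<beta>)" unfolding c2_def by (rule E.ci_cartesian) (use s a in auto)
  show "cartesian X (Tot X E) (Th d \<alpha> \<beta>)" unfolding Th_def
    by (rule E.iso_cartesian[of _ _ _ "ResO E (pr2 X \<alpha> \<beta>) (dloc d \<beta>)"]) (use s a in auto)
qed

text \<open>The gluing isomorphisms act on arbitrary arrows \<open>q\<close> into \<open>e\<^sub>\<beta>\<close>: given a second leg \<open>r\<close> with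
  \<open>\<alpha> \<cdot> r\<close> equal to \<open>\<beta>\<close> composed with the base of \<open>q\<close>, the result is an arrow into \<open>e\<^sub>\<alpha>\<close> over \<open>r\<close>.\<close>

definition Tr :: "('a, 'u) descent \<Rightarrow> 'a \<Rightarrow> 'a \<Rightarrow> 'a \<Rightarrow> 'a \<times> 'u \<times> 'u \<Rightarrow> 'a \<times> 'u \<times> 'u" where
  "Tr d \<alpha> \<beta> r q = Th d \<alpha> \<beta> \<cdot>[Tot X E] (SOME n. n \<in> Arr (Tot X E) \<and> Cod (Tot X E) n = eb d \<alpha> \<beta> \<and>
     fst n = pb_tuple X \<alpha> \<beta> r (fst q) \<and> c2 d \<alpha> \<beta> \<cdot>[Tot X E] n = q)"

text \<open>As \<open>c2\<close> is cartesian, the choice in \<open>Tr\<close> has a single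
  candidate, and any factor \<open>n\<close> of \<open>q\<close> over the right base computes
  it.\<close>

lemma Tr_I:
  assumes d: "shape d" and a: "\<alpha> \<in> S" "\<beta> \<in> S" and n: "n \<in> Arr (Tot X E)" "Cod (Tot X E) n = eb d \<alpha> \<beta>"
    and q: "c2 d \<alpha> \<beta> \<cdot>[Tot X E] n = q" and r: "r = pr1 X \<alpha> \<beta> \<cdot>[X] fst n"
  shows "Tr d \<alpha> \<beta> r q = Th d \<alpha> \<beta> \<cdot>[Tot X E] n"
proof -
  note t = shape_total2[OF d a]
  let ?P = "\<lambda>n. n \<in> Arr (Tot X E) \<and> Cod (Tot X E) n = eb d \<alpha> \<beta> \<and>
     fst n = pb_tuple X \<alpha> \<beta> r (fst q) \<and> c2 d \<alpha> \<beta> \<cdot>[Tot X E] n = q"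
  have nb: "fst n \<in> Arr X" "Cod X (fst n) = pb_ob X \<alpha> \<beta>" using E.T.base.FA_Arr[OF n(1)] E.T.base.FA_Cod[OF n(1)] n t by auto
  have "fst q = pr2 X \<alpha> \<beta> \<cdot>[X] fst n" unfolding q[symmetric] using n t by simp
  then have P: "?P n" using n q r tuple_unique[of \<alpha> \<beta> "fst n"] nb a by simp
  define N where "N = (SOME n. ?P n)"
  have PN: "?P N" unfolding N_def using P by (rule someI)
  have "N = n"
    by (rule E.T.cart_unique[OF t(10)]) (use PN[THEN conjunct1] PN[THEN conjunct2, THEN conjunct1] PN[THEN conjunct2, THEN conjunct2] P n(1,2) q t(7) in simp_all)
  then show ?thesis by (simp add: Tr_def N_def)
qed

lemma Tr_E:
  assumes d: "shape d" and a: "\<alpha> \<in> S" "\<beta> \<in> S" and q: "q \<in> Arr (Tot X E)" "Cod (Tot X E) q = ea d \<beta>"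
    and r: "r \<in> Arr X" "Cod X r = Dom X \<alpha>" "\<alpha> \<cdot>[X] r = \<beta> \<cdot>[X] fst q"
  obtains n where "n \<in> Arr (Tot X E)" "Dom (Tot X E) n = Dom (Tot X E) q" "Cod (Tot X E) n = eb d \<alpha> \<beta>"
    "c2 d \<alpha> \<beta> \<cdot>[Tot X E] n = q" "r = pr1 X \<alpha> \<beta> \<cdot>[X] fst n" "Tr d \<alpha> \<beta> r q = Th d \<alpha> \<beta> \<cdot>[Tot X E] n"
proof -
  note t = shape_total2[OF d a]
  have qb: "fst q \<in> Arr X" "Cod X (fst q) = Dom X \<beta>" using E.T.base.FA_Cod[OF q(1)] q shape_total[OF d a(2)] by auto
  have rd: "Dom X r = Dom X (fst q)" using arg_cong[OF r(3), of "Dom X"] r(1,2) qb a by simp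
  note u = tuple[of \<alpha> \<beta> r "fst q", OF _ _ _ r(1) qb(1) rd r(2) qb(2) r(3)]
  obtain n where n: "n \<in> Arr (Tot X E)" "Dom (Tot X E) n = Dom (Tot X E) q" "Cod (Tot X E) n = eb d \<alpha> \<beta>"
    "fst n = pb_tuple X \<alpha> \<beta> r (fst q)" "c2 d \<alpha> \<beta> \<cdot>[Tot X E] n = q"
    by (rule E.T.cart_factor[OF t(10) q(1), of "pb_tuple X \<alpha> \<beta> r (fst q)"]) (use u t q a in auto)
  have "r = pr1 X \<alpha> \<beta> \<cdot>[X] fst n" using n u a by simp
  with n Tr_I[OF d a n(1,3,5)] that show thesis by blast
qed

lemma Tr_simps:
  assumes "shape d" "\<alpha> \<in> S" "\<beta> \<in> S" "q \<in> Arr (Tot X E)" "Cod (Tot X E) q = ea d \<beta>"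
    "r \<in> Arr X" "Cod X r = Dom X \<alpha>" "\<alpha> \<cdot>[X] r = \<beta> \<cdot>[X] fst q"
  shows "Tr d \<alpha> \<beta> r q \<in> Arr (Tot X E)" "Dom (Tot X E) (Tr d \<alpha> \<beta> r q) = Dom (Tot X E) q"
    "Cod (Tot X E) (Tr d \<alpha> \<beta> r q) = ea d \<alpha>" "fst (Tr d \<alpha> \<beta> r q) = r"
    "cartesian X (Tot X E) q \<Longrightarrow> cartesian X (Tot X E) (Tr d \<alpha> \<beta> r q)"
proof -
  note t = shape_total2[OF assms(1-3)]
  obtain n where n: "n \<in> Arr (Tot X E)" "Dom (Tot X E) n = Dom (Tot X E) q" "Cod (Tot X E) n = eb d \<alpha> \<beta>"
    "c2 d \<alpha> \<beta> \<cdot>[Tot X E] n = q" "r = pr1 X \<alpha> \<beta> \<cdot>[X] fst n" "Tr d \<alpha> \<beta> r q = Th d \<alpha> \<beta> \<cdot>[Tot X E] n"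
    by (rule Tr_E[OF assms])
  show "Tr d \<alpha> \<beta> r q \<in> Arr (Tot X E)" "Dom (Tot X E) (Tr d \<alpha> \<beta> r q) = Dom (Tot X E) q"
    "Cod (Tot X E) (Tr d \<alpha> \<beta> r q) = ea d \<alpha>" unfolding n(6) using n(1-3) t by auto
  show "fst (Tr d \<alpha> \<beta> r q) = r" unfolding n(6) using n(1-3) n(5)[symmetric] t by simp
  assume q: "cartesian X (Tot X E) q"
  have "cartesian X (Tot X E) n"
    by (rule E.T.cart_cancel[OF t(10) n(1)]) (use n(3) t(7) q n(4) in auto)
  then show "cartesian X (Tot X E) (Tr d \<alpha> \<beta> r q)" unfolding n(6)
    by (rule E.T.cart_comp[OF t(5)]) (use n(3) t(2) in simp)
qed

text \<open>The factor of \<open>q\<close> through \<open>c2\<close>, preceded by \<open>w\<close>,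
  is a factor of the composite.\<close>

lemma Tr_nat:
  assumes d: "shape d" and a: "\<alpha> \<in> S" "\<beta> \<in> S" and q: "q \<in> Arr (Tot X E)" "Cod (Tot X E) q = ea d \<beta>"
    and r: "r \<in> Arr X" "Cod X r = Dom X \<alpha>" "\<alpha> \<cdot>[X] r = \<beta> \<cdot>[X] fst q"
    and w: "w \<in> Arr (Tot X E)" "Cod (Tot X E) w = Dom (Tot X E) q" and r': "r' = r \<cdot>[X] fst w"
  shows "Tr d \<alpha> \<beta> r' (q \<cdot>[Tot X E] w) = Tr d \<alpha> \<beta> r q \<cdot>[Tot X E] w"
proof -
  note t = shape_total2[OF d a]
  obtain n where n: "n \<in> Arr (Tot X E)" "Dom (Tot X E) n = Dom (Tot X E) q" "Cod (Tot X E) n = eb d \<alpha> \<beta>"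
    "c2 d \<alpha> \<beta> \<cdot>[Tot X E] n = q" "r = pr1 X \<alpha> \<beta> \<cdot>[X] fst n" "Tr d \<alpha> \<beta> r q = Th d \<alpha> \<beta> \<cdot>[Tot X E] n"
    by (rule Tr_E[OF d a q r])
  have nb: "fst n \<in> Arr X" "Cod X (fst n) = pb_ob X \<alpha> \<beta>" "fst w \<in> Arr X" "Cod X (fst w) = Dom X (fst n)"
    using E.T.base.FA_Cod[OF n(1)] E.T.base.FA_Dom[OF n(1)] E.T.base.FA_Cod[OF w(1)] n w t by auto
  have "c2 d \<alpha> \<beta> \<cdot>[Tot X E] (n \<cdot>[Tot X E] w) = q \<cdot>[Tot X E] w"
    by (rule E.T.compose_eq[OF n(4)]) (use n w t in auto)
  then have "Tr d \<alpha> \<beta> r' (q \<cdot>[Tot X E] w) = Th d \<alpha> \<beta> \<cdot>[Tot X E] (n \<cdot>[Tot X E] w)"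
    by (intro Tr_I[OF d a]) (use n w nb a r' in auto)
  then show ?thesis using n w t by simp
qed

text \<open>The three conditions with all coherence absorbed. The cocycle law is quantified over
  every test arrow \<open>q\<close> into \<open>ea d \<gamma>\<close> instead of being stated on a
  triple fibre product.\<close>

definition laws :: "('a, 'u) descent \<Rightarrow> bool" where
  "laws d \<longleftrightarrow> (\<forall>\<alpha>\<in>S. Tr d \<alpha> \<alpha> (Id X (Dom X \<alpha>)) (Id (Tot X E) (ea d \<alpha>)) = Id (Tot X E) (ea d \<alpha>)) \<and>
    (\<forall>\<alpha>\<in>S. \<forall>\<beta>\<in>S. \<forall>\<gamma>\<in>S. \<forall>r\<in>Arr X. \<forall>s\<in>Arr X. \<forall>q\<in>Arr (Tot X E). Cod (Tot X E) q = ea d \<gamma> \<and>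
       Cod X r = Dom X \<alpha> \<and> Cod X s = Dom X \<beta> \<and> \<alpha> \<cdot>[X] r = \<beta> \<cdot>[X] s \<and> \<beta> \<cdot>[X] s = \<gamma> \<cdot>[X] fst q \<longrightarrow>
       Tr d \<alpha> \<beta> r (Tr d \<beta> \<gamma> s q) = Tr d \<alpha> \<gamma> r q) \<and>
    (\<forall>\<alpha>\<in>S. \<forall>\<beta>\<in>S. ps d \<beta> \<cdot>[Tot X B] totA X B p (c2 d \<alpha> \<beta>) = ps d \<alpha> \<cdot>[Tot X B] totA X B p (Th d \<alpha> \<beta>))"

text \<open>Restriction along the diagonal is composition of \<open>Th\<close> with
  \<open>cmpi\<close>, by \<open>restrict_mor_total\<close>; the outer \<open>Unt\<close> and its
  inverse only account for the identity of the total category being \<open>Unt\<close>.\<close>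

lemma unit_iff:
  assumes d: "shape d" and a: "\<alpha> \<in> S"
  shows "(let V = Dom X \<alpha>; e = dloc d \<alpha>; \<delta> = pb_tuple X \<alpha> \<alpha> (Id X V) (Id X V) in
       inv_arr (Fib E V) (Unt E V e) \<cdot>[Fib E V]
         restrict_mor X E (pr2 X \<alpha> \<alpha>) (pr1 X \<alpha> \<alpha>) e e \<delta> (dtheta d (\<alpha>, \<alpha>)) \<cdot>[Fib E V] Unt E V e
       = Id (Fib E V) e) \<longleftrightarrow> Tr d \<alpha> \<alpha> (Id X (Dom X \<alpha>)) (Id (Tot X E) (ea d \<alpha>)) = Id (Tot X E) (ea d \<alpha>)"
proof -
  note t = shape_total2[OF d a a] and s = shapeD[OF d] shape_simps[OF d]
  define V where "V = Dom X \<alpha>"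
  define e where "e = dloc d \<alpha>"
  define \<delta> where "\<delta> = pb_tuple X \<alpha> \<alpha> (Id X V) (Id X V)"
  have V: "V \<in> Obj X" "e \<in> Obj (Fib E V)" using a s by (auto simp: V_def e_def)
  have \<delta>: "\<delta> \<in> Arr X" "Dom X \<delta> = V" "Cod X \<delta> = pb_ob X \<alpha> \<alpha>" "pr1 X \<alpha> \<alpha> \<cdot>[X] \<delta> = Id X V" "pr2 X \<alpha> \<alpha> \<cdot>[X] \<delta> = Id X V"
    using tuple[of \<alpha> \<alpha> "Id X V" "Id X V"] a V by (auto simp: \<delta>_def V_def)
  define R where "R = restrict_mor X E (pr2 X \<alpha> \<alpha>) (pr1 X \<alpha> \<alpha>) e e \<delta> (dtheta d (\<alpha>, \<alpha>))"
  let ?k = "E.cmpi (pr2 X \<alpha> \<alpha>) \<delta> e"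
  have eV: "e \<in> Obj (Fib E (Cod X (pr2 X \<alpha> \<alpha>)))" using V a by (simp add: V_def)
  note k = E.cmpi[of "pr2 X \<alpha> \<alpha>" \<delta> e, OF _ \<delta>(1) _ eV]
  have k': "?k \<in> Arr (Tot X E)" "Dom (Tot X E) ?k = (V, ResO E (Id X V) e)" "Cod (Tot X E) ?k = eb d \<alpha> \<alpha>" "fst ?k = \<delta>"
    "c2 d \<alpha> \<alpha> \<cdot>[Tot X E] ?k = E.ci (Id X V) e"
    using k a \<delta> V by (auto simp: c2_def eb_def V_def e_def simp del: total_simps(6))
  have ThR: "Th d \<alpha> \<alpha> \<cdot>[Tot X E] ?k = (Id X V, e, R)"
    using E.restrict_mor_total[of "pr2 X \<alpha> \<alpha>" \<delta> "pr1 X \<alpha> \<alpha>" e e "dtheta d (\<alpha>, \<alpha>)"] a \<delta> by (simp add: Th_def R_def e_def)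
  have RA: "R \<in> Arr (Fib E V)" "Dom (Fib E V) R = ResO E (Id X V) e" "Cod (Fib E V) R = ResO E (Id X V) e"
  proof -
    have "(Id X V, e, R) \<in> Arr (Tot X E)" "Dom (Tot X E) (Id X V, e, R) = (V, ResO E (Id X V) e)"
      unfolding ThR[symmetric] using t k' by auto
    then show "R \<in> Arr (Fib E V)" "Dom (Fib E V) R = ResO E (Id X V) e" "Cod (Fib E V) R = ResO E (Id X V) e" using V by auto
  qed
  have u: "E.vt V (Unt E V e) \<in> Arr (Tot X E)" "Cod (Tot X E) (E.vt V (Unt E V e)) = Dom (Tot X E) ?k"
    "fst (E.vt V (Unt E V e)) = Id X V"
    using V k' by auto
  have IdT: "Id (Tot X E) (ea d \<alpha>) = (Id X V, e, Unt E V e)" by (simp add: ea_def V_def e_def)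
  \<comment> \<open>The identity factors through \<open>c2\<close> as the comparison along the
    diagonal preceded by \<open>Unt\<close>; this is the factor that computes
    \<open>Tr\<close>.\<close>
  have "c2 d \<alpha> \<alpha> \<cdot>[Tot X E] (?k \<cdot>[Tot X E] E.vt V (Unt E V e)) = E.ci (Id X V) e \<cdot>[Tot X E] E.vt V (Unt E V e)"
    by (rule E.T.compose_eq[OF k'(5)]) (use k' u t in auto)
  also have "\<dots> = Id (Tot X E) (ea d \<alpha>)"
    using E.comp_vt[of "Id X V" e "Id (Fib E V) (ResO E (Id X V) e)" "Unt E V e"] V IdT by simp
  finally have "Tr d \<alpha> \<alpha> (Id X V) (Id (Tot X E) (ea d \<alpha>)) = Th d \<alpha> \<alpha> \<cdot>[Tot X E] (?k \<cdot>[Tot X E] E.vt V (Unt E V e))"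
    by (intro Tr_I[OF d a a]) (use k' u \<delta> V in auto)
  also have "\<dots> = (Id X V, e, R) \<cdot>[Tot X E] E.vt V (Unt E V e)"
    by (rule E.T.compose_eq[OF ThR]) (use k' u t in auto)
  also have "\<dots> = (Id X V, e, R \<cdot>[Fib E V] Unt E V e)"
    using E.comp_vt[of "Id X V" e R "Unt E V e"] V RA by simp
  finally have 1: "Tr d \<alpha> \<alpha> (Id X V) (Id (Tot X E) (ea d \<alpha>)) = Id (Tot X E) (ea d \<alpha>) \<longleftrightarrow> R \<cdot>[Fib E V] Unt E V e = Unt E V e"
    by (simp add: IdT)
  note C = E.Fib_category[OF V(1)]
  note i = category.inv_arr_simps[OF C E.Unt_isos[OF V]]
  have "R \<cdot>[Fib E V] Unt E V e = Unt E V e \<longleftrightarrow> inv_arr (Fib E V) (Unt E V e) \<cdot>[Fib E V] (R \<cdot>[Fib E V] Unt E V e) = Id (Fib E V) e"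
  proof
    assume "R \<cdot>[Fib E V] Unt E V e = Unt E V e" then show "inv_arr (Fib E V) (Unt E V e) \<cdot>[Fib E V] (R \<cdot>[Fib E V] Unt E V e) = Id (Fib E V) e"
      using i by simp
  next
    assume H: "inv_arr (Fib E V) (Unt E V e) \<cdot>[Fib E V] (R \<cdot>[Fib E V] Unt E V e) = Id (Fib E V) e"
    show "R \<cdot>[Fib E V] Unt E V e = Unt E V e"
      by (rule category.iso_cancel_left[OF C category.inv_arr_isos[OF C E.Unt_isos[OF V]]]) (use H i RA V in auto)
  qed
  with 1 show ?thesis unfolding Let_def V_def[symmetric] e_def[symmetric] \<delta>_def[symmetric] R_def[symmetric] by simp
qed

text \<open>For a chosen lift the factor through \<open>c2\<close> is \<open>cmpi\<close> along the
  induced arrow to the fibre product, and composing \<open>Th\<close> with it gives precisely the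
  restricted arrow of \<open>descent_cocycle\<close>.\<close>

lemma Tr_ci:
  assumes d: "shape d" and a: "\<alpha> \<in> S" "\<beta> \<in> S" and r: "r \<in> Arr X" "Cod X r = Dom X \<alpha>" and s: "s \<in> Arr X" "Cod X s = Dom X \<beta>"
    and rs: "\<alpha> \<cdot>[X] r = \<beta> \<cdot>[X] s"
  shows "Tr d \<alpha> \<beta> r (E.ci s (dloc d \<beta>)) = (r, dloc d \<alpha>, restrict_mor X E (pr2 X \<alpha> \<beta>) (pr1 X \<alpha> \<beta>) (dloc d \<beta>) (dloc d \<alpha>)
                (pb_tuple X \<alpha> \<beta> r s) (dtheta d (\<alpha>, \<beta>)))"
proof -
  note t = shape_total2[OF d a] and sh = shapeD[OF d] shape_simps[OF d]
  have rd: "Dom X r = Dom X s" using arg_cong[OF rs, of "Dom X"] r s a by simp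
  define u where "u = pb_tuple X \<alpha> \<beta> r s"
  have u: "u \<in> Arr X" "Dom X u = Dom X r" "Cod X u = pb_ob X \<alpha> \<beta>" "pr1 X \<alpha> \<beta> \<cdot>[X] u = r" "pr2 X \<alpha> \<beta> \<cdot>[X] u = s"
    using tuple[of \<alpha> \<beta> r s] a r s rs rd by (auto simp: u_def)
  let ?k = "E.cmpi (pr2 X \<alpha> \<beta>) u (dloc d \<beta>)"
  note k = E.cmpi[of "pr2 X \<alpha> \<beta>" u "dloc d \<beta>"]
  have "Tr d \<alpha> \<beta> r (E.ci s (dloc d \<beta>)) = Th d \<alpha> \<beta> \<cdot>[Tot X E] ?k"
    by (rule Tr_I[OF d a]) (use k a u sh in \<open>auto simp: c2_def eb_def simp del: total_simps(6)\<close>)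
  then show ?thesis
    using E.restrict_mor_total[of "pr2 X \<alpha> \<beta>" u "pr1 X \<alpha> \<beta>" "dloc d \<alpha>" "dloc d \<beta>" "dtheta d (\<alpha>, \<beta>)"] a u by (simp add: Th_def u_def)
qed

text \<open>The original equation is the general law at the universal test arrow, the chosen lift of
  the third projection. The inner value of \<open>Tr\<close> is a chosen lift preceded by the
  vertical arrow \<open>?v\<close>, past which the outer \<open>Tr\<close> moves by
  naturality.\<close>

lemma cocycle_iff:
  assumes d: "shape d" and a: "\<alpha> \<in> S" "\<beta> \<in> S" "\<gamma> \<in> S"
    and t: "triple_legs X \<alpha> \<beta> \<gamma> = (qa, qb, qc)"
  shows "(let \<theta> = (\<lambda>\<mu> \<nu> r s. restrict_mor X E (pr2 X \<mu> \<nu>) (pr1 X \<mu> \<nu>) (dloc d \<nu>) (dloc d \<mu>)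
                (pb_tuple X \<mu> \<nu> r s) (dtheta d (\<mu>, \<nu>)))
     in \<theta> \<alpha> \<beta> qa qb \<cdot>[Fib E (Dom X qa)] \<theta> \<beta> \<gamma> qb qc = \<theta> \<alpha> \<gamma> qa qc) \<longleftrightarrow>
     Tr d \<alpha> \<beta> qa (Tr d \<beta> \<gamma> qb (E.ci qc (dloc d \<gamma>))) = Tr d \<alpha> \<gamma> qa (E.ci qc (dloc d \<gamma>))"
proof -
  define \<theta> where "\<theta> = (\<lambda>\<mu> \<nu> r s. restrict_mor X E (pr2 X \<mu> \<nu>) (pr1 X \<mu> \<nu>) (dloc d \<nu>) (dloc d \<mu>)
                (pb_tuple X \<mu> \<nu> r s) (dtheta d (\<mu>, \<nu>)))"
  have "is_triple_pullback X \<alpha> \<beta> \<gamma> qa qb qc" using triple[of \<alpha> \<beta> \<gamma>] a t by simp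
  then have q: "qa \<in> Arr X" "qb \<in> Arr X" "qc \<in> Arr X" "Cod X qa = Dom X \<alpha>" "Cod X qb = Dom X \<beta>" "Cod X qc = Dom X \<gamma>"
    "Dom X qb = Dom X qa" "Dom X qc = Dom X qa" and e: "\<alpha> \<cdot>[X] qa = \<beta> \<cdot>[X] qb" "\<beta> \<cdot>[X] qb = \<gamma> \<cdot>[X] qc"
    by (auto simp: is_triple_pullback_def in_hom)
  note sh = shapeD[OF d] shape_simps[OF d]
  have e': "\<alpha> \<cdot>[X] qa = \<gamma> \<cdot>[X] qc" using e by simp
  have 1: "Tr d \<beta> \<gamma> qb (E.ci qc (dloc d \<gamma>)) = (qb, dloc d \<beta>, \<theta> \<beta> \<gamma> qb qc)"
    "Tr d \<alpha> \<gamma> qa (E.ci qc (dloc d \<gamma>)) = (qa, dloc d \<alpha>, \<theta> \<alpha> \<gamma> qa qc)"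
    "Tr d \<alpha> \<beta> qa (E.ci qb (dloc d \<beta>)) = (qa, dloc d \<alpha>, \<theta> \<alpha> \<beta> qa qb)"
    unfolding \<theta>_def by (rule Tr_ci; use d a q e e' in simp)+
  have A: "(qb, dloc d \<beta>, \<theta> \<beta> \<gamma> qb qc) \<in> Arr (Tot X E)"
    unfolding 1(1)[symmetric] by (rule Tr_simps(1)) (use d a q e sh in \<open>auto simp: ea_def\<close>)
  have A2: "(qa, dloc d \<alpha>, \<theta> \<alpha> \<beta> qa qb) \<in> Arr (Tot X E)" "Dom (Tot X E) (qa, dloc d \<alpha>, \<theta> \<alpha> \<beta> qa qb) = Dom (Tot X E) (E.ci qb (dloc d \<beta>))"
    unfolding 1(3)[symmetric] by (rule Tr_simps(1,2); use d a q e sh in \<open>auto simp: ea_def\<close>)+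
  have B: "\<theta> \<beta> \<gamma> qb qc \<in> Arr (Fib E (Dom X qa))" "Cod (Fib E (Dom X qa)) (\<theta> \<beta> \<gamma> qb qc) = ResO E qb (dloc d \<beta>)"
    using A q by auto
  have B2: "Dom (Fib E (Dom X qa)) (\<theta> \<alpha> \<beta> qa qb) = ResO E qb (dloc d \<beta>)" using A2(2) q sh a by simp
  let ?v = "E.vt (Dom X qa) (\<theta> \<beta> \<gamma> qb qc)"
  have "Tr d \<alpha> \<beta> qa (qb, dloc d \<beta>, \<theta> \<beta> \<gamma> qb qc) = Tr d \<alpha> \<beta> qa (E.ci qb (dloc d \<beta>) \<cdot>[Tot X E] ?v)"
    using E.ci_vt[OF A] q by simp
  also have "\<dots> = Tr d \<alpha> \<beta> qa (E.ci qb (dloc d \<beta>)) \<cdot>[Tot X E] ?v"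
    by (rule Tr_nat) (use d a q e sh B in \<open>auto simp: ea_def\<close>)
  also have "\<dots> = (qa, dloc d \<alpha>, \<theta> \<alpha> \<beta> qa qb \<cdot>[Fib E (Dom X qa)] \<theta> \<beta> \<gamma> qb qc)"
    unfolding 1(3) by (rule E.comp_vt[OF A2(1)]) (use B B2 in auto)
  finally show ?thesis unfolding 1 \<theta>_def[symmetric] Let_def by simp
qed

text \<open>The legs \<open>r\<close>, \<open>s\<close> and \<open>fst q\<close> have equal
  composites, so they factor through the triple fibre product, and \<open>Tr_nat\<close> carries the
  universal case along that factor.\<close>

lemma cocycle_general:
  assumes d: "shape d" and a: "\<alpha> \<in> S" "\<beta> \<in> S" "\<gamma> \<in> S"
    and t: "triple_legs X \<alpha> \<beta> \<gamma> = (qa, qb, qc)"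
    and H: "Tr d \<alpha> \<beta> qa (Tr d \<beta> \<gamma> qb (E.ci qc (dloc d \<gamma>))) = Tr d \<alpha> \<gamma> qa (E.ci qc (dloc d \<gamma>))"
    and q: "q \<in> Arr (Tot X E)" "Cod (Tot X E) q = ea d \<gamma>" and r: "r \<in> Arr X" "Cod X r = Dom X \<alpha>"
    and s: "s \<in> Arr X" "Cod X s = Dom X \<beta>" and rs: "\<alpha> \<cdot>[X] r = \<beta> \<cdot>[X] s" "\<beta> \<cdot>[X] s = \<gamma> \<cdot>[X] fst q"
  shows "Tr d \<alpha> \<beta> r (Tr d \<beta> \<gamma> s q) = Tr d \<alpha> \<gamma> r q"
proof -
  have tp: "is_triple_pullback X \<alpha> \<beta> \<gamma> qa qb qc" using triple[of \<alpha> \<beta> \<gamma>] a t by simp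
  then have Q: "qa \<in> Arr X" "qb \<in> Arr X" "qc \<in> Arr X" "Cod X qa = Dom X \<alpha>" "Cod X qb = Dom X \<beta>" "Cod X qc = Dom X \<gamma>"
    "Dom X qb = Dom X qa" "Dom X qc = Dom X qa" and e: "\<alpha> \<cdot>[X] qa = \<beta> \<cdot>[X] qb" "\<beta> \<cdot>[X] qb = \<gamma> \<cdot>[X] qc"
    by (auto simp: is_triple_pullback_def in_hom)
  note sh = shapeD[OF d] shape_simps[OF d]
  have e': "\<alpha> \<cdot>[X] qa = \<gamma> \<cdot>[X] qc" using e by simp
  have qb: "fst q \<in> Arr X" "Cod X (fst q) = Dom X \<gamma>" using E.T.base.FA_Cod[OF q(1)] q shape_total[OF d a(3)] by auto
  define W where "W = Dom X (fst q)"
  have D: "Dom X s = W" "Dom X r = W" using arg_cong[OF rs(2), of "Dom X"] arg_cong[OF rs(1), of "Dom X"] r s a qb by (auto simp: W_def)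
  have "r \<in> hom X W (Dom X \<alpha>) \<and> s \<in> hom X W (Dom X \<beta>) \<and> fst q \<in> hom X W (Dom X \<gamma>) \<and> \<alpha> \<cdot>[X] r = \<beta> \<cdot>[X] s \<and> \<beta> \<cdot>[X] s = \<gamma> \<cdot>[X] fst q"
    using r s qb rs D by (auto simp: in_hom W_def)
  then obtain u where u: "u \<in> Arr X" "Dom X u = W" "Cod X u = Dom X qa" "qa \<cdot>[X] u = r" "qb \<cdot>[X] u = s" "qc \<cdot>[X] u = fst q"
    using tp unfolding is_triple_pullback_def in_hom by metis
  let ?c = "E.ci qc (dloc d \<gamma>)"
  have cA: "?c \<in> Arr (Tot X E)" "Dom (Tot X E) ?c = (Dom X qa, ResO E qc (dloc d \<gamma>))" "Cod (Tot X E) ?c = ea d \<gamma>" "fst ?c = qc"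
    using Q sh a by (auto simp: ea_def)
  have cc: "cartesian X (Tot X E) ?c" by (rule E.ci_cartesian) (use Q sh a in auto)
  obtain n where n: "n \<in> Arr (Tot X E)" "Dom (Tot X E) n = Dom (Tot X E) q" "Cod (Tot X E) n = Dom (Tot X E) ?c" "fst n = u" "?c \<cdot>[Tot X E] n = q"
    by (rule E.T.cart_factor[OF cc q(1) u(1)]) (use q cA u in auto)
  note T1 = Tr_simps[OF d a(2,3) cA(1,3) Q(2,5), unfolded cA(4), OF e(2)]
  have 1: "Tr d \<beta> \<gamma> s q = Tr d \<beta> \<gamma> qb ?c \<cdot>[Tot X E] n"
    unfolding n(5)[symmetric] by (rule Tr_nat) (use d a cA Q e n u in auto)
  have 2: "Tr d \<alpha> \<gamma> r q = Tr d \<alpha> \<gamma> qa ?c \<cdot>[Tot X E] n"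
    unfolding n(5)[symmetric] by (rule Tr_nat) (use d a cA Q e' n u in auto)
  have 3: "Tr d \<alpha> \<beta> r (Tr d \<beta> \<gamma> qb ?c \<cdot>[Tot X E] n) = Tr d \<alpha> \<beta> qa (Tr d \<beta> \<gamma> qb ?c) \<cdot>[Tot X E] n"
    by (rule Tr_nat) (use d a T1 Q e n u cA in auto)
  show ?thesis unfolding 1 2 3 H ..
qed

text \<open>Composing with the invertible \<open>Cmp\<close> at the first projection clears the
  inverse inside \<open>sigma\<close>. What remains are the fibre components of two composites in
  the total category.\<close>

lemma compat_iff:
  assumes d: "shape d" and a: "\<alpha> \<in> S" "\<beta> \<in> S"
  shows "(let W = pb_ob X \<alpha> \<beta>; \<pi>1 = pr1 X \<alpha> \<beta>; \<pi>2 = pr2 X \<alpha> \<beta> in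
       sigma X B \<alpha> \<beta> (dbase d) \<cdot>[Fib B W] ResA B \<pi>2 (dpsi d \<beta>) \<cdot>[Fib B W] NatC p \<pi>2 (dloc d \<beta>)
       = ResA B \<pi>1 (dpsi d \<alpha>) \<cdot>[Fib B W] NatC p \<pi>1 (dloc d \<alpha>) \<cdot>[Fib B W] NatA p W (dtheta d (\<alpha>, \<beta>))) \<longleftrightarrow>
     ps d \<beta> \<cdot>[Tot X B] totA X B p (c2 d \<alpha> \<beta>) = ps d \<alpha> \<cdot>[Tot X B] totA X B p (Th d \<alpha> \<beta>)"
proof -
  define W where "W = pb_ob X \<alpha> \<beta>"
  define \<pi>1 where "\<pi>1 = pr1 X \<alpha> \<beta>"
  define \<pi>2 where "\<pi>2 = pr2 X \<alpha> \<beta>"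
  have p: "\<pi>1 \<in> Arr X" "\<pi>2 \<in> Arr X" "Dom X \<pi>1 = W" "Dom X \<pi>2 = W" "Cod X \<pi>1 = Dom X \<alpha>" "Cod X \<pi>2 = Dom X \<beta>" "W \<in> Obj X"
    "\<alpha> \<cdot>[X] \<pi>1 = \<beta> \<cdot>[X] \<pi>2" using a pr_eq[OF a] by (auto simp: W_def \<pi>1_def \<pi>2_def)
  note sh = shapeD[OF d] shape_simps[OF d, folded W_def]
  have th: "dtheta d (\<alpha>, \<beta>) \<in> Arr (Fib E W)" "Dom (Fib E W) (dtheta d (\<alpha>, \<beta>)) = ResO E \<pi>2 (dloc d \<beta>)" "Cod (Fib E W) (dtheta d (\<alpha>, \<beta>)) = ResO E \<pi>1 (dloc d \<alpha>)"
    using shape_simps(4-6)[OF d a] by (auto simp: W_def \<pi>1_def \<pi>2_def)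
  note C = B.Fib_category[OF p(7)]
  have K: "Cmp B \<alpha> \<pi>1 (dbase d) \<in> isos (Fib B W) (ResO B \<pi>1 (ResO B \<alpha> (dbase d))) (ResO B (\<alpha> \<cdot>[X] \<pi>1) (dbase d))"
    using B.Cmp_isos[of \<alpha> \<pi>1 "dbase d"] p a sh by simp
  note i = category.inv_arr_simps[OF C K]
  let ?x = "ResA B \<pi>2 (dpsi d \<beta>) \<cdot>[Fib B W] NatC p \<pi>2 (dloc d \<beta>)"
  let ?y = "ResA B \<pi>1 (dpsi d \<alpha>) \<cdot>[Fib B W] NatC p \<pi>1 (dloc d \<alpha>) \<cdot>[Fib B W] NatA p W (dtheta d (\<alpha>, \<beta>))"
  let ?\<sigma> = "sigma X B \<alpha> \<beta> (dbase d)"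
  have C2: "Cmp B \<beta> \<pi>2 (dbase d) \<in> Arr (Fib B W)" "Dom (Fib B W) (Cmp B \<beta> \<pi>2 (dbase d)) = ResO B \<pi>2 (ResO B \<beta> (dbase d))"
    "Cod (Fib B W) (Cmp B \<beta> \<pi>2 (dbase d)) = ResO B (\<alpha> \<cdot>[X] \<pi>1) (dbase d)"
    using p a sh by auto
  have \<sigma>: "?\<sigma> = inv_arr (Fib B W) (Cmp B \<alpha> \<pi>1 (dbase d)) \<cdot>[Fib B W] Cmp B \<beta> \<pi>2 (dbase d)"
    by (simp add: sigma_def W_def \<pi>1_def \<pi>2_def)
  have xA: "?x \<in> Arr (Fib B W)" "Cod (Fib B W) ?x = ResO B \<pi>2 (ResO B \<beta> (dbase d))"
    and yA: "?y \<in> Arr (Fib B W)" "Cod (Fib B W) ?y = ResO B \<pi>1 (ResO B \<alpha> (dbase d))"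
    using p a sh th by auto
  have e1: "Cmp B \<alpha> \<pi>1 (dbase d) \<cdot>[Fib B W] (?\<sigma> \<cdot>[Fib B W] ?x) = Cmp B \<beta> \<pi>2 (dbase d) \<cdot>[Fib B W] ?x"
  proof -
    have "Cmp B \<alpha> \<pi>1 (dbase d) \<cdot>[Fib B W] (inv_arr (Fib B W) (Cmp B \<alpha> \<pi>1 (dbase d)) \<cdot>[Fib B W] (Cmp B \<beta> \<pi>2 (dbase d) \<cdot>[Fib B W] ?x)) =
      Id (Fib B W) (ResO B (\<alpha> \<cdot>[X] \<pi>1) (dbase d)) \<cdot>[Fib B W] (Cmp B \<beta> \<pi>2 (dbase d) \<cdot>[Fib B W] ?x)"
      by (rule category.compose_eq[OF C i(5)]) (use i C2 xA K[THEN category.isos_Arr[OF C]] in \<open>simp_all add: category.Comp_Arr[OF C] category.Cod_Comp[OF C]\<close>)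
    moreover have "(inv_arr (Fib B W) (Cmp B \<alpha> \<pi>1 (dbase d)) \<cdot>[Fib B W] Cmp B \<beta> \<pi>2 (dbase d)) \<cdot>[Fib B W] ?x =
      inv_arr (Fib B W) (Cmp B \<alpha> \<pi>1 (dbase d)) \<cdot>[Fib B W] (Cmp B \<beta> \<pi>2 (dbase d) \<cdot>[Fib B W] ?x)"
      by (rule category.assoc[OF C]) (use i C2 xA in auto)
    moreover have "Id (Fib B W) (ResO B (\<alpha> \<cdot>[X] \<pi>1) (dbase d)) \<cdot>[Fib B W] (Cmp B \<beta> \<pi>2 (dbase d) \<cdot>[Fib B W] ?x) = Cmp B \<beta> \<pi>2 (dbase d) \<cdot>[Fib B W] ?x"
      by (rule category.Id_left[OF C]) (use C2 xA in \<open>simp_all add: category.Comp_Arr[OF C] category.Cod_Comp[OF C]\<close>)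
    ultimately show ?thesis unfolding \<sigma> by simp
  qed
  have sx: "?\<sigma> \<cdot>[Fib B W] ?x \<in> Arr (Fib B W)" "Cod (Fib B W) (?\<sigma> \<cdot>[Fib B W] ?x) = ResO B \<pi>1 (ResO B \<alpha> (dbase d))"
    unfolding \<sigma> using i C2 xA category.Comp_Arr[OF C] category.Cod_Comp[OF C] category.Dom_Comp[OF C] by simp_all
  have "?\<sigma> \<cdot>[Fib B W] ?x = ?y \<longleftrightarrow> Cmp B \<beta> \<pi>2 (dbase d) \<cdot>[Fib B W] ?x = Cmp B \<alpha> \<pi>1 (dbase d) \<cdot>[Fib B W] ?y"
    using category.iso_cancel_left[OF C K sx(1) yA(1) sx(2) yA(2)] e1 by auto
  moreover have "ps d \<beta> \<cdot>[Tot X B] totA X B p (c2 d \<alpha> \<beta>) = (\<beta> \<cdot>[X] \<pi>2, dbase d, Cmp B \<beta> \<pi>2 (dbase d) \<cdot>[Fib B W] ?x)"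
    using p a sh by (simp add: ps_def c2_def flip: \<pi>2_def)
  moreover have "ps d \<alpha> \<cdot>[Tot X B] totA X B p (Th d \<alpha> \<beta>) = (\<alpha> \<cdot>[X] \<pi>1, dbase d, Cmp B \<alpha> \<pi>1 (dbase d) \<cdot>[Fib B W] ?y)"
    using p a sh th by (simp add: ps_def Th_def flip: \<pi>1_def)
  ultimately show ?thesis using p(8) unfolding Let_def W_def[symmetric] \<pi>1_def[symmetric] \<pi>2_def[symmetric] by simp
qed

lemma descent_objects_iff: "d \<in> descent_objects X E B p U S \<longleftrightarrow> shape d \<and> laws d"
proof (cases "shape d")
  case False then show ?thesis by (simp add: descent_objects_shape)
next
  case d: True
  have "descent_unit X E S d \<longleftrightarrow> (\<forall>\<alpha>\<in>S. Tr d \<alpha> \<alpha> (Id X (Dom X \<alpha>)) (Id (Tot X E) (ea d \<alpha>)) = Id (Tot X E) (ea d \<alpha>))"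
    unfolding descent_unit_def using unit_iff[OF d] by simp
  moreover have "descent_compat X B p S d \<longleftrightarrow> (\<forall>\<alpha>\<in>S. \<forall>\<beta>\<in>S. ps d \<beta> \<cdot>[Tot X B] totA X B p (c2 d \<alpha> \<beta>) = ps d \<alpha> \<cdot>[Tot X B] totA X B p (Th d \<alpha> \<beta>))"
    unfolding descent_compat_def using compat_iff[OF d] by simp
  moreover have "descent_cocycle X E S d \<longleftrightarrow> (\<forall>\<alpha>\<in>S. \<forall>\<beta>\<in>S. \<forall>\<gamma>\<in>S. \<forall>r\<in>Arr X. \<forall>s\<in>Arr X. \<forall>q\<in>Arr (Tot X E). Cod (Tot X E) q = ea d \<gamma> \<and>
       Cod X r = Dom X \<alpha> \<and> Cod X s = Dom X \<beta> \<and> \<alpha> \<cdot>[X] r = \<beta> \<cdot>[X] s \<and> \<beta> \<cdot>[X] s = \<gamma> \<cdot>[X] fst q \<longrightarrow>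
       Tr d \<alpha> \<beta> r (Tr d \<beta> \<gamma> s q) = Tr d \<alpha> \<gamma> r q)" (is "?L \<longleftrightarrow> ?R")
  proof
    assume L: ?L
    show ?R
    proof (intro ballI impI)
      fix \<alpha> \<beta> \<gamma> r s q assume a: "\<alpha> \<in> S" "\<beta> \<in> S" "\<gamma> \<in> S" and H: "r \<in> Arr X" "s \<in> Arr X" "q \<in> Arr (Tot X E)"
        "Cod (Tot X E) q = ea d \<gamma> \<and> Cod X r = Dom X \<alpha> \<and> Cod X s = Dom X \<beta> \<and> \<alpha> \<cdot>[X] r = \<beta> \<cdot>[X] s \<and> \<beta> \<cdot>[X] s = \<gamma> \<cdot>[X] fst q"
      obtain qa qb qc where t: "triple_legs X \<alpha> \<beta> \<gamma> = (qa, qb, qc)" by (cases "triple_legs X \<alpha> \<beta> \<gamma>")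
      have "Tr d \<alpha> \<beta> qa (Tr d \<beta> \<gamma> qb (E.ci qc (dloc d \<gamma>))) = Tr d \<alpha> \<gamma> qa (E.ci qc (dloc d \<gamma>))"
        using L[unfolded descent_cocycle_def, rule_format, OF a, unfolded t Let_def prod.case] cocycle_iff[OF d a t, unfolded Let_def] by simp
      then show "Tr d \<alpha> \<beta> r (Tr d \<beta> \<gamma> s q) = Tr d \<alpha> \<gamma> r q" by (rule cocycle_general[OF d a t]) (use H in auto)
    qed
  next
    assume R: ?R
    show ?L unfolding descent_cocycle_def
    proof (intro ballI)
      fix \<alpha> \<beta> \<gamma> assume a: "\<alpha> \<in> S" "\<beta> \<in> S" "\<gamma> \<in> S"
      obtain qa qb qc where t: "triple_legs X \<alpha> \<beta> \<gamma> = (qa, qb, qc)" by (cases "triple_legs X \<alpha> \<beta> \<gamma>")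
      have "is_triple_pullback X \<alpha> \<beta> \<gamma> qa qb qc" using triple[of \<alpha> \<beta> \<gamma>] a t by simp
      then have Q: "qa \<in> Arr X" "qb \<in> Arr X" "qc \<in> Arr X" "Cod X qa = Dom X \<alpha>" "Cod X qb = Dom X \<beta>" "Cod X qc = Dom X \<gamma>"
        and e: "\<alpha> \<cdot>[X] qa = \<beta> \<cdot>[X] qb" "\<beta> \<cdot>[X] qb = \<gamma> \<cdot>[X] qc"
        by (auto simp: is_triple_pullback_def in_hom)
      have "Tr d \<alpha> \<beta> qa (Tr d \<beta> \<gamma> qb (E.ci qc (dloc d \<gamma>))) = Tr d \<alpha> \<gamma> qa (E.ci qc (dloc d \<gamma>))"
        by (rule R[rule_format]) (use a Q e shapeD[OF d] in \<open>auto simp: ea_def\<close>)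
      then show "let (q\<alpha>, q\<beta>, q\<gamma>) = triple_legs X \<alpha> \<beta> \<gamma>;
         \<theta> = (\<lambda>\<mu> \<nu> r s. restrict_mor X E (pr2 X \<mu> \<nu>) (pr1 X \<mu> \<nu>) (dloc d \<nu>) (dloc d \<mu>)
                (pb_tuple X \<mu> \<nu> r s) (dtheta d (\<mu>, \<nu>)))
        in \<theta> \<alpha> \<beta> q\<alpha> q\<beta> \<cdot>[Fib E (Dom X q\<alpha>)] \<theta> \<beta> \<gamma> q\<beta> q\<gamma> = \<theta> \<alpha> \<gamma> q\<alpha> q\<gamma>"
        unfolding t Let_def prod.case by (rule cocycle_iff[OF d a t, unfolded Let_def, THEN iffD2])
    qed
  qed
  ultimately show ?thesis using d by (simp add: descent_objects_shape laws_def)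
qed

end

section \<open>The category of descent data\<close>

context descent_setting begin

abbreviation "D \<equiv> Desc X E B p U S"
abbreviation "DA \<equiv> descent_arrows X E B p U S"
abbreviation "DO \<equiv> descent_objects X E B p U S"

lemma descent_arrowsD:
  assumes k: "k \<in> DA"
  shows "asrc k \<in> DO" "atgt k \<in> DO" "shape (asrc k)" "shape (atgt k)"
    "abase k \<in> Arr (Fib B U)" "Dom (Fib B U) (abase k) = dbase (asrc k)" "Cod (Fib B U) (abase k) = dbase (atgt k)"
    "aloc k \<in> extensional S"
    "\<And>\<alpha>. \<alpha> \<in> S \<Longrightarrow> aloc k \<alpha> \<in> Arr (Fib E (Dom X \<alpha>))"
    "\<And>\<alpha>. \<alpha> \<in> S \<Longrightarrow> Dom (Fib E (Dom X \<alpha>)) (aloc k \<alpha>) = dloc (asrc k) \<alpha>"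
    "\<And>\<alpha>. \<alpha> \<in> S \<Longrightarrow> Cod (Fib E (Dom X \<alpha>)) (aloc k \<alpha>) = dloc (atgt k) \<alpha>"
    "\<And>\<alpha> \<beta>. \<alpha> \<in> S \<Longrightarrow> \<beta> \<in> S \<Longrightarrow> ResA E (pr1 X \<alpha> \<beta>) (aloc k \<alpha>) \<cdot>[Fib E (pb_ob X \<alpha> \<beta>)] dtheta (asrc k) (\<alpha>, \<beta>) =
        dtheta (atgt k) (\<alpha>, \<beta>) \<cdot>[Fib E (pb_ob X \<alpha> \<beta>)] ResA E (pr2 X \<alpha> \<beta>) (aloc k \<beta>)"
    "\<And>\<alpha>. \<alpha> \<in> S \<Longrightarrow> ResA B \<alpha> (abase k) \<cdot>[Fib B (Dom X \<alpha>)] dpsi (asrc k) \<alpha> =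
        dpsi (atgt k) \<alpha> \<cdot>[Fib B (Dom X \<alpha>)] NatA p (Dom X \<alpha>) (aloc k \<alpha>)"
proof -
  show "asrc k \<in> DO" "atgt k \<in> DO" "shape (asrc k)" "shape (atgt k)"
    "abase k \<in> Arr (Fib B U)" "Dom (Fib B U) (abase k) = dbase (asrc k)" "Cod (Fib B U) (abase k) = dbase (atgt k)"
    using k by (auto simp: descent_arrows_def descent_objects_iff in_hom)
  have P: "aloc k \<in> (\<Pi>\<^sub>E \<alpha>\<in>S. hom (Fib E (Dom X \<alpha>)) (dloc (asrc k) \<alpha>) (dloc (atgt k) \<alpha>))" using k by (simp add: descent_arrows_def)
  then show "aloc k \<in> extensional S" by (simp add: PiE_def)
  show "aloc k \<alpha> \<in> Arr (Fib E (Dom X \<alpha>))" "Dom (Fib E (Dom X \<alpha>)) (aloc k \<alpha>) = dloc (asrc k) \<alpha>"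
    "Cod (Fib E (Dom X \<alpha>)) (aloc k \<alpha>) = dloc (atgt k) \<alpha>" if "\<alpha> \<in> S" for \<alpha> using PiE_mem[OF P that] by (auto simp: in_hom)
  show "\<And>\<alpha> \<beta>. \<alpha> \<in> S \<Longrightarrow> \<beta> \<in> S \<Longrightarrow> ResA E (pr1 X \<alpha> \<beta>) (aloc k \<alpha>) \<cdot>[Fib E (pb_ob X \<alpha> \<beta>)] dtheta (asrc k) (\<alpha>, \<beta>) =
        dtheta (atgt k) (\<alpha>, \<beta>) \<cdot>[Fib E (pb_ob X \<alpha> \<beta>)] ResA E (pr2 X \<alpha> \<beta>) (aloc k \<beta>)"
    "\<And>\<alpha>. \<alpha> \<in> S \<Longrightarrow> ResA B \<alpha> (abase k) \<cdot>[Fib B (Dom X \<alpha>)] dpsi (asrc k) \<alpha> =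
        dpsi (atgt k) \<alpha> \<cdot>[Fib B (Dom X \<alpha>)] NatA p (Dom X \<alpha>) (aloc k \<alpha>)"
    using k by (auto simp: descent_arrows_def)
qed

lemma descent_arrowsI:
  assumes "asrc k \<in> DO" "atgt k \<in> DO"
    "abase k \<in> Arr (Fib B U)" "Dom (Fib B U) (abase k) = dbase (asrc k)" "Cod (Fib B U) (abase k) = dbase (atgt k)"
    "aloc k \<in> extensional S"
    "\<And>\<alpha>. \<alpha> \<in> S \<Longrightarrow> aloc k \<alpha> \<in> Arr (Fib E (Dom X \<alpha>))"
    "\<And>\<alpha>. \<alpha> \<in> S \<Longrightarrow> Dom (Fib E (Dom X \<alpha>)) (aloc k \<alpha>) = dloc (asrc k) \<alpha>"
    "\<And>\<alpha>. \<alpha> \<in> S \<Longrightarrow> Cod (Fib E (Dom X \<alpha>)) (aloc k \<alpha>) = dloc (atgt k) \<alpha>"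
    "\<And>\<alpha> \<beta>. \<alpha> \<in> S \<Longrightarrow> \<beta> \<in> S \<Longrightarrow> ResA E (pr1 X \<alpha> \<beta>) (aloc k \<alpha>) \<cdot>[Fib E (pb_ob X \<alpha> \<beta>)] dtheta (asrc k) (\<alpha>, \<beta>) =
        dtheta (atgt k) (\<alpha>, \<beta>) \<cdot>[Fib E (pb_ob X \<alpha> \<beta>)] ResA E (pr2 X \<alpha> \<beta>) (aloc k \<beta>)"
    "\<And>\<alpha>. \<alpha> \<in> S \<Longrightarrow> ResA B \<alpha> (abase k) \<cdot>[Fib B (Dom X \<alpha>)] dpsi (asrc k) \<alpha> =
        dpsi (atgt k) \<alpha> \<cdot>[Fib B (Dom X \<alpha>)] NatA p (Dom X \<alpha>) (aloc k \<alpha>)"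
  shows "k \<in> DA"
  using assms by (simp add: descent_arrows_def in_hom PiE_def Pi_def)

lemma DO_shape: "d \<in> DO \<Longrightarrow> shape d" by (simp add: descent_objects_iff)

lemma Id_DA: "d \<in> DO \<Longrightarrow> Id D d \<in> DA"
proof (rule descent_arrowsI)
  assume d: "d \<in> DO"
  note sh = shapeD[OF DO_shape[OF d]] shape_simps[OF DO_shape[OF d]]
  show "asrc (Id D d) \<in> DO" "atgt (Id D d) \<in> DO"
    "abase (Id D d) \<in> Arr (Fib B U)" "Dom (Fib B U) (abase (Id D d)) = dbase (asrc (Id D d))" "Cod (Fib B U) (abase (Id D d)) = dbase (atgt (Id D d))"
    "aloc (Id D d) \<in> extensional S" using d sh by auto
  fix \<alpha> assume a: "\<alpha> \<in> S"
  show "aloc (Id D d) \<alpha> \<in> Arr (Fib E (Dom X \<alpha>))" "Dom (Fib E (Dom X \<alpha>)) (aloc (Id D d) \<alpha>) = dloc (asrc (Id D d)) \<alpha>"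
    "Cod (Fib E (Dom X \<alpha>)) (aloc (Id D d) \<alpha>) = dloc (atgt (Id D d)) \<alpha>" using a sh by auto
  show "ResA B \<alpha> (abase (Id D d)) \<cdot>[Fib B (Dom X \<alpha>)] dpsi (asrc (Id D d)) \<alpha> =
        dpsi (atgt (Id D d)) \<alpha> \<cdot>[Fib B (Dom X \<alpha>)] NatA p (Dom X \<alpha>) (aloc (Id D d) \<alpha>)" using a sh by simp
  fix \<beta> assume b: "\<beta> \<in> S"
  show "ResA E (pr1 X \<alpha> \<beta>) (aloc (Id D d) \<alpha>) \<cdot>[Fib E (pb_ob X \<alpha> \<beta>)] dtheta (asrc (Id D d)) (\<alpha>, \<beta>) =
        dtheta (atgt (Id D d)) (\<alpha>, \<beta>) \<cdot>[Fib E (pb_ob X \<alpha> \<beta>)] ResA E (pr2 X \<alpha> \<beta>) (aloc (Id D d) \<beta>)" using a b sh by simp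
qed

lemma Comp_DA:
  assumes l: "l \<in> DA" and k: "k \<in> DA" and kl: "asrc k = atgt l"
  shows "k \<cdot>[D] l \<in> DA"
proof (rule descent_arrowsI)
  note K = descent_arrowsD[OF k] and L = descent_arrowsD[OF l]
  note sk = shapeD[OF K(3)] shape_simps[OF K(3)] and sl = shapeD[OF L(3)] shape_simps[OF L(3)] and st = shapeD[OF K(4)] shape_simps[OF K(4)]
  show "asrc (k \<cdot>[D] l) \<in> DO" "atgt (k \<cdot>[D] l) \<in> DO"
    "abase (k \<cdot>[D] l) \<in> Arr (Fib B U)" "Dom (Fib B U) (abase (k \<cdot>[D] l)) = dbase (asrc (k \<cdot>[D] l))" "Cod (Fib B U) (abase (k \<cdot>[D] l)) = dbase (atgt (k \<cdot>[D] l))"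
    "aloc (k \<cdot>[D] l) \<in> extensional S" using K L kl by auto
  fix \<alpha> assume a: "\<alpha> \<in> S"
  show "aloc (k \<cdot>[D] l) \<alpha> \<in> Arr (Fib E (Dom X \<alpha>))" "Dom (Fib E (Dom X \<alpha>)) (aloc (k \<cdot>[D] l) \<alpha>) = dloc (asrc (k \<cdot>[D] l)) \<alpha>"
    "Cod (Fib E (Dom X \<alpha>)) (aloc (k \<cdot>[D] l) \<alpha>) = dloc (atgt (k \<cdot>[D] l)) \<alpha>" using a K L kl by auto
  have CB: "category (Fib B (Dom X \<alpha>))" using a B.Fib_category by simp
  have "ResA B \<alpha> (abase k) \<cdot>[Fib B (Dom X \<alpha>)] (dpsi (atgt l) \<alpha> \<cdot>[Fib B (Dom X \<alpha>)] NatA p (Dom X \<alpha>) (aloc l \<alpha>)) =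
    dpsi (atgt k) \<alpha> \<cdot>[Fib B (Dom X \<alpha>)] (NatA p (Dom X \<alpha>) (aloc k \<alpha>) \<cdot>[Fib B (Dom X \<alpha>)] NatA p (Dom X \<alpha>) (aloc l \<alpha>))"
    by (rule category.compose_eq2[OF CB K(13)[OF a, unfolded kl]]) (use a K(4-11) L(3-11) sk sl st kl in auto)
  then show "ResA B \<alpha> (abase (k \<cdot>[D] l)) \<cdot>[Fib B (Dom X \<alpha>)] dpsi (asrc (k \<cdot>[D] l)) \<alpha> =
        dpsi (atgt (k \<cdot>[D] l)) \<alpha> \<cdot>[Fib B (Dom X \<alpha>)] NatA p (Dom X \<alpha>) (aloc (k \<cdot>[D] l) \<alpha>)"
    using a K(3-11) L(3-11) L(13)[OF a] sk sl st kl by simp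
  fix \<beta> assume b: "\<beta> \<in> S"
  have CE: "category (Fib E (pb_ob X \<alpha> \<beta>))" using a b E.Fib_category by simp
  have "ResA E (pr1 X \<alpha> \<beta>) (aloc k \<alpha>) \<cdot>[Fib E (pb_ob X \<alpha> \<beta>)] (dtheta (atgt l) (\<alpha>, \<beta>) \<cdot>[Fib E (pb_ob X \<alpha> \<beta>)] ResA E (pr2 X \<alpha> \<beta>) (aloc l \<beta>)) =
    dtheta (atgt k) (\<alpha>, \<beta>) \<cdot>[Fib E (pb_ob X \<alpha> \<beta>)] (ResA E (pr2 X \<alpha> \<beta>) (aloc k \<beta>) \<cdot>[Fib E (pb_ob X \<alpha> \<beta>)] ResA E (pr2 X \<alpha> \<beta>) (aloc l \<beta>))"
    by (rule category.compose_eq2[OF CE K(12)[OF a b, unfolded kl]]) (use a b K(4-11) L(3-11) sk sl st kl in auto)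
  then show "ResA E (pr1 X \<alpha> \<beta>) (aloc (k \<cdot>[D] l) \<alpha>) \<cdot>[Fib E (pb_ob X \<alpha> \<beta>)] dtheta (asrc (k \<cdot>[D] l)) (\<alpha>, \<beta>) =
        dtheta (atgt (k \<cdot>[D] l)) (\<alpha>, \<beta>) \<cdot>[Fib E (pb_ob X \<alpha> \<beta>)] ResA E (pr2 X \<alpha> \<beta>) (aloc (k \<cdot>[D] l) \<beta>)"
    using a b K(3-11) L(3-11) L(12)[OF a b] sk sl st kl by simp
qed

text \<open>Families are extensional, so equations between arrows of descent data may be checked
  member by member.\<close>

lemma Desc_category: "category D"
proof
  fix k assume "k \<in> Arr D"
  then show "Dom D k \<in> Obj D" "Cod D k \<in> Obj D" using descent_arrowsD by auto
next
  fix d assume "d \<in> Obj D" then show "Id D d \<in> hom D d d" using Id_DA[of d] by (auto simp: in_hom)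
next
  fix l k x y z assume "l \<in> hom D x y" "k \<in> hom D y z"
  then show "k \<cdot>[D] l \<in> hom D x z" using Comp_DA[of l k] by (auto simp: in_hom)
next
  fix k x y assume "k \<in> hom D x y"
  then have k: "k \<in> DA" "asrc k = x" "atgt k = y" by (auto simp: in_hom)
  note K = descent_arrowsD[OF k(1)]
  have "(\<lambda>\<alpha>\<in>S. (\<lambda>\<alpha>\<in>S. Id (Fib E (Dom X \<alpha>)) (dloc y \<alpha>)) \<alpha> \<cdot>[Fib E (Dom X \<alpha>)] aloc k \<alpha>) = aloc k"
    by (rule extensionalityI[where A = S]) (use K k in auto)
  then show "Id D y \<cdot>[D] k = k" using K k by (intro descent_arr.equality) auto
  have "(\<lambda>\<alpha>\<in>S. aloc k \<alpha> \<cdot>[Fib E (Dom X \<alpha>)] (\<lambda>\<alpha>\<in>S. Id (Fib E (Dom X \<alpha>)) (dloc x \<alpha>)) \<alpha>) = aloc k"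
    by (rule extensionalityI[where A = S]) (use K k in auto)
  then show "k \<cdot>[D] Id D x = k" using K k by (intro descent_arr.equality) auto
next
  fix f g h w x y z assume "f \<in> hom D w x" "g \<in> hom D x y" "h \<in> hom D y z"
  then have k: "f \<in> DA" "asrc f = w" "atgt f = x" "g \<in> DA" "asrc g = x" "atgt g = y" "h \<in> DA" "asrc h = y" "atgt h = z"
    by (auto simp: in_hom)
  note K = descent_arrowsD[OF k(1)] descent_arrowsD[OF k(4)] descent_arrowsD[OF k(7)]
  have "(\<lambda>\<alpha>\<in>S. (\<lambda>\<alpha>\<in>S. aloc h \<alpha> \<cdot>[Fib E (Dom X \<alpha>)] aloc g \<alpha>) \<alpha> \<cdot>[Fib E (Dom X \<alpha>)] aloc f \<alpha>) =
    (\<lambda>\<alpha>\<in>S. aloc h \<alpha> \<cdot>[Fib E (Dom X \<alpha>)] (\<lambda>\<alpha>\<in>S. aloc g \<alpha> \<cdot>[Fib E (Dom X \<alpha>)] aloc f \<alpha>) \<alpha>)"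
    by (rule restrict_ext) (use K k in auto)
  then show "(h \<cdot>[D] g) \<cdot>[D] f = h \<cdot>[D] (g \<cdot>[D] f)" using K k by (intro descent_arr.equality) auto
qed

sublocale D: category D by (rule Desc_category)

text \<open>The inverse components satisfy the conditions on an arrow: each follows from the
  condition on \<open>k\<close> by cancelling an isomorphism on the left.\<close>

lemma Desc_isosI:
  assumes k: "k \<in> DA" and b: "abase k \<in> isos (Fib B U) (dbase (asrc k)) (dbase (atgt k))"
    and a: "\<And>\<alpha>. \<alpha> \<in> S \<Longrightarrow> aloc k \<alpha> \<in> isos (Fib E (Dom X \<alpha>)) (dloc (asrc k) \<alpha>) (dloc (atgt k) \<alpha>)"
  shows "k \<in> isos D (asrc k) (atgt k)"
proof -
  note K = descent_arrowsD[OF k]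
  note ib = category.inv_arr_simps[OF B.Fib_category[OF U] b]
  have CE: "category (Fib E (Dom X \<alpha>))" "category (Fib B (Dom X \<alpha>))" if "\<alpha> \<in> S" for \<alpha> using E.Fib_category B.Fib_category that by auto
  note ia = category.inv_arr_simps[OF CE(1) a]
  define l where "l = \<lparr>asrc = atgt k, atgt = asrc k, abase = inv_arr (Fib B U) (abase k), aloc = (\<lambda>\<alpha>\<in>S. inv_arr (Fib E (Dom X \<alpha>)) (aloc k \<alpha>))\<rparr>"
  note ss = shapeD[OF K(3)] shape_simps[OF K(3)] and st = shapeD[OF K(4)] shape_simps[OF K(4)]
  have l: "l \<in> DA"
  proof (rule descent_arrowsI)
    show "asrc l \<in> DO" "atgt l \<in> DO"
    "abase l \<in> Arr (Fib B U)" "Dom (Fib B U) (abase l) = dbase (asrc l)" "Cod (Fib B U) (abase l) = dbase (atgt l)"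
    "aloc l \<in> extensional S" using K ib by (auto simp: l_def)
    fix \<alpha> assume A: "\<alpha> \<in> S"
    show "aloc l \<alpha> \<in> Arr (Fib E (Dom X \<alpha>))" "Dom (Fib E (Dom X \<alpha>)) (aloc l \<alpha>) = dloc (asrc l) \<alpha>"
    "Cod (Fib E (Dom X \<alpha>)) (aloc l \<alpha>) = dloc (atgt l) \<alpha>" using A ia[OF A A] by (auto simp: l_def)
    let ?BV = "Fib B (Dom X \<alpha>)"
    let ?f = "ResA B \<alpha> (abase k)" and ?g = "ResA B \<alpha> (inv_arr (Fib B U) (abase k))"
    let ?m = "NatA p (Dom X \<alpha>) (aloc k \<alpha>)" and ?n = "NatA p (Dom X \<alpha>) (inv_arr (Fib E (Dom X \<alpha>)) (aloc k \<alpha>))"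
    have fi: "?f \<in> isos ?BV (ResO B \<alpha> (dbase (asrc k))) (ResO B \<alpha> (dbase (atgt k)))"
      using B.ResA_isos[of \<alpha> "abase k"] A b by simp
    have fg: "?f \<cdot>[?BV] ?g = Id ?BV (ResO B \<alpha> (dbase (atgt k)))"
      using B.ResA_simps(5)[of \<alpha> U "inv_arr (Fib B U) (abase k)" "abase k"] A ib K(5-7) st by simp
    have mn: "?m \<cdot>[?BV] ?n = Id ?BV (NatO p (Dom X \<alpha>) (dloc (atgt k) \<alpha>))"
      using NatA_simps(5)[of "Dom X \<alpha>" "inv_arr (Fib E (Dom X \<alpha>)) (aloc k \<alpha>)" "aloc k \<alpha>"] A ia[OF A A] K(9-11)[OF A] st by simp
    have "?f \<cdot>[?BV] (?g \<cdot>[?BV] dpsi (atgt k) \<alpha>) = dpsi (atgt k) \<alpha>"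
      using category.compose_eq[OF CE(2)[OF A] fg, of "dpsi (atgt k) \<alpha>"] A ib K(5-7) st by simp
    moreover have "?f \<cdot>[?BV] (dpsi (asrc k) \<alpha> \<cdot>[?BV] ?n) = dpsi (atgt k) \<alpha> \<cdot>[?BV] (?m \<cdot>[?BV] ?n)"
      by (rule category.compose_eq2[OF CE(2)[OF A] K(13)[OF A]]) (use A ia[OF A A] K(5-7) K(9-11)[OF A] ss st in auto)
    ultimately have "?f \<cdot>[?BV] (?g \<cdot>[?BV] dpsi (atgt k) \<alpha>) = ?f \<cdot>[?BV] (dpsi (asrc k) \<alpha> \<cdot>[?BV] ?n)"
      using mn A st by simp
    then have "?g \<cdot>[?BV] dpsi (atgt k) \<alpha> = dpsi (asrc k) \<alpha> \<cdot>[?BV] ?n"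
      by (rule category.iso_cancel_left[OF CE(2)[OF A] fi, rotated -1]) (use A ib ia[OF A A] K(5-7) K(9-11)[OF A] ss st in auto)
    then show "ResA B \<alpha> (abase l) \<cdot>[Fib B (Dom X \<alpha>)] dpsi (asrc l) \<alpha> =
        dpsi (atgt l) \<alpha> \<cdot>[Fib B (Dom X \<alpha>)] NatA p (Dom X \<alpha>) (aloc l \<alpha>)" using A by (simp add: l_def)
    fix \<beta> assume Bt: "\<beta> \<in> S"
    let ?W = "Fib E (pb_ob X \<alpha> \<beta>)"
    have CW: "category ?W" using E.Fib_category A Bt by simp
    let ?f = "ResA E (pr1 X \<alpha> \<beta>) (aloc k \<alpha>)" and ?g = "ResA E (pr1 X \<alpha> \<beta>) (inv_arr (Fib E (Dom X \<alpha>)) (aloc k \<alpha>))"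
    let ?m = "ResA E (pr2 X \<alpha> \<beta>) (aloc k \<beta>)" and ?n = "ResA E (pr2 X \<alpha> \<beta>) (inv_arr (Fib E (Dom X \<beta>)) (aloc k \<beta>))"
    have fi: "?f \<in> isos ?W (ResO E (pr1 X \<alpha> \<beta>) (dloc (asrc k) \<alpha>)) (ResO E (pr1 X \<alpha> \<beta>) (dloc (atgt k) \<alpha>))"
      using E.ResA_isos[of "pr1 X \<alpha> \<beta>" "aloc k \<alpha>"] A Bt a by simp
    have fg: "?f \<cdot>[?W] ?g = Id ?W (ResO E (pr1 X \<alpha> \<beta>) (dloc (atgt k) \<alpha>))"
      using E.ResA_simps(5)[of "pr1 X \<alpha> \<beta>" "Dom X \<alpha>" "inv_arr (Fib E (Dom X \<alpha>)) (aloc k \<alpha>)" "aloc k \<alpha>"] A Bt ia[OF A A] K(9-11)[OF A] st by simp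
    have mn: "?m \<cdot>[?W] ?n = Id ?W (ResO E (pr2 X \<alpha> \<beta>) (dloc (atgt k) \<beta>))"
      using E.ResA_simps(5)[of "pr2 X \<alpha> \<beta>" "Dom X \<beta>" "inv_arr (Fib E (Dom X \<beta>)) (aloc k \<beta>)" "aloc k \<beta>"] A Bt ia[OF Bt Bt] K(9-11)[OF Bt] st by simp
    have "?f \<cdot>[?W] (?g \<cdot>[?W] dtheta (atgt k) (\<alpha>, \<beta>)) = dtheta (atgt k) (\<alpha>, \<beta>)"
      using category.compose_eq[OF CW fg, of "dtheta (atgt k) (\<alpha>, \<beta>)"] A Bt ia[OF A A] K(9-11)[OF A] st by simp
    moreover have "?f \<cdot>[?W] (dtheta (asrc k) (\<alpha>, \<beta>) \<cdot>[?W] ?n) = dtheta (atgt k) (\<alpha>, \<beta>) \<cdot>[?W] (?m \<cdot>[?W] ?n)"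
      by (rule category.compose_eq2[OF CW K(12)[OF A Bt]]) (use A Bt ia[OF Bt Bt] K(9-11)[OF A] K(9-11)[OF Bt] ss st in auto)
    ultimately have "?f \<cdot>[?W] (?g \<cdot>[?W] dtheta (atgt k) (\<alpha>, \<beta>)) = ?f \<cdot>[?W] (dtheta (asrc k) (\<alpha>, \<beta>) \<cdot>[?W] ?n)"
      using mn A Bt st by simp
    then have "?g \<cdot>[?W] dtheta (atgt k) (\<alpha>, \<beta>) = dtheta (asrc k) (\<alpha>, \<beta>) \<cdot>[?W] ?n"
      by (rule category.iso_cancel_left[OF CW fi, rotated -1]) (use A Bt ia[OF A A] ia[OF Bt Bt] K(9-11)[OF A] K(9-11)[OF Bt] ss st in auto)
    then show "ResA E (pr1 X \<alpha> \<beta>) (aloc l \<alpha>) \<cdot>[?W] dtheta (asrc l) (\<alpha>, \<beta>) = dtheta (atgt l) (\<alpha>, \<beta>) \<cdot>[?W] ResA E (pr2 X \<alpha> \<beta>) (aloc l \<beta>)"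
      using A Bt by (simp add: l_def)
  qed
  have "l \<cdot>[D] k = Id D (asrc k)" "k \<cdot>[D] l = Id D (atgt k)"
    using ib ia by (auto simp: l_def intro: restrict_ext)
  then show ?thesis using k l by (intro D.isosI[where g = l]) (auto simp: in_hom l_def)
qed

lemma Desc_isosD:
  assumes k: "k \<in> isos D d d'"
  shows "k \<in> DA" "asrc k = d" "atgt k = d'" "abase k \<in> isos (Fib B U) (dbase d) (dbase d')"
    "\<And>\<alpha>. \<alpha> \<in> S \<Longrightarrow> aloc k \<alpha> \<in> isos (Fib E (Dom X \<alpha>)) (dloc d \<alpha>) (dloc d' \<alpha>)"
proof -
  show kA: "k \<in> DA" "asrc k = d" "atgt k = d'" using D.isos_Arr[OF k] by auto
  define l where "l = inv_arr D k"
  have l: "l \<in> DA" "asrc l = d'" "atgt l = d" and lk: "l \<cdot>[D] k = Id D d" "k \<cdot>[D] l = Id D d'"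
    using D.inv_arr_simps[OF k] unfolding l_def by simp_all
  note K = descent_arrowsD[OF kA(1)] and L = descent_arrowsD[OF l(1)]
  show "abase k \<in> isos (Fib B U) (dbase d) (dbase d')"
    by (rule category.isosI[OF B.Fib_category[OF U], where g = "abase l"]) (use lk K(5-7) L(5-7) kA l in \<open>auto simp: in_hom\<close>)
  fix \<alpha> assume a: "\<alpha> \<in> S"
  have "aloc (l \<cdot>[D] k) \<alpha> = aloc (Id D d) \<alpha>" "aloc (k \<cdot>[D] l) \<alpha> = aloc (Id D d') \<alpha>" unfolding lk by simp_all
  then have e: "aloc l \<alpha> \<cdot>[Fib E (Dom X \<alpha>)] aloc k \<alpha> = Id (Fib E (Dom X \<alpha>)) (dloc d \<alpha>)"
     "aloc k \<alpha> \<cdot>[Fib E (Dom X \<alpha>)] aloc l \<alpha> = Id (Fib E (Dom X \<alpha>)) (dloc d' \<alpha>)" using a by auto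
  show "aloc k \<alpha> \<in> isos (Fib E (Dom X \<alpha>)) (dloc d \<alpha>) (dloc d' \<alpha>)"
    by (rule category.isosI[OF E.Fib_category, where g = "aloc l \<alpha>"]) (use a e K(9-11)[OF a] L(9-11)[OF a] kA l in \<open>auto simp: in_hom\<close>)
qed

text \<open>The hypothesis is compatibility of \<open>j\<close> on the fibre product; an admissible
  \<open>q\<close> factors through \<open>c2\<close>, which carries the equation to
  \<open>q\<close>.\<close>

lemma Tr_cone:
  assumes d: "shape d" and j: "\<And>\<alpha>. \<alpha> \<in> S \<Longrightarrow> j \<alpha> \<in> Arr (Tot X E)" "\<And>\<alpha>. \<alpha> \<in> S \<Longrightarrow> Dom (Tot X E) (j \<alpha>) = ea d \<alpha>"
    and jT: "j \<alpha> \<cdot>[Tot X E] Th d \<alpha> \<beta> = j \<beta> \<cdot>[Tot X E] c2 d \<alpha> \<beta>"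
    and a: "\<alpha> \<in> S" "\<beta> \<in> S" and q: "q \<in> Arr (Tot X E)" "Cod (Tot X E) q = ea d \<beta>"
    and r: "r \<in> Arr X" "Cod X r = Dom X \<alpha>" "\<alpha> \<cdot>[X] r = \<beta> \<cdot>[X] fst q"
  shows "j \<alpha> \<cdot>[Tot X E] Tr d \<alpha> \<beta> r q = j \<beta> \<cdot>[Tot X E] q"
proof -
  note t = shape_total2[OF d a]
  obtain n where n: "n \<in> Arr (Tot X E)" "Dom (Tot X E) n = Dom (Tot X E) q" "Cod (Tot X E) n = eb d \<alpha> \<beta>"
    "c2 d \<alpha> \<beta> \<cdot>[Tot X E] n = q" "r = pr1 X \<alpha> \<beta> \<cdot>[X] fst n" "Tr d \<alpha> \<beta> r q = Th d \<alpha> \<beta> \<cdot>[Tot X E] n"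
    by (rule Tr_E[OF d a q r])
  have "j \<alpha> \<cdot>[Tot X E] (Th d \<alpha> \<beta> \<cdot>[Tot X E] n) = j \<beta> \<cdot>[Tot X E] (c2 d \<alpha> \<beta> \<cdot>[Tot X E] n)"
    by (rule E.T.compose_eq2[OF jT]) (use n(1-3) t j a in auto)
  then show ?thesis unfolding n(6) n(4) .
qed

text \<open>Arrows of a cartesian cone can be cancelled, and by \<open>Tr_cone\<close> both sides of
  the unit and cocycle laws have the same composite with \<open>j \<alpha>\<close>. The lemma serves
  to show that \<Phi>(x) is a descent datum.\<close>

lemma laws_of_cone:
  assumes d: "shape d" and j: "\<And>\<alpha>. \<alpha> \<in> S \<Longrightarrow> cartesian X (Tot X E) (j \<alpha>)" "\<And>\<alpha>. \<alpha> \<in> S \<Longrightarrow> Dom (Tot X E) (j \<alpha>) = ea d \<alpha>"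
    and jT: "\<And>\<alpha> \<beta>. \<alpha> \<in> S \<Longrightarrow> \<beta> \<in> S \<Longrightarrow> j \<alpha> \<cdot>[Tot X E] Th d \<alpha> \<beta> = j \<beta> \<cdot>[Tot X E] c2 d \<alpha> \<beta>"
    and ps: "\<And>\<alpha> \<beta>. \<alpha> \<in> S \<Longrightarrow> \<beta> \<in> S \<Longrightarrow> ps d \<beta> \<cdot>[Tot X B] totA X B p (c2 d \<alpha> \<beta>) = ps d \<alpha> \<cdot>[Tot X B] totA X B p (Th d \<alpha> \<beta>)"
  shows "laws d"
  unfolding laws_def
proof (intro conjI ballI impI)
  note jA = E.T.cart_Arr[OF j(1)]
  fix \<alpha> assume a: "\<alpha> \<in> S"
  note o = shape_total[OF d a]
  have r: "Id X (Dom X \<alpha>) \<in> Arr X" "Cod X (Id X (Dom X \<alpha>)) = Dom X \<alpha>" "\<alpha> \<cdot>[X] Id X (Dom X \<alpha>) = \<alpha> \<cdot>[X] fst (Id (Tot X E) (ea d \<alpha>))"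
    using a E.T.base.FA_Id[OF o(1)] o(2) by auto
  note T = Tr_simps[OF d a a _ _ r]
  show "Tr d \<alpha> \<alpha> (Id X (Dom X \<alpha>)) (Id (Tot X E) (ea d \<alpha>)) = Id (Tot X E) (ea d \<alpha>)"
    by (rule E.T.cart_unique[OF j(1)[OF a]])
       (use T o a jA[OF a] j(2)[OF a] E.T.base.FA_Id[OF o(1)] Tr_cone[OF d jA j(2) jT[OF a a] a a _ _ r] in auto)
next
  note jA = E.T.cart_Arr[OF j(1)]
  fix \<alpha> \<beta> \<gamma> r s q assume a: "\<alpha> \<in> S" "\<beta> \<in> S" "\<gamma> \<in> S" and H: "r \<in> Arr X" "s \<in> Arr X" "q \<in> Arr (Tot X E)"
        "Cod (Tot X E) q = ea d \<gamma> \<and> Cod X r = Dom X \<alpha> \<and> Cod X s = Dom X \<beta> \<and> \<alpha> \<cdot>[X] r = \<beta> \<cdot>[X] s \<and> \<beta> \<cdot>[X] s = \<gamma> \<cdot>[X] fst q"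
  have r: "Cod X r = Dom X \<alpha>" "\<alpha> \<cdot>[X] r = \<beta> \<cdot>[X] s" "\<alpha> \<cdot>[X] r = \<gamma> \<cdot>[X] fst q" and s: "Cod X s = Dom X \<beta>" "\<beta> \<cdot>[X] s = \<gamma> \<cdot>[X] fst q"
    and qc: "Cod (Tot X E) q = ea d \<gamma>" using H by auto
  note T1 = Tr_simps[OF d a(2,3) H(3) qc H(2) s]
  have r': "\<alpha> \<cdot>[X] r = \<beta> \<cdot>[X] fst (Tr d \<beta> \<gamma> s q)" using T1(4) r(2) by simp
  note T2 = Tr_simps[OF d a(1,2) T1(1,3) H(1) r(1) r'] and T3 = Tr_simps[OF d a(1,3) H(3) qc H(1) r(1,3)]
  have "j \<alpha> \<cdot>[Tot X E] Tr d \<alpha> \<beta> r (Tr d \<beta> \<gamma> s q) = j \<alpha> \<cdot>[Tot X E] Tr d \<alpha> \<gamma> r q"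
    using Tr_cone[OF d jA j(2) jT[OF a(1,2)] a(1,2) T1(1,3) H(1) r(1) r']
      Tr_cone[OF d jA j(2) jT[OF a(1,3)] a(1,3) H(3) qc H(1) r(1,3)]
      Tr_cone[OF d jA j(2) jT[OF a(2,3)] a(2,3) H(3) qc H(2) s] by simp
  then show "Tr d \<alpha> \<beta> r (Tr d \<beta> \<gamma> s q) = Tr d \<alpha> \<gamma> r q"
    by (rule E.T.cart_unique[OF j(1)[OF a(1)], rotated -1]) (use T2 T3 j(2) a in simp_all)
next
  fix \<alpha> \<beta> assume "\<alpha> \<in> S" "\<beta> \<in> S"
  then show "ps d \<beta> \<cdot>[Tot X B] totA X B p (c2 d \<alpha> \<beta>) = ps d \<alpha> \<cdot>[Tot X B] totA X B p (Th d \<alpha> \<beta>)" by (rule ps)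
qed

lemma sigma_simps:
  assumes a: "\<alpha> \<in> S" "\<beta> \<in> S" and x: "x \<in> Obj (Fib E U)"
  shows "sigma X E \<alpha> \<beta> x \<in> isos (Fib E (pb_ob X \<alpha> \<beta>)) (ResO E (pr2 X \<alpha> \<beta>) (ResO E \<beta> x)) (ResO E (pr1 X \<alpha> \<beta>) (ResO E \<alpha> x))"
    "Cmp E \<alpha> (pr1 X \<alpha> \<beta>) x \<cdot>[Fib E (pb_ob X \<alpha> \<beta>)] sigma X E \<alpha> \<beta> x = Cmp E \<beta> (pr2 X \<alpha> \<beta>) x"
proof -
  let ?W = "Fib E (pb_ob X \<alpha> \<beta>)"
  have C: "category ?W" using a E.Fib_category by simp
  have K1: "Cmp E \<alpha> (pr1 X \<alpha> \<beta>) x \<in> isos ?W (ResO E (pr1 X \<alpha> \<beta>) (ResO E \<alpha> x)) (ResO E (\<alpha> \<cdot>[X] pr1 X \<alpha> \<beta>) x)"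
    using E.Cmp_isos[of \<alpha> "pr1 X \<alpha> \<beta>" x] a x by simp
  have K2: "Cmp E \<beta> (pr2 X \<alpha> \<beta>) x \<in> isos ?W (ResO E (pr2 X \<alpha> \<beta>) (ResO E \<beta> x)) (ResO E (\<alpha> \<cdot>[X] pr1 X \<alpha> \<beta>) x)"
    using E.Cmp_isos[of \<beta> "pr2 X \<alpha> \<beta>" x] a x pr_eq[OF a] by simp
  show "sigma X E \<alpha> \<beta> x \<in> isos ?W (ResO E (pr2 X \<alpha> \<beta>) (ResO E \<beta> x)) (ResO E (pr1 X \<alpha> \<beta>) (ResO E \<alpha> x))"
    unfolding sigma_def by (rule category.isos_Comp[OF C K2 category.inv_arr_isos[OF C K1]])
  note i = category.inv_arr_simps[OF C K1] and k = category.isos_Arr[OF C K1] category.isos_Arr[OF C K2]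
  have "Cmp E \<alpha> (pr1 X \<alpha> \<beta>) x \<cdot>[?W] (inv_arr ?W (Cmp E \<alpha> (pr1 X \<alpha> \<beta>) x) \<cdot>[?W] Cmp E \<beta> (pr2 X \<alpha> \<beta>) x) =
     Id ?W (ResO E (\<alpha> \<cdot>[X] pr1 X \<alpha> \<beta>) x) \<cdot>[?W] Cmp E \<beta> (pr2 X \<alpha> \<beta>) x"
    by (rule category.compose_eq[OF C i(5)]) (use i k in auto)
  then show "Cmp E \<alpha> (pr1 X \<alpha> \<beta>) x \<cdot>[?W] sigma X E \<alpha> \<beta> x = Cmp E \<beta> (pr2 X \<alpha> \<beta>) x"
    using k category.Id_left[OF C] by (simp add: sigma_def)
qed

text \<open>As in \<open>compat_iff\<close>, composing with \<open>Cmp\<close> clears the inverse in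
  \<open>sigma\<close>. It turns a condition on arrows of descent data into commutation with a
  cone.\<close>

lemma cone_iff:
  assumes d: "shape d" and a: "\<alpha> \<in> S" "\<beta> \<in> S" and x: "x \<in> Obj (Fib E U)"
    and f: "f \<in> hom (Fib E (Dom X \<alpha>)) (dloc d \<alpha>) (ResO E \<alpha> x)" and g: "g \<in> hom (Fib E (Dom X \<beta>)) (dloc d \<beta>) (ResO E \<beta> x)"
  shows "(\<alpha>, x, f) \<cdot>[Tot X E] Th d \<alpha> \<beta> = (\<beta>, x, g) \<cdot>[Tot X E] c2 d \<alpha> \<beta> \<longleftrightarrow>
    ResA E (pr1 X \<alpha> \<beta>) f \<cdot>[Fib E (pb_ob X \<alpha> \<beta>)] dtheta d (\<alpha>, \<beta>) = sigma X E \<alpha> \<beta> x \<cdot>[Fib E (pb_ob X \<alpha> \<beta>)] ResA E (pr2 X \<alpha> \<beta>) g"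
proof -
  let ?W = "Fib E (pb_ob X \<alpha> \<beta>)"
  have C: "category ?W" using a E.Fib_category by simp
  note sh = shapeD[OF d] shape_simps[OF d]
  have f': "f \<in> Arr (Fib E (Dom X \<alpha>))" "Dom (Fib E (Dom X \<alpha>)) f = dloc d \<alpha>" "Cod (Fib E (Dom X \<alpha>)) f = ResO E \<alpha> x"
    and g': "g \<in> Arr (Fib E (Dom X \<beta>))" "Dom (Fib E (Dom X \<beta>)) g = dloc d \<beta>" "Cod (Fib E (Dom X \<beta>)) g = ResO E \<beta> x"
    using f g by (auto simp: in_hom)
  have K1: "Cmp E \<alpha> (pr1 X \<alpha> \<beta>) x \<in> isos ?W (ResO E (pr1 X \<alpha> \<beta>) (ResO E \<alpha> x)) (ResO E (\<alpha> \<cdot>[X] pr1 X \<alpha> \<beta>) x)"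
    using E.Cmp_isos[of \<alpha> "pr1 X \<alpha> \<beta>" x] a x by simp
  note k = category.isos_Arr[OF C K1] and s = category.isos_Arr[OF C sigma_simps(1)[OF a x]]
  let ?x = "ResA E (pr1 X \<alpha> \<beta>) f \<cdot>[?W] dtheta d (\<alpha>, \<beta>)" and ?y = "sigma X E \<alpha> \<beta> x \<cdot>[?W] ResA E (pr2 X \<alpha> \<beta>) g"
  have e: "Cmp E \<alpha> (pr1 X \<alpha> \<beta>) x \<cdot>[?W] ?y = Cmp E \<beta> (pr2 X \<alpha> \<beta>) x \<cdot>[?W] ResA E (pr2 X \<alpha> \<beta>) g"
    by (rule category.compose_eq[OF C sigma_simps(2)[OF a x]]) (use a g' k s in auto)
  have "(\<alpha>, x, f) \<cdot>[Tot X E] Th d \<alpha> \<beta> = (\<alpha> \<cdot>[X] pr1 X \<alpha> \<beta>, x, Cmp E \<alpha> (pr1 X \<alpha> \<beta>) x \<cdot>[?W] ?x)"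
    using a by (simp add: Th_def)
  moreover have "(\<beta>, x, g) \<cdot>[Tot X E] c2 d \<alpha> \<beta> = (\<beta> \<cdot>[X] pr2 X \<alpha> \<beta>, x, Cmp E \<alpha> (pr1 X \<alpha> \<beta>) x \<cdot>[?W] ?y)"
    using a e g' x sh by (simp add: c2_def)
  moreover have "Cmp E \<alpha> (pr1 X \<alpha> \<beta>) x \<cdot>[?W] ?x = Cmp E \<alpha> (pr1 X \<alpha> \<beta>) x \<cdot>[?W] ?y \<longleftrightarrow> ?x = ?y"
    using category.iso_cancel_left[OF C K1, of ?x ?y] a f' g' sh s by auto
  ultimately show ?thesis using pr_eq[OF a] by simp
qed

lemma psi_iff:
  assumes d: "shape d" and a: "\<alpha> \<in> S" and x: "x \<in> Obj (Fib E U)"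
    and f: "f \<in> hom (Fib E (Dom X \<alpha>)) (dloc d \<alpha>) (ResO E \<alpha> x)" and g: "g \<in> hom (Fib B U) (dbase d) (NatO p U x)"
  shows "B.vt U g \<cdot>[Tot X B] ps d \<alpha> = totA X B p (\<alpha>, x, f) \<longleftrightarrow>
     ResA B \<alpha> g \<cdot>[Fib B (Dom X \<alpha>)] dpsi d \<alpha> = NatC p \<alpha> x \<cdot>[Fib B (Dom X \<alpha>)] NatA p (Dom X \<alpha>) f"
proof -
  note sh = shapeD[OF d] shape_simps[OF d]
  have g': "g \<in> Arr (Fib B U)" "Dom (Fib B U) g = dbase d" "Cod (Fib B U) g = NatO p U x" using g by (auto simp: in_hom)
  have "B.vt U g \<cdot>[Tot X B] ps d \<alpha> = (\<alpha>, NatO p U x, ResA B \<alpha> g \<cdot>[Fib B (Dom X \<alpha>)] dpsi d \<alpha>)"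
    using B.vt_comp[of \<alpha> "dbase d" "dpsi d \<alpha>" g] a sh g' unfolding ps_def by (simp del: total_simps(6))
  then show ?thesis using a by simp
qed

section \<open>The comparison functor \<Phi> and its full faithfulness\<close>

abbreviation "PO \<equiv> PhiO X E p U S"
abbreviation "PA \<equiv> PhiA X E p U S"

lemma PO_simps [simp]:
  "dbase (PO x) = NatO p U x" "\<alpha> \<in> S \<Longrightarrow> dloc (PO x) \<alpha> = ResO E \<alpha> x" "\<alpha> \<in> S \<Longrightarrow> dpsi (PO x) \<alpha> = NatC p \<alpha> x"
  "\<alpha> \<in> S \<Longrightarrow> \<beta> \<in> S \<Longrightarrow> dtheta (PO x) (\<alpha>, \<beta>) = sigma X E \<alpha> \<beta> x"
  by (simp_all add: PhiO_def)

lemma PO_shape: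
  assumes x: "x \<in> Obj (Fib E U)" shows "shape (PO x)"
proof -
  have "NatC p \<alpha> x \<in> isos (Fib B (Dom X \<alpha>)) (NatO p (Dom X \<alpha>) (ResO E \<alpha> x)) (ResO B \<alpha> (NatO p U x))" if "\<alpha> \<in> S" for \<alpha>
    using NatC_isos[of \<alpha> x] that x by simp
  then show ?thesis
    unfolding shape_def using x sigma_simps(1)[of _ _ x] by (auto simp: PhiO_def)
qed

lemma PO_cone:
  assumes x: "x \<in> Obj (Fib E U)" and a: "\<alpha> \<in> S" "\<beta> \<in> S"
  shows "E.ci \<alpha> x \<cdot>[Tot X E] Th (PO x) \<alpha> \<beta> = E.ci \<beta> x \<cdot>[Tot X E] c2 (PO x) \<alpha> \<beta>"
proof -
  note s = category.isos_Arr[OF E.Fib_category sigma_simps(1)[OF a x]]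
  show ?thesis
    by (rule cone_iff[OF PO_shape[OF x] a x, THEN iffD2]) (use a x s in \<open>auto simp: in_hom\<close>)
qed

lemma PO_ps: "x \<in> Obj (Fib E U) \<Longrightarrow> \<alpha> \<in> S \<Longrightarrow> ps (PO x) \<alpha> = totA X B p (E.ci \<alpha> x)"
  by (simp add: ps_def)

lemma PO_ea: "\<alpha> \<in> S \<Longrightarrow> ea (PO x) \<alpha> = (Dom X \<alpha>, ResO E \<alpha> x)"
  by (simp add: ea_def)

text \<open>The chosen lifts with target \<open>x\<close> form the cone required by
  \<open>laws_of_cone\<close>; the condition over \<open>B\<close> is the image of the cone equation
  under \<open>p\<close>.\<close>

lemma PO_DO: assumes x: "x \<in> Obj (Fib E U)" shows "PO x \<in> DO"
  unfolding descent_objects_iff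
proof (intro conjI PO_shape[OF x] laws_of_cone[where j = "\<lambda>\<alpha>. E.ci \<alpha> x"])
  fix \<alpha> assume a: "\<alpha> \<in> S"
  show "cartesian X (Tot X E) (E.ci \<alpha> x)" by (rule E.ci_cartesian) (use a x in auto)
  show "Dom (Tot X E) (E.ci \<alpha> x) = ea (PO x) \<alpha>" using a x by (simp add: PO_ea)
  fix \<beta> assume b: "\<beta> \<in> S"
  show "E.ci \<alpha> x \<cdot>[Tot X E] Th (PO x) \<alpha> \<beta> = E.ci \<beta> x \<cdot>[Tot X E] c2 (PO x) \<alpha> \<beta>" by (rule PO_cone[OF x a b])
  note t = shape_total2[OF PO_shape[OF x] a b]
  have "totA X B p (E.ci \<beta> x \<cdot>[Tot X E] c2 (PO x) \<alpha> \<beta>) = totA X B p (E.ci \<beta> x) \<cdot>[Tot X B] totA X B p (c2 (PO x) \<alpha> \<beta>)"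
    by (rule PF.FA_comp) (use t a b x in \<open>auto simp: PO_ea simp del: total_simps(6)\<close>)
  moreover have "totA X B p (E.ci \<alpha> x \<cdot>[Tot X E] Th (PO x) \<alpha> \<beta>) = totA X B p (E.ci \<alpha> x) \<cdot>[Tot X B] totA X B p (Th (PO x) \<alpha> \<beta>)"
    by (rule PF.FA_comp) (use t a b x in \<open>auto simp: PO_ea simp del: total_simps(6)\<close>)
  ultimately show "ps (PO x) \<beta> \<cdot>[Tot X B] totA X B p (c2 (PO x) \<alpha> \<beta>) = ps (PO x) \<alpha> \<cdot>[Tot X B] totA X B p (Th (PO x) \<alpha> \<beta>)"
    unfolding PO_ps[OF x a] PO_ps[OF x b] PO_cone[OF x a b] by simp
qed

text \<open>An arrow of descent data into \<open>\<Phi>(x)\<close> is the same as a compatible family of arrows into \<open>x\<close>.\<close>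

lemma DA_to_PO:
  assumes d: "d \<in> DO" and x: "x \<in> Obj (Fib E U)"
    and f: "\<And>\<alpha>. \<alpha> \<in> S \<Longrightarrow> f \<alpha> \<in> hom (Fib E (Dom X \<alpha>)) (dloc d \<alpha>) (ResO E \<alpha> x)" and fe: "f \<in> extensional S"
    and g: "g \<in> hom (Fib B U) (dbase d) (NatO p U x)"
  shows "\<lparr>asrc = d, atgt = PO x, abase = g, aloc = f\<rparr> \<in> DA \<longleftrightarrow>
    (\<forall>\<alpha>\<in>S. \<forall>\<beta>\<in>S. (\<alpha>, x, f \<alpha>) \<cdot>[Tot X E] Th d \<alpha> \<beta> = (\<beta>, x, f \<beta>) \<cdot>[Tot X E] c2 d \<alpha> \<beta>) \<and>
    (\<forall>\<alpha>\<in>S. B.vt U g \<cdot>[Tot X B] ps d \<alpha> = totA X B p (\<alpha>, x, f \<alpha>))"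
  (is "?k \<in> DA \<longleftrightarrow> ?R1 \<and> ?R2")
proof -
  have "?k \<in> DA \<longleftrightarrow> (\<forall>\<alpha>\<in>S. \<forall>\<beta>\<in>S. ResA E (pr1 X \<alpha> \<beta>) (f \<alpha>) \<cdot>[Fib E (pb_ob X \<alpha> \<beta>)] dtheta d (\<alpha>, \<beta>) =
        sigma X E \<alpha> \<beta> x \<cdot>[Fib E (pb_ob X \<alpha> \<beta>)] ResA E (pr2 X \<alpha> \<beta>) (f \<beta>)) \<and>
     (\<forall>\<alpha>\<in>S. ResA B \<alpha> g \<cdot>[Fib B (Dom X \<alpha>)] dpsi d \<alpha> = NatC p \<alpha> x \<cdot>[Fib B (Dom X \<alpha>)] NatA p (Dom X \<alpha>) (f \<alpha>))"
    using d PO_DO[OF x] f fe g by (simp add: descent_arrows_def PiE_def Pi_def)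
  also have "\<dots> \<longleftrightarrow> ?R1 \<and> ?R2"
    using cone_iff[OF DO_shape[OF d] _ _ x f f] psi_iff[OF DO_shape[OF d] _ x f g] by simp
  finally show ?thesis .
qed

lemma DA_to_PO_D:
  assumes k: "k \<in> DA" and x: "x \<in> Obj (Fib E U)" "atgt k = PO x"
  shows "\<And>\<alpha>. \<alpha> \<in> S \<Longrightarrow> (\<alpha>, x, aloc k \<alpha>) \<in> Arr (Tot X E)"
    "\<And>\<alpha>. \<alpha> \<in> S \<Longrightarrow> Dom (Tot X E) (\<alpha>, x, aloc k \<alpha>) = ea (asrc k) \<alpha>"
    "\<And>\<alpha> \<beta>. \<alpha> \<in> S \<Longrightarrow> \<beta> \<in> S \<Longrightarrow> (\<alpha>, x, aloc k \<alpha>) \<cdot>[Tot X E] Th (asrc k) \<alpha> \<beta> = (\<beta>, x, aloc k \<beta>) \<cdot>[Tot X E] c2 (asrc k) \<alpha> \<beta>"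
    "\<And>\<alpha>. \<alpha> \<in> S \<Longrightarrow> B.vt U (abase k) \<cdot>[Tot X B] ps (asrc k) \<alpha> = totA X B p (\<alpha>, x, aloc k \<alpha>)"
proof -
  note K = descent_arrowsD[OF k]
  show "(\<alpha>, x, aloc k \<alpha>) \<in> Arr (Tot X E)" "Dom (Tot X E) (\<alpha>, x, aloc k \<alpha>) = ea (asrc k) \<alpha>" if "\<alpha> \<in> S" for \<alpha>
    using K(9-11)[OF that] that x by (auto simp: ea_def)
  have "k = \<lparr>asrc = asrc k, atgt = PO x, abase = abase k, aloc = aloc k\<rparr>" using x by (intro descent_arr.equality) auto
  then have "\<lparr>asrc = asrc k, atgt = PO x, abase = abase k, aloc = aloc k\<rparr> \<in> DA" using k by simp
  then have "(\<forall>\<alpha>\<in>S. \<forall>\<beta>\<in>S. (\<alpha>, x, aloc k \<alpha>) \<cdot>[Tot X E] Th (asrc k) \<alpha> \<beta> = (\<beta>, x, aloc k \<beta>) \<cdot>[Tot X E] c2 (asrc k) \<alpha> \<beta>) \<and>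
    (\<forall>\<alpha>\<in>S. B.vt U (abase k) \<cdot>[Tot X B] ps (asrc k) \<alpha> = totA X B p (\<alpha>, x, aloc k \<alpha>))"
    by (subst (asm) DA_to_PO) (use K x in \<open>auto simp: in_hom\<close>)
  then show "\<And>\<alpha> \<beta>. \<alpha> \<in> S \<Longrightarrow> \<beta> \<in> S \<Longrightarrow> (\<alpha>, x, aloc k \<alpha>) \<cdot>[Tot X E] Th (asrc k) \<alpha> \<beta> = (\<beta>, x, aloc k \<beta>) \<cdot>[Tot X E] c2 (asrc k) \<alpha> \<beta>"
    "\<And>\<alpha>. \<alpha> \<in> S \<Longrightarrow> B.vt U (abase k) \<cdot>[Tot X B] ps (asrc k) \<alpha> = totA X B p (\<alpha>, x, aloc k \<alpha>)" by blast+
qed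

text \<open>Each local component is the chosen lift followed by the vertical arrow of \<phi>, so
  both conditions follow from the cone equations at the source.\<close>

lemma PA_DA:
  assumes \<phi>: "\<phi> \<in> Arr (Fib E U)"
  shows "PA \<phi> \<in> DA"
proof -
  define x where "x = Dom (Fib E U) \<phi>"
  define y where "y = Cod (Fib E U) \<phi>"
  have xy: "x \<in> Obj (Fib E U)" "y \<in> Obj (Fib E U)" "Dom (Fib E U) \<phi> = x" "Cod (Fib E U) \<phi> = y" using \<phi> by (auto simp: x_def y_def)
  have vA: "E.vt U \<phi> \<in> Arr (Tot X E)" "Dom (Tot X E) (E.vt U \<phi>) = (U, x)" using \<phi> xy by auto
  have vc: "(\<alpha>, y, ResA E \<alpha> \<phi>) = E.vt U \<phi> \<cdot>[Tot X E] E.ci \<alpha> x" if "\<alpha> \<in> S" for \<alpha>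
    using E.vt_comp[of \<alpha> x "Id (Fib E (Dom X \<alpha>)) (ResO E \<alpha> x)" \<phi>] that \<phi> xy by simp
  have cA: "E.ci \<alpha> x \<in> Arr (Tot X E)" "Dom (Tot X E) (E.ci \<alpha> x) = ea (PO x) \<alpha>" "Cod (Tot X E) (E.ci \<alpha> x) = (U, x)" if "\<alpha> \<in> S" for \<alpha>
    using that xy by (auto simp: PO_ea)
  have "PA \<phi> = \<lparr>asrc = PO x, atgt = PO y, abase = NatA p U \<phi>, aloc = (\<lambda>\<alpha>\<in>S. ResA E \<alpha> \<phi>)\<rparr>"
    using xy by (simp add: PhiA_def)
  moreover have "\<lparr>asrc = PO x, atgt = PO y, abase = NatA p U \<phi>, aloc = (\<lambda>\<alpha>\<in>S. ResA E \<alpha> \<phi>)\<rparr> \<in> DA"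
  proof (subst DA_to_PO)
    have "(\<alpha>, y, ResA E \<alpha> \<phi>) \<cdot>[Tot X E] Th (PO x) \<alpha> \<beta> = (\<beta>, y, ResA E \<beta> \<phi>) \<cdot>[Tot X E] c2 (PO x) \<alpha> \<beta>" if a: "\<alpha> \<in> S" "\<beta> \<in> S" for \<alpha> \<beta>
    proof -
      note t = shape_total2[OF PO_shape[OF xy(1)] a]
      have "(E.vt U \<phi> \<cdot>[Tot X E] E.ci \<alpha> x) \<cdot>[Tot X E] Th (PO x) \<alpha> \<beta> = E.vt U \<phi> \<cdot>[Tot X E] (E.ci \<alpha> x \<cdot>[Tot X E] Th (PO x) \<alpha> \<beta>)"
        by (rule E.T.assoc) (use t a cA[OF a(1)] vA in auto)
      moreover have "(E.vt U \<phi> \<cdot>[Tot X E] E.ci \<beta> x) \<cdot>[Tot X E] c2 (PO x) \<alpha> \<beta> = E.vt U \<phi> \<cdot>[Tot X E] (E.ci \<beta> x \<cdot>[Tot X E] c2 (PO x) \<alpha> \<beta>)"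
        by (rule E.T.assoc) (use t a cA[OF a(2)] vA in auto)
      ultimately show ?thesis unfolding vc[OF a(1)] vc[OF a(2)] PO_cone[OF xy(1) a] by simp
    qed
    moreover have "B.vt U (NatA p U \<phi>) \<cdot>[Tot X B] ps (PO x) \<alpha> = totA X B p (\<alpha>, y, ResA E \<alpha> \<phi>)" if a: "\<alpha> \<in> S" for \<alpha>
    proof -
      have "totA X B p (E.vt U \<phi> \<cdot>[Tot X E] E.ci \<alpha> x) = totA X B p (E.vt U \<phi>) \<cdot>[Tot X B] totA X B p (E.ci \<alpha> x)"
        by (rule PF.FA_comp) (use a cA[OF a] vA in auto)
      then show ?thesis unfolding vc[OF a] PO_ps[OF xy(1) a] using totA_vt[OF U \<phi>] by simp
    qed
    ultimately show "(\<forall>\<alpha>\<in>S. \<forall>\<beta>\<in>S. (\<alpha>, y, (\<lambda>\<alpha>\<in>S. ResA E \<alpha> \<phi>) \<alpha>) \<cdot>[Tot X E] Th (PO x) \<alpha> \<beta> = (\<beta>, y, (\<lambda>\<alpha>\<in>S. ResA E \<alpha> \<phi>) \<beta>) \<cdot>[Tot X E] c2 (PO x) \<alpha> \<beta>) \<and>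
      (\<forall>\<alpha>\<in>S. B.vt U (NatA p U \<phi>) \<cdot>[Tot X B] ps (PO x) \<alpha> = totA X B p (\<alpha>, y, (\<lambda>\<alpha>\<in>S. ResA E \<alpha> \<phi>) \<alpha>))"
      by (simp del: total_simps(6) tot_simps)
  qed (use xy \<phi> PO_DO in \<open>auto simp: in_hom\<close>)
  ultimately show ?thesis by simp
qed

lemma Phi_functor: "cat_functor (Fib E U) D PO PA"
proof (intro cat_functor.intro cat_functor_axioms.intro)
  show "category (Fib E U)" "category D" using E.Fib_category Desc_category by auto
  show "PO x \<in> Obj D" if "x \<in> Obj (Fib E U)" for x using PO_DO that by simp
  show "PA f \<in> hom D (PO x) (PO y)" if "f \<in> hom (Fib E U) x y" for f x y
    using that PA_DA[of f] by (auto simp: in_hom PhiA_def)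
  show "PA (Id (Fib E U) x) = Id D (PO x)" if x: "x \<in> Obj (Fib E U)" for x
    using x by (intro descent_arr.equality) (auto simp: PhiA_def intro: restrict_ext)
  show "PA (g \<cdot>[Fib E U] f) = PA g \<cdot>[D] PA f" if "f \<in> hom (Fib E U) x y" "g \<in> hom (Fib E U) y z" for f g x y z
    using that by (intro descent_arr.equality) (auto simp: PhiA_def in_hom intro: restrict_ext)
qed

text \<open>The local components of \<open>k\<close>, read as arrows into \<open>y\<close>, are
  compatible along the chosen lifts with target \<open>x\<close>, so they glue in \<open>E\<close>.
  That the base component is the right one follows from separatedness of \<open>B\<close>.\<close>

lemma Phi_full:
  assumes k: "k \<in> DA" and x: "x \<in> Obj (Fib E U)" "asrc k = PO x" and y: "y \<in> Obj (Fib E U)" "atgt k = PO y"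
  shows "\<exists>\<phi>\<in>hom (Fib E U) x y. PA \<phi> = k"
proof -
  note K = descent_arrowsD[OF k] and KP = DA_to_PO_D[OF k y]
  define n where "n \<alpha> = (\<alpha>, y, aloc k \<alpha>)" for \<alpha>
  have n: "n \<alpha> \<in> Arr (Tot X E)" "Dom (Tot X E) (n \<alpha>) = ea (PO x) \<alpha>" "Cod (Tot X E) (n \<alpha>) = (U, y)" "fst (n \<alpha>) = \<alpha>" if "\<alpha> \<in> S" for \<alpha>
    using KP(1,2)[OF that] x that unfolding n_def by auto
  have nT: "n \<alpha> \<cdot>[Tot X E] Th (PO x) \<alpha> \<beta> = n \<beta> \<cdot>[Tot X E] c2 (PO x) \<alpha> \<beta>" if "\<alpha> \<in> S" "\<beta> \<in> S" for \<alpha> \<beta>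
    using KP(3)[OF that] x by (simp add: n_def del: total_simps(6))
  have ci: "E.ci \<alpha> x \<in> Arr (Tot X E)" "Dom (Tot X E) (E.ci \<alpha> x) = ea (PO x) \<alpha>" "Cod (Tot X E) (E.ci \<alpha> x) = (U, x)"
    "cartesian X (Tot X E) (E.ci \<alpha> x)" if "\<alpha> \<in> S" for \<alpha>
    using that x E.ci_cartesian[of \<alpha> x] by (auto simp: PO_ea)
  have d: "shape (PO x)" by (rule PO_shape[OF x(1)])
  have "\<exists>m. m \<in> hom (Tot X E) (U, x) (U, y) \<and> fst m = Id X U \<and> (\<forall>u\<in>S. m \<cdot>[Tot X E] E.ci u x = n u)"
  proof (rule TE.glue_cart)
    fix u v w assume u: "u \<in> S" and v: "v \<in> Arr X" "Cod X v = Dom X u" and w: "w \<in> Arr (Tot X E)"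
       "Dom (Tot X E) w = Dom (Tot X E) (E.ci (u \<cdot>[X] v) x)" "Cod (Tot X E) w = Dom (Tot X E) (E.ci u x)" "fst w = v"
       and e: "E.ci u x \<cdot>[Tot X E] w = E.ci (u \<cdot>[X] v) x"
    have uv: "u \<cdot>[X] v \<in> S" using u v by simp
    note o = shape_total[OF d uv]
    let ?q = "Id (Tot X E) (ea (PO x) (u \<cdot>[X] v))"
    have q: "?q \<in> Arr (Tot X E)" "Cod (Tot X E) ?q = ea (PO x) (u \<cdot>[X] v)" "u \<cdot>[X] v = (u \<cdot>[X] v) \<cdot>[X] fst ?q" "fst ?q = Id X (Dom X v)"
      using o E.T.base.FA_Id[OF o(1)] u v by auto
    note T = Tr_simps[OF d u uv q(1,2) v q(3)]
    \<comment> \<open>Exhibiting \<open>w\<close> as \<open>Tr\<close> of an identity lets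
      \<open>Tr_cone\<close> turn the conditions on fibre products into compatibility along the
      sieve.\<close>
    have "E.ci u x \<cdot>[Tot X E] Tr (PO x) u (u \<cdot>[X] v) v ?q = E.ci (u \<cdot>[X] v) x \<cdot>[Tot X E] ?q"
      by (rule Tr_cone[where j = "\<lambda>\<alpha>. E.ci \<alpha> x", OF d ci(1,2) PO_cone[OF x(1) u uv] u uv q(1,2) v q(3)])
    also have "\<dots> = E.ci u x \<cdot>[Tot X E] w" unfolding e by (rule E.T.Id_right) (use ci[OF uv] in auto)
    finally have "Tr (PO x) u (u \<cdot>[X] v) v ?q = w"
      by (rule E.T.cart_unique[OF ci(4)[OF u], rotated -1]) (use T w ci[OF u] in auto)
    moreover have "n u \<cdot>[Tot X E] Tr (PO x) u (u \<cdot>[X] v) v ?q = n (u \<cdot>[X] v) \<cdot>[Tot X E] ?q"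
      by (rule Tr_cone[OF d n(1,2) nT[OF u uv] u uv q(1,2) v q(3)])
    moreover have "n (u \<cdot>[X] v) \<cdot>[Tot X E] ?q = n (u \<cdot>[X] v)" by (rule E.T.Id_right) (use n[OF uv] in auto)
    ultimately show "n u \<cdot>[Tot X E] w = n (u \<cdot>[X] v)" by simp
  next
    fix u assume u: "u \<in> S"
    show "n u \<in> hom (Tot X E) (Dom (Tot X E) (E.ci u x)) (U, y) \<and> fst (n u) = Id X U \<cdot>[X] u"
      unfolding ci(2)[OF u] using n[OF u] u by (simp add: in_hom)
  qed (use S x y ci in \<open>auto simp: in_hom\<close>)
  then obtain m where m: "m \<in> Arr (Tot X E)" "Dom (Tot X E) m = (U, x)" "Cod (Tot X E) m = (U, y)" "fst m = Id X U"
    and mu: "\<And>u. u \<in> S \<Longrightarrow> m \<cdot>[Tot X E] E.ci u x = n u" unfolding in_hom by blast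
  obtain \<phi> where \<phi>: "\<phi> \<in> Arr (Fib E U)" "m = E.vt U \<phi>" by (rule E.vertical_vt[OF m(1,4) U])
  have \<phi>d: "Dom (Fib E U) \<phi> = x" "Cod (Fib E U) \<phi> = y" using m \<phi> by auto
  have loc: "ResA E u \<phi> = aloc k u" if "u \<in> S" for u
    using mu[OF that] E.vt_comp[of u x "Id (Fib E (Dom X u)) (ResO E u x)" \<phi>] \<phi> \<phi>d x that by (simp add: n_def)
  \<comment> \<open>The gluing took place in \<open>E\<close>; the arrows \<open>ps\<close> are
    cartesian lifts over the cover that separate the two candidates in \<open>B\<close>.\<close>
  have base: "B.vt U (NatA p U \<phi>) = B.vt U (abase k)"
  proof (rule TB.separated[where S = S])
    fix u assume u: "u \<in> S"
    have "totA X B p (m \<cdot>[Tot X E] E.ci u x) = totA X B p m \<cdot>[Tot X B] totA X B p (E.ci u x)"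
      by (rule PF.FA_comp) (use ci[OF u] m in auto)
    then have "B.vt U (NatA p U \<phi>) \<cdot>[Tot X B] ps (PO x) u = totA X B p (n u)"
      unfolding mu[OF u] PO_ps[OF x(1) u] using totA_vt[OF U \<phi>(1)] \<phi>(2) by simp
    also have "\<dots> = B.vt U (abase k) \<cdot>[Tot X B] ps (PO x) u" using KP(4)[OF u] x by (simp add: n_def)
    finally have e: "B.vt U (NatA p U \<phi>) \<cdot>[Tot X B] ps (PO x) u = B.vt U (abase k) \<cdot>[Tot X B] ps (PO x) u" .
    show "\<exists>q. cartesian X (Tot X B) q \<and> Cod (Tot X B) q = Dom (Tot X B) (B.vt U (NatA p U \<phi>)) \<and> fst q = u \<and>
       B.vt U (NatA p U \<phi>) \<cdot>[Tot X B] q = B.vt U (abase k) \<cdot>[Tot X B] q"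
      by (rule exI[of _ "ps (PO x) u"]) (use e shape_total[OF d u] \<phi> \<phi>d in auto)
  qed (use S \<phi> \<phi>d K(5-7) x y in auto)
  have "NatA p U \<phi> = abase k" by (rule B.vt_inj[OF U _ _ base]) (use \<phi> K in auto)
  moreover have "(\<lambda>\<alpha>\<in>S. ResA E \<alpha> \<phi>) = aloc k" by (rule extensionalityI[where A = S]) (use K(8) loc in auto)
  ultimately have "PA \<phi> = k" using \<phi>d x y by (intro descent_arr.equality) (auto simp: PhiA_def)
  then show ?thesis using \<phi> \<phi>d by (auto simp: in_hom)
qed

text \<open>Injectivity is separatedness of \<open>E\<close> along the chosen lifts, and
  surjectivity is the gluing of \<open>Phi_full\<close>.\<close>

lemma Phi_ff: "full_and_faithful (Fib E U) D PO PA"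
  unfolding full_and_faithful_def bij_betw_def
proof (intro ballI conjI)
  fix x y assume x: "x \<in> Obj (Fib E U)" and y: "y \<in> Obj (Fib E U)"
  show "inj_on PA (hom (Fib E U) x y)"
  proof (rule inj_onI)
    fix \<phi> \<psi> assume "\<phi> \<in> hom (Fib E U) x y" "\<psi> \<in> hom (Fib E U) x y" and eq: "PA \<phi> = PA \<psi>"
    then have \<phi>: "\<phi> \<in> Arr (Fib E U)" "Dom (Fib E U) \<phi> = x" "Cod (Fib E U) \<phi> = y" and \<psi>: "\<psi> \<in> Arr (Fib E U)" "Dom (Fib E U) \<psi> = x" "Cod (Fib E U) \<psi> = y"
      by (auto simp: in_hom)
    have r: "ResA E u \<phi> = ResA E u \<psi>" if "u \<in> S" for u
      using arg_cong[OF eq, of "\<lambda>k. aloc k u"] that by (simp add: PhiA_def)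
    have "E.vt U \<phi> = E.vt U \<psi>"
    proof (rule TE.separated[where S = S])
      fix u assume u: "u \<in> S"
      show "\<exists>q. cartesian X (Tot X E) q \<and> Cod (Tot X E) q = Dom (Tot X E) (E.vt U \<phi>) \<and> fst q = u \<and>
         E.vt U \<phi> \<cdot>[Tot X E] q = E.vt U \<psi> \<cdot>[Tot X E] q"
        using E.vt_comp[of u x "Id (Fib E (Dom X u)) (ResO E u x)" \<phi>] E.vt_comp[of u x "Id (Fib E (Dom X u)) (ResO E u x)" \<psi>] r[OF u] x u \<phi> \<psi> E.ci_cartesian[of u x]
        by (intro exI[of _ "E.ci u x"]) simp
    qed (use S \<phi> \<psi> x y in auto)
    then show "\<phi> = \<psi>" by (rule E.vt_inj[OF U, rotated -1]) (use \<phi> \<psi> in auto)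
  qed
  show "PA ` hom (Fib E U) x y = hom D (PO x) (PO y)"
  proof (intro equalityI subsetI)
    fix k assume "k \<in> PA ` hom (Fib E U) x y"
    then show "k \<in> hom D (PO x) (PO y)" using cat_functor.FA_hom[OF Phi_functor] by blast
  next
    fix k assume "k \<in> hom D (PO x) (PO y)"
    then show "k \<in> PA ` hom (Fib E U) x y" using Phi_full[of k x y] x y by (auto simp: in_hom)
  qed
qed

end

section \<open>Effective descent and local fibrations\<close>

context descent_setting begin

text \<open>\<Phi> is fully faithful, so only essential surjectivity is at stake: a datum is turned
  into a family on the sieve, glued there, and the resulting cone is read back as an isomorphism of
  descent data.\<close>

lemma effective_imp_equivalence:
  assumes eff: "effective X (Tot X E) (Tot X B) (totO p) (totA X B p) U S"
  shows "equivalence_of_categories (Fib E U) D PO PA"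
proof (rule cat_functor.equivalenceI[OF Phi_functor Phi_ff])
  fix d assume "d \<in> Obj D"
  then have dD: "d \<in> DO" and d: "shape d" and laws: "laws d" by (auto simp: descent_objects_iff)
  let ?I = "\<lambda>\<alpha>. Id (Tot X E) (ea d \<alpha>)"
  \<comment> \<open>Both \<alpha> and \<open>\<alpha> \<cdot>[X] g\<close> belong to the sieve, and
    \<open>g\<close> with the identity is a pair of legs for them; so the gluing isomorphism sends
    the identity to an arrow over \<open>g\<close>.\<close>
  define t where "t \<alpha> g = Tr d \<alpha> (\<alpha> \<cdot>[X] g) g (?I (\<alpha> \<cdot>[X] g))" for \<alpha> g
  have I: "?I \<alpha> \<in> Arr (Tot X E)" "Dom (Tot X E) (?I \<alpha>) = ea d \<alpha>" "Cod (Tot X E) (?I \<alpha>) = ea d \<alpha>" "fst (?I \<alpha>) = Id X (Dom X \<alpha>)"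
    "cartesian X (Tot X E) (?I \<alpha>)" if "\<alpha> \<in> S" for \<alpha>
    using shape_total[OF d that] E.T.base.FA_Id[of "ea d \<alpha>"] E.T.cart_Id by auto
  have law2: "Tr d \<alpha> \<beta> r (Tr d \<beta> \<gamma> s q) = Tr d \<alpha> \<gamma> r q"
    if "\<alpha> \<in> S" "\<beta> \<in> S" "\<gamma> \<in> S" "r \<in> Arr X" "s \<in> Arr X" "q \<in> Arr (Tot X E)" "Cod (Tot X E) q = ea d \<gamma>"
       "Cod X r = Dom X \<alpha>" "Cod X s = Dom X \<beta>" "\<alpha> \<cdot>[X] r = \<beta> \<cdot>[X] s" "\<beta> \<cdot>[X] s = \<gamma> \<cdot>[X] fst q" for \<alpha> \<beta> \<gamma> r s q
    using laws that unfolding laws_def by blast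
  have law3: "ps d \<beta> \<cdot>[Tot X B] totA X B p (c2 d \<alpha> \<beta>) = ps d \<alpha> \<cdot>[Tot X B] totA X B p (Th d \<alpha> \<beta>)" if "\<alpha> \<in> S" "\<beta> \<in> S" for \<alpha> \<beta>
    using laws that unfolding laws_def by blast
  have t: "t \<alpha> g \<in> Arr (Tot X E)" "Dom (Tot X E) (t \<alpha> g) = ea d (\<alpha> \<cdot>[X] g)" "Cod (Tot X E) (t \<alpha> g) = ea d \<alpha>" "fst (t \<alpha> g) = g"
     "cartesian X (Tot X E) (t \<alpha> g)" if "\<alpha> \<in> S" "g \<in> Arr X" "Cod X g = Dom X \<alpha>" for \<alpha> g
  proof -
    have ag: "\<alpha> \<cdot>[X] g \<in> S" using that by simp
    have e: "\<alpha> \<cdot>[X] g = (\<alpha> \<cdot>[X] g) \<cdot>[X] fst (?I (\<alpha> \<cdot>[X] g))" using I[OF ag] ag that by simp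
    note T = Tr_simps[OF d that(1) ag I(1)[OF ag] I(3)[OF ag] that(2,3) e]
    show "t \<alpha> g \<in> Arr (Tot X E)" "Dom (Tot X E) (t \<alpha> g) = ea d (\<alpha> \<cdot>[X] g)" "Cod (Tot X E) (t \<alpha> g) = ea d \<alpha>" "fst (t \<alpha> g) = g"
     "cartesian X (Tot X E) (t \<alpha> g)" unfolding t_def using T I[OF ag] by auto
  qed
  have fam: "descent_family X (Tot X E) S (ea d) t"
    unfolding descent_family_def
  proof (intro conjI ballI impI)
    fix \<alpha> assume a: "\<alpha> \<in> S"
    show "ea d \<alpha> \<in> Obj (Tot X E)" "fst (ea d \<alpha>) = Dom X \<alpha>" using shape_total[OF d a] by auto
    fix g assume g: "g \<in> Arr X" "Cod X g = Dom X \<alpha>"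
    show "t \<alpha> g \<in> hom (Tot X E) (ea d (\<alpha> \<cdot>[X] g)) (ea d \<alpha>)" "fst (t \<alpha> g) = g" "cartesian X (Tot X E) (t \<alpha> g)"
      using t[OF a g] by (auto simp: in_hom)
  next
    fix \<alpha> g h assume a: "\<alpha> \<in> S" and gA: "g \<in> Arr X" and hA: "h \<in> Arr X" and c: "Cod X g = Dom X \<alpha> \<and> Cod X h = Dom X g"
    note g = gA c[THEN conjunct1] and h = hA c[THEN conjunct2]
    have ag: "\<alpha> \<cdot>[X] g \<in> S" and h': "Cod X h = Dom X (\<alpha> \<cdot>[X] g)" using a g h by auto
    have agh: "(\<alpha> \<cdot>[X] g) \<cdot>[X] h \<in> S" "(\<alpha> \<cdot>[X] g) \<cdot>[X] h = \<alpha> \<cdot>[X] (g \<cdot>[X] h)" using ag h h' a g by simp_all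
    note t1 = t[OF a g] and t2 = t[OF ag h(1) h']
    \<comment> \<open>Functoriality: naturality of \<open>Tr\<close> brings the second transition
      inside, and the cocycle law for three successive members of the sieve merges the two.\<close>
    have "Tr d \<alpha> (\<alpha> \<cdot>[X] g) (g \<cdot>[X] h) (?I (\<alpha> \<cdot>[X] g) \<cdot>[Tot X E] t (\<alpha> \<cdot>[X] g) h) = t \<alpha> g \<cdot>[Tot X E] t (\<alpha> \<cdot>[X] g) h"
      unfolding t_def[of \<alpha> g]
      by (rule Tr_nat) (use d a ag g h I[OF ag] t2 in auto)
    moreover have "?I (\<alpha> \<cdot>[X] g) \<cdot>[Tot X E] t (\<alpha> \<cdot>[X] g) h = Tr d (\<alpha> \<cdot>[X] g) ((\<alpha> \<cdot>[X] g) \<cdot>[X] h) h (?I ((\<alpha> \<cdot>[X] g) \<cdot>[X] h))"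
      using t2 by (simp add: t_def[symmetric])
    moreover have "Tr d \<alpha> (\<alpha> \<cdot>[X] g) (g \<cdot>[X] h) (Tr d (\<alpha> \<cdot>[X] g) ((\<alpha> \<cdot>[X] g) \<cdot>[X] h) h (?I ((\<alpha> \<cdot>[X] g) \<cdot>[X] h))) = Tr d \<alpha> ((\<alpha> \<cdot>[X] g) \<cdot>[X] h) (g \<cdot>[X] h) (?I ((\<alpha> \<cdot>[X] g) \<cdot>[X] h))"
      by (rule law2) (use a ag agh(1) g h I[OF agh(1)] in auto)
    ultimately show "t \<alpha> (g \<cdot>[X] h) = t \<alpha> g \<cdot>[Tot X E] t (\<alpha> \<cdot>[X] g) h"
      unfolding t_def[of \<alpha> "g \<cdot>[X] h"] agh(2) by simp
  qed
  \<comment> \<open>This is \<open>law3\<close> preceded by the factor \<open>n\<close> through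
    which the transition is computed from \<open>Th\<close>.\<close>
  have psT: "ps d \<alpha> \<cdot>[Tot X B] totA X B p (t \<alpha> g) = ps d (\<alpha> \<cdot>[X] g)" if a: "\<alpha> \<in> S" and g: "g \<in> Arr X" "Cod X g = Dom X \<alpha>" for \<alpha> g
  proof -
    have ag: "\<alpha> \<cdot>[X] g \<in> S" using a g by simp
    note tt = shape_total2[OF d a ag]
    obtain n where n: "n \<in> Arr (Tot X E)" "Dom (Tot X E) n = Dom (Tot X E) (?I (\<alpha> \<cdot>[X] g))" "Cod (Tot X E) n = eb d \<alpha> (\<alpha> \<cdot>[X] g)"
    "c2 d \<alpha> (\<alpha> \<cdot>[X] g) \<cdot>[Tot X E] n = ?I (\<alpha> \<cdot>[X] g)" "g = pr1 X \<alpha> (\<alpha> \<cdot>[X] g) \<cdot>[X] fst n" "Tr d \<alpha> (\<alpha> \<cdot>[X] g) g (?I (\<alpha> \<cdot>[X] g)) = Th d \<alpha> (\<alpha> \<cdot>[X] g) \<cdot>[Tot X E] n"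
      by (rule Tr_E[OF d a ag I(1,3)[OF ag] g]) (use I[OF ag] a g in auto)
    have "ps d \<alpha> \<cdot>[Tot X B] totA X B p (t \<alpha> g) = ps d \<alpha> \<cdot>[Tot X B] (totA X B p (Th d \<alpha> (\<alpha> \<cdot>[X] g)) \<cdot>[Tot X B] totA X B p n)"
      unfolding t_def n(6) using PF.FA_comp[of n "Th d \<alpha> (\<alpha> \<cdot>[X] g)"] n(1,3) tt by simp
    also have "\<dots> = ps d (\<alpha> \<cdot>[X] g) \<cdot>[Tot X B] (totA X B p (c2 d \<alpha> (\<alpha> \<cdot>[X] g)) \<cdot>[Tot X B] totA X B p n)"
      by (rule B.T.compose_eq2[OF law3[OF a ag, symmetric]]) (use n(1,3) tt shape_total[OF d a] shape_total[OF d ag] in auto)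
    also have "totA X B p (c2 d \<alpha> (\<alpha> \<cdot>[X] g)) \<cdot>[Tot X B] totA X B p n = totA X B p (?I (\<alpha> \<cdot>[X] g))"
      unfolding n(4)[symmetric] using PF.FA_comp[of n "c2 d \<alpha> (\<alpha> \<cdot>[X] g)"] n(1,3) tt by simp
    also have "\<dots> = Id (Tot X B) (totO p (ea d (\<alpha> \<cdot>[X] g)))" using shape_total[OF d ag] by simp
    also have "ps d (\<alpha> \<cdot>[X] g) \<cdot>[Tot X B] \<dots> = ps d (\<alpha> \<cdot>[X] g)" using shape_total[OF d ag] by simp
    finally show ?thesis .
  qed
  have "\<exists>x j r. x \<in> Obj (Tot X E) \<and> fst x = U \<and>
        (\<forall>\<alpha>\<in>S. j \<alpha> \<in> hom (Tot X E) (ea d \<alpha>) x \<and> fst (j \<alpha>) = \<alpha> \<and> cartesian X (Tot X E) (j \<alpha>)) \<and>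
        (\<forall>\<alpha>\<in>S. \<forall>g\<in>Arr X. Cod X g = Dom X \<alpha> \<longrightarrow> j \<alpha> \<cdot>[Tot X E] t \<alpha> g = j (\<alpha> \<cdot>[X] g)) \<and>
        r \<in> isos (Tot X B) (totO p x) (U, dbase d) \<and> fst r = Id X U \<and> (\<forall>\<alpha>\<in>S. r \<cdot>[Tot X B] totA X B p (j \<alpha>) = ps d \<alpha>)"
    by (rule eff[unfolded effective_def, rule_format]) (use fam psT shape_total[OF d] shapeD[OF d] in \<open>auto simp: in_hom\<close>)
  then obtain x' j r where x': "x' \<in> Obj (Tot X E)" "fst x' = U"
    and j0: "\<And>\<alpha>. \<alpha> \<in> S \<Longrightarrow> j \<alpha> \<in> hom (Tot X E) (ea d \<alpha>) x' \<and> fst (j \<alpha>) = \<alpha> \<and> cartesian X (Tot X E) (j \<alpha>)"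
    and jt: "\<And>\<alpha> g. \<alpha> \<in> S \<Longrightarrow> g \<in> Arr X \<Longrightarrow> Cod X g = Dom X \<alpha> \<Longrightarrow> j \<alpha> \<cdot>[Tot X E] t \<alpha> g = j (\<alpha> \<cdot>[X] g)"
    and r: "r \<in> isos (Tot X B) (totO p x') (U, dbase d)" "fst r = Id X U" and rj: "\<And>\<alpha>. \<alpha> \<in> S \<Longrightarrow> r \<cdot>[Tot X B] totA X B p (j \<alpha>) = ps d \<alpha>"
    by blast
  obtain x where x: "x' = (U, x)" "x \<in> Obj (Fib E U)" using x' by (auto elim!: total_objE)
  have j: "j \<alpha> \<in> Arr (Tot X E)" "Dom (Tot X E) (j \<alpha>) = ea d \<alpha>" "Cod (Tot X E) (j \<alpha>) = (U, x)" "fst (j \<alpha>) = \<alpha>" "cartesian X (Tot X E) (j \<alpha>)" if "\<alpha> \<in> S" for \<alpha>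
    using j0[OF that] x by (auto simp: in_hom)
  define f where "f = (\<lambda>\<alpha>\<in>S. snd (snd (j \<alpha>)))"
  have jf: "j \<alpha> = (\<alpha>, x, f \<alpha>)" if "\<alpha> \<in> S" for \<alpha>
    using j(3,4)[OF that] that by (cases "j \<alpha>") (simp add: f_def)
  have f: "f \<alpha> \<in> isos (Fib E (Dom X \<alpha>)) (dloc d \<alpha>) (ResO E \<alpha> x)" if "\<alpha> \<in> S" for \<alpha>
    using E.cartesian_iso[of \<alpha> x "f \<alpha>"] j[OF that] jf[OF that] that by (simp add: ea_def)
  \<comment> \<open>The cone condition must be carried from the sieve back to fibre products.
    \<open>m\<close> compares \<open>c2\<close> with the transition along the second projection, and
    the cocycle law rewrites \<open>Th\<close> as the transition along the first projection preceded
    by the same \<open>m\<close>.\<close>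
  have jT: "j \<alpha> \<cdot>[Tot X E] Th d \<alpha> \<beta> = j \<beta> \<cdot>[Tot X E] c2 d \<alpha> \<beta>" if a: "\<alpha> \<in> S" "\<beta> \<in> S" for \<alpha> \<beta>
  proof -
    note tt = shape_total2[OF d a]
    let ?p1 = "pr1 X \<alpha> \<beta>" and ?p2 = "pr2 X \<alpha> \<beta>"
    have bp: "\<beta> \<cdot>[X] ?p2 \<in> S" "\<alpha> \<cdot>[X] ?p1 = \<beta> \<cdot>[X] ?p2" using a pr_eq[OF a] by auto
    note t1 = t[OF a(1), of ?p1] and t2 = t[OF a(2), of ?p2]
    have "Tr d \<alpha> \<beta> ?p1 (c2 d \<alpha> \<beta>) = Th d \<alpha> \<beta> \<cdot>[Tot X E] Id (Tot X E) (eb d \<alpha> \<beta>)"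
      by (rule Tr_I[OF d a]) (use tt a E.T.base.FA_Id[of "eb d \<alpha> \<beta>"] in auto)
    then have Th: "Th d \<alpha> \<beta> = Tr d \<alpha> \<beta> ?p1 (c2 d \<alpha> \<beta>)" using tt by simp
    obtain m where m: "m \<in> Arr (Tot X E)" "Dom (Tot X E) m = Dom (Tot X E) (c2 d \<alpha> \<beta>)" "Cod (Tot X E) m = Dom (Tot X E) (t \<beta> ?p2)"
       "fst m = Id X (pb_ob X \<alpha> \<beta>)" "t \<beta> ?p2 \<cdot>[Tot X E] m = c2 d \<alpha> \<beta>"
      by (rule E.T.cart_factor[OF t2(5) tt(6), of "Id X (pb_ob X \<alpha> \<beta>)"]) (use a t2 tt shape_total[OF d bp(1)] in auto)
    have "Th d \<alpha> \<beta> = Tr d \<alpha> \<beta> ?p1 (t \<beta> ?p2 \<cdot>[Tot X E] m)" using Th m(5) by simp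
    also have "\<dots> = Tr d \<alpha> \<beta> ?p1 (t \<beta> ?p2) \<cdot>[Tot X E] m"
      by (rule Tr_nat) (use d a t2 m bp in auto)
    also have "Tr d \<alpha> \<beta> ?p1 (t \<beta> ?p2) = Tr d \<alpha> (\<beta> \<cdot>[X] ?p2) ?p1 (?I (\<beta> \<cdot>[X] ?p2))"
      unfolding t_def by (rule law2) (use a bp I[OF bp(1)] in auto)
    also have "\<dots> = t \<alpha> ?p1" by (simp add: t_def bp(2))
    finally have Th2: "Th d \<alpha> \<beta> = t \<alpha> ?p1 \<cdot>[Tot X E] m" .
    have "j \<alpha> \<cdot>[Tot X E] (t \<alpha> ?p1 \<cdot>[Tot X E] m) = j (\<alpha> \<cdot>[X] ?p1) \<cdot>[Tot X E] m"
      by (rule E.T.compose_eq[OF jt]) (use a j t1 t2 m bp in auto)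
    moreover have "j \<beta> \<cdot>[Tot X E] (t \<beta> ?p2 \<cdot>[Tot X E] m) = j (\<beta> \<cdot>[X] ?p2) \<cdot>[Tot X E] m"
      by (rule E.T.compose_eq[OF jt]) (use a j t1 t2 m bp in auto)
    ultimately show ?thesis unfolding Th2 m(5)[symmetric] bp(2) by simp
  qed
  have rA: "r \<in> Arr (Tot X B)" using B.T.isos_Arr[OF r(1)] by simp
  obtain \<chi> where \<chi>: "\<chi> \<in> Arr (Fib B U)" "r = B.vt U \<chi>" by (rule B.vertical_vt[OF rA r(2) U])
  have \<chi>i: "\<chi> \<in> isos (Fib B U) (NatO p U x) (dbase d)" using B.vt_isosD[OF U \<chi>(1)] r(1) \<chi>(2) x by simp
  \<comment> \<open>Gluing yields an isomorphism towards the base object of the datum, while an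
    arrow from \<open>d\<close> to \<open>PO x\<close> needs the opposite direction.\<close>
  define g where "g = inv_arr (Fib B U) \<chi>"
  note CB = B.Fib_category[OF U]
  note gs = category.inv_arr_simps[OF CB \<chi>i, folded g_def] and \<chi>s = category.isos_Arr[OF CB \<chi>i]
  have gi: "g \<in> isos (Fib B U) (dbase d) (NatO p U x)" unfolding g_def by (rule category.inv_arr_isos[OF CB \<chi>i])
  have gr: "B.vt U g \<cdot>[Tot X B] r = Id (Tot X B) (U, NatO p U x)"
    using B.vt_Comp[OF U, of g \<chi>] B.vt_Id[OF U, of "NatO p U x"] gs \<chi>s \<chi> x U by simp
  have fh: "f \<alpha> \<in> hom (Fib E (Dom X \<alpha>)) (dloc d \<alpha>) (ResO E \<alpha> x)" if "\<alpha> \<in> S" for \<alpha> using f[OF that] by (simp add: isos_def)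
  have gh: "g \<in> hom (Fib B U) (dbase d) (NatO p U x)" using gi by (simp add: isos_def)
  let ?k = "\<lparr>asrc = d, atgt = PO x, abase = g, aloc = f\<rparr>"
  have "?k \<in> DA"
  proof (subst DA_to_PO[OF dD x(2) fh _ gh])
    have "B.vt U g \<cdot>[Tot X B] ps d \<alpha> = totA X B p (\<alpha>, x, f \<alpha>)" if a: "\<alpha> \<in> S" for \<alpha>
    proof -
      have "B.vt U g \<cdot>[Tot X B] (r \<cdot>[Tot X B] totA X B p (j \<alpha>)) = Id (Tot X B) (U, NatO p U x) \<cdot>[Tot X B] totA X B p (j \<alpha>)"
        by (rule B.T.compose_eq[OF gr]) (use B.T.isos_Arr[OF r(1)] gs U j[OF a] x in auto)
      also have "\<dots> = totA X B p (j \<alpha>)" by (rule B.T.Id_left) (use j[OF a] in auto)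
      finally show ?thesis using rj[OF a] jf[OF a] by simp
    qed
    then show "(\<forall>\<alpha>\<in>S. \<forall>\<beta>\<in>S. (\<alpha>, x, f \<alpha>) \<cdot>[Tot X E] Th d \<alpha> \<beta> = (\<beta>, x, f \<beta>) \<cdot>[Tot X E] c2 d \<alpha> \<beta>) \<and>
      (\<forall>\<alpha>\<in>S. B.vt U g \<cdot>[Tot X B] ps d \<alpha> = totA X B p (\<alpha>, x, f \<alpha>))"
      using jT by (simp add: jf del: total_simps(6) tot_simps)
  qed (auto simp: f_def)
  then have "?k \<in> isos D d (PO x)" using Desc_isosI[of ?k] gi f by simp
  then show "\<exists>x\<in>Obj (Fib E U). isos D d (PO x) \<noteq> {}" using x by blast
qed

text \<open>A family on the sieve has to be turned into gluing isomorphisms on fibre products. They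
  exist because the two projections have the same composite into \<open>U\<close>, so both
  restrictions are compared with the one object over that composite.\<close>

lemma equivalence_imp_effective:
  assumes equiv: "equivalence_of_categories (Fib E U) D PO PA"
  shows "effective X (Tot X E) (Tot X B) (totO p) (totA X B p) U S"
  unfolding effective_def
proof (intro allI impI, elim conjE)
  fix e t b \<psi>
  assume fam: "descent_family X (Tot X E) S e t" and b: "b \<in> Obj (Tot X B)" "fst b = U"
    and \<psi>0: "\<forall>\<alpha>\<in>S. \<psi> \<alpha> \<in> hom (Tot X B) (totO p (e \<alpha>)) b \<and> fst (\<psi> \<alpha>) = \<alpha> \<and> cartesian X (Tot X B) (\<psi> \<alpha>)"
    and \<psi>t0: "\<forall>\<alpha>\<in>S. \<forall>g\<in>Arr X. Cod X g = Dom X \<alpha> \<longrightarrow> \<psi> \<alpha> \<cdot>[Tot X B] totA X B p (t \<alpha> g) = \<psi> (\<alpha> \<cdot>[X] g)"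
  obtain b0 where b0: "b = (U, b0)" "b0 \<in> Obj (Fib B U)" using b by (auto elim!: total_objE)
  have e: "e \<alpha> \<in> Obj (Tot X E)" "fst (e \<alpha>) = Dom X \<alpha>" if "\<alpha> \<in> S" for \<alpha> using fam that by (auto simp: descent_family_def)
  have es: "e \<alpha> = (Dom X \<alpha>, snd (e \<alpha>))" "snd (e \<alpha>) \<in> Obj (Fib E (Dom X \<alpha>))" if "\<alpha> \<in> S" for \<alpha>
    using e[OF that] by (auto elim!: total_objE)
  have t: "t \<alpha> g \<in> Arr (Tot X E)" "Dom (Tot X E) (t \<alpha> g) = e (\<alpha> \<cdot>[X] g)" "Cod (Tot X E) (t \<alpha> g) = e \<alpha>" "fst (t \<alpha> g) = g"
     "cartesian X (Tot X E) (t \<alpha> g)" if "\<alpha> \<in> S" "g \<in> Arr X" "Cod X g = Dom X \<alpha>" for \<alpha> g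
    using fam that by (auto simp: descent_family_def in_hom)
  have tc: "t \<alpha> (g \<cdot>[X] h) = t \<alpha> g \<cdot>[Tot X E] t (\<alpha> \<cdot>[X] g) h" if "\<alpha> \<in> S" "g \<in> Arr X" "Cod X g = Dom X \<alpha>" "h \<in> Arr X" "Cod X h = Dom X g" for \<alpha> g h
    using fam that by (auto simp: descent_family_def)
  have tI: "t \<alpha> (Id X (Dom X \<alpha>)) = Id (Tot X E) (e \<alpha>)" if "\<alpha> \<in> S" for \<alpha>
    using E.T.descent_family_Id[OF fam that] that by simp
  have \<psi>: "\<psi> \<alpha> \<in> Arr (Tot X B)" "Dom (Tot X B) (\<psi> \<alpha>) = totO p (e \<alpha>)" "Cod (Tot X B) (\<psi> \<alpha>) = (U, b0)" "fst (\<psi> \<alpha>) = \<alpha>" "cartesian X (Tot X B) (\<psi> \<alpha>)" if "\<alpha> \<in> S" for \<alpha>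
    using \<psi>0 b0 that by (auto simp: in_hom)
  have \<psi>t: "\<psi> \<alpha> \<cdot>[Tot X B] totA X B p (t \<alpha> g) = \<psi> (\<alpha> \<cdot>[X] g)" if "\<alpha> \<in> S" "g \<in> Arr X" "Cod X g = Dom X \<alpha>" for \<alpha> g
    using \<psi>t0 that by blast
  have \<psi>s: "\<psi> \<alpha> = (\<alpha>, b0, snd (snd (\<psi> \<alpha>)))" if "\<alpha> \<in> S" for \<alpha> using \<psi>(3,4)[OF that] by (cases "\<psi> \<alpha>") simp
  let ?c = "\<lambda>\<alpha> \<beta>. E.ci (pr2 X \<alpha> \<beta>) (snd (e \<beta>))"
  let ?eb = "\<lambda>\<alpha> \<beta>. (pb_ob X \<alpha> \<beta>, ResO E (pr2 X \<alpha> \<beta>) (snd (e \<beta>)))"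
  have c: "?c \<alpha> \<beta> \<in> Arr (Tot X E)" "Dom (Tot X E) (?c \<alpha> \<beta>) = ?eb \<alpha> \<beta>" "Cod (Tot X E) (?c \<alpha> \<beta>) = e \<beta>"
    "cartesian X (Tot X E) (?c \<alpha> \<beta>)" if a: "\<alpha> \<in> S" "\<beta> \<in> S" for \<alpha> \<beta>
    using a es[OF a(2)] E.ci_cartesian[of "pr2 X \<alpha> \<beta>" "snd (e \<beta>)"] by auto
  \<comment> \<open>The vertical comparison of the chosen restriction of \<open>e \<beta>\<close> to
    the fibre product with the object of the family over the composite of \<beta> and the second
    projection.\<close>
  define is_M where "is_M \<alpha> \<beta> m \<longleftrightarrow> m \<in> Arr (Tot X E) \<and> Dom (Tot X E) m = ?eb \<alpha> \<beta> \<and> Cod (Tot X E) m = e (\<beta> \<cdot>[X] pr2 X \<alpha> \<beta>) \<and> fst m = Id X (pb_ob X \<alpha> \<beta>) \<and>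
      t \<beta> (pr2 X \<alpha> \<beta>) \<cdot>[Tot X E] m = ?c \<alpha> \<beta>" for \<alpha> \<beta> m
  have M_ex: "\<exists>m. is_M \<alpha> \<beta> m" if a: "\<alpha> \<in> S" "\<beta> \<in> S" for \<alpha> \<beta>
  proof -
    note t2 = t[OF a(2), of "pr2 X \<alpha> \<beta>"]
    have bp: "\<beta> \<cdot>[X] pr2 X \<alpha> \<beta> \<in> S" using a by simp
    obtain m where "m \<in> Arr (Tot X E)" "Dom (Tot X E) m = Dom (Tot X E) (?c \<alpha> \<beta>)" "Cod (Tot X E) m = Dom (Tot X E) (t \<beta> (pr2 X \<alpha> \<beta>))"
      "fst m = Id X (pb_ob X \<alpha> \<beta>)" "t \<beta> (pr2 X \<alpha> \<beta>) \<cdot>[Tot X E] m = ?c \<alpha> \<beta>"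
      by (rule E.T.cart_factor[OF t2(5) c(1)[OF a], of "Id X (pb_ob X \<alpha> \<beta>)"]) (use a t2 c[OF a] e[OF bp] in auto)
    then show ?thesis unfolding c(2)[OF a] is_M_def using t2(2) a by (intro exI[of _ m] conjI) simp_all
  qed
  define M where "M \<alpha> \<beta> = (SOME m. is_M \<alpha> \<beta> m)" for \<alpha> \<beta>
  have is_M: "is_M \<alpha> \<beta> (M \<alpha> \<beta>)" if "\<alpha> \<in> S" "\<beta> \<in> S" for \<alpha> \<beta>
    unfolding M_def by (rule someI_ex) (rule M_ex[OF that])
  have M: "M \<alpha> \<beta> \<in> Arr (Tot X E)" "Dom (Tot X E) (M \<alpha> \<beta>) = ?eb \<alpha> \<beta>"
    "Cod (Tot X E) (M \<alpha> \<beta>) = e (\<beta> \<cdot>[X] pr2 X \<alpha> \<beta>)" "fst (M \<alpha> \<beta>) = Id X (pb_ob X \<alpha> \<beta>)"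
    "t \<beta> (pr2 X \<alpha> \<beta>) \<cdot>[Tot X E] M \<alpha> \<beta> = ?c \<alpha> \<beta>" if "\<alpha> \<in> S" "\<beta> \<in> S" for \<alpha> \<beta>
    using is_M[OF that] unfolding is_M_def by blast+
  \<comment> \<open>\<open>M\<close> ends at the object over the common composite, which is also the
    source of the transition to \<open>e \<alpha>\<close>. The composite is the gluing isomorphism,
    as an arrow over the first projection.\<close>
  define T where "T \<alpha> \<beta> = t \<alpha> (pr1 X \<alpha> \<beta>) \<cdot>[Tot X E] M \<alpha> \<beta>" for \<alpha> \<beta>
  have T: "T \<alpha> \<beta> \<in> Arr (Tot X E)" "Dom (Tot X E) (T \<alpha> \<beta>) = ?eb \<alpha> \<beta>" "Cod (Tot X E) (T \<alpha> \<beta>) = e \<alpha>" "fst (T \<alpha> \<beta>) = pr1 X \<alpha> \<beta>"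
    "cartesian X (Tot X E) (T \<alpha> \<beta>)" if a: "\<alpha> \<in> S" "\<beta> \<in> S" for \<alpha> \<beta>
  proof -
    note t1 = t[OF a(1), of "pr1 X \<alpha> \<beta>"] and t2 = t[OF a(2), of "pr2 X \<alpha> \<beta>"] and m = M[OF a]
    have mc: "cartesian X (Tot X E) (M \<alpha> \<beta>)"
      by (rule E.T.cart_cancel[OF t2(5)]) (use a t2 m c[OF a] in auto)
    show "T \<alpha> \<beta> \<in> Arr (Tot X E)" "Dom (Tot X E) (T \<alpha> \<beta>) = ?eb \<alpha> \<beta>" "Cod (Tot X E) (T \<alpha> \<beta>) = e \<alpha>" "fst (T \<alpha> \<beta>) = pr1 X \<alpha> \<beta>"
      unfolding T_def using t1 m a pr_eq[OF a] by auto
    show "cartesian X (Tot X E) (T \<alpha> \<beta>)" unfolding T_def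
      by (rule E.T.cart_comp[OF t1(5) mc]) (use a t1 m pr_eq[OF a] in auto)
  qed
  have Ts: "T \<alpha> \<beta> = (pr1 X \<alpha> \<beta>, snd (e \<alpha>), snd (snd (T \<alpha> \<beta>)))" if "\<alpha> \<in> S" "\<beta> \<in> S" for \<alpha> \<beta>
    using arg_cong[OF T(3)[OF that], of snd] T(4)[OF that] by (cases "T \<alpha> \<beta>") simp
  define d where "d = \<lparr>dbase = b0, dloc = (\<lambda>\<alpha>\<in>S. snd (e \<alpha>)), dpsi = (\<lambda>\<alpha>\<in>S. snd (snd (\<psi> \<alpha>))), dtheta = (\<lambda>(\<alpha>, \<beta>)\<in>S \<times> S. snd (snd (T \<alpha> \<beta>)))\<rparr>"
  have ds: "dbase d = b0" "\<And>\<alpha>. \<alpha> \<in> S \<Longrightarrow> dloc d \<alpha> = snd (e \<alpha>)" "\<And>\<alpha>. \<alpha> \<in> S \<Longrightarrow> dpsi d \<alpha> = snd (snd (\<psi> \<alpha>))"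
    "\<And>\<alpha> \<beta>. \<alpha> \<in> S \<Longrightarrow> \<beta> \<in> S \<Longrightarrow> dtheta d (\<alpha>, \<beta>) = snd (snd (T \<alpha> \<beta>))" by (auto simp: d_def)
  have d: "shape d"
  proof -
    have "snd (snd (\<psi> \<alpha>)) \<in> isos (Fib B (Dom X \<alpha>)) (NatO p (Dom X \<alpha>) (snd (e \<alpha>))) (ResO B \<alpha> b0)" if a: "\<alpha> \<in> S" for \<alpha>
    proof -
      have "totO p (e \<alpha>) = (Dom X \<alpha>, NatO p (Dom X \<alpha>) (snd (e \<alpha>)))" using es[OF a] by (metis tot_simps(1))
      then have "Dom (Fib B (Dom X \<alpha>)) (snd (snd (\<psi> \<alpha>))) = NatO p (Dom X \<alpha>) (snd (e \<alpha>))"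
        using \<psi>(2)[OF a] by (subst (asm) \<psi>s[OF a]) simp
      then show ?thesis using B.cartesian_iso[of \<alpha> b0 "snd (snd (\<psi> \<alpha>))"] \<psi>(5)[OF a] \<psi>s[OF a] by simp
    qed
    moreover have "snd (snd (T \<alpha> \<beta>)) \<in> isos (Fib E (pb_ob X \<alpha> \<beta>)) (ResO E (pr2 X \<alpha> \<beta>) (snd (e \<beta>))) (ResO E (pr1 X \<alpha> \<beta>) (snd (e \<alpha>)))" if a: "\<alpha> \<in> S" "\<beta> \<in> S" for \<alpha> \<beta>
    proof -
      have "Dom (Fib E (pb_ob X \<alpha> \<beta>)) (snd (snd (T \<alpha> \<beta>))) = ResO E (pr2 X \<alpha> \<beta>) (snd (e \<beta>))"
        using T(2)[OF a] a by (subst (asm) Ts[OF a]) simp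
      then show ?thesis using E.cartesian_iso[of "pr1 X \<alpha> \<beta>" "snd (e \<alpha>)" "snd (snd (T \<alpha> \<beta>))"] T(5)[OF a] Ts[OF a] a by simp
    qed
    ultimately show ?thesis unfolding shape_def using b0 es by (auto simp: d_def)
  qed
  have ea: "ea d \<alpha> = e \<alpha>" if "\<alpha> \<in> S" for \<alpha> using es(1)[OF that] ds(2)[OF that] by (simp add: ea_def)
  have ps: "ps d \<alpha> = \<psi> \<alpha>" if "\<alpha> \<in> S" for \<alpha> using \<psi>s[OF that] ds that by (simp add: ps_def)
  have Th: "Th d \<alpha> \<beta> = T \<alpha> \<beta>" if "\<alpha> \<in> S" "\<beta> \<in> S" for \<alpha> \<beta> using Ts[OF that] ds that by (simp add: Th_def)
  have c2: "c2 d \<alpha> \<beta> = ?c \<alpha> \<beta>" and eb: "eb d \<alpha> \<beta> = ?eb \<alpha> \<beta>" if "\<alpha> \<in> S" "\<beta> \<in> S" for \<alpha> \<beta> using ds that by (auto simp: c2_def eb_def)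
  \<comment> \<open>For this datum, transport keeps the vertical part \<open>m\<close> of
    \<open>q\<close>: it ends at the object over the common composite, and only the transition that
    follows \<open>m\<close> is replaced.\<close>
  have TrT: "Tr d \<alpha> \<beta> r q = t \<alpha> r \<cdot>[Tot X E] m"
    if a: "\<alpha> \<in> S" "\<beta> \<in> S" and q: "q \<in> Arr (Tot X E)" "Cod (Tot X E) q = e \<beta>" and r: "r \<in> Arr X" "Cod X r = Dom X \<alpha>" "\<alpha> \<cdot>[X] r = \<beta> \<cdot>[X] fst q"
      and m: "m \<in> Arr (Tot X E)" "Cod (Tot X E) m = e (\<beta> \<cdot>[X] fst q)" "fst m = Id X (fst (Dom (Tot X E) q))" "t \<beta> (fst q) \<cdot>[Tot X E] m = q"
    for \<alpha> \<beta> q r m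
  proof -
    let ?p1 = "pr1 X \<alpha> \<beta>" and ?p2 = "pr2 X \<alpha> \<beta>"
    have q': "Cod (Tot X E) q = ea d \<beta>" using q ea a by simp
    obtain n where n: "n \<in> Arr (Tot X E)" "Dom (Tot X E) n = Dom (Tot X E) q" "Cod (Tot X E) n = eb d \<alpha> \<beta>"
      "c2 d \<alpha> \<beta> \<cdot>[Tot X E] n = q" "r = ?p1 \<cdot>[X] fst n" "Tr d \<alpha> \<beta> r q = Th d \<alpha> \<beta> \<cdot>[Tot X E] n"
      by (rule Tr_E[OF d a q(1) q' r])
    define \<tau> where "\<tau> = fst n"
    have nc: "Cod (Tot X E) n = ?eb \<alpha> \<beta>" using n(3) eb[OF a] by simp
    have \<tau>: "\<tau> \<in> Arr X" "Cod X \<tau> = pb_ob X \<alpha> \<beta>" "Dom X \<tau> = fst (Dom (Tot X E) q)"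
      using E.T.base.FA_Cod[OF n(1)] E.T.base.FA_Dom[OF n(1)] E.T.base.FA_Arr[OF n(1)] nc n(2) by (auto simp: \<tau>_def)
    have bp: "\<beta> \<cdot>[X] ?p2 \<in> S" "\<alpha> \<cdot>[X] ?p1 = \<beta> \<cdot>[X] ?p2" using a pr_eq[OF a] by auto
    have \<tau>': "Cod X \<tau> = Dom X (\<beta> \<cdot>[X] ?p2)" using \<tau> a by simp
    have fq: "fst q = ?p2 \<cdot>[X] \<tau>"
    proof -
      have "fst (c2 d \<alpha> \<beta> \<cdot>[Tot X E] n) = ?p2 \<cdot>[X] \<tau>"
        using shape_total2[OF d a] n(1,3) by (simp add: \<tau>_def)
      then show ?thesis using n(4) by simp
    qed
    let ?w = "t (\<beta> \<cdot>[X] ?p2) \<tau>"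
    note w = t[OF bp(1) \<tau>(1) \<tau>']
    note t1 = t[OF a(1), of ?p1] and t2 = t[OF a(2), of ?p2] and MM = M[OF a]
    have Mn: "M \<alpha> \<beta> \<cdot>[Tot X E] n \<in> Arr (Tot X E)" "Dom (Tot X E) (M \<alpha> \<beta> \<cdot>[Tot X E] n) = Dom (Tot X E) q"
      "Cod (Tot X E) (M \<alpha> \<beta> \<cdot>[Tot X E] n) = e (\<beta> \<cdot>[X] ?p2)" "fst (M \<alpha> \<beta> \<cdot>[Tot X E] n) = \<tau>"
      using MM n(1,2) nc \<tau> by (auto simp: \<tau>_def)
    have wb: "fst (Dom (Tot X E) ?w) = Dom X \<tau>" using w e[of "(\<beta> \<cdot>[X] ?p2) \<cdot>[X] \<tau>"] bp \<tau>(1) \<tau>' a by simp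
    obtain m' where m': "m' \<in> Arr (Tot X E)" "Dom (Tot X E) m' = Dom (Tot X E) (M \<alpha> \<beta> \<cdot>[Tot X E] n)" "Cod (Tot X E) m' = Dom (Tot X E) ?w" "fst m' = Id X (Dom X \<tau>)"
      "?w \<cdot>[Tot X E] m' = M \<alpha> \<beta> \<cdot>[Tot X E] n"
    proof (rule E.T.cart_factor[OF w(5) Mn(1), of "Id X (Dom X \<tau>)"])
      show "Id X (Dom X \<tau>) \<in> Arr X" "Cod X (Id X (Dom X \<tau>)) = fst (Dom (Tot X E) ?w)" using wb \<tau>(1) by simp_all
      show "Cod (Tot X E) (M \<alpha> \<beta> \<cdot>[Tot X E] n) = Cod (Tot X E) ?w" unfolding Mn(3) w(3) ..
      show "fst (M \<alpha> \<beta> \<cdot>[Tot X E] n) = fst ?w \<cdot>[X] Id X (Dom X \<tau>)" unfolding Mn(4) w(4) using \<tau>(1) by simp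
    qed (rule that)
    have bq: "\<beta> \<cdot>[X] fst q = (\<beta> \<cdot>[X] ?p2) \<cdot>[X] \<tau>" using fq a \<tau> by simp
    have fqA: "fst q \<in> Arr X" "Cod X (fst q) = Dom X \<beta>" using fq a \<tau> by auto
    note tq = t[OF a(2) fqA]
    have "t \<beta> (fst q) \<cdot>[Tot X E] m' = t \<beta> ?p2 \<cdot>[Tot X E] (?w \<cdot>[Tot X E] m')"
      unfolding fq tc[OF a(2) pr_S(2,6)[OF a] \<tau>(1), unfolded pr_S(4)[OF a], OF \<tau>(2)]
      by (rule E.T.assoc) (use m' w t2 a in auto)
    also have "\<dots> = ?c \<alpha> \<beta> \<cdot>[Tot X E] n" unfolding m'(5)
      by (rule E.T.compose_eq[OF MM(5)]) (use n(1) nc MM t2 a in auto)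
    also have "\<dots> = q" using n(4) c2[OF a] by simp
    finally have mq: "t \<beta> (fst q) \<cdot>[Tot X E] m' = q" .
    \<comment> \<open>Both are vertical factors of \<open>q\<close> through the cartesian transition
      over \<open>fst q\<close>.\<close>
    have "m' = m"
      by (rule E.T.cart_unique[OF tq(5)]) (use m m' mq w tq \<tau> bq in auto)
    then have "T \<alpha> \<beta> \<cdot>[Tot X E] n = t \<alpha> ?p1 \<cdot>[Tot X E] (?w \<cdot>[Tot X E] m)"
      unfolding T_def using m'(5) MM n(1) nc t1 a bp by simp
    also have "\<dots> = (t \<alpha> ?p1 \<cdot>[Tot X E] ?w) \<cdot>[Tot X E] m"
      by (rule E.T.assoc[symmetric]) (use m m' \<open>m' = m\<close> w t1 a bp in auto)
    also have "t \<alpha> ?p1 \<cdot>[Tot X E] ?w = t \<alpha> r"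
      unfolding n(5) \<tau>_def[symmetric] using tc[OF a(1) pr_S(1,5)[OF a] \<tau>(1), unfolded pr_S(3)[OF a], OF \<tau>(2)] bp by simp
    finally show ?thesis unfolding n(6) using Th[OF a] by simp
  qed
  have vert: "\<exists>m. m \<in> Arr (Tot X E) \<and> Dom (Tot X E) m = Dom (Tot X E) q \<and> Cod (Tot X E) m = e (\<beta> \<cdot>[X] fst q) \<and> fst m = Id X (fst (Dom (Tot X E) q)) \<and> t \<beta> (fst q) \<cdot>[Tot X E] m = q"
    if a: "\<beta> \<in> S" and q: "q \<in> Arr (Tot X E)" "Cod (Tot X E) q = e \<beta>" for \<beta> q
  proof -
    have fq: "fst q \<in> Arr X" "Cod X (fst q) = Dom X \<beta>" "Dom X (fst q) = fst (Dom (Tot X E) q)"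
      using E.T.base.FA_Arr[OF q(1)] E.T.base.FA_Cod[OF q(1)] E.T.base.FA_Dom[OF q(1)] q e[OF a] by auto
    note tq = t[OF a fq(1,2)]
    have bq: "\<beta> \<cdot>[X] fst q \<in> S" using a fq by simp
    obtain m where "m \<in> Arr (Tot X E)" "Dom (Tot X E) m = Dom (Tot X E) q" "Cod (Tot X E) m = Dom (Tot X E) (t \<beta> (fst q))"
      "fst m = Id X (fst (Dom (Tot X E) q))" "t \<beta> (fst q) \<cdot>[Tot X E] m = q"
      by (rule E.T.cart_factor[OF tq(5) q(1), of "Id X (fst (Dom (Tot X E) q))"]) (use q tq fq e[OF bq] a in auto)
    then show ?thesis using tq(2) by (intro exI[of _ m] conjI) simp_all
  qed
  have laws: "laws d"
    unfolding laws_def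
  proof (intro conjI ballI impI)
    fix \<alpha> assume a: "\<alpha> \<in> S"
    note e' = e[OF a] E.T.base.FA_Id[OF e(1)[OF a]]
    have "Tr d \<alpha> \<alpha> (Id X (Dom X \<alpha>)) (Id (Tot X E) (e \<alpha>)) = t \<alpha> (Id X (Dom X \<alpha>)) \<cdot>[Tot X E] Id (Tot X E) (e \<alpha>)"
      by (rule TrT) (use a e' tI[OF a] in auto)
    then show "Tr d \<alpha> \<alpha> (Id X (Dom X \<alpha>)) (Id (Tot X E) (ea d \<alpha>)) = Id (Tot X E) (ea d \<alpha>)"
      using tI[OF a] ea[OF a] e' by simp
  next
    fix \<alpha> \<beta> \<gamma> r s q assume a: "\<alpha> \<in> S" "\<beta> \<in> S" "\<gamma> \<in> S" and H: "r \<in> Arr X" "s \<in> Arr X" "q \<in> Arr (Tot X E)"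
        "Cod (Tot X E) q = ea d \<gamma> \<and> Cod X r = Dom X \<alpha> \<and> Cod X s = Dom X \<beta> \<and> \<alpha> \<cdot>[X] r = \<beta> \<cdot>[X] s \<and> \<beta> \<cdot>[X] s = \<gamma> \<cdot>[X] fst q"
    have r: "Cod X r = Dom X \<alpha>" "\<alpha> \<cdot>[X] r = \<beta> \<cdot>[X] s" "\<alpha> \<cdot>[X] r = \<gamma> \<cdot>[X] fst q" and s: "Cod X s = Dom X \<beta>" "\<beta> \<cdot>[X] s = \<gamma> \<cdot>[X] fst q"
      and qc: "Cod (Tot X E) q = e \<gamma>" using H ea[OF a(3)] by auto
    obtain m where m: "m \<in> Arr (Tot X E)" "Dom (Tot X E) m = Dom (Tot X E) q" "Cod (Tot X E) m = e (\<gamma> \<cdot>[X] fst q)" "fst m = Id X (fst (Dom (Tot X E) q))" "t \<gamma> (fst q) \<cdot>[Tot X E] m = q"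
      using vert[OF a(3) H(3) qc] by blast
    have 1: "Tr d \<beta> \<gamma> s q = t \<beta> s \<cdot>[Tot X E] m" by (rule TrT[OF a(2,3) H(3) qc H(2) s m(1,3,4,5)])
    have 2: "Tr d \<alpha> \<gamma> r q = t \<alpha> r \<cdot>[Tot X E] m" by (rule TrT[OF a(1,3) H(3) qc H(1) r(1,3) m(1,3,4,5)])
    note ts = t[OF a(2) H(2) s(1)]
    have sd: "Dom X s = fst (Dom (Tot X E) q)"
      using arg_cong[OF s(2), of "Dom X"] E.T.base.FA_Arr[OF H(3)] E.T.base.FA_Cod[OF H(3)] E.T.base.FA_Dom[OF H(3)] qc e[OF a(3)] a H(2) s(1) by simp
    have tsm: "t \<beta> s \<cdot>[Tot X E] m \<in> Arr (Tot X E)" "Cod (Tot X E) (t \<beta> s \<cdot>[Tot X E] m) = e \<beta>" "fst (t \<beta> s \<cdot>[Tot X E] m) = s"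
      "Dom (Tot X E) (t \<beta> s \<cdot>[Tot X E] m) = Dom (Tot X E) q"
      using ts m s sd H(2) by auto
    have "Tr d \<alpha> \<beta> r (t \<beta> s \<cdot>[Tot X E] m) = t \<alpha> r \<cdot>[Tot X E] m"
      by (rule TrT[OF a(1,2) tsm(1,2) H(1) r(1)]) (use r s m tsm in auto)
    then show "Tr d \<alpha> \<beta> r (Tr d \<beta> \<gamma> s q) = Tr d \<alpha> \<gamma> r q" unfolding 1 2 .
  next
    fix \<alpha> \<beta> assume a: "\<alpha> \<in> S" "\<beta> \<in> S"
    let ?p1 = "pr1 X \<alpha> \<beta>" and ?p2 = "pr2 X \<alpha> \<beta>"
    have bp: "\<beta> \<cdot>[X] ?p2 \<in> S" "\<alpha> \<cdot>[X] ?p1 = \<beta> \<cdot>[X] ?p2" using a pr_eq[OF a] by auto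
    note t1 = t[OF a(1), of ?p1] and t2 = t[OF a(2), of ?p2] and MM = M[OF a]
    have "\<psi> \<alpha> \<cdot>[Tot X B] (totA X B p (t \<alpha> ?p1) \<cdot>[Tot X B] totA X B p (M \<alpha> \<beta>)) = \<psi> (\<alpha> \<cdot>[X] ?p1) \<cdot>[Tot X B] totA X B p (M \<alpha> \<beta>)"
      by (rule B.T.compose_eq[OF \<psi>t]) (use a t1 MM \<psi> bp in auto)
    moreover have "\<psi> \<beta> \<cdot>[Tot X B] (totA X B p (t \<beta> ?p2) \<cdot>[Tot X B] totA X B p (M \<alpha> \<beta>)) = \<psi> (\<beta> \<cdot>[X] ?p2) \<cdot>[Tot X B] totA X B p (M \<alpha> \<beta>)"
      by (rule B.T.compose_eq[OF \<psi>t]) (use a t2 MM \<psi> bp in auto)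
    moreover have "totA X B p (T \<alpha> \<beta>) = totA X B p (t \<alpha> ?p1) \<cdot>[Tot X B] totA X B p (M \<alpha> \<beta>)"
      unfolding T_def by (rule PF.FA_comp) (use a t1 MM bp in auto)
    moreover have "totA X B p (?c \<alpha> \<beta>) = totA X B p (t \<beta> ?p2) \<cdot>[Tot X B] totA X B p (M \<alpha> \<beta>)"
      unfolding MM(5)[symmetric] by (rule PF.FA_comp) (use a t2 MM bp in auto)
    ultimately show "ps d \<beta> \<cdot>[Tot X B] totA X B p (c2 d \<alpha> \<beta>) = ps d \<alpha> \<cdot>[Tot X B] totA X B p (Th d \<alpha> \<beta>)"
      unfolding ps[OF a(1)] ps[OF a(2)] c2[OF a] Th[OF a] bp(2) by simp
  qed
  have dD: "d \<in> DO" using d laws by (simp add: descent_objects_iff)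
  \<comment> \<open>Here the equivalence is used: the constructed datum is isomorphic to some
    \<open>PO x\<close>, and the local components of the isomorphism will be the cone.\<close>
  obtain x k where x: "x \<in> Obj (Fib E U)" and k: "k \<in> isos D d (PO x)"
    using equivalence_ess_surj[OF equiv, of d] dD by auto
  note ki = Desc_isosD[OF k]
  note K = descent_arrowsD[OF ki(1)] and KP = DA_to_PO_D[OF ki(1) x ki(3), unfolded ki(2)]
  note CB = B.Fib_category[OF U]
  define j where "j \<alpha> = (\<alpha>, x, aloc k \<alpha>)" for \<alpha>
  \<comment> \<open>The base component of \<open>k\<close> runs from \<open>b0\<close> to the image
    of \<open>x\<close>, so the comparison required by \<open>effective\<close> is its
    inverse.\<close>
  define r where "r = B.vt U (inv_arr (Fib B U) (abase k))"
  note gs = category.inv_arr_simps[OF CB ki(4)] and ks = category.isos_Arr[OF CB ki(4)]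
  have j: "j \<alpha> \<in> Arr (Tot X E)" "Dom (Tot X E) (j \<alpha>) = ea d \<alpha>" "Cod (Tot X E) (j \<alpha>) = (U, x)" "fst (j \<alpha>) = \<alpha>" "cartesian X (Tot X E) (j \<alpha>)" if a: "\<alpha> \<in> S" for \<alpha>
  proof -
    show "j \<alpha> \<in> Arr (Tot X E)" "Dom (Tot X E) (j \<alpha>) = ea d \<alpha>" unfolding j_def by (rule KP(1,2)[OF a])+
    show "Cod (Tot X E) (j \<alpha>) = (U, x)" "fst (j \<alpha>) = \<alpha>" using a by (auto simp: j_def)
    show "cartesian X (Tot X E) (j \<alpha>)" unfolding j_def
      by (rule E.iso_cartesian[OF KP(1)[OF a]]) (use ki(5)[OF a] a in auto)
  qed
  have jt: "j \<alpha> \<cdot>[Tot X E] t \<alpha> g = j (\<alpha> \<cdot>[X] g)" if a: "\<alpha> \<in> S" and g: "g \<in> Arr X" "Cod X g = Dom X \<alpha>" for \<alpha> g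
  proof -
    have ag: "\<alpha> \<cdot>[X] g \<in> S" using a g by simp
    let ?q = "Id (Tot X E) (e (\<alpha> \<cdot>[X] g))"
    have q: "?q \<in> Arr (Tot X E)" "Cod (Tot X E) ?q = e (\<alpha> \<cdot>[X] g)" "Dom (Tot X E) ?q = e (\<alpha> \<cdot>[X] g)" "fst ?q = Id X (Dom X (\<alpha> \<cdot>[X] g))"
      using e[OF ag] E.T.base.FA_Id[OF e(1)[OF ag]] by auto
    have eq: "\<alpha> \<cdot>[X] g = (\<alpha> \<cdot>[X] g) \<cdot>[X] fst ?q" using q(4) ag by simp
    have "Tr d \<alpha> (\<alpha> \<cdot>[X] g) g ?q = t \<alpha> g \<cdot>[Tot X E] ?q"
    proof (rule TrT[OF a ag q(1,2) g eq q(1)])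
      show "t (\<alpha> \<cdot>[X] g) (fst ?q) \<cdot>[Tot X E] ?q = ?q" unfolding q(4) tI[OF ag] using e[OF ag] by simp
    qed (use q eq e[OF ag] in auto)
    then have "Tr d \<alpha> (\<alpha> \<cdot>[X] g) g ?q = t \<alpha> g" using t[OF a g] by simp
    moreover have "j \<alpha> \<cdot>[Tot X E] Tr d \<alpha> (\<alpha> \<cdot>[X] g) g ?q = j (\<alpha> \<cdot>[X] g) \<cdot>[Tot X E] ?q"
      by (rule Tr_cone[OF d j(1,2) _ a ag q(1) _ g eq]) (use KP(3)[OF a ag] q ea[OF ag] in \<open>auto simp: j_def simp del: total_simps(6)\<close>)
    ultimately show ?thesis using j[OF ag] ea[OF ag] by simp
  qed
  have ri: "r \<in> isos (Tot X B) (totO p (U, x)) b"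
    unfolding r_def b0 using B.vt_isos[OF U category.inv_arr_isos[OF CB ki(4)]] ds by simp
  have rj: "r \<cdot>[Tot X B] totA X B p (j \<alpha>) = \<psi> \<alpha>" if a: "\<alpha> \<in> S" for \<alpha>
  proof -
    note p = shape_total[OF d a]
    have rg: "r \<cdot>[Tot X B] B.vt U (abase k) = Id (Tot X B) (U, dbase d)"
      using B.vt_Comp[OF U, of "inv_arr (Fib B U) (abase k)" "abase k"] B.vt_Id[OF U, of "dbase d"] gs ks shapeD[OF d] by (simp add: r_def)
    have "r \<cdot>[Tot X B] (B.vt U (abase k) \<cdot>[Tot X B] ps d \<alpha>) = Id (Tot X B) (U, dbase d) \<cdot>[Tot X B] ps d \<alpha>"
      by (rule B.T.compose_eq[OF rg]) (use p gs ks U in \<open>auto simp: r_def\<close>)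
    also have "\<dots> = ps d \<alpha>" by (rule B.T.Id_left) (use p in auto)
    finally show ?thesis using KP(4)[OF a] ps[OF a] by (simp add: j_def)
  qed
  show "\<exists>x j r. x \<in> Obj (Tot X E) \<and> fst x = U \<and>
        (\<forall>\<alpha>\<in>S. j \<alpha> \<in> hom (Tot X E) (e \<alpha>) x \<and> fst (j \<alpha>) = \<alpha> \<and> cartesian X (Tot X E) (j \<alpha>)) \<and>
        (\<forall>\<alpha>\<in>S. \<forall>g\<in>Arr X. Cod X g = Dom X \<alpha> \<longrightarrow> j \<alpha> \<cdot>[Tot X E] t \<alpha> g = j (\<alpha> \<cdot>[X] g)) \<and>
        r \<in> isos (Tot X B) (totO p x) b \<and> fst r = Id X U \<and> (\<forall>\<alpha>\<in>S. r \<cdot>[Tot X B] totA X B p (j \<alpha>) = \<psi> \<alpha>)"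
  proof (intro exI conjI ballI impI)
    show "(U, x) \<in> Obj (Tot X E)" "fst (U, x) = U" using x by auto
    show "r \<in> isos (Tot X B) (totO p (U, x)) b" by (rule ri)
    show "fst r = Id X U" unfolding r_def using gs U by simp
    show "j \<alpha> \<in> hom (Tot X E) (e \<alpha>) (U, x)" "fst (j \<alpha>) = \<alpha>" "cartesian X (Tot X E) (j \<alpha>)" if "\<alpha> \<in> S" for \<alpha>
      using j[OF that] ea[OF that] by (auto simp: in_hom)
    show "j \<alpha> \<cdot>[Tot X E] t \<alpha> g = j (\<alpha> \<cdot>[X] g)" if "\<alpha> \<in> S" "g \<in> Arr X" "Cod X g = Dom X \<alpha>" for \<alpha> g using jt that by blast
    show "r \<cdot>[Tot X B] totA X B p (j \<alpha>) = \<psi> \<alpha>" if "\<alpha> \<in> S" for \<alpha> using rj[OF that] .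
  qed
qed

end

section \<open>Sieves as discrete prestacks\<close>

lemma (in category) slice_homE:
  assumes "F \<in> hom (slice X V) f g"
  obtains w where "F = (g, w)" "g \<in> Arr X" "Cod X g = V" "w \<in> Arr X" "Cod X w = Dom X g" "f = g \<cdot>[X] w"
  using assms that by (cases F) (simp add: slice_def in_hom)

lemma (in category) slice_category: "category (slice X V)"
proof
  fix F assume "F \<in> Arr (slice X V)"
  then show "Dom (slice X V) F \<in> Obj (slice X V)" "Cod (slice X V) F \<in> Obj (slice X V)" by (auto simp: slice_def)
next
  fix f assume "f \<in> Obj (slice X V)"
  then show "Id (slice X V) f \<in> hom (slice X V) f f" by (auto simp: slice_def in_hom)
next
  fix F G f g h assume "F \<in> hom (slice X V) f g" "G \<in> hom (slice X V) g h"
  then show "G \<cdot>[slice X V] F \<in> hom (slice X V) f h"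
    by (elim slice_homE) (simp add: slice_def in_hom)
next
  fix F f g assume "F \<in> hom (slice X V) f g"
  then show "Id (slice X V) g \<cdot>[slice X V] F = F" "F \<cdot>[slice X V] Id (slice X V) f = F"
    by (elim slice_homE; simp add: slice_def)+
next
  fix F G H f g h k assume "F \<in> hom (slice X V) f g" "G \<in> hom (slice X V) g h" "H \<in> hom (slice X V) h k"
  then show "(H \<cdot>[slice X V] G) \<cdot>[slice X V] F = H \<cdot>[slice X V] (G \<cdot>[slice X V] F)"
    by (elim slice_homE) (simp add: slice_def)
qed

section \<open>Lifting of local weak equivalences against a map with effective descent\<close>

lemma lifts_of_effective:
  assumes site: "site X J" and E: "prestack X J E" and B: "prestack X J B" and p: "pseudonatural X E B p"
    and f: "(A, C, f) \<in> local_weak_equivalences X J"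
    and eff: "\<And>U S. U \<in> Obj X \<Longrightarrow> S \<in> J U \<Longrightarrow> effective X (Tot X E) (Tot X B) (totO p) (totA X B p) U S"
  shows "lifts X A C f E B p"
  unfolding lifts_def
proof (intro allI impI, elim conjE)
  fix h k \<gamma>
  assume h: "pseudonatural X A E h" and k: "pseudonatural X C B k"
    and g: "invertible_modification X A B (psnat_comp X B p h) (psnat_comp X B k f) \<gamma>"
  have f1: "pseudonatural X A C f" and f2: "\<And>U. U \<in> Obj X \<Longrightarrow> full_and_faithful (Fib A U) (Fib C U) (NatO f U) (NatA f U)"
    and f3: "\<And>U b. U \<in> Obj X \<Longrightarrow> b \<in> Obj (Fib C U) \<Longrightarrow> \<exists>S\<in>J U. \<forall>\<alpha>\<in>S. \<exists>b'\<in>Obj (Fib A (Dom X \<alpha>)).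
        isos (Fib C (Dom X \<alpha>)) (NatO f (Dom X \<alpha>) b') (ResO C \<alpha> b) \<noteq> {}"
    using f unfolding local_weak_equivalences_def by auto
  interpret site X J by (rule site)
  interpret p: pseudonatural X E B p by (rule p)
  interpret f: pseudonatural X A C f by (rule f1)
  interpret h: pseudonatural X A E h by (rule h)
  interpret k: pseudonatural X C B k by (rule k)
  interpret g: modification X A B "psnat_comp X B p h" "psnat_comp X B k f" \<gamma>
    using g by (simp add: invertible_modification_def)
  \<comment> \<open>The square moves to the total categories: \<gamma> becomes the vertical
    isomorphism \<open>g.vertical\<close>, and a local preimage with its isomorphism becomes a
    cartesian arrow into \<open>c\<close>.\<close>
  interpret L: lifting_square X J "Tot X A" "Tot X C" "Tot X E" "Tot X B" "totO f" "totA X C f" "totO h" "totA X E h"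
      "totO k" "totA X B k" "totO p" "totA X B p" g.vertical
  proof (intro lifting_square.intro lifting_square_axioms.intro)
    show "prestack_fib X J (Tot X E)" "prestack_fib X J (Tot X B)" using prestack_glue[OF site] E B by auto
    show "fibred_functor X (Tot X A) (Tot X C) (totO f) (totA X C f)" by (rule f.tot_fibred_functor)
    show "fibred_functor X (Tot X A) (Tot X E) (totO h) (totA X E h)" by (rule h.tot_fibred_functor)
    show "fibred_functor X (Tot X C) (Tot X B) (totO k) (totA X B k)" by (rule k.tot_fibred_functor)
    show "fibred_functor X (Tot X E) (Tot X B) (totO p) (totA X B p)" by (rule p.tot_fibred_functor)
    show "full_and_faithful (Tot X A) (Tot X C) (totO f) (totA X C f)" by (rule f.tot_ff[OF f2])
    show "\<exists>S\<in>J (fst c). \<forall>u\<in>S. \<exists>a\<in>Obj (Tot X A). \<exists>\<omega>. \<omega> \<in> hom (Tot X C) (totO f a) c \<and> cartesian X (Tot X C) \<omega> \<and> fst \<omega> = u"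
      if cO: "c \<in> Obj (Tot X C)" for c
    proof -
      obtain U b where c: "c = (U, b)" "U \<in> Obj X" "b \<in> Obj (Fib C U)" by (rule total_objE[OF cO])
      obtain S where S: "S \<in> J U" and loc: "\<And>\<alpha>. \<alpha> \<in> S \<Longrightarrow> \<exists>b'\<in>Obj (Fib A (Dom X \<alpha>)). isos (Fib C (Dom X \<alpha>)) (NatO f (Dom X \<alpha>) b') (ResO C \<alpha> b) \<noteq> {}"
        using f3[OF c(2,3)] by blast
      have "\<exists>a\<in>Obj (Tot X A). \<exists>\<omega>. \<omega> \<in> hom (Tot X C) (totO f a) c \<and> cartesian X (Tot X C) \<omega> \<and> fst \<omega> = u" if u: "u \<in> S" for u
      proof -
        have uA: "u \<in> Arr X" "Cod X u = U" using cover_Arr[OF c(2) S u] by auto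
        obtain b' i where b': "b' \<in> Obj (Fib A (Dom X u))" and i: "i \<in> isos (Fib C (Dom X u)) (NatO f (Dom X u) b') (ResO C u b)"
          using loc[OF u] by blast
        note iA = category.isos_Arr[OF f.B.Fib_category i]
        have "(u, b, i) \<in> Arr (Tot X C)" using uA c iA by auto
        then have "cartesian X (Tot X C) (u, b, i)" using i by (rule f.B.iso_cartesian)
        moreover have "(u, b, i) \<in> hom (Tot X C) (totO f (Dom X u, b')) c" using uA c iA by (auto simp: in_hom)
        moreover have "(Dom X u, b') \<in> Obj (Tot X A)" using uA b' by simp
        ultimately show ?thesis by (intro bexI[of _ "(Dom X u, b')"] exI[of _ "(u, b, i)"]) auto
      qed
      then show ?thesis using S unfolding c(1) fst_conv by blast
    qed
    fix a assume "a \<in> Obj (Tot X A)"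
    then obtain U x where a: "a = (U, x)" "U \<in> Obj X" "x \<in> Obj (Fib A U)" by (rule total_objE)
    show "g.vertical a \<in> isos (Tot X B) (totO p (totO h a)) (totO k (totO f a))"
      using p.B.vt_isos[OF a(2) invertible_modification_isos[OF g a(2,3)]] by (simp add: g.vertical_def a psnat_comp_def)
    show "fst (g.vertical a) = Id X (fst a)" using a by (simp add: g.vertical_def)
  next
    fix v assume v: "v \<in> Arr (Tot X A)"
    show "g.vertical (Cod (Tot X A) v) \<cdot>[Tot X B] totA X B p (totA X E h v) = totA X B k (totA X C f v) \<cdot>[Tot X B] g.vertical (Dom (Tot X A) v)"
      using g.vertical_nat[OF v] tot_comp(2)[OF h p v] tot_comp(2)[OF f1 k v] by simp
  qed (rule eff)
  obtain LO LA \<kappa>' \<rho>' where L: "fibred_functor X (Tot X C) (Tot X E) LO LA"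
    and k1: "\<And>a. a \<in> Obj (Tot X A) \<Longrightarrow> \<kappa>' a \<in> isos (Tot X E) (totO h a) (LO (totO f a)) \<and> fst (\<kappa>' a) = Id X (fst a)"
    and k2: "\<And>v. v \<in> Arr (Tot X A) \<Longrightarrow> \<kappa>' (Cod (Tot X A) v) \<cdot>[Tot X E] totA X E h v = LA (totA X C f v) \<cdot>[Tot X E] \<kappa>' (Dom (Tot X A) v)"
    and r1: "\<And>c. c \<in> Obj (Tot X C) \<Longrightarrow> \<rho>' c \<in> isos (Tot X B) (totO p (LO c)) (totO k c) \<and> fst (\<rho>' c) = Id X (fst c)"
    and r2: "\<And>v. v \<in> Arr (Tot X C) \<Longrightarrow> \<rho>' (Cod (Tot X C) v) \<cdot>[Tot X B] totA X B p (LA v) = totA X B k v \<cdot>[Tot X B] \<rho>' (Dom (Tot X C) v)"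
    and gg: "\<And>a. a \<in> Obj (Tot X A) \<Longrightarrow> g.vertical a = \<rho>' (totO f a) \<cdot>[Tot X B] totA X B p (\<kappa>' a)"
    by (rule L.lift_exists) blast
  obtain l where l: "pseudonatural X C E l" and lO: "\<And>z. z \<in> Obj (Tot X C) \<Longrightarrow> totO l z = LO z" and lA: "\<And>v. v \<in> Arr (Tot X C) \<Longrightarrow> totA X E l v = LA v"
    using psnat_of_fibred_functor[OF f.B.pseudofunctor_axioms p.E.pseudofunctor_axioms L] by blast
  interpret tf: cat_functor "Tot X A" "Tot X C" "totO f" "totA X C f" by (rule f.tot_functor)
  have lf: "pseudonatural X A E (psnat_comp X E l f)" by (rule psnat_comp_pseudonatural[OF f1 l])
  have pl: "pseudonatural X C B (psnat_comp X B p l)" by (rule psnat_comp_pseudonatural[OF l p])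
  obtain \<kappa> where K: "invertible_modification X A E h (psnat_comp X E l f) \<kappa>"
    and K': "\<And>U x. U \<in> Obj X \<Longrightarrow> x \<in> Obj (Fib A U) \<Longrightarrow> \<kappa> U x \<in> hom (Fib E U) (NatO h U x) (NatO (psnat_comp X E l f) U x) \<and> \<kappa>' (U, x) = p.E.vt U (\<kappa> U x)"
  proof (rule modification_of_transformation[OF h lf, of \<kappa>'])
    show "\<kappa>' z \<in> isos (Tot X E) (totO h z) (totO (psnat_comp X E l f) z) \<and> fst (\<kappa>' z) = Id X (fst z)" if z: "z \<in> Obj (Tot X A)" for z
      using k1[OF z] lO[of "totO f z"] z by (simp add: tot_comp(1)[OF f1 l])
    show "\<kappa>' (Cod (Tot X A) v) \<cdot>[Tot X E] totA X E h v = totA X E (psnat_comp X E l f) v \<cdot>[Tot X E] \<kappa>' (Dom (Tot X A) v)" if v: "v \<in> Arr (Tot X A)" for v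
      using k2[OF v] lA[of "totA X C f v"] v by (simp add: tot_comp(2)[OF f1 l])
  qed (rule that)
  obtain \<rho> where R: "invertible_modification X C B (psnat_comp X B p l) k \<rho>"
    and R': "\<And>U x. U \<in> Obj X \<Longrightarrow> x \<in> Obj (Fib C U) \<Longrightarrow> \<rho> U x \<in> hom (Fib B U) (NatO (psnat_comp X B p l) U x) (NatO k U x) \<and> \<rho>' (U, x) = p.B.vt U (\<rho> U x)"
  proof (rule modification_of_transformation[OF pl k, of \<rho>'])
    show "\<rho>' z \<in> isos (Tot X B) (totO (psnat_comp X B p l) z) (totO k z) \<and> fst (\<rho>' z) = Id X (fst z)" if z: "z \<in> Obj (Tot X C)" for z
      using r1[OF z] lO[OF z] z by (simp add: tot_comp(1)[OF l p])
    show "\<rho>' (Cod (Tot X C) v) \<cdot>[Tot X B] totA X B (psnat_comp X B p l) v = totA X B k v \<cdot>[Tot X B] \<rho>' (Dom (Tot X C) v)" if v: "v \<in> Arr (Tot X C)" for v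
      using r2[OF v] lA[OF v] v by (simp add: tot_comp(2)[OF l p])
  qed (rule that)
  \<comment> \<open>The equation of 2-cells is known for the vertical arrows, and \<open>vt\<close>
    is injective on each fibre.\<close>
  have "\<gamma> U x = \<rho> U (NatO f U x) \<cdot>[Fib B U] NatA p U (\<kappa> U x)" if U: "U \<in> Obj X" and x: "x \<in> Obj (Fib A U)" for U x
  proof (rule p.B.vt_inj[OF U])
    have K2: "\<kappa> U x \<in> Arr (Fib E U)" "Cod (Fib E U) (\<kappa> U x) = NatO l U (NatO f U x)" "\<kappa>' (U, x) = p.E.vt U (\<kappa> U x)"
      using K'[OF U x] by (auto simp: in_hom psnat_comp_def)
    have R2: "\<rho> U (NatO f U x) \<in> Arr (Fib B U)" "Dom (Fib B U) (\<rho> U (NatO f U x)) = NatO p U (NatO l U (NatO f U x))"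
      "\<rho>' (U, NatO f U x) = p.B.vt U (\<rho> U (NatO f U x))"
      using R'[OF U, of "NatO f U x"] U x by (auto simp: in_hom psnat_comp_def)
    show "\<gamma> U x \<in> Arr (Fib B U)" using U x by simp
    show "\<rho> U (NatO f U x) \<cdot>[Fib B U] NatA p U (\<kappa> U x) \<in> Arr (Fib B U)" using U x K2 R2 by simp
    show "p.B.vt U (\<gamma> U x) = p.B.vt U (\<rho> U (NatO f U x) \<cdot>[Fib B U] NatA p U (\<kappa> U x))"
      using gg[of "(U, x)"] U x K2 R2 p.totA_vt[OF U K2(1)] p.B.vt_Comp[OF U, of "\<rho> U (NatO f U x)" "NatA p U (\<kappa> U x)"]
      by (simp add: g.vertical_def)
  qed
  then show "\<exists>l \<kappa> \<rho>. pseudonatural X C E l \<and> invertible_modification X A E h (psnat_comp X E l f) \<kappa> \<and>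
     invertible_modification X C B (psnat_comp X B p l) k \<rho> \<and>
     (\<forall>U\<in>Obj X. \<forall>x\<in>Obj (Fib A U). \<gamma> U x = \<rho> U (NatO f U x) \<cdot>[Fib B U] NatA p U (\<kappa> U x))"
    using l K R by blast
qed

section \<open>The discrete prestack of a sieve\<close>

locale encoded_sieves = site X J for X :: "('o, 'a) cat" and J :: "'o \<Rightarrow> 'a set set" +
  fixes U :: 'o and enc :: "'o \<Rightarrow> 'a \<Rightarrow> 'u"
  assumes precanonical: "precanonical X J" and U: "U \<in> Obj X"
    and enc_inj: "V \<in> Obj X \<Longrightarrow> inj_on (enc V) (hom X V U)"
begin

text \<open>Objects of a fibre must be elements of \<open>'u\<close>, so an arrow from
  \<open>V\<close> to \<open>U\<close> is represented by its code; \<open>dec\<close> is only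
  applied meaningfully to such codes.\<close>

definition dec :: "'o \<Rightarrow> 'u \<Rightarrow> 'a" where "dec V x = inv_into (hom X V U) (enc V) x"

definition res :: "'a \<Rightarrow> 'u \<Rightarrow> 'u" where "res f x = enc (Dom X f) (dec (Cod X f) x \<cdot>[X] f)"

text \<open>The sieve \<open>R\<close> on \<open>U\<close>, viewed as a subpresheaf of the representable of \<open>U\<close> and hence as a
  pseudofunctor with discrete fibres.\<close>

definition disc :: "'a set \<Rightarrow> ('o, 'a, 'u) psfun" where
  "disc R = \<lparr>
     Fib = (\<lambda>V. \<lparr>Obj = enc V ` {u \<in> R. Dom X u = V}, Arr = enc V ` {u \<in> R. Dom X u = V},
       Dom = (\<lambda>x. x), Cod = (\<lambda>x. x), Id = (\<lambda>x. x), Comp = (\<lambda>y x. x)\<rparr>),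
     ResO = res, ResA = res, Unt = (\<lambda>V x. x), Cmp = (\<lambda>f g x. res (f \<cdot>[X] g) x)\<rparr>"

lemma disc_simps [simp]:
  "Obj (Fib (disc R) V) = enc V ` {u \<in> R. Dom X u = V}" "Arr (Fib (disc R) V) = enc V ` {u \<in> R. Dom X u = V}"
  "Dom (Fib (disc R) V) x = x" "Cod (Fib (disc R) V) x = x" "Id (Fib (disc R) V) x = x" "y \<cdot>[Fib (disc R) V] x = x"
  "ResO (disc R) = res" "ResA (disc R) = res" "Unt (disc R) V x = x" "Cmp (disc R) f g x = res (f \<cdot>[X] g) x"
  by (simp_all add: disc_def)

lemma dec_enc [simp]: "u \<in> Arr X \<Longrightarrow> Cod X u = U \<Longrightarrow> Dom X u = V \<Longrightarrow> dec V (enc V u) = u"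
  unfolding dec_def using enc_inj[of V] by (intro inv_into_f_f) (auto simp: in_hom)

lemma res_enc [simp]: "u \<in> Arr X \<Longrightarrow> Cod X u = U \<Longrightarrow> Dom X u = V \<Longrightarrow> Cod X f = V \<Longrightarrow> res f (enc V u) = enc (Dom X f) (u \<cdot>[X] f)"
  by (simp add: res_def)

lemma enc_eq: "u \<in> Arr X \<Longrightarrow> Cod X u = U \<Longrightarrow> Dom X u = V \<Longrightarrow> v \<in> Arr X \<Longrightarrow> Cod X v = U \<Longrightarrow> Dom X v = V \<Longrightarrow> enc V u = enc V v \<longleftrightarrow> u = v"
  using enc_inj[of V] by (auto simp: inj_on_def in_hom)

definition max_sieve :: "'a set" where "max_sieve = {f \<in> Arr X. Cod X f = U}"

lemma max_sieve_is_sieve: "is_sieve X U max_sieve"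
  by (auto simp: is_sieve_def max_sieve_def)

context
  fixes R assumes R: "is_sieve X U R"
begin

lemma R_simps [simp]:
  "u \<in> R \<Longrightarrow> u \<in> Arr X" "u \<in> R \<Longrightarrow> Cod X u = U" "u \<in> R \<Longrightarrow> g \<in> Arr X \<Longrightarrow> Cod X g = Dom X u \<Longrightarrow> u \<cdot>[X] g \<in> R"
  using R by (auto simp: is_sieve_def)

lemma disc_category: "category (Fib (disc R) V)"
  by unfold_locales (auto simp: in_hom)

lemma disc_isos: "x \<in> Obj (Fib (disc R) V) \<Longrightarrow> x \<in> isos (Fib (disc R) V) x x"
  by (rule category.isosI[OF disc_category, where g = x]) (auto simp: in_hom)

lemma disc_res_functor: "f \<in> Arr X \<Longrightarrow> Cod X f = V \<Longrightarrow> Dom X f = W \<Longrightarrow> cat_functor (Fib (disc R) V) (Fib (disc R) W) (res f) (res f)"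
  by (intro cat_functor.intro cat_functor_axioms.intro disc_category) (auto simp: in_hom)

lemma disc_pseudofunctor: "pseudofunctor X (disc R)"
proof (intro pseudofunctor.intro pseudofunctor_axioms.intro)
  show "category X" by unfold_locales
  show "category (Fib (disc R) V)" for V by (rule disc_category)
  fix f V W assume "f \<in> hom X V W"
  then have f: "f \<in> Arr X" "Dom X f = V" "Cod X f = W" by (auto simp: in_hom)
  show "cat_functor (Fib (disc R) W) (Fib (disc R) V) (ResO (disc R) f) (ResA (disc R) f)"
    using disc_res_functor f by simp
  show "Cmp (disc R) (Id X W) f x \<cdot>[Fib (disc R) V] ResA (disc R) f (Unt (disc R) W x) = Id (Fib (disc R) V) (ResO (disc R) f x)"
    "Cmp (disc R) f (Id X V) x \<cdot>[Fib (disc R) V] Unt (disc R) V (ResO (disc R) f x) = Id (Fib (disc R) V) (ResO (disc R) f x)" for x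
    by simp_all
  fix g T assume "g \<in> hom X T V"
  then have g: "g \<in> Arr X" "Dom X g = T" "Cod X g = V" by (auto simp: in_hom)
  have fg: "f \<cdot>[X] g \<in> Arr X" "Dom X (f \<cdot>[X] g) = T" "Cod X (f \<cdot>[X] g) = W" using f g by auto
  have rr: "res g (res f x) = res (f \<cdot>[X] g) x" if "x \<in> Obj (Fib (disc R) W)" for x
    using that f g fg by auto
  show "natural_iso (Fib (disc R) W) (Fib (disc R) T) (\<lambda>x. ResO (disc R) g (ResO (disc R) f x)) (\<lambda>\<phi>. ResA (disc R) g (ResA (disc R) f \<phi>))
     (ResO (disc R) (f \<cdot>[X] g)) (ResA (disc R) (f \<cdot>[X] g)) (Cmp (disc R) f g)"
  proof (intro natural_iso.intro natural_iso_axioms.intro)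
    show "cat_functor (Fib (disc R) W) (Fib (disc R) T) (\<lambda>x. ResO (disc R) g (ResO (disc R) f x)) (\<lambda>\<phi>. ResA (disc R) g (ResA (disc R) f \<phi>))"
      using f g by (intro cat_functor.intro cat_functor_axioms.intro disc_category) (auto simp: in_hom)
    show "cat_functor (Fib (disc R) W) (Fib (disc R) T) (ResO (disc R) (f \<cdot>[X] g)) (ResA (disc R) (f \<cdot>[X] g))"
      using disc_res_functor[of "f \<cdot>[X] g"] fg by simp
    show "Cmp (disc R) f g x \<in> isos (Fib (disc R) T) (ResO (disc R) g (ResO (disc R) f x)) (ResO (disc R) (f \<cdot>[X] g) x)"
      if x: "x \<in> Obj (Fib (disc R) W)" for x
    proof -
      have "res (f \<cdot>[X] g) x \<in> Obj (Fib (disc R) T)" using x f g by auto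
      then show ?thesis using disc_isos rr[OF x] by simp
    qed
    show "Cmp (disc R) f g y \<cdot>[Fib (disc R) T] ResA (disc R) g (ResA (disc R) f \<phi>) = ResA (disc R) (f \<cdot>[X] g) \<phi> \<cdot>[Fib (disc R) T] Cmp (disc R) f g x"
      if "\<phi> \<in> hom (Fib (disc R) W) x y" for \<phi> x y
      using that rr[of x] by (auto simp: in_hom)
  qed
  fix h Q x assume "h \<in> hom X Q T" and "x \<in> Obj (Fib (disc R) W)"
  then have h: "h \<in> Arr X" "Dom X h = Q" "Cod X h = T" and x: "x \<in> Obj (Fib (disc R) W)" by (auto simp: in_hom)
  show "Cmp (disc R) (f \<cdot>[X] g) h x \<cdot>[Fib (disc R) Q] ResA (disc R) h (Cmp (disc R) f g x) =
     Cmp (disc R) f (g \<cdot>[X] h) x \<cdot>[Fib (disc R) Q] Cmp (disc R) g h (ResO (disc R) f x)"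
    using f g h fg x by auto
next
  fix V assume V: "V \<in> Obj X"
  have rI: "res (Id X V) x = x" if "x \<in> Obj (Fib (disc R) V)" for x using that V by auto
  show "natural_iso (Fib (disc R) V) (Fib (disc R) V) (\<lambda>x. x) (\<lambda>\<phi>. \<phi>) (ResO (disc R) (Id X V)) (ResA (disc R) (Id X V)) (Unt (disc R) V)"
  proof (intro natural_iso.intro natural_iso_axioms.intro)
    show "cat_functor (Fib (disc R) V) (Fib (disc R) V) (\<lambda>x. x) (\<lambda>\<phi>. \<phi>)"
      by (intro cat_functor.intro cat_functor_axioms.intro disc_category) (auto simp: in_hom)
    show "cat_functor (Fib (disc R) V) (Fib (disc R) V) (ResO (disc R) (Id X V)) (ResA (disc R) (Id X V))"
      using disc_res_functor[of "Id X V"] V by simp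
    show "Unt (disc R) V x \<in> isos (Fib (disc R) V) x (ResO (disc R) (Id X V) x)" if "x \<in> Obj (Fib (disc R) V)" for x
      using disc_isos[OF that] rI[OF that] by simp
    show "Unt (disc R) V y \<cdot>[Fib (disc R) V] \<phi> = ResA (disc R) (Id X V) \<phi> \<cdot>[Fib (disc R) V] Unt (disc R) V x"
      if "\<phi> \<in> hom (Fib (disc R) V) x y" for \<phi> x y using that by (auto simp: in_hom)
  qed
qed

text \<open>For the codes of \<open>u\<close> and \<open>v\<close>, the sections of the hom presheaf
  at \<open>f\<close> form a singleton if the composites of \<open>u\<close> and \<open>v\<close>
  with \<open>f\<close> agree, and are empty otherwise. Gluing thus means that this agreement may be
  tested on a cover, which is uniqueness of amalgamation in the representable of
  \<open>U\<close>.\<close>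

lemma disc_prestack: "prestack X J (disc R)"
  unfolding prestack_def
proof (intro conjI ballI disc_pseudofunctor)
  fix V a b assume V: "V \<in> Obj X" and a0: "a \<in> Obj (Fib (disc R) V)" and b0: "b \<in> Obj (Fib (disc R) V)"
  obtain u where u: "a = enc V u" "u \<in> R" "Dom X u = V" using a0 by auto
  obtain v where v: "b = enc V v" "v \<in> R" "Dom X v = V" using b0 by auto
  let ?H = "hom_presheaf X (disc R) a b"
  have Sec: "s \<in> Sec ?H f \<longleftrightarrow> s = res f b \<and> u \<cdot>[X] f = v \<cdot>[X] f" if f: "f \<in> Arr X" "Cod X f = V" for s f
  proof -
    have "enc (Dom X f) (u \<cdot>[X] f) = enc (Dom X f) (v \<cdot>[X] f) \<longleftrightarrow> u \<cdot>[X] f = v \<cdot>[X] f"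
      by (rule enc_eq) (use u v f in auto)
    moreover have "v \<cdot>[X] f \<in> {w \<in> R. Dom X w = Dom X f}" using v f by auto
    ultimately show ?thesis using u v f by (auto simp: hom_presheaf_def in_hom)
  qed
  have Rst: "Rest ?H (f, g) s = res (f \<cdot>[X] g) b" if f: "f \<in> Arr X" "Cod X f = V" and g: "g \<in> Arr X" "Cod X g = Dom X f" and s: "s \<in> Sec ?H f" for f g s
  proof -
    have s': "s = res f b" "u \<cdot>[X] f = v \<cdot>[X] f" using s Sec[OF f] by auto
    have x: "enc (Dom X g) (v \<cdot>[X] (f \<cdot>[X] g)) \<in> Obj (Fib (disc R) (Dom X g))" using v f g by auto
    have uv: "u \<cdot>[X] (f \<cdot>[X] g) = v \<cdot>[X] (f \<cdot>[X] g)"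
      by (rule X.compose_eq2[OF s'(2)]) (use u v f g in auto)
    note i = disc_isos[OF x]
    have "inv_arr (Fib (disc R) (Dom X g)) (enc (Dom X g) (v \<cdot>[X] (f \<cdot>[X] g))) = enc (Dom X g) (v \<cdot>[X] (f \<cdot>[X] g))"
      using category.inv_arr_simps(2)[OF disc_category i] by simp
    then show ?thesis using u v f g uv by (simp add: hom_presheaf_def restrict_mor_def)
  qed
  have cat: "category (slice X V)" by (rule X.slice_category)
  have "presheaf (slice X V) ?H"
  proof (intro presheaf.intro presheaf_axioms.intro cat)
    fix F g0 f s assume "F \<in> hom (slice X V) g0 f" and s: "s \<in> Sec ?H f"
    then obtain g where F: "F = (f, g)" "g0 = f \<cdot>[X] g" and fg: "f \<in> Arr X" "Cod X f = V" "g \<in> Arr X" "Cod X g = Dom X f"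
      by (auto simp: slice_def in_hom)
    have uvf: "u \<cdot>[X] f = v \<cdot>[X] f" using s Sec[OF fg(1,2)] by auto
    have uv: "u \<cdot>[X] (f \<cdot>[X] g) = v \<cdot>[X] (f \<cdot>[X] g)"
      by (rule X.compose_eq2[OF uvf]) (use u v fg in auto)
    show RS: "Rest ?H F s \<in> Sec ?H g0"
      unfolding F using Rst[OF fg s] Sec[of "f \<cdot>[X] g"] fg uv by simp
    fix G h0 assume "G \<in> hom (slice X V) h0 g0"
    then obtain h where G: "G = (f \<cdot>[X] g, h)" and h: "h \<in> Arr X" "Cod X h = Dom X g"
      using fg F by (auto simp: slice_def in_hom)
    have "F \<cdot>[slice X V] G = (f, g \<cdot>[X] h)" by (simp add: F G slice_def)
    then show "Rest ?H (F \<cdot>[slice X V] G) s = Rest ?H G (Rest ?H F s)"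
      using Rst[OF fg(1,2) _ _ s, of "g \<cdot>[X] h"] Rst[of "f \<cdot>[X] g" h "Rest ?H F s"] RS fg h F G by simp
  next
    fix f s assume f: "f \<in> Obj (slice X V)" and s: "s \<in> Sec ?H f"
    then have f': "f \<in> Arr X" "Cod X f = V" by (auto simp: slice_def)
    have "Id (slice X V) f = (f, Id X (Dom X f))" by (simp add: slice_def)
    then show "Rest ?H (Id (slice X V) f) s = s" using Rst[OF f' _ _ s, of "Id X (Dom X f)"] f' s Sec[OF f'] by simp
  qed
  moreover have "\<exists>!t. t \<in> Sec ?H f \<and> (\<forall>F\<in>T. Rest ?H F t = s F)"
    if f: "f \<in> Obj (slice X V)" and T: "T \<in> slice_topology X J V f" and s: "matching_family (slice X V) ?H T s" for f T s
  proof -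
    have f': "f \<in> Arr X" "Cod X f = V" using f by (auto simp: slice_def)
    have TJ: "snd ` T \<in> J (Dom X f)" and TS: "is_sieve (slice X V) f T" using T by (auto simp: slice_topology_def)
    have Tg: "\<exists>g. F = (f, g) \<and> g \<in> Arr X \<and> Cod X g = Dom X f" if "F \<in> T" for F
      using TS that by (auto simp: is_sieve_def slice_def)
    have sF: "s (f, g) = res (f \<cdot>[X] g) b" "u \<cdot>[X] (f \<cdot>[X] g) = v \<cdot>[X] (f \<cdot>[X] g)" if g: "(f, g) \<in> T" for g
    proof -
      have "g \<in> Arr X" "Cod X g = Dom X f" using Tg[OF g] by auto
      moreover have "s (f, g) \<in> Sec ?H (f \<cdot>[X] g)" using s g by (auto simp: matching_family_def slice_def)
      ultimately show "s (f, g) = res (f \<cdot>[X] g) b" "u \<cdot>[X] (f \<cdot>[X] g) = v \<cdot>[X] (f \<cdot>[X] g)" using Sec[of "f \<cdot>[X] g"] f' by auto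
    qed
    have snd: "g \<in> snd ` T \<longleftrightarrow> (f, g) \<in> T" for g using Tg by force
    \<comment> \<open>Both composites amalgamate the same matching family of the representable of
      \<open>U\<close>; this is where precanonicity is used.\<close>
    have uvf: "u \<cdot>[X] f = v \<cdot>[X] f"
    proof -
      have D: "Dom X f \<in> Obj X" using f' by simp
      let ?r = "representable X U"
      have "matching_family X ?r (snd ` T) (\<lambda>g. (u \<cdot>[X] f) \<cdot>[X] g)"
        unfolding matching_family_def using cover_Arr[OF D TJ] u f' by (auto simp: representable_def in_hom)
      moreover have "is_sheaf X J ?r" using precanonical U by (simp add: precanonical_def)
      ultimately have ex: "\<exists>!t. t \<in> Sec ?r (Dom X f) \<and> (\<forall>g\<in>snd ` T. Rest ?r g t = (u \<cdot>[X] f) \<cdot>[X] g)"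
        using D TJ unfolding is_sheaf_def by blast
      have "u \<cdot>[X] f \<in> Sec ?r (Dom X f) \<and> (\<forall>g\<in>snd ` T. Rest ?r g (u \<cdot>[X] f) = (u \<cdot>[X] f) \<cdot>[X] g)"
        using u f' by (auto simp: representable_def in_hom)
      moreover have "v \<cdot>[X] f \<in> Sec ?r (Dom X f) \<and> (\<forall>g\<in>snd ` T. Rest ?r g (v \<cdot>[X] f) = (u \<cdot>[X] f) \<cdot>[X] g)"
      proof (intro conjI ballI)
        show "v \<cdot>[X] f \<in> Sec ?r (Dom X f)" using v f' by (auto simp: representable_def in_hom)
        fix g assume g: "g \<in> snd ` T"
        show "Rest ?r g (v \<cdot>[X] f) = (u \<cdot>[X] f) \<cdot>[X] g"
          using sF(2)[OF snd[THEN iffD1, OF g]] cover_Arr[OF D TJ g] u v f' by (simp add: representable_def)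
      qed
      ultimately show ?thesis using ex by blast
    qed
    show ?thesis
    proof (rule ex1I[of _ "res f b"])
      have m: "res f b \<in> Sec ?H f" using Sec[OF f'] uvf by simp
      show "res f b \<in> Sec ?H f \<and> (\<forall>F\<in>T. Rest ?H F (res f b) = s F)"
      proof (intro conjI ballI m)
        fix F assume F: "F \<in> T"
        then obtain g where g: "F = (f, g)" "g \<in> Arr X" "Cod X g = Dom X f" using Tg by blast
        show "Rest ?H F (res f b) = s F" using Rst[OF f' g(2,3) m] sF(1)[of g] F g by simp
      qed
      show "t = res f b" if "t \<in> Sec ?H f \<and> (\<forall>F\<in>T. Rest ?H F t = s F)" for t
        using that Sec[OF f'] by blast
    qed
  qed
  ultimately show "is_sheaf (slice X V) (slice_topology X J V) ?H" unfolding is_sheaf_def by blast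
qed

lemma disc_arrE:
  assumes "f \<in> Arr (Tot X (disc R))"
  obtains g u where "f = (g, enc (Cod X g) u, enc (Dom X g) (u \<cdot>[X] g))" "g \<in> Arr X" "u \<in> R" "Dom X u = Cod X g"
proof -
  obtain g y \<phi> where f: "f = (g, y, \<phi>)" "g \<in> Arr X" "y \<in> Obj (Fib (disc R) (Cod X g))" "\<phi> = res g y"
    using assms by (auto elim!: total_arrE)
  obtain u where "y = enc (Cod X g) u" "u \<in> R" "Dom X u = Cod X g" using f by auto
  then show thesis using f that by simp
qed

lemma disc_objE:
  assumes "z \<in> Obj (Tot X (disc R))"
  obtains u where "z = (Dom X u, enc (Dom X u) u)" "u \<in> R"
  using assms by (auto elim!: total_objE)

lemma disc_arrI: "g \<in> Arr X \<Longrightarrow> u \<in> R \<Longrightarrow> Dom X u = Cod X g \<Longrightarrow> (g, enc (Cod X g) u, enc (Dom X g) (u \<cdot>[X] g)) \<in> Arr (Tot X (disc R))"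
  by auto

text \<open>Every arrow of a discrete fibre is an identity, hence invertible, and
  \<open>iso_cartesian\<close> applies.\<close>

lemma disc_cart: "f \<in> Arr (Tot X (disc R)) \<Longrightarrow> cartesian X (Tot X (disc R)) f"
proof -
  assume f: "f \<in> Arr (Tot X (disc R))"
  then obtain g u where fe: "f = (g, enc (Cod X g) u, enc (Dom X g) (u \<cdot>[X] g))" "g \<in> Arr X" "u \<in> R" "Dom X u = Cod X g" by (rule disc_arrE)
  have "enc (Dom X g) (u \<cdot>[X] g) \<in> isos (Fib (disc R) (Dom X g)) (enc (Dom X g) (u \<cdot>[X] g)) (enc (Dom X g) (u \<cdot>[X] g))"
    using fe by (intro disc_isos) auto
  then show ?thesis using f unfolding fe(1) by (intro pseudofunctor.iso_cartesian[OF disc_pseudofunctor]) (use fe in auto)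
qed

text \<open>Up to codes, the total category of a discrete sieve is the sieve as a full subcategory
  of the slice, and all its arrows are cartesian. A descent family is therefore a cartesian functor
  out of it.\<close>

lemma functor_of_family:
  assumes T: "fibred X T" and fam: "descent_family X T R e t"
  shows "fibred_functor X (Tot X (disc R)) T (\<lambda>(V, x). e (dec V x)) (\<lambda>(g, y, \<phi>). t (dec (Cod X g) y) g)"
proof -
  interpret T: fibred X T by (rule T)
  have e: "e u \<in> Obj T" "fst (e u) = Dom X u" if "u \<in> R" for u using fam that by (auto simp: descent_family_def)
  have t: "t u g \<in> Arr T" "Dom T (t u g) = e (u \<cdot>[X] g)" "Cod T (t u g) = e u" "fst (t u g) = g" "cartesian X T (t u g)"
    if "u \<in> R" "g \<in> Arr X" "Cod X g = Dom X u" for u g using fam that by (auto simp: descent_family_def in_hom)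
  have tc: "t u (g \<cdot>[X] h) = t u g \<cdot>[T] t (u \<cdot>[X] g) h" if "u \<in> R" "g \<in> Arr X" "Cod X g = Dom X u" "h \<in> Arr X" "Cod X h = Dom X g" for u g h
    using fam that by (auto simp: descent_family_def)
  show ?thesis
  proof (intro fibred_functor.intro fibred_functor_axioms.intro cat_functor.intro cat_functor_axioms.intro)
    show "fibred X (Tot X (disc R))" "category (Tot X (disc R))"
      by (rule pseudofunctor.total_fibred[OF disc_pseudofunctor] pseudofunctor.total_category[OF disc_pseudofunctor])+
    show "fibred X T" "category T" by unfold_locales
    fix z assume "z \<in> Obj (Tot X (disc R))"
    then obtain u where z: "z = (Dom X u, enc (Dom X u) u)" "u \<in> R" by (rule disc_objE)
    show "(case z of (V, x) \<Rightarrow> e (dec V x)) \<in> Obj T" "fst (case z of (V, x) \<Rightarrow> e (dec V x)) = fst z"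
      using z e by auto
    show "(case Id (Tot X (disc R)) z of (g, y, \<phi>) \<Rightarrow> t (dec (Cod X g) y) g) = Id T (case z of (V, x) \<Rightarrow> e (dec V x))"
      using z T.descent_family_Id[OF fam z(2)] by simp
  next
    fix f x y assume "f \<in> hom (Tot X (disc R)) x y"
    then have f: "f \<in> Arr (Tot X (disc R))" "Dom (Tot X (disc R)) f = x" "Cod (Tot X (disc R)) f = y" by (auto simp: in_hom)
    obtain g u where fe: "f = (g, enc (Cod X g) u, enc (Dom X g) (u \<cdot>[X] g))" "g \<in> Arr X" "u \<in> R" "Dom X u = Cod X g" using f(1) by (rule disc_arrE)
    show "(case f of (g, y, \<phi>) \<Rightarrow> t (dec (Cod X g) y) g) \<in> hom T (case x of (V, x) \<Rightarrow> e (dec V x)) (case y of (V, x) \<Rightarrow> e (dec V x))"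
      using f(2,3)[symmetric] fe t[of u g] by (simp add: in_hom)
  next
    fix f k x y z assume "f \<in> hom (Tot X (disc R)) x y" "k \<in> hom (Tot X (disc R)) y z"
    then have f: "f \<in> Arr (Tot X (disc R))" "k \<in> Arr (Tot X (disc R))" "Cod (Tot X (disc R)) f = Dom (Tot X (disc R)) k" by (auto simp: in_hom)
    obtain h v where fe: "f = (h, enc (Cod X h) v, enc (Dom X h) (v \<cdot>[X] h))" "h \<in> Arr X" "v \<in> R" "Dom X v = Cod X h" using f(1) by (rule disc_arrE)
    obtain g u where ke: "k = (g, enc (Cod X g) u, enc (Dom X g) (u \<cdot>[X] g))" "g \<in> Arr X" "u \<in> R" "Dom X u = Cod X g" using f(2) by (rule disc_arrE)
    have hg: "Cod X h = Dom X g" and "enc (Dom X g) v = enc (Dom X g) (u \<cdot>[X] g)" using f(3) fe(1) ke(1) by auto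
    \<comment> \<open>Composability only says that two codes agree; injectivity of the coding
      returns to the arrows.\<close>
    then have "v = u \<cdot>[X] g" using fe ke by (subst (asm) enc_eq) auto
    then show "(case k \<cdot>[Tot X (disc R)] f of (g, y, \<phi>) \<Rightarrow> t (dec (Cod X g) y) g) = (case k of (g, y, \<phi>) \<Rightarrow> t (dec (Cod X g) y) g) \<cdot>[T] (case f of (g, y, \<phi>) \<Rightarrow> t (dec (Cod X g) y) g)"
      using fe ke hg tc[of u g h] by simp
  next
    fix f assume "f \<in> Arr (Tot X (disc R))"
    then obtain g u where fe: "f = (g, enc (Cod X g) u, enc (Dom X g) (u \<cdot>[X] g))" "g \<in> Arr X" "u \<in> R" "Dom X u = Cod X g" by (rule disc_arrE)
    then show "fst (case f of (g, y, \<phi>) \<Rightarrow> t (dec (Cod X g) y) g) = fst f" using t[of u g] by simp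
  next
    fix f assume "cartesian X (Tot X (disc R)) f"
    then have "f \<in> Arr (Tot X (disc R))" by (simp add: cartesian_def)
    then obtain g u where fe: "f = (g, enc (Cod X g) u, enc (Dom X g) (u \<cdot>[X] g))" "g \<in> Arr X" "u \<in> R" "Dom X u = Cod X g" by (rule disc_arrE)
    then show "cartesian X T (case f of (g, y, \<phi>) \<Rightarrow> t (dec (Cod X g) y) g)" using t[of u g] by simp
  qed
qed

end

declare R_simps [simp del]

section \<open>The inclusion of a covering sieve in the representable\<close>

definition incl :: "('o, 'a, 'u) psnat" where
  "incl = \<lparr>NatO = (\<lambda>V x. x), NatA = (\<lambda>V \<phi>. \<phi>), NatC = res\<rparr>"

lemma incl_simps [simp]: "NatO incl V x = x" "NatA incl V \<phi> = \<phi>" "NatC incl = res"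
  by (simp_all add: incl_def)

lemma incl_pseudonatural:
  assumes R: "is_sieve X U R"
  shows "pseudonatural X (disc R) (disc max_sieve) incl"
proof -
  note M = max_sieve_is_sieve
  have RM: "R \<subseteq> max_sieve" using R by (auto simp: is_sieve_def max_sieve_def)
  have oM: "x \<in> Obj (Fib (disc max_sieve) V)" if "x \<in> Obj (Fib (disc R) V)" for x V using that RM by auto
  show ?thesis
  proof (intro pseudonatural.intro pseudonatural_axioms.intro disc_pseudofunctor R M)
    show "cat_functor (Fib (disc R) V) (Fib (disc max_sieve) V) (NatO incl V) (NatA incl V)" for V
      using RM by (intro cat_functor.intro cat_functor_axioms.intro disc_category R M) (auto simp: in_hom)
    fix f V W assume "f \<in> hom X V W"
    then have f: "f \<in> Arr X" "Dom X f = V" "Cod X f = W" by (auto simp: in_hom)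
    have RF: "cat_functor (Fib (disc R) W) (Fib (disc max_sieve) V) (res f) (res f)"
      using disc_res_functor[OF R f(1,3,2)] RM oM
      by (intro cat_functor.intro cat_functor_axioms.intro disc_category R M) (auto simp: cat_functor_def cat_functor_axioms_def in_hom)
    show "natural_iso (Fib (disc R) W) (Fib (disc max_sieve) V) (\<lambda>x. NatO incl V (ResO (disc R) f x)) (\<lambda>\<phi>. NatA incl V (ResA (disc R) f \<phi>))
       (\<lambda>x. ResO (disc max_sieve) f (NatO incl W x)) (\<lambda>\<phi>. ResA (disc max_sieve) f (NatA incl W \<phi>)) (NatC incl f)"
    proof (intro natural_iso.intro natural_iso_axioms.intro)
      show "NatC incl f x \<in> isos (Fib (disc max_sieve) V) (NatO incl V (ResO (disc R) f x)) (ResO (disc max_sieve) f (NatO incl W x))" if x: "x \<in> Obj (Fib (disc R) W)" for x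
        using disc_isos[OF M, of "res f x" V] cat_functor.FO_Obj[OF RF x] by simp
    qed (use RF in \<open>auto simp: in_hom\<close>)
    fix g T x assume "g \<in> hom X T V" and x: "x \<in> Obj (Fib (disc R) W)"
    then have g: "g \<in> Arr X" "Dom X g = T" "Cod X g = V" by (auto simp: in_hom)
    have "res g (res f x) = res (f \<cdot>[X] g) x" using x f g R_simps[OF R] by auto
    then show "NatC incl (f \<cdot>[X] g) x \<cdot>[Fib (disc max_sieve) T] NatA incl T (Cmp (disc R) f g x) =
      Cmp (disc max_sieve) f g (NatO incl W x) \<cdot>[Fib (disc max_sieve) T] ResA (disc max_sieve) g (NatC incl f x) \<cdot>[Fib (disc max_sieve) T] NatC incl g (ResO (disc R) f x)"
      by simp
  qed simp
qed

text \<open>For an arrow \<open>u\<close> into \<open>U\<close> the required cover is the pullback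
  of \<open>S\<close> along \<open>u\<close>: over each of its members the restriction of
  \<open>u\<close> lies in \<open>S\<close>, so the local preimage is that restriction
  itself.\<close>

lemma incl_local_weak_equivalence:
  assumes S: "S \<in> J U"
  shows "(disc S, disc max_sieve, incl) \<in> local_weak_equivalences X J"
proof -
  have R: "is_sieve X U S" by (rule covers_sieve[OF U S])
  note M = max_sieve_is_sieve
  have RM: "S \<subseteq> max_sieve" using R by (auto simp: is_sieve_def max_sieve_def)
  have "full_and_faithful (Fib (disc S) V) (Fib (disc max_sieve) V) (NatO incl V) (NatA incl V)" for V
    unfolding full_and_faithful_def bij_betw_def using RM by (auto simp: in_hom inj_on_def)
  moreover have "\<exists>T\<in>J V. \<forall>\<alpha>\<in>T. \<exists>b'\<in>Obj (Fib (disc S) (Dom X \<alpha>)). isos (Fib (disc max_sieve) (Dom X \<alpha>)) (NatO incl (Dom X \<alpha>) b') (ResO (disc max_sieve) \<alpha> b) \<noteq> {}"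
    if V: "V \<in> Obj X" and b: "b \<in> Obj (Fib (disc max_sieve) V)" for V b
  proof -
    obtain u where u: "b = enc V u" "u \<in> Arr X" "Cod X u = U" "Dom X u = V" using b by (auto simp: max_sieve_def)
    have T: "pull_sieve X u S \<in> J V" using stable_cover[of u V U S] u S by (simp add: in_hom)
    moreover have "\<exists>b'\<in>Obj (Fib (disc S) (Dom X \<alpha>)). isos (Fib (disc max_sieve) (Dom X \<alpha>)) (NatO incl (Dom X \<alpha>) b') (ResO (disc max_sieve) \<alpha> b) \<noteq> {}"
      if a: "\<alpha> \<in> pull_sieve X u S" for \<alpha>
    proof (rule bexI[of _ "enc (Dom X \<alpha>) (u \<cdot>[X] \<alpha>)"])
      have al: "\<alpha> \<in> Arr X" "Cod X \<alpha> = V" "u \<cdot>[X] \<alpha> \<in> S" using a u by (auto simp: pull_sieve_def)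
      then show o: "enc (Dom X \<alpha>) (u \<cdot>[X] \<alpha>) \<in> Obj (Fib (disc S) (Dom X \<alpha>))" using u by auto
      have "enc (Dom X \<alpha>) (u \<cdot>[X] \<alpha>) \<in> isos (Fib (disc max_sieve) (Dom X \<alpha>)) (enc (Dom X \<alpha>) (u \<cdot>[X] \<alpha>)) (enc (Dom X \<alpha>) (u \<cdot>[X] \<alpha>))"
        by (rule disc_isos[OF M]) (use o RM in auto)
      then show "isos (Fib (disc max_sieve) (Dom X \<alpha>)) (NatO incl (Dom X \<alpha>) (enc (Dom X \<alpha>) (u \<cdot>[X] \<alpha>))) (ResO (disc max_sieve) \<alpha> b) \<noteq> {}"
        using u al by auto
    qed
    ultimately show ?thesis by blast
  qed
  ultimately show ?thesis
    using disc_prestack[OF R] disc_prestack[OF M] incl_pseudonatural[OF R]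
    by (simp add: local_weak_equivalences_def)
qed

end

section \<open>Gluing by lifting\<close>

context encoded_sieves begin

text \<open>The descent datum is a map from the sieve to \<open>E\<close> over a map from the representable to \<open>B\<close>;
  evaluating a lift at the identity of \<open>U\<close> glues it.\<close>

lemma effective_of_lifting:
  assumes p: "pseudonatural X E B p" and S: "S \<in> J U" and lifts: "lifts X (disc S) (disc max_sieve) incl E B p"
  shows "effective X (Tot X E) (Tot X B) (totO p) (totA X B p) U S"
  unfolding effective_def
proof (intro allI impI, elim conjE)
  fix e t b \<psi>
  assume fam: "descent_family X (Tot X E) S e t" and b: "b \<in> Obj (Tot X B)" "fst b = U"
    and \<psi>0: "\<forall>\<alpha>\<in>S. \<psi> \<alpha> \<in> hom (Tot X B) (totO p (e \<alpha>)) b \<and> fst (\<psi> \<alpha>) = \<alpha> \<and> cartesian X (Tot X B) (\<psi> \<alpha>)"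
    and \<psi>t0: "\<forall>\<alpha>\<in>S. \<forall>g\<in>Arr X. Cod X g = Dom X \<alpha> \<longrightarrow> \<psi> \<alpha> \<cdot>[Tot X B] totA X B p (t \<alpha> g) = \<psi> (\<alpha> \<cdot>[X] g)"
  interpret p: pseudonatural X E B p by (rule p)
  interpret PF: fibred_functor X "Tot X E" "Tot X B" "totO p" "totA X B p" by (rule p.tot_fibred_functor)
  have R: "is_sieve X U S" by (rule covers_sieve[OF U S])
  note M = max_sieve_is_sieve
  interpret DS: pseudofunctor X "disc S" by (rule disc_pseudofunctor[OF R])
  interpret DM: pseudofunctor X "disc max_sieve" by (rule disc_pseudofunctor[OF M])
  interpret i: pseudonatural X "disc S" "disc max_sieve" incl by (rule incl_pseudonatural[OF R])
  have SM: "\<alpha> \<in> max_sieve" if "\<alpha> \<in> S" for \<alpha> using R that by (auto simp: is_sieve_def max_sieve_def)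
  note S1 = R_simps[OF R] and M1 = R_simps[OF M]
  obtain b0 where b0: "b = (U, b0)" "b0 \<in> Obj (Fib B U)" using b by (auto elim!: total_objE)
  have e: "e \<alpha> \<in> Obj (Tot X E)" "fst (e \<alpha>) = Dom X \<alpha>" if "\<alpha> \<in> S" for \<alpha> using fam that by (auto simp: descent_family_def)
  have t: "t \<alpha> g \<in> Arr (Tot X E)" "Dom (Tot X E) (t \<alpha> g) = e (\<alpha> \<cdot>[X] g)" "Cod (Tot X E) (t \<alpha> g) = e \<alpha>" "fst (t \<alpha> g) = g"
     if "\<alpha> \<in> S" "g \<in> Arr X" "Cod X g = Dom X \<alpha>" for \<alpha> g
    using fam that by (auto simp: descent_family_def in_hom)
  have \<psi>: "\<psi> \<alpha> \<in> Arr (Tot X B)" "Dom (Tot X B) (\<psi> \<alpha>) = totO p (e \<alpha>)" "Cod (Tot X B) (\<psi> \<alpha>) = (U, b0)" "fst (\<psi> \<alpha>) = \<alpha>" "cartesian X (Tot X B) (\<psi> \<alpha>)" if "\<alpha> \<in> S" for \<alpha>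
    using \<psi>0 b0 that by (auto simp: in_hom)
  have \<psi>t: "\<psi> \<alpha> \<cdot>[Tot X B] totA X B p (t \<alpha> g) = \<psi> (\<alpha> \<cdot>[X] g)" if "\<alpha> \<in> S" "g \<in> Arr X" "Cod X g = Dom X \<alpha>" for \<alpha> g
    using \<psi>t0 that by blast
  note km = p.B.cmpi[where x = b0]
  have ci: "p.B.ci u b0 \<in> Arr (Tot X B)" "Dom (Tot X B) (p.B.ci u b0) = (Dom X u, ResO B u b0)" "Cod (Tot X B) (p.B.ci u b0) = (U, b0)"
    "fst (p.B.ci u b0) = u" "cartesian X (Tot X B) (p.B.ci u b0)" if "u \<in> max_sieve" for u
    using that b0 M1(1,2)[OF that] p.B.ci_cartesian[of u b0] by auto
  have kmM: "p.B.cmpi u g b0 \<in> Arr (Tot X B)" "Dom (Tot X B) (p.B.cmpi u g b0) = (Dom X g, ResO B (u \<cdot>[X] g) b0)"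
    "Cod (Tot X B) (p.B.cmpi u g b0) = (Dom X u, ResO B u b0)" "fst (p.B.cmpi u g b0) = g"
    "p.B.ci u b0 \<cdot>[Tot X B] p.B.cmpi u g b0 = p.B.ci (u \<cdot>[X] g) b0" "cartesian X (Tot X B) (p.B.cmpi u g b0)"
    if "u \<in> max_sieve" "g \<in> Arr X" "Cod X g = Dom X u" for u g
    using km[of u g] that b0 M1(1,2)[OF that(1)] by (auto simp del: total_simps(6))
  \<comment> \<open>The map from the representable that names \<open>b\<close>: an arrow goes to the
    restriction of \<open>b\<close> along it, and the transitions are the comparisons of chosen
    lifts.\<close>
  define ke where "ke u = (Dom X u, ResO B u b0)" for u
  define kt where "kt u g = p.B.cmpi u g b0" for u g
  have famK: "descent_family X (Tot X B) max_sieve ke kt"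
    unfolding descent_family_def
  proof (intro conjI ballI impI)
    fix u assume u: "u \<in> max_sieve"
    show "ke u \<in> Obj (Tot X B)" "fst (ke u) = Dom X u" using u M1[OF u] b0 by (auto simp: ke_def)
    fix g assume g: "g \<in> Arr X" "Cod X g = Dom X u"
    show "kt u g \<in> hom (Tot X B) (ke (u \<cdot>[X] g)) (ke u)" "fst (kt u g) = g" "cartesian X (Tot X B) (kt u g)"
      using kmM[OF u g] u g M1[OF u] by (auto simp: in_hom ke_def kt_def)
  next
    fix u g h assume u: "u \<in> max_sieve" and gA: "g \<in> Arr X" and hA: "h \<in> Arr X" and c: "Cod X g = Dom X u \<and> Cod X h = Dom X g"
    note g = gA c[THEN conjunct1] and h = hA c[THEN conjunct2]
    have uA: "u \<in> Arr X" "Cod X u = U" using M1[OF u] by auto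
    have ug: "u \<cdot>[X] g \<in> max_sieve" "Cod X h = Dom X (u \<cdot>[X] g)" using M1(3)[OF u g] uA g h by auto
    have gh: "g \<cdot>[X] h \<in> Arr X" "Cod X (g \<cdot>[X] h) = Dom X u" using g h by auto
    note k1 = kmM[OF u g] and k2 = kmM[OF ug(1) h(1) ug(2)] and k3 = kmM[OF u gh]
    have "p.B.ci u b0 \<cdot>[Tot X B] (kt u g \<cdot>[Tot X B] kt (u \<cdot>[X] g) h) = p.B.ci (u \<cdot>[X] g) b0 \<cdot>[Tot X B] kt (u \<cdot>[X] g) h"
      unfolding kt_def by (rule p.B.T.compose_eq[OF k1(5)]) (use k1 k2 ci[OF u] uA g in auto)
    also have "\<dots> = p.B.ci u b0 \<cdot>[Tot X B] kt u (g \<cdot>[X] h)"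
      unfolding kt_def k2(5) k3(5) using uA g h by simp
    finally have e: "p.B.ci u b0 \<cdot>[Tot X B] kt u (g \<cdot>[X] h) = p.B.ci u b0 \<cdot>[Tot X B] (kt u g \<cdot>[Tot X B] kt (u \<cdot>[X] g) h)" by simp
    show "kt u (g \<cdot>[X] h) = kt u g \<cdot>[Tot X B] kt (u \<cdot>[X] g) h"
      by (rule p.B.T.cart_unique[OF ci(5)[OF u] _ _ _ _ _ e]) (use k1 k2 k3 ci[OF u] uA g in \<open>auto simp: kt_def\<close>)
  qed
  obtain h where h: "pseudonatural X (disc S) E h"
    and hO: "\<And>z. z \<in> Obj (Tot X (disc S)) \<Longrightarrow> totO h z = (\<lambda>(V, x). e (dec V x)) z"
    and hA: "\<And>f. f \<in> Arr (Tot X (disc S)) \<Longrightarrow> totA X E h f = (\<lambda>(g, y, \<phi>). t (dec (Cod X g) y) g) f"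
    using psnat_of_fibred_functor[OF DS.pseudofunctor_axioms p.E.pseudofunctor_axioms functor_of_family[OF R p.E.total_fibred fam]] by blast
  obtain k where k: "pseudonatural X (disc max_sieve) B k"
    and kO: "\<And>z. z \<in> Obj (Tot X (disc max_sieve)) \<Longrightarrow> totO k z = (\<lambda>(V, x). ke (dec V x)) z"
    and kA: "\<And>f. f \<in> Arr (Tot X (disc max_sieve)) \<Longrightarrow> totA X B k f = (\<lambda>(g, y, \<phi>). kt (dec (Cod X g) y) g) f"
    using psnat_of_fibred_functor[OF DM.pseudofunctor_axioms p.B.pseudofunctor_axioms functor_of_family[OF M p.B.total_fibred famK]] by blast
  define ob where "ob \<alpha> = (Dom X \<alpha>, enc (Dom X \<alpha>) \<alpha>)" for \<alpha>
  define ar where "ar \<alpha> g = (g, enc (Cod X g) \<alpha>, enc (Dom X g) (\<alpha> \<cdot>[X] g))" for \<alpha> g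
  have obS: "ob \<alpha> \<in> Obj (Tot X (disc S))" if "\<alpha> \<in> S" for \<alpha> using that S1 by (auto simp: ob_def)
  have obM: "ob \<alpha> \<in> Obj (Tot X (disc max_sieve))" if "\<alpha> \<in> max_sieve" for \<alpha> using that M1 by (auto simp: ob_def)
  have arS: "ar \<alpha> g \<in> Arr (Tot X (disc S))" "Dom (Tot X (disc S)) (ar \<alpha> g) = ob (\<alpha> \<cdot>[X] g)" "Cod (Tot X (disc S)) (ar \<alpha> g) = ob \<alpha>"
    if "\<alpha> \<in> S" "g \<in> Arr X" "Cod X g = Dom X \<alpha>" for \<alpha> g
    using disc_arrI[OF R, of g \<alpha>] that S1[OF that(1)] by (auto simp: ob_def ar_def)
  have arM: "ar \<alpha> g \<in> Arr (Tot X (disc max_sieve))" "Dom (Tot X (disc max_sieve)) (ar \<alpha> g) = ob (\<alpha> \<cdot>[X] g)" "Cod (Tot X (disc max_sieve)) (ar \<alpha> g) = ob \<alpha>" "fst (ar \<alpha> g) = g"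
    "cartesian X (Tot X (disc max_sieve)) (ar \<alpha> g)"
    if "\<alpha> \<in> max_sieve" "g \<in> Arr X" "Cod X g = Dom X \<alpha>" for \<alpha> g
    using disc_arrI[OF M, of g \<alpha>] disc_cart[OF M, of "ar \<alpha> g"] that M1[OF that(1)] by (auto simp: ob_def ar_def)
  have iO: "totO incl z = z" for z by (cases z) simp
  have iA: "totA X (disc max_sieve) incl f = f" if "f \<in> Arr (Tot X (disc S))" for f
    using that by (auto elim!: total_arrE)
  have hOb: "totO h (ob \<alpha>) = e \<alpha>" if "\<alpha> \<in> S" for \<alpha> using hO[OF obS[OF that]] S1[OF that] by (simp add: ob_def)
  have kOb: "totO k (ob \<alpha>) = (Dom X \<alpha>, ResO B \<alpha> b0)" if "\<alpha> \<in> max_sieve" for \<alpha> using kO[OF obM[OF that]] M1[OF that] by (simp add: ob_def ke_def)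
  have hAr: "totA X E h (ar \<alpha> g) = t \<alpha> g" if "\<alpha> \<in> S" "g \<in> Arr X" "Cod X g = Dom X \<alpha>" for \<alpha> g
    using hA[OF arS(1)[OF that]] S1[OF that(1)] that by (simp add: ar_def)
  have kAr: "totA X B k (ar \<alpha> g) = p.B.cmpi \<alpha> g b0" if "\<alpha> \<in> max_sieve" "g \<in> Arr X" "Cod X g = Dom X \<alpha>" for \<alpha> g
    using kA[OF arM(1)[OF that]] M1[OF that(1)] that by (simp add: ar_def kt_def)
  have obE: "\<exists>\<alpha>\<in>S. z = ob \<alpha>" if "z \<in> Obj (Tot X (disc S))" for z
    by (rule disc_objE[OF R that]) (auto simp: ob_def)
  have arE: "\<exists>\<alpha>\<in>S. \<exists>g\<in>Arr X. Cod X g = Dom X \<alpha> \<and> f = ar \<alpha> g" if "f \<in> Arr (Tot X (disc S))" for f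
    by (rule disc_arrE[OF R that]) (force simp: ar_def)
  \<comment> \<open>The 2-cell of the lifting problem: \<open>\<psi> \<alpha>\<close> and the chosen
    lift of \<open>b\<close> along \<alpha> have the same base and target, so they differ by a
    vertical arrow, which is invertible as both are cartesian.\<close>
  have "\<exists>m. m \<in> Arr (Tot X B) \<and> Dom (Tot X B) m = totO p (e \<alpha>) \<and> Cod (Tot X B) m = (Dom X \<alpha>, ResO B \<alpha> b0) \<and> fst m = Id X (Dom X \<alpha>) \<and>
     p.B.ci \<alpha> b0 \<cdot>[Tot X B] m = \<psi> \<alpha>" if a: "\<alpha> \<in> S" for \<alpha>
  proof -
    note c = ci[OF SM[OF a]]
    obtain m where "m \<in> Arr (Tot X B)" "Dom (Tot X B) m = Dom (Tot X B) (\<psi> \<alpha>)" "Cod (Tot X B) m = Dom (Tot X B) (p.B.ci \<alpha> b0)"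
      "fst m = Id X (Dom X \<alpha>)" "p.B.ci \<alpha> b0 \<cdot>[Tot X B] m = \<psi> \<alpha>"
      by (rule p.B.T.cart_factor[OF c(5) \<psi>(1)[OF a], of "Id X (Dom X \<alpha>)"]) (use c \<psi>[OF a] S1[OF a] in auto)
    then show ?thesis using c(2) \<psi>(2)[OF a] by (intro exI[of _ m] conjI) simp_all
  qed
  then obtain \<Gamma> where \<Gamma>: "\<And>\<alpha>. \<alpha> \<in> S \<Longrightarrow> \<Gamma> \<alpha> \<in> Arr (Tot X B)" "\<And>\<alpha>. \<alpha> \<in> S \<Longrightarrow> Dom (Tot X B) (\<Gamma> \<alpha>) = totO p (e \<alpha>)"
     "\<And>\<alpha>. \<alpha> \<in> S \<Longrightarrow> Cod (Tot X B) (\<Gamma> \<alpha>) = (Dom X \<alpha>, ResO B \<alpha> b0)" "\<And>\<alpha>. \<alpha> \<in> S \<Longrightarrow> fst (\<Gamma> \<alpha>) = Id X (Dom X \<alpha>)"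
     "\<And>\<alpha>. \<alpha> \<in> S \<Longrightarrow> p.B.ci \<alpha> b0 \<cdot>[Tot X B] \<Gamma> \<alpha> = \<psi> \<alpha>" by metis
  have \<Gamma>iso: "\<Gamma> \<alpha> \<in> isos (Tot X B) (totO p (e \<alpha>)) (Dom X \<alpha>, ResO B \<alpha> b0)" if a: "\<alpha> \<in> S" for \<alpha>
  proof -
    have "cartesian X (Tot X B) (\<Gamma> \<alpha>)"
      by (rule p.B.T.cart_cancel[OF ci(5)[OF SM[OF a]] \<Gamma>(1)[OF a]]) (use \<Gamma>(3,5)[OF a] ci(2)[OF SM[OF a]] \<psi>(5)[OF a] in simp_all)
    then show ?thesis using p.B.T.cart_vertical_iso[of "\<Gamma> \<alpha>"] \<Gamma>(2-4)[OF a] by simp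
  qed
  have \<Gamma>nat: "\<Gamma> \<alpha> \<cdot>[Tot X B] totA X B p (t \<alpha> g) = p.B.cmpi \<alpha> g b0 \<cdot>[Tot X B] \<Gamma> (\<alpha> \<cdot>[X] g)" if a: "\<alpha> \<in> S" and g: "g \<in> Arr X" "Cod X g = Dom X \<alpha>" for \<alpha> g
  proof -
    have ag: "\<alpha> \<cdot>[X] g \<in> S" by (rule S1(3)[OF a g])
    note aM = SM[OF a] and agM = SM[OF ag]
    note c = ci[OF aM] and m = kmM[OF aM g] and G = \<Gamma>[OF a] and G2 = \<Gamma>[OF ag] and tt = t[OF a g]
    have d: "Dom X (\<alpha> \<cdot>[X] g) = Dom X g" using S1[OF a] g by simp
    have "p.B.ci \<alpha> b0 \<cdot>[Tot X B] (\<Gamma> \<alpha> \<cdot>[Tot X B] totA X B p (t \<alpha> g)) = \<psi> \<alpha> \<cdot>[Tot X B] totA X B p (t \<alpha> g)"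
      by (rule p.B.T.compose_eq[OF G(5)]) (use G(1-4) c tt in auto)
    also have "\<dots> = \<psi> (\<alpha> \<cdot>[X] g)" by (rule \<psi>t[OF a g])
    also have "\<dots> = p.B.ci \<alpha> b0 \<cdot>[Tot X B] (p.B.cmpi \<alpha> g b0 \<cdot>[Tot X B] \<Gamma> (\<alpha> \<cdot>[X] g))"
      unfolding G2(5)[symmetric] by (rule p.B.T.compose_eq[OF m(5), symmetric]) (use G2(1-4) c m d in auto)
    finally show ?thesis
      by (rule p.B.T.cart_unique[OF c(5), rotated -1]) (use G(1-4) G2(1-4) c m tt d S1[OF a] g in auto)
  qed
  have ph: "pseudonatural X (disc S) B (psnat_comp X B p h)" by (rule psnat_comp_pseudonatural[OF h p])
  have ki: "pseudonatural X (disc S) B (psnat_comp X B k incl)" by (rule psnat_comp_pseudonatural[OF i.pseudonatural_axioms k])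
  define \<Gamma>' where "\<Gamma>' = (\<lambda>(V, x). \<Gamma> (dec V x))"
  have \<Gamma>ob: "\<Gamma>' (ob \<alpha>) = \<Gamma> \<alpha>" if "\<alpha> \<in> S" for \<alpha> using S1[OF that] by (simp add: \<Gamma>'_def ob_def)
  obtain \<gamma> where \<gamma>: "invertible_modification X (disc S) B (psnat_comp X B p h) (psnat_comp X B k incl) \<gamma>"
    and \<gamma>v: "\<And>V x. V \<in> Obj X \<Longrightarrow> x \<in> Obj (Fib (disc S) V) \<Longrightarrow> \<gamma> V x \<in> hom (Fib B V) (NatO (psnat_comp X B p h) V x) (NatO (psnat_comp X B k incl) V x) \<and> \<Gamma>' (V, x) = p.B.vt V (\<gamma> V x)"
  proof (rule modification_of_transformation[OF ph ki, of \<Gamma>'])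
    fix z assume "z \<in> Obj (Tot X (disc S))"
    then obtain \<alpha> where a: "\<alpha> \<in> S" "z = ob \<alpha>" using obE by blast
    show "\<Gamma>' z \<in> isos (Tot X B) (totO (psnat_comp X B p h) z) (totO (psnat_comp X B k incl) z) \<and> fst (\<Gamma>' z) = Id X (fst z)"
      using \<Gamma>iso[OF a(1)] \<Gamma>(4)[OF a(1)] unfolding a(2) \<Gamma>ob[OF a(1)] tot_comp(1)[OF h p] tot_comp(1)[OF i.pseudonatural_axioms k] iO hOb[OF a(1)] kOb[OF SM[OF a(1)]]
      by (simp add: ob_def)
  next
    fix f assume f: "f \<in> Arr (Tot X (disc S))"
    then obtain \<alpha> g where a: "\<alpha> \<in> S" and g: "g \<in> Arr X" "Cod X g = Dom X \<alpha>" and fe: "f = ar \<alpha> g" using arE by blast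
    have ag: "\<alpha> \<cdot>[X] g \<in> S" by (rule S1(3)[OF a g])
    show "\<Gamma>' (Cod (Tot X (disc S)) f) \<cdot>[Tot X B] totA X B (psnat_comp X B p h) f =
       totA X B (psnat_comp X B k incl) f \<cdot>[Tot X B] \<Gamma>' (Dom (Tot X (disc S)) f)"
      unfolding tot_comp(2)[OF h p f] tot_comp(2)[OF i.pseudonatural_axioms k f] iA[OF f]
      unfolding fe arS(2,3)[OF a g] \<Gamma>ob[OF a] \<Gamma>ob[OF ag] hAr[OF a g] kAr[OF SM[OF a] g] by (rule \<Gamma>nat[OF a g])
  qed (rule that)
  obtain l \<kappa> \<rho> where l: "pseudonatural X (disc max_sieve) E l"
    and \<kappa>: "invertible_modification X (disc S) E h (psnat_comp X E l incl) \<kappa>"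
    and \<rho>: "invertible_modification X (disc max_sieve) B (psnat_comp X B p l) k \<rho>"
    and \<gamma>eq: "\<And>V x. V \<in> Obj X \<Longrightarrow> x \<in> Obj (Fib (disc S) V) \<Longrightarrow> \<gamma> V x = \<rho> V (NatO incl V x) \<cdot>[Fib B V] NatA p V (\<kappa> V x)"
    using lifts[unfolded lifts_def, rule_format, of h k \<gamma>] h k \<gamma> by blast
  interpret l: pseudonatural X "disc max_sieve" E l by (rule l)
  interpret LF: fibred_functor X "Tot X (disc max_sieve)" "Tot X E" "totO l" "totA X E l" by (rule l.tot_fibred_functor)
  interpret km: modification X "disc S" E h "psnat_comp X E l incl" \<kappa> using \<kappa> by (simp add: invertible_modification_def)
  interpret rm: modification X "disc max_sieve" B "psnat_comp X B p l" k \<rho> using \<rho> by (simp add: invertible_modification_def)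
  \<comment> \<open>The universal element of the representable: \<open>ar (Id X U) \<alpha>\<close>
    is an arrow to it from each member \<alpha> of the sieve, and the lift turns these arrows into a
    cone.\<close>
  let ?one = "ob (Id X U)"
  have oneM: "Id X U \<in> max_sieve" using U by (simp add: max_sieve_def)
  have one: "?one \<in> Obj (Tot X (disc max_sieve))" "fst ?one = U" using obM[OF oneM] U by (auto simp: ob_def)
  define x where "x = totO l ?one"
  have x: "x \<in> Obj (Tot X E)" "fst x = U" using one by (auto simp: x_def)
  have Ks: "km.vertical (ob \<alpha>) \<in> isos (Tot X E) (e \<alpha>) (totO l (ob \<alpha>))" "fst (km.vertical (ob \<alpha>)) = Id X (Dom X \<alpha>)" if a: "\<alpha> \<in> S" for \<alpha>
  proof -
    have o: "Dom X \<alpha> \<in> Obj X" "enc (Dom X \<alpha>) \<alpha> \<in> Obj (Fib (disc S) (Dom X \<alpha>))" using obS[OF a] by (auto simp: ob_def)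
    have "p.E.vt (Dom X \<alpha>) (\<kappa> (Dom X \<alpha>) (enc (Dom X \<alpha>) \<alpha>)) \<in> isos (Tot X E) (totO h (ob \<alpha>)) (totO (psnat_comp X E l incl) (ob \<alpha>))"
      using p.E.vt_isos[OF o(1) invertible_modification_isos[OF \<kappa> o]] by (simp add: ob_def)
    then show "km.vertical (ob \<alpha>) \<in> isos (Tot X E) (e \<alpha>) (totO l (ob \<alpha>))"
      unfolding hOb[OF a] tot_comp(1)[OF i.pseudonatural_axioms l] iO by (simp add: km.vertical_def ob_def)
    show "fst (km.vertical (ob \<alpha>)) = Id X (Dom X \<alpha>)" using km.m_simps[OF o] o by (simp add: km.vertical_def ob_def)
  qed
  note KA = p.E.T.isos_Arr[OF Ks(1)]
  have Rs: "rm.vertical (ob \<alpha>) \<in> isos (Tot X B) (totO p (totO l (ob \<alpha>))) (Dom X \<alpha>, ResO B \<alpha> b0)" "fst (rm.vertical (ob \<alpha>)) = Id X (Dom X \<alpha>)" if a: "\<alpha> \<in> max_sieve" for \<alpha>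
  proof -
    have o: "Dom X \<alpha> \<in> Obj X" "enc (Dom X \<alpha>) \<alpha> \<in> Obj (Fib (disc max_sieve) (Dom X \<alpha>))" using obM[OF a] by (auto simp: ob_def)
    have "p.B.vt (Dom X \<alpha>) (\<rho> (Dom X \<alpha>) (enc (Dom X \<alpha>) \<alpha>)) \<in> isos (Tot X B) (totO (psnat_comp X B p l) (ob \<alpha>)) (totO k (ob \<alpha>))"
      using p.B.vt_isos[OF o(1) invertible_modification_isos[OF \<rho> o]] by (simp add: ob_def)
    then show "rm.vertical (ob \<alpha>) \<in> isos (Tot X B) (totO p (totO l (ob \<alpha>))) (Dom X \<alpha>, ResO B \<alpha> b0)"
      unfolding kOb[OF a] tot_comp(1)[OF l p] by (simp add: rm.vertical_def ob_def)
    show "fst (rm.vertical (ob \<alpha>)) = Id X (Dom X \<alpha>)" using rm.m_simps[OF o] o by (simp add: rm.vertical_def ob_def)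
  qed
  note RA = p.B.T.isos_Arr[OF Rs(1)]
  \<comment> \<open>The equation of 2-cells satisfied by the lift, read in the total category at
    \<alpha>.\<close>
  have \<Gamma>f: "\<Gamma> \<alpha> = rm.vertical (ob \<alpha>) \<cdot>[Tot X B] totA X B p (km.vertical (ob \<alpha>))" if a: "\<alpha> \<in> S" for \<alpha>
  proof -
    let ?V = "Dom X \<alpha>" and ?y = "enc (Dom X \<alpha>) \<alpha>"
    have o: "?V \<in> Obj X" "?y \<in> Obj (Fib (disc S) ?V)" using obS[OF a] by (auto simp: ob_def)
    have oM: "?y \<in> Obj (Fib (disc max_sieve) ?V)" using obM[OF SM[OF a]] by (simp add: ob_def)
    have "\<Gamma> \<alpha> = p.B.vt ?V (\<rho> ?V ?y \<cdot>[Fib B ?V] NatA p ?V (\<kappa> ?V ?y))"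
      using \<gamma>v[OF o] \<gamma>eq[OF o] \<Gamma>ob[OF a] by (simp add: ob_def)
    also have "\<dots> = p.B.vt ?V (\<rho> ?V ?y) \<cdot>[Tot X B] p.B.vt ?V (NatA p ?V (\<kappa> ?V ?y))"
      by (rule p.B.vt_Comp[OF o(1)]) (use km.m_simps[OF o] rm.m_simps[OF o(1) oM] o in \<open>auto simp: psnat_comp_def\<close>)
    also have "p.B.vt ?V (NatA p ?V (\<kappa> ?V ?y)) = totA X B p (p.E.vt ?V (\<kappa> ?V ?y))"
      by (rule p.totA_vt[symmetric, OF o(1)]) (use km.m_simps[OF o] in auto)
    finally show ?thesis by (simp add: km.vertical_def rm.vertical_def ob_def)
  qed
  have aU: "Id X U \<cdot>[X] \<alpha> = \<alpha>" "Cod X \<alpha> = Dom X (Id X U)" if "\<alpha> \<in> S" for \<alpha> using S1[OF that] U by auto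
  have aM: "ar (Id X U) \<alpha> \<in> Arr (Tot X (disc max_sieve))" "Dom (Tot X (disc max_sieve)) (ar (Id X U) \<alpha>) = ob \<alpha>" "Cod (Tot X (disc max_sieve)) (ar (Id X U) \<alpha>) = ?one"
    "fst (ar (Id X U) \<alpha>) = \<alpha>" "cartesian X (Tot X (disc max_sieve)) (ar (Id X U) \<alpha>)" if "\<alpha> \<in> S" for \<alpha>
    using arM[OF oneM _ aU(2)[OF that]] aU[OF that] S1[OF that] by auto
  \<comment> \<open>The lift sends the arrow from \<alpha> to the universal element to a cartesian
    arrow; \<kappa> replaces its source by \<open>e \<alpha>\<close>.\<close>
  define j where "j \<alpha> = totA X E l (ar (Id X U) \<alpha>) \<cdot>[Tot X E] km.vertical (ob \<alpha>)" for \<alpha>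
  have j: "j \<alpha> \<in> Arr (Tot X E)" "Dom (Tot X E) (j \<alpha>) = e \<alpha>" "Cod (Tot X E) (j \<alpha>) = x" "fst (j \<alpha>) = \<alpha>" "cartesian X (Tot X E) (j \<alpha>)" if a: "\<alpha> \<in> S" for \<alpha>
  proof -
    note A = aM[OF a] and K = KA[OF a] Ks(2)[OF a]
    show "j \<alpha> \<in> Arr (Tot X E)" "Dom (Tot X E) (j \<alpha>) = e \<alpha>" "Cod (Tot X E) (j \<alpha>) = x" "fst (j \<alpha>) = \<alpha>"
      using A K S1[OF a] by (auto simp: j_def x_def)
    have "cartesian X (Tot X E) (km.vertical (ob \<alpha>))"
      by (rule p.E.T.iso_cart[OF Ks(1)[OF a]]) (use Ks(2)[OF a] e[OF a] in simp)
    then show "cartesian X (Tot X E) (j \<alpha>)" unfolding j_def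
      by (rule p.E.T.cart_comp[OF LF.FA_cart[OF A(5)]]) (use A K in simp)
  qed
  have jt: "j \<alpha> \<cdot>[Tot X E] t \<alpha> g = j (\<alpha> \<cdot>[X] g)" if a: "\<alpha> \<in> S" and g: "g \<in> Arr X" "Cod X g = Dom X \<alpha>" for \<alpha> g
  proof -
    have ag: "\<alpha> \<cdot>[X] g \<in> S" by (rule S1(3)[OF a g])
    note A = aM[OF a] and A2 = aM[OF ag] and K = KA[OF a] and K2 = KA[OF ag] and tt = t[OF a g] and r = arM[OF SM[OF a] g]
    have n: "km.vertical (ob \<alpha>) \<cdot>[Tot X E] t \<alpha> g = totA X E l (ar \<alpha> g) \<cdot>[Tot X E] km.vertical (ob (\<alpha> \<cdot>[X] g))"
      using km.vertical_nat[OF arS(1)[OF a g]]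
      unfolding tot_comp(2)[OF i.pseudonatural_axioms l arS(1)[OF a g]] iA[OF arS(1)[OF a g]] arS(2,3)[OF a g] hAr[OF a g] .
    have "ar (Id X U) \<alpha> \<cdot>[Tot X (disc max_sieve)] ar \<alpha> g = ar (Id X U) (\<alpha> \<cdot>[X] g)"
      using S1[OF a] g U by (simp add: ar_def)
    then have c: "totA X E l (ar (Id X U) \<alpha>) \<cdot>[Tot X E] totA X E l (ar \<alpha> g) = totA X E l (ar (Id X U) (\<alpha> \<cdot>[X] g))"
      using LF.FA_comp[of "ar \<alpha> g" "ar (Id X U) \<alpha>"] A r by simp
    have "j \<alpha> \<cdot>[Tot X E] t \<alpha> g = totA X E l (ar (Id X U) \<alpha>) \<cdot>[Tot X E] (km.vertical (ob \<alpha>) \<cdot>[Tot X E] t \<alpha> g)"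
      unfolding j_def by (rule p.E.T.assoc) (use A K tt in auto)
    also have "\<dots> = totA X E l (ar (Id X U) (\<alpha> \<cdot>[X] g)) \<cdot>[Tot X E] km.vertical (ob (\<alpha> \<cdot>[X] g))"
      unfolding n by (rule p.E.T.compose_eq[OF c]) (use A r K2 in auto)
    finally show ?thesis by (simp add: j_def)
  qed
  note c1 = ci[OF oneM]
  have R1: "rm.vertical ?one \<in> isos (Tot X B) (totO p x) (U, ResO B (Id X U) b0)" "fst (rm.vertical ?one) = Id X U"
    using Rs[OF oneM] U by (auto simp: x_def)
  \<comment> \<open>\<rho> at the universal element ends in the restriction of \<open>b\<close>
    along an identity; the chosen lift of that identity is an isomorphism and undoes the
    restriction.\<close>
  define r where "r = p.B.ci (Id X U) b0 \<cdot>[Tot X B] rm.vertical ?one"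
  have ciI: "p.B.ci (Id X U) b0 \<in> isos (Tot X B) (U, ResO B (Id X U) b0) (U, b0)"
    using p.B.T.cart_vertical_iso[OF c1(5), unfolded c1(2-4)] U by simp
  have ri: "r \<in> isos (Tot X B) (totO p x) b" unfolding r_def b0(1) by (rule p.B.T.isos_Comp[OF R1(1) ciI])
  have rb: "fst r = Id X U"
    unfolding r_def using p.B.T.isos_Arr[OF R1(1)] R1(2) c1(1-4) U by (subst p.B.T.base.FA_comp) auto
  have rj: "r \<cdot>[Tot X B] totA X B p (j \<alpha>) = \<psi> \<alpha>" if a: "\<alpha> \<in> S" for \<alpha>
  proof -
    note A = aM[OF a] and K = KA[OF a] and RR = RA[OF SM[OF a]] and R1A = p.B.T.isos_Arr[OF R1(1)]
    note m = kmM[OF oneM S1(1)[OF a] aU(2)[OF a], unfolded aU(1)[OF a]]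
    have n: "rm.vertical ?one \<cdot>[Tot X B] totA X B p (totA X E l (ar (Id X U) \<alpha>)) = p.B.cmpi (Id X U) \<alpha> b0 \<cdot>[Tot X B] rm.vertical (ob \<alpha>)"
      using rm.vertical_nat[OF A(1)] unfolding A(2,3) tot_comp(2)[OF l p A(1)] kAr[OF oneM S1(1)[OF a] aU(2)[OF a]] .
    have "totA X B p (j \<alpha>) = totA X B p (totA X E l (ar (Id X U) \<alpha>)) \<cdot>[Tot X B] totA X B p (km.vertical (ob \<alpha>))"
      unfolding j_def by (rule PF.FA_comp) (use A K in auto)
    then have "r \<cdot>[Tot X B] totA X B p (j \<alpha>) = p.B.ci (Id X U) b0 \<cdot>[Tot X B] (rm.vertical ?one \<cdot>[Tot X B] (totA X B p (totA X E l (ar (Id X U) \<alpha>)) \<cdot>[Tot X B] totA X B p (km.vertical (ob \<alpha>))))"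
      unfolding r_def by (simp only:) (rule p.B.T.assoc; use A K R1A c1 U in \<open>auto simp: x_def\<close>)
    also have "rm.vertical ?one \<cdot>[Tot X B] (totA X B p (totA X E l (ar (Id X U) \<alpha>)) \<cdot>[Tot X B] totA X B p (km.vertical (ob \<alpha>))) =
      p.B.cmpi (Id X U) \<alpha> b0 \<cdot>[Tot X B] (rm.vertical (ob \<alpha>) \<cdot>[Tot X B] totA X B p (km.vertical (ob \<alpha>)))"
      by (rule p.B.T.compose_eq2[OF n]) (use A K R1A RR m U S1[OF a] in \<open>auto simp: x_def\<close>)
    also have "\<dots> = p.B.cmpi (Id X U) \<alpha> b0 \<cdot>[Tot X B] \<Gamma> \<alpha>" by (simp add: \<Gamma>f[OF a])
    also have "p.B.ci (Id X U) b0 \<cdot>[Tot X B] (p.B.cmpi (Id X U) \<alpha> b0 \<cdot>[Tot X B] \<Gamma> \<alpha>) = p.B.ci \<alpha> b0 \<cdot>[Tot X B] \<Gamma> \<alpha>"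
      by (rule p.B.T.compose_eq[OF m(5)]) (use m c1 \<Gamma>(1,3)[OF a] U in auto)
    also have "\<dots> = \<psi> \<alpha>" by (rule \<Gamma>(5)[OF a])
    finally show ?thesis .
  qed
  show "\<exists>x j r. x \<in> Obj (Tot X E) \<and> fst x = U \<and>
        (\<forall>\<alpha>\<in>S. j \<alpha> \<in> hom (Tot X E) (e \<alpha>) x \<and> fst (j \<alpha>) = \<alpha> \<and> cartesian X (Tot X E) (j \<alpha>)) \<and>
        (\<forall>\<alpha>\<in>S. \<forall>g\<in>Arr X. Cod X g = Dom X \<alpha> \<longrightarrow> j \<alpha> \<cdot>[Tot X E] t \<alpha> g = j (\<alpha> \<cdot>[X] g)) \<and>
        r \<in> isos (Tot X B) (totO p x) b \<and> fst r = Id X U \<and> (\<forall>\<alpha>\<in>S. r \<cdot>[Tot X B] totA X B p (j \<alpha>) = \<psi> \<alpha>)"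
  proof (intro exI conjI ballI impI)
    show "x \<in> Obj (Tot X E)" "fst x = U" by (fact x)+
    show "r \<in> isos (Tot X B) (totO p x) b" "fst r = Id X U" by (fact ri rb)+
    show "j \<alpha> \<in> hom (Tot X E) (e \<alpha>) x" "fst (j \<alpha>) = \<alpha>" "cartesian X (Tot X E) (j \<alpha>)" if "\<alpha> \<in> S" for \<alpha>
      using j[OF that] by (auto simp: in_hom)
    show "j \<alpha> \<cdot>[Tot X E] t \<alpha> g = j (\<alpha> \<cdot>[X] g)" if "\<alpha> \<in> S" "g \<in> Arr X" "Cod X g = Dom X \<alpha>" for \<alpha> g using jt that by blast
    show "r \<cdot>[Tot X B] totA X B p (j \<alpha>) = \<psi> \<alpha>" if "\<alpha> \<in> S" for \<alpha> using rj[OF that] .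
  qed
qed

end

theorem theorem4p5:
  fixes \<C> :: "('o, 'a) cat" and J :: "'o \<Rightarrow> 'a set set"
    and E B :: "('o, 'a, 'u) psfun" and p :: "('o, 'a, 'u) psnat"
  assumes site: "site \<C> J"
    and precanonical: "precanonical \<C> J"
    and locally_small: "\<And>U V. U \<in> Obj \<C> \<Longrightarrow> V \<in> Obj \<C> \<Longrightarrow> hom \<C> U V \<lesssim> (UNIV :: 'u set)"
    and prestack_E: "prestack \<C> J E"
    and prestack_B: "prestack \<C> J B"
    and map_p: "pseudonatural \<C> E B p"
  shows "local_fibration \<C> J E B p \<longleftrightarrow>
    class_lifts \<C> (local_weak_equivalences \<C> J) E B p"
proof
  have desc: "descent_setting \<C> J E B p U S" if "U \<in> Obj \<C>" "S \<in> J U" for U S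
    using site map_p prestack_E prestack_B that by (intro descent_setting.intro descent_setting_axioms.intro)
  {
    assume "local_fibration \<C> J E B p"
    then have "effective \<C> (Tot \<C> E) (Tot \<C> B) (totO p) (totA \<C> B p) U S" if "U \<in> Obj \<C>" "S \<in> J U" for U S
      using descent_setting.equivalence_imp_effective[OF desc[OF that]] that by (simp add: local_fibration_def)
    then show "class_lifts \<C> (local_weak_equivalences \<C> J) E B p"
      unfolding class_lifts_def using lifts_of_effective[OF site prestack_E prestack_B map_p] by blast
  next
    assume W: "class_lifts \<C> (local_weak_equivalences \<C> J) E B p"
    show "local_fibration \<C> J E B p"
      unfolding local_fibration_def
    proof (intro ballI)
      fix U S assume U: "U \<in> Obj \<C>" and S: "S \<in> J U"
      \<comment> \<open>Local smallness lets the representable of \<open>U\<close> take values in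
        \<open>'u\<close>; injective codes are chosen for one \<open>U\<close> at a time.\<close>
      have "\<exists>f :: 'a \<Rightarrow> 'u. inj_on f (hom \<C> V U)" if "V \<in> Obj \<C>" for V
        using locally_small[OF that U] by (auto simp: lepoll_def)
      then obtain enc :: "'o \<Rightarrow> 'a \<Rightarrow> 'u" where enc: "\<And>V. V \<in> Obj \<C> \<Longrightarrow> inj_on (enc V) (hom \<C> V U)" by metis
      interpret encoded_sieves \<C> J U enc
        using site precanonical U enc by (intro encoded_sieves.intro encoded_sieves_axioms.intro)
      have "lifts \<C> (disc S) (disc max_sieve) incl E B p"
        using W incl_local_weak_equivalence[OF S] by (auto simp: class_lifts_def)
      then have "effective \<C> (Tot \<C> E) (Tot \<C> B) (totO p) (totA \<C> B p) U S"
        by (rule effective_of_lifting[OF map_p S])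
      then show "equivalence_of_categories (Fib E U) (Desc \<C> E B p U S) (PhiO \<C> E p U S) (PhiA \<C> E p U S)"
        by (rule descent_setting.effective_imp_equivalence[OF desc[OF U S]])
    qed
  }
qed

end
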